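(* Let $A=U_q(\mathfrak{gl}_{N_1})\boxtimes\cdots\boxtimes U_q(\mathfrak{gl}_{N_d})\cong U_q(\mathfrak{gl}_{N_1}\oplus\cdots\oplus\mathfrak{gl}_{N_d})$ with all $N_b>1$, and let $V=V_1\oplus\cdots\oplus V_d$ be its vector representation of dimension $N_1+\cdots+N_d$. There exists a surjective algebra homomorphism $$\Phi\colon\mathrm{YH}_{d,n}\to\operatorname{End}_A(V^{\otimes n}),$$ given by $t_i\mapsto\tau_i$, $s_i\mapsto\sigma_i$. It is an isomorphism if and only if $n\leq N_b$ for all $1\leq b\leq d$.
   Context: $q$ is an indeterminate, $\Bbbk=\mathbb{C}(q)$, $d\ge1$, $n\geq1$, and $\zeta\in\Bbbk$ is a primitive $d$-th root of unity. $V_b$ is the vector representation of $U_q(\mathfrak{gl}_{N_b})$ of dimension $N_b$, viewed as an $A$-module with the other tensor factors of $A$ acting through their counits; $A$ acts on $V^{\otimes n}$ via its comultiplication. The framed braid group $\mathcal{FB}_{d,n}$ has generators $s_1,\dots,s_{n-1},t_1,\dots,t_n$ and relations $s_is_j=s_js_i$ if $|i-j|>1$, $s_is_js_i=s_js_is_j$ if $|i-j|=1$, $t_i^d=1$, $t_it_j=t_jt_i$, $s_it_j=t_{s_i(j)}s_i$, where $s_i$ acts on indices as the transposition $(i,i+1)$. The Yokonuma–Hecke algebra $\mathrm{YH}_{d,n}$ is the quotient of $\Bbbk\mathcal{FB}_{d,n}$ by the relations $s_i^2=(q-q^{-1})E_is_i+1$ ($1\le i\le n-1$), where $E_i=\frac1d\sum_{a=1}^dt_i^at_{i+1}^{-a}$.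 $\check R^{(b)}\in\operatorname{End}_{U_q(\mathfrak{gl}_{N_b})}(V_b\otimes V_b)$ is the action of the $R$-matrix (composed with the flip), normalized so that $(\check R^{(b)})^2=(q-q^{-1})\check R^{(b)}+1$, with eigenvalue $q$ on the $q$-symmetric square and $-q^{-1}$ on the $q$-antisymmetric square. On $V^{\otimes n}$: $\tau_i$ acts on the $i$-th factor by $v\mapsto\zeta^{b-1}v$ for $v\in V_b$; $\sigma_i$ acts on factors $i,i+1$ by $v\otimes w\mapsto w\otimes v$ if $v\in V_b,w\in V_c$, $b\neq c$, and by $\check R^{(b)}$ on $V_b\otimes V_b$. *)

theory Defs
  imports
    Complex_Main
    "HOL-Algebra.QuotRing"
    "HOL-Algebra.Module"
    "HOL-Computational_Algebra.Polynomial"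
    "HOL-Computational_Algebra.Fraction_Field"
    "HOL-Combinatorics.Transposition"
begin

section \<open>The base field\<close>

type_synonym Cq = "complex poly fract"

definition qq :: Cq where
  "qq = Fract [:0, 1:] 1"

lemma qq_nonzero: "qq \<noteq> 0"
  by (simp add: qq_def Zero_fract_def eq_fract)

section \<open>Algebras over a field\<close>

text \<open>
  An associative unital algebra over a field given by a type \<open>'k\<close> is represented by a
  \<^type>\<open>module\<close> record, whose fields are the ring operations and the scalar multiplication. The
  algebras below are noncommutative, so the locale \<^locale>\<open>algebra\<close> does not apply to them.
\<close>

definition alg_hom :: "('k, 'a) module \<Rightarrow> ('k, 'b) module \<Rightarrow> ('a \<Rightarrow> 'b) set" where
  "alg_hom A B =
    {f \<in> ring_hom A B. \<forall>c. \<forall>x\<in>carrier A. f (c \<odot>\<^bsub>A\<^esub> x) = c \<odot>\<^bsub>B\<^esub> f x}"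

definition alg_iso :: "('k, 'a) module \<Rightarrow> ('k, 'b) module \<Rightarrow> ('a \<Rightarrow> 'b) set" where
  "alg_iso A B = {f \<in> alg_hom A B. bij_betw f (carrier A) (carrier B)}"

definition quot_alg :: "('k, 'a) module \<Rightarrow> 'a set \<Rightarrow> ('k, 'a set) module" where
  "quot_alg A I =
    ring.extend (A Quot I) (module.fields (\<lambda>c X. \<Union>x\<in>X. I +>\<^bsub>A\<^esub> (c \<odot>\<^bsub>A\<^esub> x)))"

definition rel_ideal :: "('k, 'a) module \<Rightarrow> ('a \<times> 'a) set \<Rightarrow> 'a set" where
  "rel_ideal A R = genideal A {x \<ominus>\<^bsub>A\<^esub> y | x y. (x, y) \<in> R}"

definition alg_mod_rels :: "('k, 'a) module \<Rightarrow> ('a \<times> 'a) set \<Rightarrow> ('k, 'a set) module" where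
  "alg_mod_rels A R = quot_alg A (rel_ideal A R)"

definition kdelta :: "'x \<Rightarrow> 'x \<Rightarrow> 'k::field" where
  "kdelta x = (\<lambda>y. if y = x then 1 else 0)"

text \<open>
  The monoid algebra \<open>k[M]\<close>: finitely supported functions on \<open>M\<close> under convolution, with
  basis \<open>kdelta x\<close> for \<open>x \<in> carrier M\<close>. It specializes to group algebras, to free algebras
  (free monoids), and, as \<open>k[M \<times> M] = k[M] \<otimes> k[M]\<close>, to tensor squares of free algebras.
\<close>

definition monoid_algebra :: "'m monoid \<Rightarrow> ('k::field, 'm \<Rightarrow> 'k) module" where
  "monoid_algebra M =
    \<lparr>carrier = {f. finite {x. f x \<noteq> 0} \<and> {x. f x \<noteq> 0} \<subseteq> carrier M},
     monoid.mult = (\<lambda>f g z. \<Sum>(x, y) \<in> {(x, y). f x \<noteq> 0 \<and> g y \<noteq> 0 \<and> x \<otimes>\<^bsub>M\<^esub> y = z}. f x * g y),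
     one = kdelta \<one>\<^bsub>M\<^esub>,
     zero = (\<lambda>_. 0),
     add = (\<lambda>f g x. f x + g x),
     module.smult = (\<lambda>c f x. c * f x)\<rparr>"

definition free_monoid :: "'g set \<Rightarrow> 'g list monoid" where
  "free_monoid X = \<lparr>carrier = lists X, monoid.mult = (@), one = []\<rparr>"

definition free_algebra :: "'g set \<Rightarrow> ('k::field, 'g list \<Rightarrow> 'k) module" where
  "free_algebra X = monoid_algebra (free_monoid X)"

text \<open>
  The algebra homomorphism from a free algebra to \<open>E\<close> that sends each generator \<open>g\<close> to \<open>\<rho> g\<close>.
\<close>

definition free_lift :: "('k::field, 'e) module \<Rightarrow> ('g \<Rightarrow> 'e) \<Rightarrow> ('g list \<Rightarrow> 'k) \<Rightarrow> 'e" where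
  "free_lift E \<rho> a =
    (\<Oplus>\<^bsub>E\<^esub>u\<in>{u. a u \<noteq> 0}. a u \<odot>\<^bsub>E\<^esub> foldr (\<lambda>g x. \<rho> g \<otimes>\<^bsub>E\<^esub> x) u \<one>\<^bsub>E\<^esub>)"

section \<open>Endomorphism algebras of based vector spaces\<close>

text \<open>For finite \<open>B\<close>, \<open>vspace B\<close> is the vector space with basis \<open>kdelta x\<close>, \<open>x \<in> B\<close>.\<close>

definition vspace :: "'x set \<Rightarrow> ('x \<Rightarrow> 'k::field) set" where
  "vspace B = {v. \<forall>x. x \<notin> B \<longrightarrow> v x = 0}"

definition endo_alg :: "'x set \<Rightarrow> ('k::field, ('x \<Rightarrow> 'k) \<Rightarrow> 'x \<Rightarrow> 'k) module" where
  "endo_alg B =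
    \<lparr>carrier = {f \<in> vspace B \<rightarrow>\<^sub>E vspace B.
        (\<forall>v\<in>vspace B. \<forall>w\<in>vspace B. f (\<lambda>x. v x + w x) = (\<lambda>x. f v x + f w x)) \<and>
        (\<forall>c. \<forall>v\<in>vspace B. f (\<lambda>x. c * v x) = (\<lambda>x. c * f v x))},
     monoid.mult = (\<lambda>f g. compose (vspace B) f g),
     one = (\<lambda>v\<in>vspace B. v),
     zero = (\<lambda>v\<in>vspace B. \<lambda>_. 0),
     add = (\<lambda>f g. \<lambda>v\<in>vspace B. \<lambda>x. f v x + g v x),
     module.smult = (\<lambda>c f. \<lambda>v\<in>vspace B. \<lambda>x. c * f v x)\<rparr>"

text \<open>The linear operator on \<open>vspace B\<close> with \<open>x \<mapsto> \<phi> x\<close> on basis vectors.\<close>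

definition lin_ext :: "'x set \<Rightarrow> ('x \<Rightarrow> 'x \<Rightarrow> 'k) \<Rightarrow> ('x \<Rightarrow> 'k::field) \<Rightarrow> 'x \<Rightarrow> 'k" where
  "lin_ext B \<phi> = (\<lambda>v\<in>vspace B. \<lambda>y. if y \<in> B then \<Sum>x\<in>B. v x * \<phi> x y else 0)"

section \<open>Groups by generators and relations, and the framed braid group\<close>

text \<open>
  Words are lists of pairs \<open>(g, e)\<close>, where \<open>(g, True)\<close> stands for \<open>g\<close> and \<open>(g, False)\<close> for its
  inverse.
\<close>

type_synonym 'g gword = "('g \<times> bool) list"

inductive_set group_cong :: "'g set \<Rightarrow> ('g gword \<times> 'g gword) set \<Rightarrow> ('g gword \<times> 'g gword) set"
  for X :: "'g set" and R :: "('g gword \<times> 'g gword) set"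
where
  refl: "u \<in> lists (X \<times> UNIV) \<Longrightarrow> (u, u) \<in> group_cong X R"
| sym: "(u, v) \<in> group_cong X R \<Longrightarrow> (v, u) \<in> group_cong X R"
| trans: "(u, v) \<in> group_cong X R \<Longrightarrow> (v, w) \<in> group_cong X R \<Longrightarrow> (u, w) \<in> group_cong X R"
| append: "(u, v) \<in> group_cong X R \<Longrightarrow> (u', v') \<in> group_cong X R \<Longrightarrow>
    (u @ u', v @ v') \<in> group_cong X R"
| cancel: "g \<in> X \<Longrightarrow> ([(g, e), (g, \<not> e)], []) \<in> group_cong X R"
| rel: "(u, v) \<in> R \<Longrightarrow> u \<in> lists (X \<times> UNIV) \<Longrightarrow> v \<in> lists (X \<times> UNIV) \<Longrightarrow> (u, v) \<in> group_cong X R"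

definition presented_group :: "'g set \<Rightarrow> ('g gword \<times> 'g gword) set \<Rightarrow> 'g gword set monoid" where
  "presented_group X R =
    \<lparr>carrier = lists (X \<times> UNIV) // group_cong X R,
     monoid.mult = (\<lambda>P Q. \<Union>u\<in>P. \<Union>v\<in>Q. group_cong X R `` {u @ v}),
     one = group_cong X R `` {[]}\<rparr>"

datatype fb_gen = Sgen nat | Tgen nat

definition fb_gens :: "nat \<Rightarrow> fb_gen set" where
  "fb_gens n = Sgen ` {1..<n} \<union> Tgen ` {1..n}"

abbreviation sw :: "nat \<Rightarrow> fb_gen gword" where "sw i \<equiv> [(Sgen i, True)]"
abbreviation tw :: "nat \<Rightarrow> fb_gen gword" where "tw i \<equiv> [(Tgen i, True)]"

inductive_set fb_rels :: "nat \<Rightarrow> nat \<Rightarrow> (fb_gen gword \<times> fb_gen gword) set"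
  for d n :: nat
where
  s_far: "i \<in> {1..<n} \<Longrightarrow> j \<in> {1..<n} \<Longrightarrow> \<bar>int i - int j\<bar> > 1 \<Longrightarrow>
    (sw i @ sw j, sw j @ sw i) \<in> fb_rels d n"
| s_braid: "i \<in> {1..<n} \<Longrightarrow> j \<in> {1..<n} \<Longrightarrow> \<bar>int i - int j\<bar> = 1 \<Longrightarrow>
    (sw i @ sw j @ sw i, sw j @ sw i @ sw j) \<in> fb_rels d n"
| t_power: "i \<in> {1..n} \<Longrightarrow> (concat (replicate d (tw i)), []) \<in> fb_rels d n"
| t_comm: "i \<in> {1..n} \<Longrightarrow> j \<in> {1..n} \<Longrightarrow> (tw i @ tw j, tw j @ tw i) \<in> fb_rels d n"
| s_t: "i \<in> {1..<n} \<Longrightarrow> j \<in> {1..n} \<Longrightarrow>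
    (sw i @ tw j, tw (Transposition.transpose i (i + 1) j) @ sw i) \<in> fb_rels d n"

definition FB :: "nat \<Rightarrow> nat \<Rightarrow> fb_gen gword set monoid" where
  "FB d n = presented_group (fb_gens n) (fb_rels d n)"

definition fb_s :: "nat \<Rightarrow> nat \<Rightarrow> nat \<Rightarrow> fb_gen gword set" where
  "fb_s d n i = group_cong (fb_gens n) (fb_rels d n) `` {sw i}"

definition fb_t :: "nat \<Rightarrow> nat \<Rightarrow> nat \<Rightarrow> fb_gen gword set" where
  "fb_t d n i = group_cong (fb_gens n) (fb_rels d n) `` {tw i}"

section \<open>The Yokonuma--Hecke algebra\<close>

definition kFB :: "nat \<Rightarrow> nat \<Rightarrow> (Cq, fb_gen gword set \<Rightarrow> Cq) module" where
  "kFB d n = monoid_algebra (FB d n)"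

definition yh_E :: "nat \<Rightarrow> nat \<Rightarrow> nat \<Rightarrow> fb_gen gword set \<Rightarrow> Cq" where
  "yh_E d n i =
    (1 / of_nat d) \<odot>\<^bsub>kFB d n\<^esub>
      (\<Oplus>\<^bsub>kFB d n\<^esub>a\<in>{1..d}. kdelta
        (fb_t d n i [^]\<^bsub>FB d n\<^esub> a \<otimes>\<^bsub>FB d n\<^esub> inv\<^bsub>FB d n\<^esub> (fb_t d n (i + 1) [^]\<^bsub>FB d n\<^esub> a)))"

definition yh_rels :: "nat \<Rightarrow> nat \<Rightarrow> ((fb_gen gword set \<Rightarrow> Cq) \<times> (fb_gen gword set \<Rightarrow> Cq)) set" where
  "yh_rels d n =
    {(kdelta (fb_s d n i) \<otimes>\<^bsub>kFB d n\<^esub> kdelta (fb_s d n i),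
      (qq - inverse qq) \<odot>\<^bsub>kFB d n\<^esub> (yh_E d n i \<otimes>\<^bsub>kFB d n\<^esub> kdelta (fb_s d n i))
        \<oplus>\<^bsub>kFB d n\<^esub> \<one>\<^bsub>kFB d n\<^esub>) | i. i \<in> {1..<n}}"

definition YH :: "nat \<Rightarrow> nat \<Rightarrow> (Cq, (fb_gen gword set \<Rightarrow> Cq) set) module" where
  "YH d n = alg_mod_rels (kFB d n) (yh_rels d n)"

definition yh_s :: "nat \<Rightarrow> nat \<Rightarrow> nat \<Rightarrow> (fb_gen gword set \<Rightarrow> Cq) set" where
  "yh_s d n i = rel_ideal (kFB d n) (yh_rels d n) +>\<^bsub>kFB d n\<^esub> kdelta (fb_s d n i)"

definition yh_t :: "nat \<Rightarrow> nat \<Rightarrow> nat \<Rightarrow> (fb_gen gword set \<Rightarrow> Cq) set" where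
  "yh_t d n i = rel_ideal (kFB d n) (yh_rels d n) +>\<^bsub>kFB d n\<^esub> kdelta (fb_t d n i)"

section \<open>The quantum group\<close>

datatype uq_gen = UE nat | UF nat | UK nat | UKinv nat

definition uq_gens :: "nat \<Rightarrow> uq_gen set" where
  "uq_gens m = UE ` {1..<m} \<union> UF ` {1..<m} \<union> UK ` {1..m} \<union> UKinv ` {1..m}"

text \<open>
  The exponent in \<open>K\<^sub>j E\<^sub>i K\<^sub>j\<^sup>-\<^sup>1 = q\<^bsup>wt j i\<^esup> E\<^sub>i\<close>, i.e. the coefficient of \<open>\<epsilon>\<^sub>j\<close> in the simple root
  \<open>\<epsilon>\<^sub>i - \<epsilon>\<^sub>i\<^sub>+\<^sub>1\<close>.
\<close>

definition wt :: "nat \<Rightarrow> nat \<Rightarrow> int" where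
  "wt j i = (if j = i then 1 else if j = i + 1 then -1 else 0)"

text \<open>
  The defining relations of the Drinfeld--Jimbo algebra \<open>U\<^sub>q(gl\<^sub>m)\<close>, imposed on a family \<open>\<iota>\<close> of
  elements of an algebra \<open>A\<close>.
\<close>

inductive_set uq_rels :: "(Cq, 'a) module \<Rightarrow> (uq_gen \<Rightarrow> 'a) \<Rightarrow> nat \<Rightarrow> ('a \<times> 'a) set"
  for A :: "(Cq, 'a) module" (structure) and \<iota> :: "uq_gen \<Rightarrow> 'a" and m :: nat
where
  K_Kinv: "j \<in> {1..m} \<Longrightarrow> (\<iota> (UK j) \<otimes> \<iota> (UKinv j), \<one>) \<in> uq_rels A \<iota> m"
| Kinv_K: "j \<in> {1..m} \<Longrightarrow> (\<iota> (UKinv j) \<otimes> \<iota> (UK j), \<one>) \<in> uq_rels A \<iota> m"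
| K_K: "i \<in> {1..m} \<Longrightarrow> j \<in> {1..m} \<Longrightarrow>
    (\<iota> (UK i) \<otimes> \<iota> (UK j), \<iota> (UK j) \<otimes> \<iota> (UK i)) \<in> uq_rels A \<iota> m"
| K_E: "j \<in> {1..m} \<Longrightarrow> i \<in> {1..<m} \<Longrightarrow>
    (\<iota> (UK j) \<otimes> \<iota> (UE i) \<otimes> \<iota> (UKinv j), (qq powi wt j i) \<odot> \<iota> (UE i)) \<in> uq_rels A \<iota> m"
| K_F: "j \<in> {1..m} \<Longrightarrow> i \<in> {1..<m} \<Longrightarrow>
    (\<iota> (UK j) \<otimes> \<iota> (UF i) \<otimes> \<iota> (UKinv j), (qq powi (- wt j i)) \<odot> \<iota> (UF i)) \<in> uq_rels A \<iota> m"
| E_F_same: "i \<in> {1..<m} \<Longrightarrow>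
    (\<iota> (UE i) \<otimes> \<iota> (UF i) \<ominus> \<iota> (UF i) \<otimes> \<iota> (UE i),
     (1 / (qq - inverse qq)) \<odot> (\<iota> (UK i) \<otimes> \<iota> (UKinv (i + 1)) \<ominus> \<iota> (UKinv i) \<otimes> \<iota> (UK (i + 1))))
    \<in> uq_rels A \<iota> m"
| E_F_diff: "i \<in> {1..<m} \<Longrightarrow> j \<in> {1..<m} \<Longrightarrow> i \<noteq> j \<Longrightarrow>
    (\<iota> (UE i) \<otimes> \<iota> (UF j), \<iota> (UF j) \<otimes> \<iota> (UE i)) \<in> uq_rels A \<iota> m"
| E_far: "i \<in> {1..<m} \<Longrightarrow> j \<in> {1..<m} \<Longrightarrow> \<bar>int i - int j\<bar> > 1 \<Longrightarrow>
    (\<iota> (UE i) \<otimes> \<iota> (UE j), \<iota> (UE j) \<otimes> \<iota> (UE i)) \<in> uq_rels A \<iota> m"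
| F_far: "i \<in> {1..<m} \<Longrightarrow> j \<in> {1..<m} \<Longrightarrow> \<bar>int i - int j\<bar> > 1 \<Longrightarrow>
    (\<iota> (UF i) \<otimes> \<iota> (UF j), \<iota> (UF j) \<otimes> \<iota> (UF i)) \<in> uq_rels A \<iota> m"
| E_Serre: "i \<in> {1..<m} \<Longrightarrow> j \<in> {1..<m} \<Longrightarrow> \<bar>int i - int j\<bar> = 1 \<Longrightarrow>
    (\<iota> (UE i) \<otimes> \<iota> (UE i) \<otimes> \<iota> (UE j) \<oplus> \<iota> (UE j) \<otimes> \<iota> (UE i) \<otimes> \<iota> (UE i),
     (qq + inverse qq) \<odot> (\<iota> (UE i) \<otimes> \<iota> (UE j) \<otimes> \<iota> (UE i))) \<in> uq_rels A \<iota> m"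
| F_Serre: "i \<in> {1..<m} \<Longrightarrow> j \<in> {1..<m} \<Longrightarrow> \<bar>int i - int j\<bar> = 1 \<Longrightarrow>
    (\<iota> (UF i) \<otimes> \<iota> (UF i) \<otimes> \<iota> (UF j) \<oplus> \<iota> (UF j) \<otimes> \<iota> (UF i) \<otimes> \<iota> (UF i),
     (qq + inverse qq) \<odot> (\<iota> (UF i) \<otimes> \<iota> (UF j) \<otimes> \<iota> (UF i))) \<in> uq_rels A \<iota> m"

text \<open>
  The algebra \<open>U\<^sub>q(gl\<^bsub>N 1\<^esub> \<oplus> \<dots> \<oplus> gl\<^bsub>N d\<^esub>)\<close>. The generator \<open>(b, g)\<close> is the generator \<open>g\<close> of the
  \<open>b\<close>-th factor. The relations are those of each factor together with the commutation of distinct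
  factors, which present the tensor product of the algebras \<open>U\<^sub>q(gl\<^bsub>N b\<^esub>)\<close>.
\<close>

type_synonym agen = "nat \<times> uq_gen"
type_synonym afree = "agen list \<Rightarrow> Cq"

definition a_gens :: "nat \<Rightarrow> (nat \<Rightarrow> nat) \<Rightarrow> agen set" where
  "a_gens d N = (SIGMA b:{1..d}. uq_gens (N b))"

definition a_free :: "nat \<Rightarrow> (nat \<Rightarrow> nat) \<Rightarrow> (Cq, afree) module" where
  "a_free d N = free_algebra (a_gens d N)"

definition a_rels :: "nat \<Rightarrow> (nat \<Rightarrow> nat) \<Rightarrow> (afree \<times> afree) set" where
  "a_rels d N =
    (\<Union>b\<in>{1..d}. uq_rels (a_free d N) (\<lambda>g. kdelta [(b, g)]) (N b)) \<union>
    {(kdelta [(b, g)] \<otimes>\<^bsub>a_free d N\<^esub> kdelta [(c, h)],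
      kdelta [(c, h)] \<otimes>\<^bsub>a_free d N\<^esub> kdelta [(b, g)]) | b c g h.
        b \<noteq> c \<and> (b, g) \<in> a_gens d N \<and> (c, h) \<in> a_gens d N}"

definition Uq :: "nat \<Rightarrow> (nat \<Rightarrow> nat) \<Rightarrow> (Cq, afree set) module" where
  "Uq d N = alg_mod_rels (a_free d N) (a_rels d N)"

text \<open>
  Counit and comultiplication, lifted to the free algebra. The convention is
  \<open>\<Delta>(E\<^sub>i) = E\<^sub>i \<otimes> K\<^sub>i K\<^sub>i\<^sub>+\<^sub>1\<^sup>-\<^sup>1 + 1 \<otimes> E\<^sub>i\<close>, \<open>\<Delta>(F\<^sub>i) = F\<^sub>i \<otimes> 1 + K\<^sub>i\<^sup>-\<^sup>1 K\<^sub>i\<^sub>+\<^sub>1 \<otimes> F\<^sub>i\<close>, \<open>\<Delta>(K\<^sub>i) = K\<^sub>i \<otimes> K\<^sub>i\<close>.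
\<close>

fun counit_gen :: "uq_gen \<Rightarrow> Cq" where
  "counit_gen (UE i) = 0"
| "counit_gen (UF i) = 0"
| "counit_gen (UK j) = 1"
| "counit_gen (UKinv j) = 1"

definition a_free2 :: "nat \<Rightarrow> (nat \<Rightarrow> nat) \<Rightarrow> (Cq, agen list \<times> agen list \<Rightarrow> Cq) module" where
  "a_free2 d N = monoid_algebra (free_monoid (a_gens d N) \<times>\<times> free_monoid (a_gens d N))"

fun comult_gen :: "nat \<Rightarrow> (nat \<Rightarrow> nat) \<Rightarrow> agen \<Rightarrow> agen list \<times> agen list \<Rightarrow> Cq" where
  "comult_gen d N (b, UE i) =
    kdelta ([(b, UE i)], [(b, UK i), (b, UKinv (i + 1))]) \<oplus>\<^bsub>a_free2 d N\<^esub> kdelta ([], [(b, UE i)])"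
| "comult_gen d N (b, UF i) =
    kdelta ([(b, UF i)], []) \<oplus>\<^bsub>a_free2 d N\<^esub> kdelta ([(b, UKinv i), (b, UK (i + 1))], [(b, UF i)])"
| "comult_gen d N (b, UK j) = kdelta ([(b, UK j)], [(b, UK j)])"
| "comult_gen d N (b, UKinv j) = kdelta ([(b, UKinv j)], [(b, UKinv j)])"

definition comult :: "nat \<Rightarrow> (nat \<Rightarrow> nat) \<Rightarrow> afree \<Rightarrow> agen list \<times> agen list \<Rightarrow> Cq" where
  "comult d N = free_lift (a_free2 d N) (comult_gen d N)"

section \<open>The vector representation and its tensor powers\<close>

text \<open>
  \<open>V = V\<^sub>1 \<oplus> \<dots> \<oplus> V\<^sub>d\<close> has the basis \<open>kdelta (b, i)\<close> with \<open>1 \<le> b \<le> d\<close>, \<open>1 \<le> i \<le> N b\<close>, and its \<open>n\<close>-th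
  tensor power has as basis the words of length \<open>n\<close> in these pairs.
\<close>

definition vbasis :: "nat \<Rightarrow> (nat \<Rightarrow> nat) \<Rightarrow> (nat \<times> nat) set" where
  "vbasis d N = (SIGMA b:{1..d}. {1..N b})"

definition tbasis :: "nat \<Rightarrow> (nat \<Rightarrow> nat) \<Rightarrow> nat \<Rightarrow> (nat \<times> nat) list set" where
  "tbasis d N n = {w. length w = n \<and> set w \<subseteq> vbasis d N}"

type_synonym tvec = "(nat \<times> nat) list \<Rightarrow> Cq"

fun vec_act :: "uq_gen \<Rightarrow> (nat \<Rightarrow> Cq) \<Rightarrow> nat \<Rightarrow> Cq" where
  "vec_act (UE i) v k = (if k = i then v (i + 1) else 0)"
| "vec_act (UF i) v k = (if k = i + 1 then v i else 0)"
| "vec_act (UK j) v k = (if k = j then qq * v k else v k)"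
| "vec_act (UKinv j) v k = (if k = j then inverse qq * v k else v k)"

definition v_gen :: "nat \<Rightarrow> (nat \<Rightarrow> nat) \<Rightarrow> agen \<Rightarrow> (nat \<times> nat \<Rightarrow> Cq) \<Rightarrow> nat \<times> nat \<Rightarrow> Cq" where
  "v_gen d N = (\<lambda>(b, g). \<lambda>v\<in>vspace (vbasis d N). \<lambda>(c, k).
    if c = b then vec_act g (\<lambda>i. v (b, i)) k else counit_gen g * v (c, k))"

definition v_act :: "nat \<Rightarrow> (nat \<Rightarrow> nat) \<Rightarrow> afree \<Rightarrow> (nat \<times> nat \<Rightarrow> Cq) \<Rightarrow> nat \<times> nat \<Rightarrow> Cq" where
  "v_act d N = free_lift (endo_alg (vbasis d N)) (v_gen d N)"

text \<open>The operator \<open>f \<otimes> g\<close> on \<open>V \<otimes> V\<^bsup>\<otimes>m\<^esup> = V\<^bsup>\<otimes>(m+1)\<^esup>\<close>.\<close>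

definition op_tensor ::
  "nat \<Rightarrow> (nat \<Rightarrow> nat) \<Rightarrow> nat \<Rightarrow> ((nat \<times> nat \<Rightarrow> Cq) \<Rightarrow> nat \<times> nat \<Rightarrow> Cq) \<Rightarrow> (tvec \<Rightarrow> tvec) \<Rightarrow> tvec \<Rightarrow> tvec"
where
  "op_tensor d N m f g =
    lin_ext (tbasis d N (m + 1)) (\<lambda>w w'. f (kdelta (hd w)) (hd w') * g (kdelta (tl w)) (tl w'))"

primrec t_act :: "nat \<Rightarrow> (nat \<Rightarrow> nat) \<Rightarrow> nat \<Rightarrow> afree \<Rightarrow> tvec \<Rightarrow> tvec" where
  "t_act d N 0 =
    free_lift (endo_alg (tbasis d N 0))
      (\<lambda>(b, g). counit_gen g \<odot>\<^bsub>endo_alg (tbasis d N 0)\<^esub> \<one>\<^bsub>endo_alg (tbasis d N 0)\<^esub>)"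
| "t_act d N (Suc m) = (\<lambda>a.
    \<Oplus>\<^bsub>endo_alg (tbasis d N (Suc m))\<^esub>p\<in>{p. comult d N a p \<noteq> 0}.
      comult d N a p \<odot>\<^bsub>endo_alg (tbasis d N (Suc m))\<^esub>
        op_tensor d N m (v_act d N (kdelta (fst p))) (t_act d N m (kdelta (snd p))))"

text \<open>
  Elements of \<^const>\<open>Uq\<close> are cosets \<open>X\<close> in the free algebra. All representatives of \<open>X\<close> act by
  the same operator.
\<close>

definition Uq_act :: "nat \<Rightarrow> (nat \<Rightarrow> nat) \<Rightarrow> nat \<Rightarrow> afree set \<Rightarrow> tvec \<Rightarrow> tvec" where
  "Uq_act d N n X = the_elem (t_act d N n ` X)"

definition End_Uq :: "nat \<Rightarrow> (nat \<Rightarrow> nat) \<Rightarrow> nat \<Rightarrow> (Cq, tvec \<Rightarrow> tvec) module" where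
  "End_Uq d N n = (endo_alg (tbasis d N n))
    \<lparr>carrier := {f \<in> carrier (endo_alg (tbasis d N n)).
      \<forall>X\<in>carrier (Uq d N). \<forall>v\<in>vspace (tbasis d N n). f (Uq_act d N n X v) = Uq_act d N n X (f v)}\<rparr>"

section \<open>The operators on tensor space\<close>

definition tau :: "nat \<Rightarrow> (nat \<Rightarrow> nat) \<Rightarrow> nat \<Rightarrow> Cq \<Rightarrow> nat \<Rightarrow> tvec \<Rightarrow> tvec" where
  "tau d N n \<zeta> i = lin_ext (tbasis d N n) (\<lambda>w w'. \<zeta> ^ (fst (w ! (i - 1)) - 1) * kdelta w w')"

text \<open>
  The operator \<open>\<check>R\<close> on \<open>k\<^sup>m \<otimes> k\<^sup>m\<close>, whose basis is indexed by pairs \<open>(j, k)\<close>. For the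
  comultiplication chosen above, the \<open>q\<close>-symmetric square is spanned by \<open>v\<^sub>j \<otimes> v\<^sub>j\<close> and
  \<open>v\<^sub>j \<otimes> v\<^sub>k + q v\<^sub>k \<otimes> v\<^sub>j\<close>, and the \<open>q\<close>-antisymmetric square by \<open>q v\<^sub>j \<otimes> v\<^sub>k - v\<^sub>k \<otimes> v\<^sub>j\<close>, for \<open>j < k\<close>.
\<close>

definition Rcheck :: "nat \<Rightarrow> (nat \<times> nat \<Rightarrow> Cq) \<Rightarrow> nat \<times> nat \<Rightarrow> Cq" where
  "Rcheck m = lin_ext ({1..m} \<times> {1..m}) (\<lambda>(j, k) y.
    if j = k then qq * kdelta (j, j) y
    else if j < k then kdelta (k, j) y
    else kdelta (k, j) y + (qq - inverse qq) * kdelta (j, k) y)"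

lemma Rcheck_apply:
  assumes "v \<in> vspace ({1..m} \<times> {1..m})"
  shows "Rcheck m v = (\<lambda>(a, b).
    if a = b then qq * v (a, a) else if a < b then v (b, a)
    else v (b, a) + (qq - inverse qq) * v (a, b))"
proof -
  let ?\<phi> = "\<lambda>(j, k) y. if j = k then qq * kdelta (j, j) y
    else if j < k then kdelta (k, j) y
    else kdelta (k, j) y + (qq - inverse qq) * kdelta (j, k) y"
  have "Rcheck m v (a, b) =
    (if a = b then qq * v (a, a) else if a < b then v (b, a)
     else v (b, a) + (qq - inverse qq) * v (a, b))" for a b
  proof (cases "(a, b) \<in> {1..m} \<times> {1..m}")
    case True
    then have "Rcheck m v (a, b) = (\<Sum>x\<in>{1..m} \<times> {1..m}. v x * ?\<phi> x (a, b))"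
      using assms by (simp add: Rcheck_def lin_ext_def)
    also have "\<dots> = (\<Sum>x\<in>{(a, b), (b, a)}. v x * ?\<phi> x (a, b))"
      by (rule sum.mono_neutral_right) (use True in \<open>auto simp: kdelta_def split: if_splits\<close>)
    finally show ?thesis
      by (auto simp: kdelta_def algebra_simps)
  next
    case False
    then have "v (a, b) = 0" "v (b, a) = 0"
      using assms unfolding vspace_def by blast+
    moreover have "Rcheck m v (a, b) = 0"
      using assms False unfolding Rcheck_def lin_ext_def by (simp only: restrict_apply if_True if_False)
    ultimately show ?thesis by auto
  qed
  then show ?thesis by auto
qed

lemma Rcheck_in_vspace:
  assumes "v \<in> vspace ({1..m} \<times> {1..m})"
  shows "Rcheck m v \<in> vspace ({1..m} \<times> {1..m})"
  using assms by (simp add: Rcheck_def lin_ext_def vspace_def)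

lemma Rcheck_Hecke:
  assumes "v \<in> vspace ({1..m} \<times> {1..m})"
  shows "Rcheck m (Rcheck m v) = (\<lambda>y. (qq - inverse qq) * Rcheck m v y + v y)"
  by (subst Rcheck_apply[OF Rcheck_in_vspace[OF assms]], unfold Rcheck_apply[OF assms])
    (use qq_nonzero in \<open>auto simp: fun_eq_iff algebra_simps\<close>)

lemma Rcheck_diag:
  assumes "j \<in> {1..m}"
  shows "Rcheck m (kdelta (j, j)) = (\<lambda>y. qq * kdelta (j, j) y)"
proof -
  have "kdelta (j, j) \<in> vspace ({1..m} \<times> {1..m})"
    using assms by (auto simp: vspace_def kdelta_def)
  from Rcheck_apply[OF this] show ?thesis
    by (auto simp: fun_eq_iff kdelta_def)
qed

lemma Rcheck_sym:
  assumes "j \<in> {1..m}" "k \<in> {1..m}" "j < k"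
  shows "Rcheck m (\<lambda>y. kdelta (j, k) y + qq * kdelta (k, j) y) =
    (\<lambda>y. qq * (kdelta (j, k) y + qq * kdelta (k, j) y))"
proof -
  have "(\<lambda>y. kdelta (j, k) y + qq * kdelta (k, j) y) \<in> vspace ({1..m} \<times> {1..m})"
    using assms by (auto simp: vspace_def kdelta_def)
  from Rcheck_apply[OF this] show ?thesis
    using assms qq_nonzero by (auto simp: fun_eq_iff kdelta_def algebra_simps)
qed

lemma Rcheck_antisym:
  assumes "j \<in> {1..m}" "k \<in> {1..m}" "j < k"
  shows "Rcheck m (\<lambda>y. qq * kdelta (j, k) y - kdelta (k, j) y) =
    (\<lambda>y. - inverse qq * (qq * kdelta (j, k) y - kdelta (k, j) y))"
proof -
  have "(\<lambda>y. qq * kdelta (j, k) y - kdelta (k, j) y) \<in> vspace ({1..m} \<times> {1..m})"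
    using assms by (auto simp: vspace_def kdelta_def)
  from Rcheck_apply[OF this] show ?thesis
    using assms qq_nonzero by (auto simp: fun_eq_iff kdelta_def algebra_simps)
qed

text \<open>
  The operator on \<open>V \<otimes> V\<close> as a matrix: the coefficient of \<open>x' \<otimes> y'\<close> in the image of \<open>x \<otimes> y\<close>.
\<close>

definition sigma2 :: "(nat \<Rightarrow> nat) \<Rightarrow> (nat \<times> nat) \<times> (nat \<times> nat) \<Rightarrow> (nat \<times> nat) \<times> (nat \<times> nat) \<Rightarrow> Cq" where
  "sigma2 N = (\<lambda>((b, j), (c, k)) ((b', j'), (c', k')).
    if b = c then (if b' = b \<and> c' = b then Rcheck (N b) (kdelta (j, k)) (j', k') else 0)
    else kdelta ((c, k), (b, j)) ((b', j'), (c', k')))"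

definition sigma :: "nat \<Rightarrow> (nat \<Rightarrow> nat) \<Rightarrow> nat \<Rightarrow> nat \<Rightarrow> tvec \<Rightarrow> tvec" where
  "sigma d N n i = lin_ext (tbasis d N n) (\<lambda>w w'.
    if \<forall>r<n. r \<noteq> i - 1 \<and> r \<noteq> i \<longrightarrow> w' ! r = w ! r
    then sigma2 N (w ! (i - 1), w ! i) (w' ! (i - 1), w' ! i) else 0)"

end

theory Submission
  imports Defs "HOL-Combinatorics.Combinatorics"
begin

text \<open>
  The commutant is deformed from \<open>q = 1\<close>. The elements \<open>e\<^sub>c s\<^sub>u\<close>, where \<open>e\<^sub>c\<close> is the idempotent of
  the colour sequence \<open>c\<close> and \<open>u\<close> runs through normal forms of permutations, span the
  Yokonuma--Hecke algebra, and their images have matrix entries that are regular at \<open>q = 1\<close>, where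
  they become permutation operators cut down to colour sequences. A matrix commuting with the
  quantum group can be scaled to be regular at \<open>q = 1\<close>, and its value there commutes with the
  \<open>gl\<close>-action. A polarization argument shows that such a matrix vanishes if it is orthogonal to all
  permutation operators. Hence the images that are independent at \<open>q = 1\<close> already span the commutant.

  If all \<open>N b \<ge> n\<close>, the permutation operators are independent, so the spanning set is a basis and
  the map is injective. If some \<open>N b < n\<close>, the antisymmetrizer of a constant colour sequence vanishes
  at \<open>q = 1\<close>, so some \<open>e\<^sub>c s\<^sub>u\<close> has the same image as a combination of the others. Injectivity would turn
  this into a relation in the algebra, contradicting the first case for larger \<open>N b\<close>.
\<close>

text \<open>Neither complete reducibility for the quantum group nor the dimension d^n n! of the
  Yokonuma-Hecke algebra is presupposed; the latter drops out once a representation with large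
  \<open>N b\<close> separates the elements of the spanning set. The obstacle at q = 1 is that all
  K-generators become the identity, so the limit of a commuting matrix carries no condition from the
  torus. That it preserves weights is extracted before specializing, from the fact that distinct
  powers of q are distinct. Together with the limits of E and F this gives commutation with all
  matrix units inside each colour, and then with their symmetrized products. Over the complex
  numbers a positive definite form takes the place of the double centralizer theorem: orthogonality
  to all coloured permutations makes a sum of squared norms vanish. The idempotents e_c exist
  because the field contains a primitive d-th root of unity and d is invertible in it, so colour
  sequences and exponents of t-monomials are exchanged by a finite Fourier transform. One direction
  produces e_c, the other recovers coefficients in the proof of injectivity.\<close>

locale kalgebra = ring A for A :: "('k::field, 'a) module" (structure) +
  assumes smult_closed [simp, intro]: "x \<in> carrier A \<Longrightarrow> c \<odot> x \<in> carrier A"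
    and smult_l_distr: "x \<in> carrier A \<Longrightarrow> (c + e) \<odot> x = c \<odot> x \<oplus> e \<odot> x"
    and smult_r_distr: "x \<in> carrier A \<Longrightarrow> y \<in> carrier A \<Longrightarrow> c \<odot> (x \<oplus> y) = c \<odot> x \<oplus> c \<odot> y"
    and smult_assoc: "x \<in> carrier A \<Longrightarrow> (c * e) \<odot> x = c \<odot> (e \<odot> x)"
    and smult_one [simp]: "x \<in> carrier A \<Longrightarrow> 1 \<odot> x = x"
    and smult_mult_l: "x \<in> carrier A \<Longrightarrow> y \<in> carrier A \<Longrightarrow> (c \<odot> x) \<otimes> y = c \<odot> (x \<otimes> y)"
    and smult_mult_r: "x \<in> carrier A \<Longrightarrow> y \<in> carrier A \<Longrightarrow> x \<otimes> (c \<odot> y) = c \<odot> (x \<otimes> y)"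
begin

lemma smult_l_null [simp]:
  assumes "x \<in> carrier A"
  shows "0 \<odot> x = \<zero>"
proof -
  have "0 \<odot> x \<oplus> 0 \<odot> x = 0 \<odot> x"
    using smult_l_distr[OF assms, of 0 0] by simp
  then show ?thesis
    using assms by (metis add.l_cancel_one smult_closed)
qed

lemma smult_r_null [simp]: "c \<odot> \<zero> = \<zero>"
proof -
  have "c \<odot> \<zero> \<oplus> c \<odot> \<zero> = c \<odot> \<zero>"
    using smult_r_distr[of \<zero> \<zero> c] by simp
  then show ?thesis
    by (metis add.l_cancel_one smult_closed zero_closed)
qed

lemma smult_minus_one:
  assumes "x \<in> carrier A"
  shows "(- 1) \<odot> x = \<ominus> x"
proof -
  have "(- 1) \<odot> x \<oplus> x = \<zero>"
    using smult_l_distr[OF assms, of "- 1" 1] assms by simp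
  then show ?thesis
    using assms by (simp add: minus_equality)
qed

end

section \<open>Linear spans in an algebra\<close>

inductive_set lspan :: "('k::field, 'a) module \<Rightarrow> 'a set \<Rightarrow> 'a set"
  for A :: "('k, 'a) module" (structure) and X :: "'a set"
where
  zero: "\<zero> \<in> lspan A X"
| step: "x \<in> X \<Longrightarrow> v \<in> lspan A X \<Longrightarrow> c \<odot> x \<oplus> v \<in> lspan A X"

context kalgebra
begin

lemma lspan_carrier:
  assumes "X \<subseteq> carrier A" "v \<in> lspan A X"
  shows "v \<in> carrier A"
  using assms(2,1) by (induction rule: lspan.induct) (auto simp: subset_iff)

lemma lspan_incl:
  assumes "X \<subseteq> carrier A" "x \<in> X"
  shows "x \<in> lspan A X"
  using lspan.step[of x X "\<zero>" A 1, OF assms(2) lspan.zero] assms by auto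

lemma lspan_smult:
  assumes "X \<subseteq> carrier A" "v \<in> lspan A X"
  shows "c \<odot> v \<in> lspan A X"
  using assms(2)
proof induction
  case (step x v e)
  then have "c \<odot> (e \<odot> x \<oplus> v) = (c * e) \<odot> x \<oplus> c \<odot> v"
    using assms(1) lspan_carrier[OF assms(1)] by (auto simp: smult_r_distr smult_assoc)
  with step show ?case
    by (auto intro: lspan.step)
qed (auto intro: lspan.zero)

lemma lspan_add:
  assumes "X \<subseteq> carrier A" "v \<in> lspan A X" "w \<in> lspan A X"
  shows "v \<oplus> w \<in> lspan A X"
  using assms(2)
proof induction
  case zero
  then show ?case
    using assms lspan_carrier[OF assms(1)] by auto
next
  case (step x v e)
  then have "(e \<odot> x \<oplus> v) \<oplus> w = e \<odot> x \<oplus> (v \<oplus> w)"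
    using assms lspan_carrier[OF assms(1)] by (auto intro!: a_assoc)
  with step show ?case
    by (auto intro: lspan.step)
qed

lemma lspan_minus:
  assumes "X \<subseteq> carrier A" "v \<in> lspan A X" "w \<in> lspan A X"
  shows "v \<ominus> w \<in> lspan A X"
  using lspan_add[OF assms(1,2) lspan_smult[OF assms(1,3), of "- 1"]]
    lspan_carrier[OF assms(1,3)] by (simp add: smult_minus_one a_minus_def)

lemma lspan_finsum:
  assumes "X \<subseteq> carrier A" "finite S" "\<And>i. i \<in> S \<Longrightarrow> f i \<in> lspan A X"
  shows "(\<Oplus>i\<in>S. f i) \<in> lspan A X"
  using assms(2,3)
proof induction
  case (insert i S)
  then have "f \<in> S \<rightarrow> carrier A" "f i \<in> carrier A"
    using lspan_carrier[OF assms(1)] by auto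
  with insert show ?case
    by (auto simp: finsum_insert intro!: lspan_add[OF assms(1)])
qed (auto intro: lspan.zero)

text \<open>Linearity of \<open>f\<close> enters as two premises. The main instances are
  multiplications by a fixed element from one side, which reduce products of spans to products of
  spanning elements.\<close>

lemma lspan_linear_image:
  assumes X: "X \<subseteq> carrier A" and Y: "Y \<subseteq> carrier A"
    and f: "\<And>c x y. x \<in> carrier A \<Longrightarrow> y \<in> carrier A \<Longrightarrow> f (c \<odot> x \<oplus> y) = c \<odot> f x \<oplus> f y" "f \<zero> = \<zero>"
    and XY: "\<And>x. x \<in> X \<Longrightarrow> f x \<in> lspan A Y" and v: "v \<in> lspan A X"
  shows "f v \<in> lspan A Y"
  using v
proof induction
  case zero
  then show ?case using f(2) lspan.zero by simp
next
  case (step x v c)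
  then have "f (c \<odot> x \<oplus> v) = c \<odot> f x \<oplus> f v"
    using X lspan_carrier[OF X] by (intro f(1)) auto
  with step show ?case
    by (simp add: lspan_add[OF Y] lspan_smult[OF Y] XY)
qed

lemma lspan_subset:
  assumes "X \<subseteq> carrier A" "Y \<subseteq> carrier A" "X \<subseteq> lspan A Y"
  shows "lspan A X \<subseteq> lspan A Y"
proof
  fix v assume "v \<in> lspan A X"
  from lspan_linear_image[where f = "\<lambda>x. x", OF assms(1,2) _ _ _ this]
  show "v \<in> lspan A Y" using assms(3) by auto
qed

lemma lspan_mult_right:
  assumes "X \<subseteq> carrier A" "Y \<subseteq> carrier A" "z \<in> carrier A"
    and "\<And>x. x \<in> X \<Longrightarrow> x \<otimes> z \<in> lspan A Y" "v \<in> lspan A X"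
  shows "v \<otimes> z \<in> lspan A Y"
  using assms by (intro lspan_linear_image[where f = "\<lambda>x. x \<otimes> z", OF assms(1,2) _ _ _ assms(5)])
    (auto simp: l_distr smult_mult_l)

lemma lspan_mult_left:
  assumes "X \<subseteq> carrier A" "Y \<subseteq> carrier A" "z \<in> carrier A"
    and "\<And>x. x \<in> X \<Longrightarrow> z \<otimes> x \<in> lspan A Y" "v \<in> lspan A X"
  shows "z \<otimes> v \<in> lspan A Y"
  using assms by (intro lspan_linear_image[where f = "\<lambda>x. z \<otimes> x", OF assms(1,2) _ _ _ assms(5)])
    (auto simp: r_distr smult_mult_r)

end

text \<open>Passes from the inductive span to coordinates. The coefficients are indexed by
  \<open>J\<close> and not by the vectors \<open>g j\<close>, so repetitions in the family do no
  harm.\<close>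

lemma lspan_lincomb:
  assumes A: "kalgebra A" and "finite J" and g: "g \<in> J \<rightarrow> carrier A" and v: "v \<in> lspan A (g ` J)"
  shows "\<exists>\<alpha>. v = (\<Oplus>\<^bsub>A\<^esub>j\<in>J. \<alpha> j \<odot>\<^bsub>A\<^esub> g j)"
  using v
proof induction
  interpret kalgebra A by fact
  case zero
  have "(\<Oplus>\<^bsub>A\<^esub>j\<in>J. 0 \<odot>\<^bsub>A\<^esub> g j) = (\<Oplus>\<^bsub>A\<^esub>j\<in>J. \<zero>\<^bsub>A\<^esub>)"
    using g by (intro finsum_cong') (auto simp: Pi_iff)
  then show ?case
    by (intro exI[of _ "\<lambda>_. 0"]) simp
next
  interpret kalgebra A by fact
  case (step x v c)
  then obtain \<alpha> i where v: "v = (\<Oplus>\<^bsub>A\<^esub>j\<in>J. \<alpha> j \<odot>\<^bsub>A\<^esub> g j)" and i: "i \<in> J" "x = g i"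
    by blast
  have J: "J = insert i (J - {i})" "finite (J - {i})" using i \<open>finite J\<close> by auto
  have cl: "(\<lambda>j. \<beta> j \<odot>\<^bsub>A\<^esub> g j) \<in> J - {i} \<rightarrow> carrier A" "\<beta> i \<odot>\<^bsub>A\<^esub> g i \<in> carrier A" for \<beta>
    using g i by auto
  have split: "(\<Oplus>\<^bsub>A\<^esub>j\<in>J. \<beta> j \<odot>\<^bsub>A\<^esub> g j) = \<beta> i \<odot>\<^bsub>A\<^esub> g i \<oplus>\<^bsub>A\<^esub> (\<Oplus>\<^bsub>A\<^esub>j\<in>J - {i}. \<beta> j \<odot>\<^bsub>A\<^esub> g j)" for \<beta>
    by (subst J(1)) (rule finsum_insert; use J cl in auto)
  \<comment> \<open>The index \<open>i\<close> may already carry a coefficient from the induction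
    hypothesis, so \<open>c\<close> is added to it.\<close>
  define \<beta> where "\<beta> = \<alpha>(i := c + \<alpha> i)"
  have eq: "(\<Oplus>\<^bsub>A\<^esub>j\<in>J - {i}. \<beta> j \<odot>\<^bsub>A\<^esub> g j) = (\<Oplus>\<^bsub>A\<^esub>j\<in>J - {i}. \<alpha> j \<odot>\<^bsub>A\<^esub> g j)"
    using g by (intro finsum_cong') (auto simp: \<beta>_def)
  have "(\<Oplus>\<^bsub>A\<^esub>j\<in>J. \<beta> j \<odot>\<^bsub>A\<^esub> g j) = c \<odot>\<^bsub>A\<^esub> x \<oplus>\<^bsub>A\<^esub> v"
    unfolding v split[of \<beta>] split[of \<alpha>] eq
    using g i cl by (auto simp: \<beta>_def smult_l_distr a_assoc Pi_iff)
  then show ?case by metis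
qed

section \<open>Algebra homomorphisms\<close>

lemma alg_homD:
  assumes "f \<in> alg_hom A B"
  shows "x \<in> carrier A \<Longrightarrow> f x \<in> carrier B"
    and "x \<in> carrier A \<Longrightarrow> y \<in> carrier A \<Longrightarrow> f (x \<otimes>\<^bsub>A\<^esub> y) = f x \<otimes>\<^bsub>B\<^esub> f y"
    and "x \<in> carrier A \<Longrightarrow> y \<in> carrier A \<Longrightarrow> f (x \<oplus>\<^bsub>A\<^esub> y) = f x \<oplus>\<^bsub>B\<^esub> f y"
    and "f \<one>\<^bsub>A\<^esub> = \<one>\<^bsub>B\<^esub>"
    and "x \<in> carrier A \<Longrightarrow> f (c \<odot>\<^bsub>A\<^esub> x) = c \<odot>\<^bsub>B\<^esub> f x"
  using assms by (auto simp: alg_hom_def ring_hom_def)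

lemma alg_hom_more:
  assumes "kalgebra A" "kalgebra B" "f \<in> alg_hom A B"
  shows "f \<zero>\<^bsub>A\<^esub> = \<zero>\<^bsub>B\<^esub>"
    and "x \<in> carrier A \<Longrightarrow> y \<in> carrier A \<Longrightarrow> f (x \<ominus>\<^bsub>A\<^esub> y) = f x \<ominus>\<^bsub>B\<^esub> f y"
    and "finite S \<Longrightarrow> g \<in> S \<rightarrow> carrier A \<Longrightarrow> f (\<Oplus>\<^bsub>A\<^esub>i\<in>S. g i) = (\<Oplus>\<^bsub>B\<^esub>i\<in>S. f (g i))"
proof -
  interpret A: kalgebra A by fact
  interpret B: kalgebra B by fact
  note h = alg_homD[OF assms(3)]
  show z: "f \<zero>\<^bsub>A\<^esub> = \<zero>\<^bsub>B\<^esub>"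
    using h(5)[of "\<zero>\<^bsub>A\<^esub>" 0] h(1)[of "\<zero>\<^bsub>A\<^esub>"] by simp
  show "f (x \<ominus>\<^bsub>A\<^esub> y) = f x \<ominus>\<^bsub>B\<^esub> f y" if "x \<in> carrier A" "y \<in> carrier A"
    using that h by (simp add: a_minus_def A.smult_minus_one[symmetric] B.smult_minus_one[symmetric])
  show "f (\<Oplus>\<^bsub>A\<^esub>i\<in>S. g i) = (\<Oplus>\<^bsub>B\<^esub>i\<in>S. f (g i))" if "finite S" "g \<in> S \<rightarrow> carrier A"
    using that
  proof induction
    case (insert i S)
    then have "g i \<in> carrier A" "g \<in> S \<rightarrow> carrier A" by auto
    moreover have "f (g i) \<in> carrier B" "(\<lambda>i. f (g i)) \<in> S \<rightarrow> carrier B"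
      using insert.prems h(1) by auto
    ultimately show ?case
      using insert h(3) by (simp add: A.finsum_insert B.finsum_insert A.finsum_closed)
  qed (simp add: z)
qed

lemma alg_hom_comp:
  assumes "f \<in> alg_hom A B" "g \<in> alg_hom B C"
  shows "(\<lambda>x. g (f x)) \<in> alg_hom A C"
  using assms by (auto simp: alg_hom_def ring_hom_def Pi_iff)

section \<open>Monoid algebras\<close>

lemma monoid_algebra_simps:
  "carrier (monoid_algebra M) = {f. finite {x. f x \<noteq> 0} \<and> {x. f x \<noteq> 0} \<subseteq> carrier M}"
  "one (monoid_algebra M) = kdelta \<one>\<^bsub>M\<^esub>"
  "zero (monoid_algebra M) = (\<lambda>_. 0)"
  "f \<oplus>\<^bsub>monoid_algebra M\<^esub> g = (\<lambda>x. f x + g x)"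
  "c \<odot>\<^bsub>monoid_algebra M\<^esub> f = (\<lambda>x. c * f x)"
  by (simp_all add: monoid_algebra_def)

text \<open>The definition sums over the exact supports, which differ from one product to the next.
  Any finite sets containing the supports serve as well, so different products can be compared over
  a common index set.\<close>

lemma monoid_algebra_mult:
  assumes "finite S" "finite T" "\<And>x. x \<notin> S \<Longrightarrow> f x = 0" "\<And>x. x \<notin> T \<Longrightarrow> g x = 0"
  shows "(f \<otimes>\<^bsub>monoid_algebra M\<^esub> g) z = (\<Sum>x\<in>S. \<Sum>y\<in>T. if x \<otimes>\<^bsub>M\<^esub> y = z then f x * g y else 0)"
proof -
  have "(f \<otimes>\<^bsub>monoid_algebra M\<^esub> g) z = (\<Sum>(x, y) \<in> {(x, y). f x \<noteq> 0 \<and> g y \<noteq> 0 \<and> x \<otimes>\<^bsub>M\<^esub> y = z}. f x * g y)"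
    by (simp add: monoid_algebra_def)
  also have "\<dots> = (\<Sum>(x, y)\<in>S \<times> T. if x \<otimes>\<^bsub>M\<^esub> y = z then f x * g y else 0)"
  proof (rule sum.mono_neutral_cong_left)
    show "{(x, y). f x \<noteq> 0 \<and> g y \<noteq> 0 \<and> x \<otimes>\<^bsub>M\<^esub> y = z} \<subseteq> S \<times> T" using assms by blast
  qed (use assms in \<open>auto split: if_splits\<close>)
  also have "\<dots> = (\<Sum>x\<in>S. \<Sum>y\<in>T. if x \<otimes>\<^bsub>M\<^esub> y = z then f x * g y else 0)"
    by (simp add: sum.cartesian_product)
  finally show ?thesis .
qed

lemma kdelta_carrier [simp]: "x \<in> carrier M \<Longrightarrow> kdelta x \<in> carrier (monoid_algebra M)"
  by (auto simp: monoid_algebra_simps kdelta_def)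

lemma kdelta_mult:
  "kdelta x \<otimes>\<^bsub>monoid_algebra M\<^esub> kdelta y = kdelta (x \<otimes>\<^bsub>M\<^esub> y)"
proof
  fix z
  show "(kdelta x \<otimes>\<^bsub>monoid_algebra M\<^esub> kdelta y) z = kdelta (x \<otimes>\<^bsub>M\<^esub> y) z"
    by (subst monoid_algebra_mult[of "{x}" "{y}"]) (auto simp: kdelta_def)
qed

text \<open>Peels one point off the support at a time. Linear identities in the monoid algebra are
  thereby checked on basis elements.\<close>

lemma monoid_algebra_induct [consumes 1, case_names zero step]:
  assumes "f \<in> carrier (monoid_algebra M)"
    and "P (\<lambda>_. 0)"
    and "\<And>c x f. x \<in> carrier M \<Longrightarrow> f \<in> carrier (monoid_algebra M) \<Longrightarrow> P f \<Longrightarrow>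
      P (\<lambda>y. c * kdelta x y + f y)"
  shows "P f"
proof -
  have "finite S \<Longrightarrow> S \<subseteq> carrier M \<Longrightarrow> {x. f x \<noteq> 0} = S \<Longrightarrow> P f" for S
  proof (induction S arbitrary: f rule: finite_induct)
    case empty
    then have "f = (\<lambda>_. 0)" by auto
    then show ?case using assms(2) by simp
  next
    case (insert x S)
    let ?f = "\<lambda>y. if y = x then 0 else f y"
    have f: "f = (\<lambda>y. f x * kdelta x y + ?f y)" by (auto simp: kdelta_def)
    have "{y. ?f y \<noteq> 0} = S" using insert.hyps insert.prems by auto
    moreover from this have "?f \<in> carrier (monoid_algebra M)"
      using insert by (auto simp: monoid_algebra_simps)
    ultimately show ?case
      by (subst f, intro assms(3)) (use insert in auto)
  qed
  then show ?thesis using assms(1) by (auto simp: monoid_algebra_simps)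
qed

lemma monoid_algebra_supp:
  assumes "f \<in> carrier (monoid_algebra M)"
  shows "finite {x. f x \<noteq> 0}" "x \<notin> carrier M \<Longrightarrow> f x = 0"
  using assms by (auto simp: monoid_algebra_simps)

lemma monoid_algebra_add_closed:
  assumes "f \<in> carrier (monoid_algebra M)" "g \<in> carrier (monoid_algebra M)"
  shows "(\<lambda>x. f x + g x) \<in> carrier (monoid_algebra M)"
proof -
  have "{x. f x + g x \<noteq> 0} \<subseteq> {x. f x \<noteq> 0} \<union> {x. g x \<noteq> 0}" by auto
  then show ?thesis
    using assms by (auto simp: monoid_algebra_simps intro: finite_subset)
qed

lemma monoid_algebra_smult_closed:
  assumes "f \<in> carrier (monoid_algebra M)"
  shows "(\<lambda>x. c * f x) \<in> carrier (monoid_algebra M)"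
proof -
  have "{x. c * f x \<noteq> 0} \<subseteq> {x. f x \<noteq> 0}" by auto
  then show ?thesis
    using assms by (auto simp: monoid_algebra_simps intro: finite_subset)
qed

lemma monoid_algebra_l_distr:
  assumes "f \<in> carrier (monoid_algebra M)" "g \<in> carrier (monoid_algebra M)" "h \<in> carrier (monoid_algebra M)"
  shows "(\<lambda>x. c * f x + g x) \<otimes>\<^bsub>monoid_algebra M\<^esub> h =
    (\<lambda>x. c * (f \<otimes>\<^bsub>monoid_algebra M\<^esub> h) x + (g \<otimes>\<^bsub>monoid_algebra M\<^esub> h) x)" (is "?l = ?r")
proof
  fix z
  let ?S = "{x. f x \<noteq> 0} \<union> {x. g x \<noteq> 0}" and ?T = "{x. h x \<noteq> 0}"
  have fin: "finite ?S" "finite ?T" using assms monoid_algebra_supp(1) by auto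
  show "?l z = ?r z"
    by (subst (1 2 3) monoid_algebra_mult[of ?S ?T])
       (use fin in \<open>auto simp: sum_distrib_left sum.distrib[symmetric] algebra_simps intro!: sum.cong\<close>)
qed

lemma monoid_algebra_r_distr:
  assumes "f \<in> carrier (monoid_algebra M)" "g \<in> carrier (monoid_algebra M)" "h \<in> carrier (monoid_algebra M)"
  shows "h \<otimes>\<^bsub>monoid_algebra M\<^esub> (\<lambda>x. c * f x + g x) =
    (\<lambda>x. c * (h \<otimes>\<^bsub>monoid_algebra M\<^esub> f) x + (h \<otimes>\<^bsub>monoid_algebra M\<^esub> g) x)" (is "?l = ?r")
proof
  fix z
  let ?S = "{x. f x \<noteq> 0} \<union> {x. g x \<noteq> 0}" and ?T = "{x. h x \<noteq> 0}"
  have fin: "finite ?S" "finite ?T" using assms monoid_algebra_supp(1) by auto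
  show "?l z = ?r z"
    by (subst (1 2 3) monoid_algebra_mult[of ?T ?S])
       (use fin in \<open>auto simp: sum_distrib_left sum.distrib[symmetric] algebra_simps intro!: sum.cong\<close>)
qed

lemma monoid_algebra_zero_mult:
  "(\<lambda>_. 0) \<otimes>\<^bsub>monoid_algebra M\<^esub> h = (\<lambda>_. 0)" "h \<otimes>\<^bsub>monoid_algebra M\<^esub> (\<lambda>_. 0) = (\<lambda>_. 0)"
  by (auto simp: monoid_algebra_def)

lemma monoid_algebra_kalgebra:
  assumes "Group.monoid M"
  shows "kalgebra (monoid_algebra M :: ('k::field, 'm \<Rightarrow> 'k) module)"
proof -
  interpret M: Group.monoid M by fact
  let ?A = "monoid_algebra M :: ('k, 'm \<Rightarrow> 'k) module"
  note zc = monoid_algebra_zero_mult[of M] and ld = monoid_algebra_l_distr[of _ M] and rd = monoid_algebra_r_distr[of _ M]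
  have null: "(\<lambda>_. 0) \<in> carrier ?A" by (auto simp: monoid_algebra_simps)
  have lin: "(\<lambda>y. c * f y + g y) \<in> carrier ?A" if "f \<in> carrier ?A" "g \<in> carrier ?A" for c f g
    using monoid_algebra_add_closed[OF monoid_algebra_smult_closed[OF that(1)] that(2)] .
  have mult: "f \<otimes>\<^bsub>?A\<^esub> g \<in> carrier ?A" if f: "f \<in> carrier ?A" and g: "g \<in> carrier ?A" for f g
    using f
  proof (induction rule: monoid_algebra_induct)
    case zero
    then show ?case by (simp add: zc null)
  next
    case (step c x f)
    have "kdelta x \<otimes>\<^bsub>?A\<^esub> g \<in> carrier ?A"
      using g
    proof (induction rule: monoid_algebra_induct)
      case (step e y g)
      then show ?case using \<open>x \<in> carrier M\<close> by (simp add: rd kdelta_mult lin)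
    qed (simp add: zc null)
    with step g show ?case by (simp add: ld lin)
  qed
  \<comment> \<open>Three nested inductions, one for each factor, reduce to three basis elements,
    where associativity is that of \<open>M\<close>.\<close>
  have assoc: "(f \<otimes>\<^bsub>?A\<^esub> g) \<otimes>\<^bsub>?A\<^esub> h = f \<otimes>\<^bsub>?A\<^esub> (g \<otimes>\<^bsub>?A\<^esub> h)"
    if f: "f \<in> carrier ?A" and g: "g \<in> carrier ?A" and h: "h \<in> carrier ?A" for f g h
    using f
  proof (induction rule: monoid_algebra_induct)
    case (step c x f)
    have "(kdelta x \<otimes>\<^bsub>?A\<^esub> g) \<otimes>\<^bsub>?A\<^esub> h = kdelta x \<otimes>\<^bsub>?A\<^esub> (g \<otimes>\<^bsub>?A\<^esub> h)"
      using g
    proof (induction rule: monoid_algebra_induct)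
      case (step e y g)
      have "(kdelta x \<otimes>\<^bsub>?A\<^esub> kdelta y) \<otimes>\<^bsub>?A\<^esub> h = kdelta x \<otimes>\<^bsub>?A\<^esub> (kdelta y \<otimes>\<^bsub>?A\<^esub> h)"
        using h
      proof (induction rule: monoid_algebra_induct)
        case (step e' z h)
        then show ?case
          using \<open>x \<in> carrier M\<close> \<open>y \<in> carrier M\<close>
          by (simp add: rd kdelta_mult lin mult M.m_assoc)
      qed (simp add: zc)
      with step h \<open>x \<in> carrier M\<close> show ?case
        by (simp add: rd ld mult)
    qed (simp add: zc)
    with step g h show ?case
      by (simp add: ld mult)
  qed (simp add: zc)
  have one: "kdelta \<one>\<^bsub>M\<^esub> \<otimes>\<^bsub>?A\<^esub> f = f \<and> f \<otimes>\<^bsub>?A\<^esub> kdelta \<one>\<^bsub>M\<^esub> = f" if "f \<in> carrier ?A" for f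
    using that
  proof (induction rule: monoid_algebra_induct)
    case (step c x f)
    then show ?case by (simp add: rd ld kdelta_mult)
  qed (simp add: zc)
  have neg: "\<exists>g\<in>carrier ?A. (\<lambda>x. g x + f x) = (\<lambda>_. 0)" if "f \<in> carrier ?A" for f
    using monoid_algebra_smult_closed[OF that, of "- 1"] by (intro bexI[of _ "\<lambda>x. - 1 * f x"]) auto
  show ?thesis
  proof (intro kalgebra.intro ringI abelian_groupI monoidI kalgebra_axioms.intro)
    show "(x \<oplus>\<^bsub>?A\<^esub> y) \<otimes>\<^bsub>?A\<^esub> z = x \<otimes>\<^bsub>?A\<^esub> z \<oplus>\<^bsub>?A\<^esub> y \<otimes>\<^bsub>?A\<^esub> z"
      "z \<otimes>\<^bsub>?A\<^esub> (x \<oplus>\<^bsub>?A\<^esub> y) = z \<otimes>\<^bsub>?A\<^esub> x \<oplus>\<^bsub>?A\<^esub> z \<otimes>\<^bsub>?A\<^esub> y"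
      if "x \<in> carrier ?A" "y \<in> carrier ?A" "z \<in> carrier ?A" for x y z
      using ld[of x y z 1] rd[of x y z 1] that by (simp_all add: monoid_algebra_simps(4))
    show "(c \<odot>\<^bsub>?A\<^esub> x) \<otimes>\<^bsub>?A\<^esub> y = c \<odot>\<^bsub>?A\<^esub> (x \<otimes>\<^bsub>?A\<^esub> y)" "x \<otimes>\<^bsub>?A\<^esub> (c \<odot>\<^bsub>?A\<^esub> y) = c \<odot>\<^bsub>?A\<^esub> (x \<otimes>\<^bsub>?A\<^esub> y)"
      if "x \<in> carrier ?A" "y \<in> carrier ?A" for x y c
      using ld[of x "\<lambda>_. 0" y c] rd[of y "\<lambda>_. 0" x c] that null
      by (simp_all add: monoid_algebra_simps(5) zc)
  qed (use mult assoc one neg null monoid_algebra_add_closed monoid_algebra_smult_closed in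
      \<open>auto simp: monoid_algebra_simps(2-5) algebra_simps\<close>)
qed

text \<open>The linear extension of a map on the basis. Both \<open>free_lift\<close> and the
  recursive clause of \<open>t_act\<close> turn out to be instances, which gives their homomorphism
  properties without separate inductions.\<close>

definition mlift :: "('k::field, 'e) module \<Rightarrow> ('m \<Rightarrow> 'e) \<Rightarrow> ('m \<Rightarrow> 'k) \<Rightarrow> 'e" where
  "mlift E \<phi> a = (\<Oplus>\<^bsub>E\<^esub>u\<in>{u. a u \<noteq> 0}. a u \<odot>\<^bsub>E\<^esub> \<phi> u)"

lemma mlift_linear:
  assumes E: "kalgebra E" and \<phi>: "\<phi> \<in> carrier M \<rightarrow> carrier E"
    and a: "a \<in> carrier (monoid_algebra M)"
  shows "mlift E \<phi> a \<in> carrier E"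
    and "x \<in> carrier M \<Longrightarrow> mlift E \<phi> (\<lambda>y. c * kdelta x y + a y) = c \<odot>\<^bsub>E\<^esub> \<phi> x \<oplus>\<^bsub>E\<^esub> mlift E \<phi> a"
proof -
  interpret E: kalgebra E by fact
  have cl: "(\<lambda>u. f u \<odot>\<^bsub>E\<^esub> \<phi> u) \<in> S \<rightarrow> carrier E" if "S \<subseteq> carrier M" for f S
    using that \<phi> by auto
  have a': "finite {u. a u \<noteq> 0}" "{u. a u \<noteq> 0} \<subseteq> carrier M"
    using a by (auto simp: monoid_algebra_simps)
  then show "mlift E \<phi> a \<in> carrier E"
    unfolding mlift_def using cl by (intro E.finsum_closed) auto
  have sup: "mlift E \<phi> f = (\<Oplus>\<^bsub>E\<^esub>u\<in>S. f u \<odot>\<^bsub>E\<^esub> \<phi> u)"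
    if "finite S" "S \<subseteq> carrier M" "{u. f u \<noteq> 0} \<subseteq> S" for f S
    unfolding mlift_def
    using that \<phi> by (intro E.add.finprod_mono_neutral_cong_left) (auto simp: Pi_iff subset_iff)
  assume x: "x \<in> carrier M"
  define S where "S = {u. a u \<noteq> 0} - {x}"
  have S: "finite S" "S \<subseteq> carrier M" "x \<notin> S" using a' by (auto simp: S_def)
  have eq: "(\<Oplus>\<^bsub>E\<^esub>u\<in>S. (c * kdelta x u + a u) \<odot>\<^bsub>E\<^esub> \<phi> u) = (\<Oplus>\<^bsub>E\<^esub>u\<in>S. a u \<odot>\<^bsub>E\<^esub> \<phi> u)"
    using S \<phi> by (intro E.finsum_cong') (auto simp: kdelta_def)
  have "mlift E \<phi> (\<lambda>y. c * kdelta x y + a y) = (\<Oplus>\<^bsub>E\<^esub>u\<in>insert x S. (c * kdelta x u + a u) \<odot>\<^bsub>E\<^esub> \<phi> u)"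
    using S x by (intro sup) (auto simp: S_def kdelta_def)
  also have "\<dots> = (c + a x) \<odot>\<^bsub>E\<^esub> \<phi> x \<oplus>\<^bsub>E\<^esub> (\<Oplus>\<^bsub>E\<^esub>u\<in>S. a u \<odot>\<^bsub>E\<^esub> \<phi> u)"
    using S x \<phi> cl[OF S(2)] by (subst E.finsum_insert) (auto simp: eq, simp add: kdelta_def)
  also have "\<dots> = c \<odot>\<^bsub>E\<^esub> \<phi> x \<oplus>\<^bsub>E\<^esub> (a x \<odot>\<^bsub>E\<^esub> \<phi> x \<oplus>\<^bsub>E\<^esub> (\<Oplus>\<^bsub>E\<^esub>u\<in>S. a u \<odot>\<^bsub>E\<^esub> \<phi> u))"
    using x \<phi> E.finsum_closed[OF cl[OF S(2)]] by (simp add: E.smult_l_distr E.a_assoc Pi_iff)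
  also have "a x \<odot>\<^bsub>E\<^esub> \<phi> x \<oplus>\<^bsub>E\<^esub> (\<Oplus>\<^bsub>E\<^esub>u\<in>S. a u \<odot>\<^bsub>E\<^esub> \<phi> u) = (\<Oplus>\<^bsub>E\<^esub>u\<in>insert x S. a u \<odot>\<^bsub>E\<^esub> \<phi> u)"
    using S x \<phi> cl[OF S(2)] by (subst E.finsum_insert) auto
  also have "\<dots> = mlift E \<phi> a"
    using S x a' by (intro sup[symmetric]) (auto simp: S_def)
  finally show "mlift E \<phi> (\<lambda>y. c * kdelta x y + a y) = c \<odot>\<^bsub>E\<^esub> \<phi> x \<oplus>\<^bsub>E\<^esub> mlift E \<phi> a" .
qed

lemma mlift_zero:
  assumes "kalgebra E"
  shows "mlift E \<phi> (\<lambda>_. 0) = \<zero>\<^bsub>E\<^esub>"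
proof -
  interpret E: kalgebra E by fact
  show ?thesis by (simp add: mlift_def)
qed

lemma mlift_kdelta:
  fixes M :: "'m monoid"
  assumes E: "kalgebra E" and \<phi>: "\<phi> \<in> carrier M \<rightarrow> carrier E" and x: "x \<in> carrier M"
  shows "mlift E \<phi> (kdelta x) = \<phi> x"
proof -
  interpret E: kalgebra E by fact
  have "(\<lambda>_. 0) \<in> carrier (monoid_algebra M)" by (auto simp: monoid_algebra_simps)
  from mlift_linear(2)[OF E \<phi> this x, of 1] show ?thesis
    using \<phi> x by (auto simp: mlift_zero[OF E] Pi_iff)
qed

text \<open>Universal property of \<open>k[M]\<close>: inductions on both factors bring
  multiplicativity down to basis elements, where it is the assumption on \<open>\<phi>\<close>. It
  is applied to groups, to free monoids, and to a product of two free monoids for the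
  comultiplication.\<close>

lemma mlift_alg_hom:
  assumes M: "Group.monoid M" and E: "kalgebra E" and \<phi>: "\<phi> \<in> carrier M \<rightarrow> carrier E"
    and mult: "\<And>x y. x \<in> carrier M \<Longrightarrow> y \<in> carrier M \<Longrightarrow> \<phi> (x \<otimes>\<^bsub>M\<^esub> y) = \<phi> x \<otimes>\<^bsub>E\<^esub> \<phi> y"
    and one: "\<phi> \<one>\<^bsub>M\<^esub> = \<one>\<^bsub>E\<^esub>"
  shows "mlift E \<phi> \<in> alg_hom (monoid_algebra M) E"
proof -
  interpret M: Group.monoid M by fact
  interpret E: kalgebra E by fact
  interpret A: kalgebra "monoid_algebra M" by (rule monoid_algebra_kalgebra[OF M])
  let ?A = "monoid_algebra M"
  let ?h = "mlift E \<phi>"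
  note closed = mlift_linear(1)[OF E \<phi>] and lin = mlift_linear(2)[OF E \<phi>]
  note delta = mlift_kdelta[OF E \<phi>]
  have \<phi>c: "\<phi> x \<in> carrier E" if "x \<in> carrier M" for x
    using \<phi> that by auto
  have linA: "(\<lambda>y. c * f y + g y) \<in> carrier ?A" if "f \<in> carrier ?A" "g \<in> carrier ?A" for c f g
    using A.a_closed[OF A.smult_closed[OF that(1)] that(2)] by (simp add: monoid_algebra_simps(4,5))
  have smult: "?h (\<lambda>x. c * f x) = c \<odot>\<^bsub>E\<^esub> ?h f" if "f \<in> carrier ?A" for f c
    using that
  proof (induction rule: monoid_algebra_induct)
    case (step e x f)
    have "?h (\<lambda>y. c * (e * kdelta x y + f y)) = ?h (\<lambda>y. (c * e) * kdelta x y + c * f y)"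
      by (simp add: algebra_simps)
    also have "\<dots> = (c * e) \<odot>\<^bsub>E\<^esub> \<phi> x \<oplus>\<^bsub>E\<^esub> ?h (\<lambda>y. c * f y)"
      using step monoid_algebra_smult_closed by (intro lin) auto
    finally show ?case
      using step by (simp add: lin E.smult_assoc E.smult_r_distr \<phi>c closed)
  qed (simp add: mlift_zero[OF E])
  have add: "?h (\<lambda>x. f x + g x) = ?h f \<oplus>\<^bsub>E\<^esub> ?h g" if "f \<in> carrier ?A" "g \<in> carrier ?A" for f g
    using that
  proof (induction rule: monoid_algebra_induct)
    case (step e x f)
    have "?h (\<lambda>y. e * kdelta x y + f y + g y) = ?h (\<lambda>y. e * kdelta x y + (f y + g y))"
      by (simp add: algebra_simps)
    also have "\<dots> = e \<odot>\<^bsub>E\<^esub> \<phi> x \<oplus>\<^bsub>E\<^esub> ?h (\<lambda>y. f y + g y)"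
      using step monoid_algebra_add_closed by (intro lin) auto
    finally show ?case
      using step by (simp add: lin \<phi>c closed E.a_assoc)
  qed (simp add: mlift_zero[OF E] closed)
  have cadd: "?h (\<lambda>x. c * f x + g x) = c \<odot>\<^bsub>E\<^esub> ?h f \<oplus>\<^bsub>E\<^esub> ?h g" if "f \<in> carrier ?A" "g \<in> carrier ?A" for c f g
    using add[OF monoid_algebra_smult_closed that(2)] that smult by auto
  have mul: "?h (f \<otimes>\<^bsub>?A\<^esub> g) = ?h f \<otimes>\<^bsub>E\<^esub> ?h g" if f: "f \<in> carrier ?A" and g: "g \<in> carrier ?A" for f g
    using f
  proof (induction rule: monoid_algebra_induct)
    case zero
    then show ?case by (simp add: monoid_algebra_zero_mult mlift_zero[OF E] closed g)
  next
    case (step c x f)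
    have "?h (kdelta x \<otimes>\<^bsub>?A\<^esub> g) = \<phi> x \<otimes>\<^bsub>E\<^esub> ?h g"
      using g
    proof (induction rule: monoid_algebra_induct)
      case (step e y g)
      have "?h (kdelta x \<otimes>\<^bsub>?A\<^esub> (\<lambda>z. e * kdelta y z + g z)) =
        ?h (\<lambda>z. e * kdelta (x \<otimes>\<^bsub>M\<^esub> y) z + (kdelta x \<otimes>\<^bsub>?A\<^esub> g) z)"
        using step \<open>x \<in> carrier M\<close> by (simp add: monoid_algebra_r_distr kdelta_mult)
      also have "\<dots> = e \<odot>\<^bsub>E\<^esub> \<phi> (x \<otimes>\<^bsub>M\<^esub> y) \<oplus>\<^bsub>E\<^esub> ?h (kdelta x \<otimes>\<^bsub>?A\<^esub> g)"
        using step \<open>x \<in> carrier M\<close> by (intro lin) auto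
      finally show ?case
        using step \<open>x \<in> carrier M\<close> by (simp add: lin \<phi>c closed mult E.r_distr E.smult_mult_r)
    qed (simp add: monoid_algebra_zero_mult mlift_zero[OF E] \<open>x \<in> carrier M\<close> \<phi>c)
    with step g show ?case
      by (simp add: monoid_algebra_l_distr cadd lin delta \<phi>c closed E.l_distr E.smult_mult_l)
  qed
  show ?thesis
    using closed mul add smult one delta[of "\<one>\<^bsub>M\<^esub>"]
    by (auto simp: alg_hom_def ring_hom_def monoid_algebra_simps(2,4,5))
qed

section \<open>Quotients by relations\<close>

lemma the_elem_image_const:
  assumes "A \<noteq> {}" "\<And>y. y \<in> A \<Longrightarrow> f y = c"
  shows "the_elem (f ` A) = c"
proof -
  have "f ` A = {c}" using assms by blast
  then show ?thesis by simp
qed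

lemma quot_alg_simps:
  "carrier (quot_alg A I) = a_rcosets\<^bsub>A\<^esub> I"
  "monoid.mult (quot_alg A I) = rcoset_mult A I"
  "one (quot_alg A I) = I +>\<^bsub>A\<^esub> \<one>\<^bsub>A\<^esub>"
  "zero (quot_alg A I) = I"
  "add (quot_alg A I) = set_add A"
  by (simp_all add: quot_alg_def ring.defs module.defs FactRing_def)

context kalgebra
begin

lemma rel_ideal_ideal:
  assumes "R \<subseteq> carrier A \<times> carrier A"
  shows "ideal (rel_ideal A R) A"
  unfolding rel_ideal_def using assms by (intro genideal_ideal) auto

lemma rel_ideal_incl:
  assumes "R \<subseteq> carrier A \<times> carrier A" "(x, y) \<in> R"
  shows "x \<ominus> y \<in> rel_ideal A R"
proof -
  have "{x \<ominus> y | x y. (x, y) \<in> R} \<subseteq> rel_ideal A R"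
    unfolding rel_ideal_def using assms by (intro genideal_self) auto
  with assms show ?thesis by auto
qed

text \<open>A ring ideal is a subspace, because scaling by \<open>c\<close> is multiplication by
  \<open>c \<odot> \<one>\<close>. All representatives therefore scale into the same coset and the
  union in the definition collapses.\<close>

lemma quot_alg_smult:
  assumes "ideal I A" "x \<in> carrier A"
  shows "c \<odot>\<^bsub>quot_alg A I\<^esub> (I +> x) = I +> c \<odot> x"
proof -
  interpret I: ideal I A by fact
  have "I +> c \<odot> y = I +> c \<odot> x" if "y \<in> I +> x" for y
  proof -
    from that obtain i where i: "i \<in> I" "y = i \<oplus> x"
      by (auto simp: a_r_coset_def r_coset_def)
    then have "c \<odot> y = (c \<odot> \<one>) \<otimes> i \<oplus> c \<odot> x"
      using assms(2) by (auto simp: smult_r_distr smult_mult_l)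
    moreover have "(c \<odot> \<one>) \<otimes> i \<in> I" using i by (auto intro: I.I_l_closed)
    ultimately have "c \<odot> y \<in> I +> c \<odot> x"
      by (auto simp: a_r_coset_def r_coset_def)
    then show ?thesis
      using assms(2) using I.a_repr_independence'[of "c \<odot> y" "c \<odot> x"] by simp
  qed
  moreover have "x \<in> I +> x" using assms by (simp add: I.a_rcos_self)
  ultimately have "(\<Union>y\<in>I +> x. I +> c \<odot> y) = I +> c \<odot> x" by blast
  then show ?thesis by (simp add: quot_alg_def ring.defs module.defs)
qed

lemma quot_alg_kalgebra:
  assumes "ideal I A"
  shows "kalgebra (quot_alg A I)"
proof -
  interpret I: ideal I A by fact
  interpret Q: ring "A Quot I" by (rule I.quotient_is_ring)
  have sel: "carrier (quot_alg A I) = carrier (A Quot I)" "monoid.mult (quot_alg A I) = monoid.mult (A Quot I)"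
    "one (quot_alg A I) = one (A Quot I)" "zero (quot_alg A I) = zero (A Quot I)" "add (quot_alg A I) = add (A Quot I)"
    by (simp_all add: quot_alg_simps FactRing_def)
  have "ring (quot_alg A I)"
    by (intro ringI abelian_groupI monoidI; unfold sel)
      ((rule Q.a_assoc Q.a_comm Q.m_assoc Q.l_distr Q.r_distr; assumption) |
       (simp; fail) | (blast intro: Q.l_neg Q.a_inv_closed))+
  have ex: "\<exists>a\<in>carrier A. X = I +> a" if "X \<in> carrier (quot_alg A I)" for X
    using that by (auto simp: quot_alg_simps A_RCOSETS_def RCOSETS_def a_r_coset_def)
  have cl: "I +> a \<in> carrier (quot_alg A I)" if "a \<in> carrier A" for a
    using that by (auto simp: quot_alg_simps A_RCOSETS_def RCOSETS_def a_r_coset_def)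
  note ops = quot_alg_smult[OF assms] quot_alg_simps(2,5) I.rcoset_mult_add I.a_rcos_sum
  show ?thesis
  proof (intro kalgebra.intro kalgebra_axioms.intro)
    show "ring (quot_alg A I)" by fact
  qed (drule ex, (drule ex)?, elim bexE,
      simp add: ops smult_l_distr smult_r_distr smult_assoc smult_mult_l smult_mult_r cl)+
qed

lemma quot_alg_proj:
  assumes "ideal I A"
  shows "(\<lambda>x. I +> x) \<in> alg_hom A (quot_alg A I)"
    and "carrier (quot_alg A I) = (\<lambda>x. I +> x) ` carrier A"
proof -
  interpret I: ideal I A by fact
  show c: "carrier (quot_alg A I) = (\<lambda>x. I +> x) ` carrier A"
    by (auto simp: quot_alg_simps A_RCOSETS_def RCOSETS_def a_r_coset_def)
  then show "(\<lambda>x. I +> x) \<in> alg_hom A (quot_alg A I)"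
    by (auto simp: alg_hom_def ring_hom_def quot_alg_simps(2-5) quot_alg_smult[OF assms]
        I.rcoset_mult_add I.a_rcos_sum)
qed

lemma rel_coset_eq:
  assumes "R \<subseteq> carrier A \<times> carrier A" "(x, y) \<in> R"
  shows "rel_ideal A R +> x = rel_ideal A R +> y"
proof -
  interpret I: ideal "rel_ideal A R" A by (rule rel_ideal_ideal[OF assms(1)])
  have c: "x \<in> carrier A" "y \<in> carrier A" using assms by auto
  have "(x \<ominus> y) \<oplus> y \<in> rel_ideal A R +> y"
    using rel_ideal_incl[OF assms] by (auto simp: a_r_coset_def r_coset_def)
  moreover have "(x \<ominus> y) \<oplus> y = x" using c by (simp add: a_minus_def a_assoc l_neg)
  ultimately show ?thesis
    using c using I.a_repr_independence'[of x y] by simp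
qed

lemma rel_ideal_kernel:
  assumes E: "kalgebra E" and h: "h \<in> alg_hom A E" and R: "R \<subseteq> carrier A \<times> carrier A"
    and eq: "\<forall>(x, y)\<in>R. h x = h y" and a: "a \<in> rel_ideal A R"
  shows "h a = \<zero>\<^bsub>E\<^esub>"
proof -
  interpret E: kalgebra E by fact
  have hom: "ring_hom_ring A E h"
    by (rule ring_hom_ringI2[OF ring_axioms E.ring_axioms]) (use h in \<open>simp add: alg_hom_def\<close>)
  have "x \<ominus> y \<in> a_kernel A E h" if xy: "(x, y) \<in> R" for x y
  proof -
    have xy': "x \<in> carrier A" "y \<in> carrier A" using subsetD[OF R xy] by simp_all
    have "h x = h y" using bspec[OF eq xy] by simp
    then have "h (x \<ominus> y) = h y \<ominus>\<^bsub>E\<^esub> h y"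
      using alg_hom_more(2)[OF kalgebra_axioms E h xy'] by simp
    also have "\<dots> = \<zero>\<^bsub>E\<^esub>"
      unfolding a_minus_def by (rule E.r_neg[OF alg_homD(1)[OF h xy'(2)]])
    finally show ?thesis
      using xy' by (simp add: a_kernel_def')
  qed
  then have "{x \<ominus> y | x y. (x, y) \<in> R} \<subseteq> a_kernel A E h" by blast
  then have "rel_ideal A R \<subseteq> a_kernel A E h"
    unfolding rel_ideal_def by (rule genideal_minimal[OF ring_hom_ring.kernel_is_ideal[OF hom]])
  from subsetD[OF this a] show ?thesis by (simp add: a_kernel_def')
qed

text \<open>A homomorphism that respects the relations kills the ideal they generate, so it is
  constant on cosets and \<open>the_elem\<close> returns the common value. It serves both for maps
  out of the Yokonuma-Hecke algebra and for the action of the quantum group through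
  representatives.\<close>

lemma rel_coset_image:
  assumes E: "kalgebra E" and h: "h \<in> alg_hom A E" and R: "R \<subseteq> carrier A \<times> carrier A"
    and eq: "\<forall>(x, y)\<in>R. h x = h y" and a: "a \<in> carrier A"
  shows "the_elem (h ` (rel_ideal A R +> a)) = h a"
proof -
  interpret I: ideal "rel_ideal A R" A by (rule rel_ideal_ideal[OF R])
  interpret E: kalgebra E by fact
  have *: "h x = h a" if "x \<in> rel_ideal A R +> a" for x
  proof -
    from that obtain i where i: "i \<in> rel_ideal A R" "x = i \<oplus> a"
      by (auto simp: a_r_coset_def r_coset_def)
    have "h x = h i \<oplus>\<^bsub>E\<^esub> h a"
      unfolding i(2) by (rule alg_homD(3)[OF h I.a_Hcarr[OF i(1)] a])
    also have "\<dots> = h a"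
      unfolding rel_ideal_kernel[OF E h R eq i(1)] by (rule E.l_zero[OF alg_homD(1)[OF h a]])
    finally show ?thesis .
  qed
  have "rel_ideal A R +> a \<noteq> {}" using a I.a_rcos_self by blast
  from the_elem_image_const[of _ h, OF this *] show ?thesis .
qed

lemma alg_mod_rels_lift:
  assumes E: "kalgebra E" and h: "h \<in> alg_hom A E" and R: "R \<subseteq> carrier A \<times> carrier A"
    and eq: "\<forall>(x, y)\<in>R. h x = h y"
  shows "(\<lambda>X. the_elem (h ` X)) \<in> alg_hom (alg_mod_rels A R) E"
proof -
  note ideal = rel_ideal_ideal[OF R]
  interpret I: ideal "rel_ideal A R" A by (rule ideal)
  note img = rel_coset_image[OF E h R eq]
  let ?Q = "quot_alg A (rel_ideal A R)"
  let ?h = "\<lambda>X. the_elem (h ` X)"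
  have ex: "\<exists>a\<in>carrier A. X = rel_ideal A R +> a" if "X \<in> carrier ?Q" for X
    using that quot_alg_proj(2)[OF ideal] by blast
  have "?h \<in> ring_hom ?Q E"
  proof (rule ring_hom_memI)
    fix X Y assume "X \<in> carrier ?Q" "Y \<in> carrier ?Q"
    then obtain a b where a: "a \<in> carrier A" "X = rel_ideal A R +> a"
      and b: "b \<in> carrier A" "Y = rel_ideal A R +> b"
      using ex by meson
    show "?h (X \<otimes>\<^bsub>?Q\<^esub> Y) = ?h X \<otimes>\<^bsub>E\<^esub> ?h Y"
      unfolding a(2) b(2) quot_alg_simps(2) I.rcoset_mult_add[OF a(1) b(1)] img[OF a(1)] img[OF b(1)]
        img[OF m_closed[OF a(1) b(1)]]
      by (rule alg_homD(2)[OF h a(1) b(1)])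
    show "?h (X \<oplus>\<^bsub>?Q\<^esub> Y) = ?h X \<oplus>\<^bsub>E\<^esub> ?h Y"
      unfolding a(2) b(2) quot_alg_simps(5) I.a_rcos_sum[OF a(1) b(1)] img[OF a(1)] img[OF b(1)]
        img[OF a_closed[OF a(1) b(1)]]
      by (rule alg_homD(3)[OF h a(1) b(1)])
  next
    fix X assume "X \<in> carrier ?Q"
    then obtain a where a: "a \<in> carrier A" "X = rel_ideal A R +> a" using ex by meson
    show "?h X \<in> carrier E"
      unfolding a(2) img[OF a(1)] by (rule alg_homD(1)[OF h a(1)])
  next
    show "?h \<one>\<^bsub>?Q\<^esub> = \<one>\<^bsub>E\<^esub>"
      unfolding quot_alg_simps(3) img[OF one_closed] by (rule alg_homD(4)[OF h])
  qed
  moreover have "?h (c \<odot>\<^bsub>?Q\<^esub> X) = c \<odot>\<^bsub>E\<^esub> ?h X" if X: "X \<in> carrier ?Q" for c X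
  proof -
    from X obtain a where a: "a \<in> carrier A" "X = rel_ideal A R +> a" using ex by meson
    show ?thesis
      unfolding a(2) quot_alg_smult[OF ideal a(1)] img[OF a(1)] img[OF smult_closed[OF a(1)]]
      by (rule alg_homD(5)[OF h a(1)])
  qed
  ultimately show ?thesis by (simp add: alg_hom_def alg_mod_rels_def)
qed

end

section \<open>Presented groups\<close>

lemma group_cong_lists:
  assumes "(u, v) \<in> group_cong X R"
  shows "u \<in> lists (X \<times> UNIV) \<and> v \<in> lists (X \<times> UNIV)"
  using assms by induction auto

lemma group_cong_equiv: "equiv (lists (X \<times> UNIV)) (group_cong X R)"
  by (rule equivI)
    (auto simp: refl_on_def sym_def trans_def dest: group_cong_lists
      intro: group_cong.refl group_cong.sym group_cong.trans)

lemma presented_group_class: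
  assumes "u \<in> lists (X \<times> UNIV)"
  shows "group_cong X R `` {u} \<in> carrier (presented_group X R)"
  using assms by (simp add: presented_group_def quotientI)

lemma presented_group_cases:
  assumes "P \<in> carrier (presented_group X R)"
  obtains u where "u \<in> lists (X \<times> UNIV)" "P = group_cong X R `` {u}"
  using assms unfolding presented_group_def by (auto simp del: lists_eq_set elim!: quotientE)

lemma presented_group_mult:
  assumes "u \<in> lists (X \<times> UNIV)" "v \<in> lists (X \<times> UNIV)"
  shows "group_cong X R `` {u} \<otimes>\<^bsub>presented_group X R\<^esub> group_cong X R `` {v} = group_cong X R `` {u @ v}"
proof -
  have "group_cong X R `` {u' @ v'} = group_cong X R `` {u @ v}"
    if "(u, u') \<in> group_cong X R" "(v, v') \<in> group_cong X R" for u' v'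
    using group_cong.append[OF that] equiv_class_eq[OF group_cong_equiv] by metis
  then have "(\<Union>u'\<in>group_cong X R `` {u}. \<Union>v'\<in>group_cong X R `` {v}. group_cong X R `` {u' @ v'}) =
      group_cong X R `` {u @ v}"
    using group_cong.refl[OF assms(1), of R] group_cong.refl[OF assms(2), of R] by blast
  then show ?thesis by (simp add: presented_group_def)
qed

lemma presented_group_one: "\<one>\<^bsub>presented_group X R\<^esub> = group_cong X R `` {[]}"
  by (simp add: presented_group_def)

text \<open>The reversed word with flipped signs meets the original word at a cancelling pair. The
  flipped letter stands on the left there, so the cancellation rule is used at the sign
  \<open>\<not> e\<close>.\<close>

lemma presented_group_inverse:
  assumes "u \<in> lists (X \<times> UNIV)"
  shows "(map (\<lambda>(g, e). (g, \<not> e)) (rev u) @ u, []) \<in> group_cong X R"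
  using assms
proof (induction u)
  case (Cons a u)
  obtain g e where a: "a = (g, e)" by (cases a)
  let ?v = "map (\<lambda>(g, e). (g, \<not> e)) (rev u)"
  have "u \<in> lists (X \<times> UNIV)" "?v \<in> lists (X \<times> UNIV)" "g \<in> X"
    using Cons a by auto
  note r = group_cong.refl[OF this(1), of R] group_cong.refl[OF this(2), of R]
  have "(?v @ ([(g, \<not> e), (g, \<not> \<not> e)] @ u), ?v @ ([] @ u)) \<in> group_cong X R"
    by (intro group_cong.append r group_cong.cancel \<open>g \<in> X\<close>)
  with Cons show ?case
    by (auto simp: a intro: group_cong.trans)
qed (auto intro: group_cong.refl)

lemma presented_group_group: "group (presented_group X R)"
proof (rule groupI)
  let ?G = "presented_group X R"
  show "P \<otimes>\<^bsub>?G\<^esub> Q \<in> carrier ?G" if "P \<in> carrier ?G" "Q \<in> carrier ?G" for P Q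
    using that by (elim presented_group_cases) (auto simp: presented_group_mult intro!: presented_group_class)
  show "\<one>\<^bsub>?G\<^esub> \<in> carrier ?G"
    by (auto simp: presented_group_one intro: presented_group_class)
  show "P \<otimes>\<^bsub>?G\<^esub> Q \<otimes>\<^bsub>?G\<^esub> S = P \<otimes>\<^bsub>?G\<^esub> (Q \<otimes>\<^bsub>?G\<^esub> S)"
    if "P \<in> carrier ?G" "Q \<in> carrier ?G" "S \<in> carrier ?G" for P Q S
    using that by (elim presented_group_cases) (simp add: presented_group_mult)
  show "\<one>\<^bsub>?G\<^esub> \<otimes>\<^bsub>?G\<^esub> P = P" if "P \<in> carrier ?G" for P
    using that by (elim presented_group_cases) (simp add: presented_group_mult presented_group_one)
  show "\<exists>Q\<in>carrier ?G. Q \<otimes>\<^bsub>?G\<^esub> P = \<one>\<^bsub>?G\<^esub>" if P: "P \<in> carrier ?G" for P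
  proof -
    from P obtain u where u: "u \<in> lists (X \<times> UNIV)" "P = group_cong X R `` {u}"
      by (rule presented_group_cases)
    let ?v = "map (\<lambda>(g, e). (g, \<not> e)) (rev u)"
    have v: "?v \<in> lists (X \<times> UNIV)" using u by auto
    have "group_cong X R `` {?v @ u} = group_cong X R `` {[]}"
      by (rule equiv_class_eq[OF group_cong_equiv presented_group_inverse[OF u(1)]])
    then show ?thesis
      using u v by (intro bexI[of _ "group_cong X R `` {?v}"])
        (auto simp: presented_group_mult presented_group_one intro: presented_group_class)
  qed
qed

context Group.monoid
begin

definition word_eval :: "('w \<Rightarrow> 'a) \<Rightarrow> 'w list \<Rightarrow> 'a" where
  "word_eval \<rho> u = foldr (\<lambda>g x. \<rho> g \<otimes> x) u \<one>"

lemma word_eval_simps [simp]: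
  "word_eval \<rho> [] = \<one>" "word_eval \<rho> (g # u) = \<rho> g \<otimes> word_eval \<rho> u"
  by (simp_all add: word_eval_def)

lemma word_eval_closed:
  assumes "\<And>g. g \<in> X \<Longrightarrow> \<rho> g \<in> carrier G" "u \<in> lists X"
  shows "word_eval \<rho> u \<in> carrier G"
  using assms(2) by induction (auto simp: assms(1))

lemma word_eval_append:
  assumes "\<And>g. g \<in> X \<Longrightarrow> \<rho> g \<in> carrier G" "u \<in> lists X" "v \<in> lists X"
  shows "word_eval \<rho> (u @ v) = word_eval \<rho> u \<otimes> word_eval \<rho> v"
  using assms(2) by induction (auto simp: assms word_eval_closed[OF assms(1)] m_assoc)

lemma group_cong_word_eval:
  assumes \<rho>: "\<And>g e. g \<in> X \<Longrightarrow> \<rho> (g, e) \<in> carrier G"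
    and inv: "\<And>g e. g \<in> X \<Longrightarrow> \<rho> (g, e) \<otimes> \<rho> (g, \<not> e) = \<one>"
    and R: "\<And>u v. (u, v) \<in> R \<Longrightarrow> u \<in> lists (X \<times> UNIV) \<Longrightarrow> v \<in> lists (X \<times> UNIV) \<Longrightarrow>
      word_eval \<rho> u = word_eval \<rho> v"
    and "(u, v) \<in> group_cong X R"
  shows "word_eval \<rho> u = word_eval \<rho> v"
  using assms(4)
proof induction
  case (append u v u' v')
  then show ?case
    using group_cong_lists[OF append.hyps(1)] group_cong_lists[OF append.hyps(2)]
    by (metis word_eval_append[of "X \<times> UNIV" \<rho>] \<rho> mem_Times_iff prod.collapse)
next
  case (cancel g e)
  then show ?case using \<rho> inv by simp
qed (use R in auto)

text \<open>The target is just a monoid, namely later the multiplicative monoid of an endomorphism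
  algebra. Prescribing images for both signs of each generator, inverse to each other on both sides,
  replaces inverses in the target.\<close>

lemma presented_group_lift:
  assumes \<rho>: "\<And>g e. g \<in> X \<Longrightarrow> \<rho> (g, e) \<in> carrier G"
    and inv: "\<And>g e. g \<in> X \<Longrightarrow> \<rho> (g, e) \<otimes> \<rho> (g, \<not> e) = \<one>"
    and R: "\<And>u v. (u, v) \<in> R \<Longrightarrow> u \<in> lists (X \<times> UNIV) \<Longrightarrow> v \<in> lists (X \<times> UNIV) \<Longrightarrow>
      word_eval \<rho> u = word_eval \<rho> v"
  shows "\<exists>\<phi>\<in>hom (presented_group X R) G.
    (\<forall>u\<in>lists (X \<times> UNIV). \<phi> (group_cong X R `` {u}) = word_eval \<rho> u) \<and> \<phi> \<one>\<^bsub>presented_group X R\<^esub> = \<one>"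
proof -
  define \<phi> where "\<phi> P = the_elem (word_eval \<rho> ` P)" for P
  have \<phi>: "\<phi> (group_cong X R `` {u}) = word_eval \<rho> u" if "u \<in> lists (X \<times> UNIV)" for u
  proof -
    have *: "word_eval \<rho> v = word_eval \<rho> u" if "v \<in> group_cong X R `` {u}" for v
      using group_cong_word_eval[OF \<rho> inv R] that by fastforce
    have "group_cong X R `` {u} \<noteq> {}"
      using group_cong.refl[OF that, of R] by blast
    from the_elem_image_const[of _ "word_eval \<rho>", OF this *] show ?thesis
      unfolding \<phi>_def .
  qed
  have cl: "word_eval \<rho> u \<in> carrier G" if "u \<in> lists (X \<times> UNIV)" for u
    using \<rho> by (intro word_eval_closed[OF _ that]) auto
  have app: "word_eval \<rho> (u @ v) = word_eval \<rho> u \<otimes> word_eval \<rho> v"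
    if "u \<in> lists (X \<times> UNIV)" "v \<in> lists (X \<times> UNIV)" for u v
    using \<rho> by (intro word_eval_append[OF _ that]) auto
  have "\<phi> \<in> hom (presented_group X R) G"
  proof (rule homI)
    fix P Q assume P: "P \<in> carrier (presented_group X R)" and Q: "Q \<in> carrier (presented_group X R)"
    from P obtain u where u: "u \<in> lists (X \<times> UNIV)" "P = group_cong X R `` {u}"
      by (rule presented_group_cases)
    from Q obtain v where v: "v \<in> lists (X \<times> UNIV)" "Q = group_cong X R `` {v}"
      by (rule presented_group_cases)
    show "\<phi> (P \<otimes>\<^bsub>presented_group X R\<^esub> Q) = \<phi> P \<otimes> \<phi> Q"
      using u v by (simp add: presented_group_mult \<phi> app)
    show "\<phi> P \<in> carrier G" using u by (simp add: \<phi> cl)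
  qed
  then show ?thesis
    using \<phi> \<phi>[of "[]"] by (intro bexI[of _ \<phi>]) (auto simp: presented_group_one)
qed

end

section \<open>Endomorphism algebras\<close>

lemma vspace_closed:
  "v \<in> vspace B \<Longrightarrow> w \<in> vspace B \<Longrightarrow> (\<lambda>x. v x + w x) \<in> vspace B"
  "v \<in> vspace B \<Longrightarrow> (\<lambda>x. c * v x) \<in> vspace B"
  "(\<lambda>_. 0) \<in> vspace B"
  "x \<in> B \<Longrightarrow> kdelta x \<in> vspace B"
  by (auto simp: vspace_def kdelta_def)

lemma endo_algD:
  assumes "f \<in> carrier (endo_alg B)"
  shows "v \<in> vspace B \<Longrightarrow> f v \<in> vspace B"
    and "v \<notin> vspace B \<Longrightarrow> f v = undefined"
    and "v \<in> vspace B \<Longrightarrow> w \<in> vspace B \<Longrightarrow> f (\<lambda>x. v x + w x) = (\<lambda>x. f v x + f w x)"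
    and "v \<in> vspace B \<Longrightarrow> f (\<lambda>x. c * v x) = (\<lambda>x. c * f v x)"
proof -
  have f: "f \<in> vspace B \<rightarrow>\<^sub>E vspace B"
    and add: "\<forall>v\<in>vspace B. \<forall>w\<in>vspace B. f (\<lambda>x. v x + w x) = (\<lambda>x. f v x + f w x)"
    and smult: "\<forall>c. \<forall>v\<in>vspace B. f (\<lambda>x. c * v x) = (\<lambda>x. c * f v x)"
    using assms unfolding endo_alg_def partial_object.simps by blast+
  show "v \<in> vspace B \<Longrightarrow> f v \<in> vspace B"
    by (rule PiE_mem[OF f])
  show "v \<notin> vspace B \<Longrightarrow> f v = undefined"
    by (rule PiE_arb[OF f])
  show "v \<in> vspace B \<Longrightarrow> w \<in> vspace B \<Longrightarrow> f (\<lambda>x. v x + w x) = (\<lambda>x. f v x + f w x)"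
    using add by blast
  show "v \<in> vspace B \<Longrightarrow> f (\<lambda>x. c * v x) = (\<lambda>x. c * f v x)"
    using smult by blast
qed

lemma endo_algI:
  assumes "\<And>v. v \<in> vspace B \<Longrightarrow> f v \<in> vspace B"
    and "\<And>v. v \<notin> vspace B \<Longrightarrow> f v = undefined"
    and "\<And>v w. v \<in> vspace B \<Longrightarrow> w \<in> vspace B \<Longrightarrow> f (\<lambda>x. v x + w x) = (\<lambda>x. f v x + f w x)"
    and "\<And>c v. v \<in> vspace B \<Longrightarrow> f (\<lambda>x. c * v x) = (\<lambda>x. c * f v x)"
  shows "f \<in> carrier (endo_alg B)"
  unfolding endo_alg_def partial_object.simps
  by (intro CollectI conjI ballI allI PiE_I assms) assumption+

lemma endo_alg_ext:
  assumes "f \<in> carrier (endo_alg B)" "g \<in> carrier (endo_alg B)" "\<And>v. v \<in> vspace B \<Longrightarrow> f v = g v"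
  shows "f = g"
proof
  fix v
  show "f v = g v"
    by (cases "v \<in> vspace B") (simp_all add: assms(3) endo_algD(2)[OF assms(1)] endo_algD(2)[OF assms(2)])
qed

lemma endo_alg_simps:
  "v \<in> vspace B \<Longrightarrow> (f \<otimes>\<^bsub>endo_alg B\<^esub> g) v = f (g v)"
  "v \<in> vspace B \<Longrightarrow> (f \<oplus>\<^bsub>endo_alg B\<^esub> g) v = (\<lambda>x. f v x + g v x)"
  "v \<in> vspace B \<Longrightarrow> (c \<odot>\<^bsub>endo_alg B\<^esub> f) v = (\<lambda>x. c * f v x)"
  "v \<in> vspace B \<Longrightarrow> \<one>\<^bsub>endo_alg B\<^esub> v = v"
  "v \<in> vspace B \<Longrightarrow> \<zero>\<^bsub>endo_alg B\<^esub> v = (\<lambda>_. 0)"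
  by (simp_all add: endo_alg_def compose_def)

lemma endo_alg_closed:
  assumes "f \<in> carrier (endo_alg B)"
  shows "g \<in> carrier (endo_alg B) \<Longrightarrow> f \<otimes>\<^bsub>endo_alg B\<^esub> g \<in> carrier (endo_alg B)"
    and "g \<in> carrier (endo_alg B) \<Longrightarrow> f \<oplus>\<^bsub>endo_alg B\<^esub> g \<in> carrier (endo_alg B)"
    and "c \<odot>\<^bsub>endo_alg B\<^esub> f \<in> carrier (endo_alg B)"
proof -
  note cl = vspace_closed endo_algD(1)[OF assms(1)]
  note f = endo_algD(3,4)[OF assms(1)]
  have undef: "(f \<otimes>\<^bsub>endo_alg B\<^esub> g) v = undefined" "(f \<oplus>\<^bsub>endo_alg B\<^esub> g) v = undefined"
    "(c \<odot>\<^bsub>endo_alg B\<^esub> f) v = undefined" if "v \<notin> vspace B" for v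
    using that by (simp_all add: endo_alg_def compose_def)
  show "c \<odot>\<^bsub>endo_alg B\<^esub> f \<in> carrier (endo_alg B)"
    by (rule endo_algI) (simp_all add: undef endo_alg_simps(3) cl f distrib_left mult.left_commute)
  assume g: "g \<in> carrier (endo_alg B)"
  note g = endo_algD(1)[OF g] endo_algD(3,4)[OF g]
  show "f \<otimes>\<^bsub>endo_alg B\<^esub> g \<in> carrier (endo_alg B)"
    by (rule endo_algI) (simp_all add: undef endo_alg_simps(1) cl f g)
  show "f \<oplus>\<^bsub>endo_alg B\<^esub> g \<in> carrier (endo_alg B)"
    by (rule endo_algI) (simp_all add: undef endo_alg_simps(2) cl f g distrib_left add.assoc add.left_commute)
qed

lemma endo_alg_one_zero:
  "\<one>\<^bsub>endo_alg B\<^esub> \<in> carrier (endo_alg B)" "\<zero>\<^bsub>endo_alg B\<^esub> \<in> carrier (endo_alg B)"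
proof -
  show "\<one>\<^bsub>endo_alg B\<^esub> \<in> carrier (endo_alg B)"
    by (rule endo_algI) (simp_all add: endo_alg_simps vspace_closed, simp add: endo_alg_def)
  show "\<zero>\<^bsub>endo_alg B\<^esub> \<in> carrier (endo_alg B)"
    by (rule endo_algI) (simp_all add: endo_alg_simps vspace_closed, simp add: endo_alg_def)
qed

lemma endo_alg_kalgebra: "kalgebra (endo_alg B :: ('k::field, _) module)"
proof -
  let ?E = "endo_alg B :: ('k, _) module"
  note cl = endo_alg_closed endo_alg_one_zero
  note ext = endo_alg_ext[of _ B] and ev = endo_alg_simps[of _ B] endo_algD(1)[of _ B]
  have neg: "\<exists>g\<in>carrier ?E. g \<oplus>\<^bsub>?E\<^esub> f = \<zero>\<^bsub>?E\<^esub>" if "f \<in> carrier ?E" for f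
  proof (rule bexI)
    show "((- 1) \<odot>\<^bsub>?E\<^esub> f) \<oplus>\<^bsub>?E\<^esub> f = \<zero>\<^bsub>?E\<^esub>"
      by (rule ext) (intro cl that, intro cl that, simp add: cl that ev)
  qed (simp add: cl that)
  show ?thesis
  proof (intro kalgebra.intro ringI abelian_groupI monoidI kalgebra_axioms.intro neg)
    fix f g h assume f: "f \<in> carrier ?E" and g: "g \<in> carrier ?E" and h: "h \<in> carrier ?E"
    show "f \<oplus>\<^bsub>?E\<^esub> g \<oplus>\<^bsub>?E\<^esub> h = f \<oplus>\<^bsub>?E\<^esub> (g \<oplus>\<^bsub>?E\<^esub> h)"
      by (rule ext) (simp_all add: cl f g h ev add.assoc)
    show "f \<otimes>\<^bsub>?E\<^esub> g \<otimes>\<^bsub>?E\<^esub> h = f \<otimes>\<^bsub>?E\<^esub> (g \<otimes>\<^bsub>?E\<^esub> h)"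
      by (rule ext) (simp_all add: cl f g h ev)
    show "(f \<oplus>\<^bsub>?E\<^esub> g) \<otimes>\<^bsub>?E\<^esub> h = f \<otimes>\<^bsub>?E\<^esub> h \<oplus>\<^bsub>?E\<^esub> g \<otimes>\<^bsub>?E\<^esub> h"
      by (rule ext) (simp_all add: cl f g h ev)
    show "h \<otimes>\<^bsub>?E\<^esub> (f \<oplus>\<^bsub>?E\<^esub> g) = h \<otimes>\<^bsub>?E\<^esub> f \<oplus>\<^bsub>?E\<^esub> h \<otimes>\<^bsub>?E\<^esub> g"
      by (rule ext) (simp_all add: cl f g h ev endo_algD(3)[OF h])
  next
    fix f g assume f: "f \<in> carrier ?E" and g: "g \<in> carrier ?E"
    show "f \<oplus>\<^bsub>?E\<^esub> g = g \<oplus>\<^bsub>?E\<^esub> f"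
      by (rule ext) (simp_all add: cl f g ev add.commute)
    fix c
    show "c \<odot>\<^bsub>?E\<^esub> (f \<oplus>\<^bsub>?E\<^esub> g) = c \<odot>\<^bsub>?E\<^esub> f \<oplus>\<^bsub>?E\<^esub> c \<odot>\<^bsub>?E\<^esub> g"
      by (rule ext) (simp_all add: cl f g ev distrib_left)
    show "(c \<odot>\<^bsub>?E\<^esub> f) \<otimes>\<^bsub>?E\<^esub> g = c \<odot>\<^bsub>?E\<^esub> (f \<otimes>\<^bsub>?E\<^esub> g)"
      by (rule ext) (simp_all add: cl f g ev)
    show "f \<otimes>\<^bsub>?E\<^esub> (c \<odot>\<^bsub>?E\<^esub> g) = c \<odot>\<^bsub>?E\<^esub> (f \<otimes>\<^bsub>?E\<^esub> g)"
      by (rule ext) (simp_all add: cl f g ev endo_algD(4)[OF f])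
  next
    fix f c e assume f: "f \<in> carrier ?E"
    show "\<zero>\<^bsub>?E\<^esub> \<oplus>\<^bsub>?E\<^esub> f = f" "\<one>\<^bsub>?E\<^esub> \<otimes>\<^bsub>?E\<^esub> f = f" "f \<otimes>\<^bsub>?E\<^esub> \<one>\<^bsub>?E\<^esub> = f" "1 \<odot>\<^bsub>?E\<^esub> f = f"
      by (rule ext; simp_all add: cl f ev)+
    show "(c + e) \<odot>\<^bsub>?E\<^esub> f = c \<odot>\<^bsub>?E\<^esub> f \<oplus>\<^bsub>?E\<^esub> e \<odot>\<^bsub>?E\<^esub> f"
      by (rule ext) (simp_all add: cl f ev distrib_right)
    show "(c * e) \<odot>\<^bsub>?E\<^esub> f = c \<odot>\<^bsub>?E\<^esub> (e \<odot>\<^bsub>?E\<^esub> f)"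
      by (rule ext) (simp_all add: cl f ev mult.assoc)
  qed (simp_all add: cl)
qed

lemma endo_alg_finsum:
  assumes "finite S" "\<And>i. i \<in> S \<Longrightarrow> f i \<in> carrier (endo_alg B)" "v \<in> vspace B"
  shows "(\<Oplus>\<^bsub>endo_alg B\<^esub>i\<in>S. f i) v y = (\<Sum>i\<in>S. f i v y)"
proof -
  interpret E: kalgebra "endo_alg B" by (rule endo_alg_kalgebra)
  show ?thesis
    using assms(1,2)
  proof induction
    case (insert i S)
    then have "f \<in> S \<rightarrow> carrier (endo_alg B)" "f i \<in> carrier (endo_alg B)" by auto
    with insert assms(3) show ?case
      by (simp add: E.finsum_insert endo_alg_simps)
  qed (simp add: endo_alg_simps assms(3))
qed

text \<open>Fixes the matrix convention: \<open>f (kdelta x) y\<close> is the entry in column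
  \<open>x\<close> and row \<open>y\<close>. Endomorphisms are compared through these entries from
  here on.\<close>

lemma endo_alg_matrix:
  fixes v :: "'x \<Rightarrow> 'k::field"
  assumes "finite B" and f: "f \<in> carrier (endo_alg B)" and v: "v \<in> vspace B"
  shows "f v y = (\<Sum>x\<in>B. v x * f (kdelta x) y)"
proof -
  have *: "f (\<lambda>y. \<Sum>x\<in>S. v x * kdelta x y) = (\<lambda>y. \<Sum>x\<in>S. v x * f (kdelta x) y)"
    if "S \<subseteq> B" for S
    using finite_subset[OF that assms(1)] that
  proof (induction S)
    case empty
    show ?case using endo_algD(4)[OF f vspace_closed(3), of 0] by simp
  next
    case (insert x S)
    have "(\<lambda>y. \<Sum>x\<in>S. v x * kdelta x y) \<in> vspace B"
      using insert.prems by (auto simp: vspace_def kdelta_def intro!: sum.neutral)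
    then show ?case
      using insert by (simp add: endo_algD(3,4)[OF f] vspace_closed)
  qed
  have "v = (\<lambda>y. \<Sum>x\<in>B. v x * kdelta x y)"
    using v assms(1) by (auto simp: vspace_def kdelta_def if_distrib sum.If_cases cong: if_cong)
  then show ?thesis using *[OF subset_refl] by metis
qed

section \<open>Operators on words\<close>

type_synonym letter = "nat \<times> nat"

text \<open>The eigenvalue of a group-like diagonal element on a basis word, when
  \<open>\<mu>\<close> gives its eigenvalues on letters.\<close>

definition wprod :: "(letter \<Rightarrow> 'k::field) \<Rightarrow> letter list \<Rightarrow> 'k" where
  "wprod \<mu> w = prod_list (map \<mu> w)"

lemma wprod_simps [simp]: "wprod \<mu> [] = 1" "wprod \<mu> (x # w) = \<mu> x * wprod \<mu> w"
  by (simp_all add: wprod_def)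

text \<open>The eigenvalue of K_i K_(i+1)^(-1) on a letter, where \<open>p\<close> and
  \<open>p'\<close> stand for the letters i and i+1 of one colour.\<close>

definition kap :: "'k::field \<Rightarrow> letter \<Rightarrow> letter \<Rightarrow> letter \<Rightarrow> 'k" where
  "kap q p p' x = (if x = p then q else if x = p' then inverse q else 1)"

lemma kap_nonzero [simp]: "q \<noteq> 0 \<Longrightarrow> kap q p p' x \<noteq> 0"
  by (simp add: kap_def)

lemma kap_eval:
  "kap q p p' p = q" "p \<noteq> p' \<Longrightarrow> kap q p p' p' = inverse q"
  "x \<noteq> p \<Longrightarrow> x \<noteq> p' \<Longrightarrow> kap q p p' x = 1"
  by (auto simp: kap_def)

text \<open>Here \<open>f\<close> is a coordinate function, and the value at a word is a coefficient
  of the image. Since E_i sends v_(i+1) to v_i, the word with \<open>p'\<close> is read where the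
  result shows \<open>p\<close>. The two summands are the two terms of the comultiplication of E_i,
  with \<open>wprod\<close> as K_i K_(i+1)^(-1) on the remaining factors. The parameter
  \<open>q\<close> and the absence of d, N and n allow the same operator to be used at
  \<open>qq\<close> and at 1.\<close>

fun Eop :: "'k::field \<Rightarrow> letter \<Rightarrow> letter \<Rightarrow> (letter list \<Rightarrow> 'k) \<Rightarrow> letter list \<Rightarrow> 'k" where
  "Eop q p p' f [] = 0"
| "Eop q p p' f (x # w) =
    (if x = p then wprod (kap q p p') w * f (p' # w) else 0) + Eop q p p' (\<lambda>u. f (x # u)) w"

text \<open>The comultiplication of F_i puts K_i^(-1) K_(i+1) on the left factor, so each letter
  that is passed contributes an inverse weight while the tail is left untwisted.\<close>

fun Fop :: "'k::field \<Rightarrow> letter \<Rightarrow> letter \<Rightarrow> (letter list \<Rightarrow> 'k) \<Rightarrow> letter list \<Rightarrow> 'k" where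
  "Fop q p p' f [] = 0"
| "Fop q p p' f (x # w) =
    (if x = p' then f (p # w) else 0) + inverse (kap q p p' x) * Fop q p p' (\<lambda>u. f (x # u)) w"

lemma Eop_linear [simp]:
  "Eop q p p' (\<lambda>u. f u + g u) w = Eop q p p' f w + Eop q p p' g w"
  "Eop q p p' (\<lambda>u. c * f u) w = c * Eop q p p' f w"
  "Eop q p p' (\<lambda>u. 0) w = 0"
  by (induction w arbitrary: f g) (simp_all add: algebra_simps)

lemma Fop_linear [simp]:
  "Fop q p p' (\<lambda>u. f u + g u) w = Fop q p p' f w + Fop q p p' g w"
  "Fop q p p' (\<lambda>u. c * f u) w = c * Fop q p p' f w"
  "Fop q p p' (\<lambda>u. 0) w = 0"
  by (induction w arbitrary: f g) (simp_all add: algebra_simps)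

text \<open>Exchanging one letter \<open>p\<close> for \<open>p'\<close> changes the product of
  weights by the ratio of \<open>\<mu> p'\<close> to \<open>\<mu> p\<close>. Clearing the
  denominator gives a form that holds for all \<open>\<mu>\<close>, with zeros allowed.\<close>

lemma Eop_wprod:
  "\<mu> p * Eop q p p' (\<lambda>u. wprod \<mu> u * f u) w = \<mu> p' * (wprod \<mu> w * Eop q p p' f w)"
proof (induction w arbitrary: f)
  case (Cons x w)
  have 1: "Eop q p p' (\<lambda>u. wprod \<mu> (x # u) * f (x # u)) w = \<mu> x * Eop q p p' (\<lambda>u. wprod \<mu> u * f (x # u)) w"
    by (simp add: mult.assoc)
  have 2: "\<mu> p * (c * Eop q p p' (\<lambda>u. wprod \<mu> u * f (x # u)) w) =
      c * (\<mu> p' * (wprod \<mu> w * Eop q p p' (\<lambda>u. f (x # u)) w))" for c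
    by (subst Cons.IH[symmetric]) (simp add: mult.left_commute)
  show ?case
    by (simp only: Eop.simps 1 distrib_left 2 if_distrib mult_zero_right wprod_simps mult.assoc) (simp add: algebra_simps 2 Cons.IH)
qed simp

lemma Fop_wprod:
  "\<mu> p' * Fop q p p' (\<lambda>u. wprod \<mu> u * f u) w = \<mu> p * (wprod \<mu> w * Fop q p p' f w)"
proof (induction w arbitrary: f)
  case (Cons x w)
  have 1: "Fop q p p' (\<lambda>u. wprod \<mu> (x # u) * f (x # u)) w = \<mu> x * Fop q p p' (\<lambda>u. wprod \<mu> u * f (x # u)) w"
    by (simp add: mult.assoc)
  have 2: "\<mu> p' * (c * Fop q p p' (\<lambda>u. wprod \<mu> u * f (x # u)) w) =
      c * (\<mu> p * (wprod \<mu> w * Fop q p p' (\<lambda>u. f (x # u)) w))" for c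
    by (subst Cons.IH[symmetric]) (simp add: mult.left_commute)
  show ?case
    by (simp only: Fop.simps 1 distrib_left 2 if_distrib mult_zero_right wprod_simps mult.assoc) (simp add: algebra_simps 2 Cons.IH)
qed simp

lemma Eop_wprod':
  assumes "\<mu> p \<noteq> 0"
  shows "Eop q p p' (\<lambda>u. wprod \<mu> u * f u) w = \<mu> p' * inverse (\<mu> p) * (wprod \<mu> w * Eop q p p' f w)"
  using Eop_wprod[of \<mu> p q p' f w] assms by (simp add: field_simps)

lemma Fop_wprod':
  assumes "\<mu> p' \<noteq> 0"
  shows "Fop q p p' (\<lambda>u. wprod \<mu> u * f u) w = \<mu> p * inverse (\<mu> p') * (wprod \<mu> w * Fop q p p' f w)"
  using Fop_wprod[of \<mu> p' q p f w] assms by (simp add: field_simps)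

lemma wprod_inverse: "wprod (\<lambda>x. inverse (\<mu> x)) w = inverse (wprod \<mu> w)"
  by (induction w) simp_all

text \<open>For disjoint pairs of letters, each weight \<open>kap\<close> is 1 on the letters of the
  other pair. The twists in the two comultiplications therefore create no scalar when the operators
  are exchanged.\<close>

lemma Eop_Eop_commute:
  assumes "q \<noteq> 0" "p \<noteq> p'" "r \<noteq> r'" "{p, p'} \<inter> {r, r'} = {}"
  shows "Eop q p p' (Eop q r r' f) w = Eop q r r' (Eop q p p' f) w"
proof (induction w arbitrary: f)
  case (Cons x w)
  have k: "kap q p p' r = 1" "kap q p p' r' = 1" "kap q r r' p = 1" "kap q r r' p' = 1"
    "p \<noteq> r" "p \<noteq> r'" "p' \<noteq> r" "p' \<noteq> r'" "r \<noteq> p" "r' \<noteq> p" "r \<noteq> p'" "r' \<noteq> p'"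
    using assms by (auto simp: kap_def)
  consider "x = p" | "x = r" | "x \<noteq> p" "x \<noteq> r" by blast
  then show ?case
    using assms Cons by cases (simp_all add: k Eop_wprod'[of "kap q _ _"] mult.left_commute)
qed simp

lemma Fop_Fop_commute:
  assumes "q \<noteq> 0" "p \<noteq> p'" "r \<noteq> r'" "{p, p'} \<inter> {r, r'} = {}"
  shows "Fop q p p' (Fop q r r' f) w = Fop q r r' (Fop q p p' f) w"
proof (induction w arbitrary: f)
  case (Cons x w)
  have k: "kap q p p' r = 1" "kap q p p' r' = 1" "kap q r r' p = 1" "kap q r r' p' = 1"
    "p \<noteq> r" "p \<noteq> r'" "p' \<noteq> r" "p' \<noteq> r'" "r \<noteq> p" "r' \<noteq> p" "r \<noteq> p'" "r' \<noteq> p'"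
    using assms by (auto simp: kap_def)
  consider "x = p'" | "x = r'" | "x \<noteq> p'" "x \<noteq> r'" by blast
  then show ?case
    using assms Cons by cases (simp_all add: k kap_eval mult.left_commute)
qed simp

text \<open>The pairs may overlap in \<open>p' = r\<close> or \<open>p = r'\<close>, which is the
  case of neighbouring simple roots. The scalar that arises when one operator changes a letter
  weighted by the other arises in both orders, so it cancels.\<close>

lemma Eop_Fop_commute:
  assumes "q \<noteq> 0" "p \<noteq> p'" "r \<noteq> r'" "p \<noteq> r" "p' \<noteq> r'"
  shows "Eop q p p' (Fop q r r' f) w = Fop q r r' (Eop q p p' f) w"
proof (induction w arbitrary: f)
  case (Cons x w)
  have k: "kap q p p' r = (if p' = r then inverse q else 1)" "kap q p p' r' = (if p = r' then q else 1)"
    "kap q r r' p = (if p = r' then inverse q else 1)" "kap q r r' p' = (if p' = r then q else 1)"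
    "kap q p p' p = q" "kap q p p' p' = inverse q" "kap q r r' r = q" "kap q r r' r' = inverse q"
    using assms by (auto simp: kap_def)
  note neq = assms assms(2-)[symmetric] Fop_wprod'[of "kap q _ _"]
  consider "x = p" "x \<noteq> r'" | "x = r'" "x \<noteq> p" | "x = r'" "x = p" | "x \<noteq> p" "x \<noteq> r'" by blast
  then show ?case
  proof cases
    case 1
    then show ?thesis using Cons[of "\<lambda>u. f (x # u)"] by (simp add: k neq) (simp add: field_simps neq)?
  next
    case 2
    then show ?thesis using Cons[of "\<lambda>u. f (x # u)"] by (simp add: k neq) (simp add: field_simps neq)?
  next
    case 3
    then have e: "r' = p" "x = p" by simp_all
    show ?thesis
      using Cons[of "\<lambda>u. f (x # u)"] unfolding e
      by (simp add: k[unfolded e] neq[unfolded e]) (simp add: field_simps neq)?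
  next
    case 4
    then show ?thesis using Cons[of "\<lambda>u. f (x # u)"] by (simp add: k neq) (simp add: field_simps neq)?
  qed
qed simp

text \<open>A telescoping sum along the word: a first letter \<open>p\<close> or \<open>p'\<close>
  contributes plus or minus the weight of the tail and rescales the commutator on the tail by
  \<open>inverse q\<close> or \<open>q\<close>. Multiplying by \<open>q - inverse q\<close> keeps
  the identity free of division.\<close>

lemma Eop_Fop_same:
  assumes "q \<noteq> 0" "p \<noteq> p'"
  shows "(q - inverse q) * (Eop q p p' (Fop q p p' f) w - Fop q p p' (Eop q p p' f) w) =
    (wprod (kap q p p') w - inverse (wprod (kap q p p') w)) * f w"
proof (induction w arbitrary: f)
  case (Cons x w)
  note simps = Fop_wprod'[of "kap q _ _"] assms assms(2)[symmetric] kap_eval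
  let ?W = "wprod (kap q p p') w"
  let ?D = "Eop q p p' (Fop q p p' (\<lambda>u. f (x # u))) w - Fop q p p' (Eop q p p' (\<lambda>u. f (x # u))) w"
  have W: "?W \<noteq> 0" by (induction w) (simp_all add: assms)
  have IH: "(q - inverse q) * (c * ?D) = c * ((?W - inverse ?W) * f (x # w))" for c
    unfolding Cons.IH[of "\<lambda>u. f (x # u)", symmetric] by (rule mult.left_commute)
  consider "x = p" | "x = p'" | "x \<noteq> p" "x \<noteq> p'" by blast
  then show ?case
  proof cases
    case 1
    then have D: "Eop q p p' (Fop q p p' f) (x # w) - Fop q p p' (Eop q p p' f) (x # w) = ?W * f (x # w) + inverse q * ?D"
      by (simp add: simps) (simp add: algebra_simps simps)
    show ?thesis
      unfolding D distrib_left IH using 1 W by (simp add: simps) (simp add: field_simps simps)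
  next
    case 2
    then have D: "Eop q p p' (Fop q p p' f) (x # w) - Fop q p p' (Eop q p p' f) (x # w) = - ?W * f (x # w) + q * ?D"
      by (simp add: simps) (simp add: algebra_simps simps)
    show ?thesis
      unfolding D distrib_left IH using 2 W by (simp add: simps) (simp add: field_simps simps)
  next
    case 3
    then show ?thesis
      using Cons[of "\<lambda>u. f (x # u)"] by (simp add: simps)
  qed
qed simp

text \<open>The two statements are the Serre relation for a root and its right or left neighbour.
  The induction hypothesis is turned into a rule that eliminates the monomial beginning with the
  repeated operator; what remains after splitting off the first letter is a polynomial identity in
  \<open>q\<close> and \<open>inverse q\<close>.\<close>

lemma Eop_Serre:
  assumes "q \<noteq> 0" "p \<noteq> p'" "p \<noteq> p''" "p' \<noteq> p''"
  shows "Eop q p p' (Eop q p p' (Eop q p' p'' f)) w + Eop q p' p'' (Eop q p p' (Eop q p p' f)) w =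
      (q + inverse q) * Eop q p p' (Eop q p' p'' (Eop q p p' f)) w"
    and "Eop q p' p'' (Eop q p' p'' (Eop q p p' f)) w + Eop q p p' (Eop q p' p'' (Eop q p' p'' f)) w =
      (q + inverse q) * Eop q p' p'' (Eop q p p' (Eop q p' p'' f)) w"
proof (induction w arbitrary: f)
  note [simp] = Eop_wprod'[of "kap q _ _"] assms assms(2-4)[symmetric] kap_eval
  case (Cons x w)
  have IH1: "Eop q p p' (Eop q p p' (Eop q p' p'' g)) w =
      (q + inverse q) * Eop q p p' (Eop q p' p'' (Eop q p p' g)) w - Eop q p' p'' (Eop q p p' (Eop q p p' g)) w" for g
    using Cons(1)[of g] by (simp add: eq_diff_eq)
  have IH2: "Eop q p' p'' (Eop q p' p'' (Eop q p p' g)) w =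
      (q + inverse q) * Eop q p' p'' (Eop q p p' (Eop q p' p'' g)) w - Eop q p p' (Eop q p' p'' (Eop q p' p'' g)) w" for g
    using Cons(2)[of g] by (simp add: eq_diff_eq)
  consider "x = p" | "x = p'" | "x = p''" | "x \<noteq> p" "x \<noteq> p'" "x \<noteq> p''" by blast
  note cs = this
  {
    case 1
    from cs show ?case
    proof cases
      case 1
      then show ?thesis
        by (simp add: IH1; simp add: field_simps)
    next
      case 2
      then show ?thesis
        by (simp add: IH1; simp add: field_simps)
    next
      case 3
      then show ?thesis
        by (simp add: IH1; simp add: field_simps)
    next
      case 4
      then show ?thesis
        by (simp add: IH1; simp add: field_simps)
    qed
  next
    case 2
    from cs show ?case
    proof cases
      case 1
      then show ?thesis
        by (simp add: IH2; simp add: field_simps)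
    next
      case 2
      then show ?thesis
        by (simp add: IH2; simp add: field_simps)
    next
      case 3
      then show ?thesis
        by (simp add: IH2; simp add: field_simps)
    next
      case 4
      then show ?thesis
        by (simp add: IH2; simp add: field_simps)
    qed
  }
qed simp_all

lemma Fop_Serre:
  assumes "q \<noteq> 0" "p \<noteq> p'" "p \<noteq> p''" "p' \<noteq> p''"
  shows "Fop q p p' (Fop q p p' (Fop q p' p'' f)) w + Fop q p' p'' (Fop q p p' (Fop q p p' f)) w =
      (q + inverse q) * Fop q p p' (Fop q p' p'' (Fop q p p' f)) w"
    and "Fop q p' p'' (Fop q p' p'' (Fop q p p' f)) w + Fop q p p' (Fop q p' p'' (Fop q p' p'' f)) w =
      (q + inverse q) * Fop q p' p'' (Fop q p p' (Fop q p' p'' f)) w"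
proof (induction w arbitrary: f)
  note [simp] = assms assms(2-4)[symmetric] kap_eval
  case (Cons x w)
  have IH1: "Fop q p p' (Fop q p p' (Fop q p' p'' g)) w =
      (q + inverse q) * Fop q p p' (Fop q p' p'' (Fop q p p' g)) w - Fop q p' p'' (Fop q p p' (Fop q p p' g)) w" for g
    using Cons(1)[of g] by (simp add: eq_diff_eq)
  have IH2: "Fop q p' p'' (Fop q p' p'' (Fop q p p' g)) w =
      (q + inverse q) * Fop q p' p'' (Fop q p p' (Fop q p' p'' g)) w - Fop q p p' (Fop q p' p'' (Fop q p' p'' g)) w" for g
    using Cons(2)[of g] by (simp add: eq_diff_eq)
  consider "x = p" | "x = p'" | "x = p''" | "x \<noteq> p" "x \<noteq> p'" "x \<noteq> p''" by blast
  note cs = this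
  {
    case 1
    from cs show ?case
    proof cases
      case 1
      then show ?thesis
        by (simp add: IH1; simp add: field_simps)
    next
      case 2
      then show ?thesis
        by (simp add: IH1; simp add: field_simps)
    next
      case 3
      then show ?thesis
        by (simp add: IH1; simp add: field_simps)
    next
      case 4
      then show ?thesis
        by (simp add: IH1; simp add: field_simps)
    qed
  next
    case 2
    from cs show ?case
    proof cases
      case 1
      then show ?thesis
        by (simp add: IH2; simp add: field_simps)
    next
      case 2
      then show ?thesis
        by (simp add: IH2; simp add: field_simps)
    next
      case 3
      then show ?thesis
        by (simp add: IH2; simp add: field_simps)
    next
      case 4
      then show ?thesis
        by (simp add: IH2; simp add: field_simps)
    qed
  }
qed simp_all

section \<open>Hecke operators on words\<close>

definition swp :: "nat \<Rightarrow> 'a list \<Rightarrow> 'a list" where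
  "swp r w = w[r := w ! Suc r, Suc r := w ! r]"

lemma swp_simps [simp]:
  "swp (Suc r) (x # w) = x # swp r w"
  "swp 0 (x # y # w) = y # x # w"
  "length (swp r w) = length w"
  by (simp_all add: swp_def)

lemma mset_swp [simp]: "Suc r < length w \<Longrightarrow> mset (swp r w) = mset w"
  unfolding swp_def by (rule mset_swap) simp_all

lemma set_swp [simp]: "Suc r < length w \<Longrightarrow> set (swp r w) = set w"
  by (rule mset_eq_setD) simp

lemma swp_nth:
  "Suc r < length w \<Longrightarrow> m < length w \<Longrightarrow> swp r w ! m = w ! (if m = r then Suc r else if m = Suc r then r else m)"
  by (simp add: swp_def nth_list_update)

lemma swp_swp [simp]: "Suc r < length w \<Longrightarrow> swp r (swp r w) = w"
  by (rule nth_equalityI) (simp_all add: swp_nth)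

lemma map_swp: "Suc r < length w \<Longrightarrow> map f (swp r w) = swp r (map f w)"
  by (rule nth_equalityI) (simp_all add: swp_nth)

lemma wprod_swp: "Suc r < length w \<Longrightarrow> wprod \<mu> (swp r w) = wprod \<mu> w"
  unfolding wprod_def prod_mset_prod_list[symmetric] by simp

definition lgt :: "letter \<Rightarrow> letter \<Rightarrow> bool" where
  "lgt x y \<longleftrightarrow> fst x = fst y \<and> snd y < snd x"

lemma lgt_irrefl [simp]: "\<not> lgt x x"
  and lgt_asym: "lgt x y \<Longrightarrow> \<not> lgt y x"
  and lgt_trans: "lgt x y \<Longrightarrow> lgt y z \<Longrightarrow> lgt x z"
  and lgt_total1: "lgt x y \<Longrightarrow> lgt x z \<Longrightarrow> y = z \<or> lgt y z \<or> lgt z y"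
  and lgt_total2: "lgt y x \<Longrightarrow> lgt z x \<Longrightarrow> y = z \<or> lgt y z \<or> lgt z y"
  and lgt_fst: "lgt x y \<Longrightarrow> fst x = fst y"
  and fst_eq_iff_lgt: "fst x = fst y \<longleftrightarrow> x = y \<or> lgt x y \<or> lgt y x"
  by (auto simp: lgt_def prod_eq_iff)

text \<open>The coordinate form of the braiding on positions \<open>r\<close> and
  \<open>r + 1\<close>, counted from 0, so that \<open>sigma\<close> at i is \<open>Sop\<close> at i
  - 1. Letters of different colours are neither equal nor related by \<open>lgt\<close>; hence the
  same formula covers the R-matrix inside a colour and the flip between colours.\<close>

definition Sop :: "'k::field \<Rightarrow> nat \<Rightarrow> (letter list \<Rightarrow> 'k) \<Rightarrow> letter list \<Rightarrow> 'k" where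
  "Sop q r f w = (if w ! r = w ! Suc r then q * f w else f (swp r w) +
    (if lgt (w ! r) (w ! Suc r) then (q - inverse q) * f w else 0))"

text \<open>With \<open>sbe\<close>, the coefficients of keeping and of exchanging two adjacent
  letters. Separating them turns operator identities for \<open>Sop\<close> into identities between
  scalars.\<close>

definition sal :: "'k::field \<Rightarrow> letter \<Rightarrow> letter \<Rightarrow> 'k" where
  "sal q x y = (if x = y then q else if lgt x y then q - inverse q else 0)"

definition sbe :: "letter \<Rightarrow> letter \<Rightarrow> 'k::field" where
  "sbe x y = (if x = y then 0 else 1)"

lemma Sop_0': "Sop q 0 f (x # y # w) = sal q x y * f (x # y # w) + sbe x y * f (y # x # w)"
  by (simp add: Sop_def sal_def sbe_def)

lemma sal_quadratic:
  assumes "(q::'k::field) \<noteq> 0"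
  shows "q * q = (q - inverse q) * q + 1"
  using assms by (simp add: algebra_simps)

text \<open>Both sides of the braid relation expand over the six rearrangements of three letters.
  These are the coefficients at \<open>x y z\<close>, \<open>y x z\<close> and \<open>x z y\<close>;
  the other three agree by inspection.\<close>

lemma sal_braid:
  assumes "(q::'k::field) \<noteq> 0"
  shows "sal q x y * sal q x y * sal q y z + sbe x y * sbe y x * sal q x z =
      sal q y z * sal q y z * sal q x y + sbe y z * sbe z y * sal q x z" (is ?A)
    and "sbe x y * (sal q x y * sal q y z + sal q x z * sal q y x) = sbe x y * (sal q y z * sal q x z)" (is ?B)
    and "sbe y z * (sal q x y * sal q x z) = sbe y z * (sal q y z * sal q x y + sal q x z * sal q z y)" (is ?C)
proof -
  \<comment> \<open>The difference \<open>q - inverse q\<close> is kept opaque, and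
    \<open>q * q = c * q + 1\<close> is the only relation between the two scalars that is
    used.\<close>
  define c where "c = q - inverse q"
  have c: "q * q = c * q + 1" "q * (q * e) = c * q * e + e" for e
    using sal_quadratic[OF assms] by (simp_all add: c_def mult.assoc[symmetric] distrib_right)
  have sal: "sal q x y = (if x = y then q else if lgt x y then c else 0)" for x y
    by (simp add: sal_def c_def)
  have null: "sal q x y * sal q y x = 0" "sal q x y * (sal q y x * e) = 0" if "x \<noteq> y" for x y e
    using that lgt_asym[of x y] by (auto simp: sal)
  have two: "sal q x y = 0 \<or> sal q x y = c" if "x \<noteq> y" for x y
    using that by (simp add: sal)
  have eqs: "sal q x x = q" "sbe x x = (0::'k)" "x \<noteq> y \<Longrightarrow> sbe x y = (1::'k)" for x y
    by (simp_all add: sal sbe_def)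
  consider "x = y" "y = z" | "x = y" "y \<noteq> z" | "x \<noteq> y" "y = z" | "x \<noteq> y" "y \<noteq> z" "x = z" | "x \<noteq> y" "y \<noteq> z" "x \<noteq> z"
    by blast
  then have "?A \<and> ?B \<and> ?C"
  proof cases
    case 1
    then show ?thesis by (simp add: eqs)
  next
    case 2
    then show ?thesis
      using two[OF 2(2)] null(1)[OF 2(2)] by (elim disjE) (auto simp: eqs c algebra_simps)
  next
    case 3
    then show ?thesis
      using two[OF 3(1)] null(1)[OF 3(1)] by (elim disjE) (auto simp: eqs c algebra_simps)
  next
    case 4
    then have "sal q x y = 0 \<or> sal q y x = 0" using null(1)[of x y] by simp
    with 4 show ?thesis by (elim disjE) (simp_all add: eqs algebra_simps)
  next
    case 5
    then have ?A using two[OF 5(1)] two[OF 5(2)] by (elim disjE) (simp_all add: eqs)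
    moreover have ?B ?C using 5 by (auto simp: sal sbe_def lgt_def prod_eq_iff)
    ultimately show ?thesis by simp
  qed
  then show ?A ?B ?C by simp_all
qed

lemma Sop_Suc [simp]: "Sop q (Suc r) f (x # w) = Sop q r (\<lambda>u. f (x # u)) w"
  by (simp add: Sop_def)

lemma Sop_0 [simp]: "Sop q 0 f (x # y # w) = (if x = y then q * f (x # y # w) else f (y # x # w) +
    (if lgt x y then (q - inverse q) * f (x # y # w) else 0))"
  by (simp add: Sop_def)

lemma Sop_linear:
  "Sop q r (\<lambda>u. f u + g u) w = Sop q r f w + Sop q r g w"
  "Sop q r (\<lambda>u. c * f u) w = c * Sop q r f w"
  "Sop q r (\<lambda>u. 0) w = 0"
  by (simp_all add: Sop_def algebra_simps)

text \<open>Between different colours \<open>Sop\<close> is a pure exchange and carries the factor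
  \<open>m\<close> to the exchanged word. Inside a colour there is also a diagonal term, which
  forces \<open>m\<close> to agree on both words. The lemma yields the relation between s_i and t_j
  as well as commutation with diagonal K-elements.\<close>

lemma Sop_diag:
  assumes "Suc r < length w" "fst (w ! r) = fst (w ! Suc r) \<Longrightarrow> m (swp r w) = m w"
  shows "Sop q r (\<lambda>u. m u * f u) w = m (swp r w) * Sop q r f w"
proof (cases "fst (w ! r) = fst (w ! Suc r)")
  case True
  then have "m (swp r w) = m w" by (rule assms(2))
  then show ?thesis by (simp add: Sop_def algebra_simps)
next
  case False
  then have "w ! r \<noteq> w ! Suc r" by auto
  with False show ?thesis by (simp add: Sop_def lgt_def)
qed

lemma Sop_wprod:
  assumes "Suc r < length w"
  shows "Sop q r (\<lambda>u. wprod \<mu> u * f u) w = wprod \<mu> w * Sop q r f w"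
  using assms by (subst Sop_diag) (simp_all add: wprod_swp)

lemma Sop_far:
  assumes "Suc r < s" "Suc s < length w"
  shows "Sop q r (Sop q s f) w = Sop q s (Sop q r f) w"
  using assms
proof (induction r arbitrary: s w f)
  case 0
  then obtain x y u where w: "w = x # y # u" by (cases w; cases "tl w") auto
  from 0 obtain s' where s: "s = Suc (Suc s')" by (cases s; cases "s - 1") auto
  show ?case
    by (cases "x = y"; cases "lgt x y") (simp_all add: w s Sop_linear)
next
  case (Suc r)
  then obtain x u where w: "w = x # u" by (cases w) auto
  from Suc.prems obtain s' where s: "s = Suc s'" by (cases s) auto
  show ?case using Suc.IH[of s' u "\<lambda>u. f (x # u)"] Suc.prems by (simp add: w s)
qed

lemma Sop_braid:
  assumes "Suc (Suc r) < length w" "q \<noteq> 0"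
  shows "Sop q r (Sop q (Suc r) (Sop q r f)) w = Sop q (Suc r) (Sop q r (Sop q (Suc r) f)) w"
  using assms(1)
proof (induction r arbitrary: w f)
  case 0
  then obtain x y z u where w: "w = x # y # z # u" by (cases w; cases "tl w"; cases "tl (tl w)") auto
  have S1: "Sop q (Suc 0) g (a # b # e # u) = sal q b e * g (a # b # e # u) + sbe b e * g (a # e # b # u)" for g a b e
    by (simp add: Sop_0' del: Sop_0)
  note S0 = Sop_0'[where w = "_ # _"]
  \<comment> \<open>The six rearrangements of \<open>x y z\<close>, grouped so that the three
    coefficients not symmetric at sight are exactly the left sides of
    \<open>sal_braid\<close>.\<close>
  have "Sop q 0 (Sop q (Suc 0) (Sop q 0 f)) w =
      (sal q x y * sal q x y * sal q y z + sbe x y * sbe y x * sal q x z) * f (x # y # z # u) +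
      sbe x y * (sal q x y * sal q y z + sal q x z * sal q y x) * f (y # x # z # u) +
      sbe y z * (sal q x y * sal q x z) * f (x # z # y # u) +
      sal q x y * sbe y z * sbe x z * f (z # x # y # u) + sbe x y * sbe x z * sal q y z * f (y # z # x # u) +
      sbe x y * sbe x z * sbe y z * f (z # y # x # u)"
    unfolding w S0 S1 by (simp add: algebra_simps)
  also have "\<dots> = Sop q (Suc 0) (Sop q 0 (Sop q (Suc 0) f)) w"
    unfolding sal_braid(1)[OF assms(2), of x y z] sal_braid(2,3)[OF assms(2)] w S0 S1
    by (simp add: algebra_simps)
  finally show ?case .
next
  case (Suc r)
  then obtain x u where w: "w = x # u" by (cases w) auto
  show ?case using Suc.IH[of u "\<lambda>u. f (x # u)"] Suc.prems by (simp add: w)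
qed

text \<open>Between different colours the exchange is an involution and the linear term is absent.
  The colour test is what the element E_i of the Yokonuma-Hecke algebra becomes on tensor
  space.\<close>

lemma Sop_quadratic:
  assumes "Suc r < length w" "q \<noteq> 0"
  shows "Sop q r (Sop q r f) w = (q - inverse q) * (if fst (w ! r) = fst (w ! Suc r) then Sop q r f w else 0) + f w"
  using assms(1)
proof (induction r arbitrary: w f)
  case 0
  then obtain x y u where w: "w = x # y # u" by (cases w; cases "tl w") auto
  have 1: "sal q x y * sal q x y + sbe x y * sbe y x = (q - inverse q) * (if fst x = fst y then sal q x y else 0) + 1"
    using assms(2) by (cases x; cases y) (auto simp: sal_def sbe_def lgt_def field_simps)
  have 2: "sal q x y * sbe x y + sbe x y * sal q y x = (q - inverse q) * (if fst x = fst y then sbe x y else 0)"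
    using assms(2) by (cases x; cases y) (auto simp: sal_def sbe_def lgt_def)
  have "Sop q 0 (Sop q 0 f) w = (sal q x y * sal q x y + sbe x y * sbe y x) * f (x # y # u) +
      (sal q x y * sbe x y + sbe x y * sal q y x) * f (y # x # u)"
    unfolding w Sop_0' by (simp add: algebra_simps)
  also have "\<dots> = (q - inverse q) * (if fst x = fst y then Sop q 0 f w else 0) + f w"
    unfolding 1 2 w Sop_0' by (simp add: algebra_simps)
  finally show ?case by (simp add: w)
next
  case (Suc r)
  then obtain x u where w: "w = x # u" by (cases w) auto
  show ?case using Suc.IH[of u "\<lambda>u. f (x # u)"] Suc.prems by (simp add: w)
qed

text \<open>The twist on the tail is invariant under exchanging letters, so it passes through
  \<open>Sop\<close> in the induction step. This leaves the first two positions, where all pairs of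
  letters are compared with the pair of neighbouring letters.\<close>

lemma Eop_Sop_commute:
  assumes "Suc r < length w" "q \<noteq> 0"
  shows "Eop q (b, i) (b, Suc i) (Sop q r f) w = Sop q r (Eop q (b, i) (b, Suc i) f) w"
  using assms(1)
proof (induction r arbitrary: w f)
  case 0
  then obtain x y u where w: "w = x # y # u" by (cases w; cases "tl w") auto
  define p p' where "p = (b, i)" and "p' = (b, Suc i)"
  have pp: "p \<noteq> p'" "p' \<noteq> p" "sal q p p' = 0" "sal q p' p = q - inverse q" "sal q p p = q" "sal q p' p' = q"
    by (simp_all add: p_def p'_def sal_def lgt_def)
  have sbe: "sbe z z = (0::'a)" "z \<noteq> z' \<Longrightarrow> sbe z z' = (1::'a)" for z z'
    by (simp_all add: sbe_def)
  have eq: "Eop q p p' (\<lambda>v. Sop q 0 f (x # y # v)) u =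
    sal q x y * Eop q p p' (\<lambda>v. f (x # y # v)) u + sbe x y * Eop q p p' (\<lambda>v. f (y # x # v)) u"
    unfolding Sop_0' by simp
  \<comment> \<open>No index lies strictly between i and i + 1, so a third letter compares in the
    same way with \<open>p\<close> and with \<open>p'\<close>. This is where simple roots
    matter.\<close>
  have other: "sal q p z = sal q p' z" "sal q z p = sal q z p'" if "z \<noteq> p" "z \<noteq> p'" for z
    using that by (auto simp: p_def p'_def sal_def lgt_def prod_eq_iff)
  consider "x = p" | "x = p'" | "x \<noteq> p" "x \<noteq> p'" by blast
  note cx = this
  consider "y = p" | "y = p'" | "y \<noteq> p" "y \<noteq> p'" by blast
  note cy = this
  have "Eop q p p' (Sop q 0 f) (x # y # u) = Sop q 0 (Eop q p p' f) (x # y # u)"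
    unfolding Eop.simps eq Sop_0'
    by (rule cx; rule cy; simp add: pp kap_eval other sbe assms; simp add: field_simps assms)
  then show ?case by (simp add: w p_def p'_def)
next
  case (Suc r)
  then obtain x u where w: "w = x # u" by (cases w) auto
  have "Eop q (b, i) (b, Suc i) (\<lambda>v. Sop q r (\<lambda>u. f (x # u)) v) u = Sop q r (\<lambda>v. Eop q (b, i) (b, Suc i) (\<lambda>u. f (x # u)) v) u"
    using Suc.IH[of u "\<lambda>u. f (x # u)"] Suc.prems by (simp add: w)
  then show ?case using Suc.prems by (simp add: w Sop_linear Sop_wprod)
qed

lemma Fop_Sop_commute:
  assumes "Suc r < length w" "q \<noteq> 0"
  shows "Fop q (b, i) (b, Suc i) (Sop q r f) w = Sop q r (Fop q (b, i) (b, Suc i) f) w"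
  using assms(1)
proof (induction r arbitrary: w f)
  case 0
  then obtain x y u where w: "w = x # y # u" by (cases w; cases "tl w") auto
  define p p' where "p = (b, i)" and "p' = (b, Suc i)"
  have pp: "p \<noteq> p'" "p' \<noteq> p" "sal q p p' = 0" "sal q p' p = q - inverse q" "sal q p p = q" "sal q p' p' = q"
    by (simp_all add: p_def p'_def sal_def lgt_def)
  have sbe: "sbe z z = (0::'a)" "z \<noteq> z' \<Longrightarrow> sbe z z' = (1::'a)" for z z'
    by (simp_all add: sbe_def)
  have eq: "Fop q p p' (\<lambda>v. Sop q 0 f (x # y # v)) u =
    sal q x y * Fop q p p' (\<lambda>v. f (x # y # v)) u + sbe x y * Fop q p p' (\<lambda>v. f (y # x # v)) u"
    unfolding Sop_0' by simp
  have other: "sal q p z = sal q p' z" "sal q z p = sal q z p'" if "z \<noteq> p" "z \<noteq> p'" for z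
    using that by (auto simp: p_def p'_def sal_def lgt_def prod_eq_iff)
  consider "x = p" | "x = p'" | "x \<noteq> p" "x \<noteq> p'" by blast
  note cx = this
  consider "y = p" | "y = p'" | "y \<noteq> p" "y \<noteq> p'" by blast
  note cy = this
  have "Fop q p p' (Sop q 0 f) (x # y # u) = Sop q 0 (Fop q p p' f) (x # y # u)"
    unfolding Fop.simps eq Sop_0'
    by (rule cx; rule cy; simp add: pp kap_eval other sbe assms; simp add: field_simps assms)
  then show ?case by (simp add: w p_def p'_def)
next
  case (Suc r)
  then obtain x u where w: "w = x # u" by (cases w) auto
  have "Fop q (b, i) (b, Suc i) (\<lambda>v. Sop q r (\<lambda>u. f (x # u)) v) u = Sop q r (\<lambda>v. Fop q (b, i) (b, Suc i) (\<lambda>u. f (x # u)) v) u"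
    using Suc.IH[of u "\<lambda>u. f (x # u)"] Suc.prems by (simp add: w)
  then show ?case using Suc.prems by (simp add: w Sop_linear Sop_wprod)
qed

section \<open>The action on tensor space\<close>

lemma free_monoid_simps [simp]:
  "carrier (free_monoid X) = lists X" "x \<otimes>\<^bsub>free_monoid X\<^esub> y = x @ y" "\<one>\<^bsub>free_monoid X\<^esub> = []"
  by (simp_all add: free_monoid_def)

lemma free_monoid_monoid: "Group.monoid (free_monoid X)"
  by (rule monoidI) auto

text \<open>The right-nested product in \<open>free_lift\<close> is evaluation of words in the
  target monoid, so this is the universal property of the monoid algebra of a free monoid.\<close>

lemma free_lift_alg_hom:
  assumes E: "kalgebra E" and \<rho>: "\<And>g. g \<in> X \<Longrightarrow> \<rho> g \<in> carrier E"
  shows "free_lift E \<rho> \<in> alg_hom (free_algebra X) E"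
    and "g \<in> X \<Longrightarrow> free_lift E \<rho> (kdelta [g]) = \<rho> g"
proof -
  interpret E: kalgebra E by fact
  have eq: "free_lift E \<rho> = mlift E (E.word_eval \<rho>)"
    by (simp add: fun_eq_iff free_lift_def mlift_def E.word_eval_def)
  have cl: "E.word_eval \<rho> \<in> carrier (free_monoid X) \<rightarrow> carrier E"
    by (auto simp del: lists_eq_set intro!: E.word_eval_closed[where X = X] \<rho>)
  show "free_lift E \<rho> \<in> alg_hom (free_algebra X) E"
    unfolding eq free_algebra_def
    by (rule mlift_alg_hom[OF free_monoid_monoid E cl])
      (simp_all add: E.word_eval_append[OF \<rho>, of X] del: lists_eq_set)
  show "free_lift E \<rho> (kdelta [g]) = \<rho> g" if "g \<in> X"
    unfolding eq using that \<rho> by (subst mlift_kdelta[OF E cl]) auto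
qed

lemma lin_ext_apply:
  "v \<in> vspace B \<Longrightarrow> lin_ext B \<phi> v y = (if y \<in> B then \<Sum>x\<in>B. v x * \<phi> x y else 0)"
  by (simp add: lin_ext_def)

lemma lin_ext_carrier:
  fixes B :: "'x set" and \<phi> :: "'x \<Rightarrow> 'x \<Rightarrow> 'k::field"
  shows "lin_ext B \<phi> \<in> carrier (endo_alg B)"
proof (rule endo_algI)
  fix v w :: "'x \<Rightarrow> 'k" assume v: "v \<in> vspace B" and w: "w \<in> vspace B"
  show "lin_ext B \<phi> (\<lambda>x. v x + w x) = (\<lambda>x. lin_ext B \<phi> v x + lin_ext B \<phi> w x)"
    by (rule ext) (simp add: lin_ext_apply v w vspace_closed distrib_right sum.distrib)
next
  fix v :: "'x \<Rightarrow> 'k" and c assume v: "v \<in> vspace B"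
  show "lin_ext B \<phi> (\<lambda>x. c * v x) = (\<lambda>x. c * lin_ext B \<phi> v x)"
    by (rule ext) (simp add: lin_ext_apply v vspace_closed sum_distrib_left mult.assoc)
next
  fix v :: "'x \<Rightarrow> 'k" assume v: "v \<in> vspace B"
  show "lin_ext B \<phi> v \<in> vspace B" using v by (simp add: lin_ext_def vspace_def)
qed (simp add: lin_ext_def)

lemma lin_ext_kdelta:
  assumes "finite B" "x \<in> B"
  shows "lin_ext B \<phi> (kdelta x) y = (if y \<in> B then \<phi> x y else 0)"
proof -
  have "(\<Sum>z\<in>B. kdelta x z * \<phi> z y) = (\<Sum>z\<in>B. if z = x then \<phi> z y else 0)"
    by (rule sum.cong) (simp_all add: kdelta_def)
  then show ?thesis using assms by (simp add: lin_ext_apply vspace_closed)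
qed

lemma endo_alg_kdelta_eqI:
  fixes f g :: "('x \<Rightarrow> 'k::field) \<Rightarrow> 'x \<Rightarrow> 'k"
  assumes "finite B" "f \<in> carrier (endo_alg B)" "g \<in> carrier (endo_alg B)"
    and "\<And>x y. x \<in> B \<Longrightarrow> f (kdelta x) y = g (kdelta x) y"
  shows "f = g"
proof (rule endo_alg_ext[OF assms(2,3)], rule ext)
  fix v :: "'x \<Rightarrow> 'k" and y assume v: "v \<in> vspace B"
  show "f v y = g v y"
    unfolding endo_alg_matrix[OF assms(1,2) v] endo_alg_matrix[OF assms(1,3) v]
    by (rule sum.cong) (simp_all add: assms(4))
qed

lemma endo_alg_null:
  assumes "f \<in> carrier (endo_alg B)"
  shows "f (\<lambda>_. 0) = (\<lambda>_. 0)"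
  using endo_algD(4)[OF assms vspace_closed(3), of 0] by simp

lemma tbasis_Cons: "x # w \<in> tbasis d N (Suc m) \<longleftrightarrow> x \<in> vbasis d N \<and> w \<in> tbasis d N m"
  by (auto simp: tbasis_def)

lemma tbasis_Suc: "tbasis d N (Suc m) = (\<lambda>(x, w). x # w) ` (vbasis d N \<times> tbasis d N m)"
proof -
  have "w \<in> (\<lambda>(x, w). x # w) ` (vbasis d N \<times> tbasis d N m)" if "w \<in> tbasis d N (Suc m)" for w
    using that by (cases w) (auto simp: tbasis_def)
  then show ?thesis by (auto simp: tbasis_Cons)
qed

lemma finite_vbasis [simp]: "finite (vbasis d N)"
  by (simp add: vbasis_def)

lemma finite_tbasis [simp]: "finite (tbasis d N m)"
  by (induction m) (auto simp: tbasis_Suc, simp add: tbasis_def)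

lemma sum_tbasis_Suc: "(\<Sum>w\<in>tbasis d N (Suc m). F w) = (\<Sum>x\<in>vbasis d N. \<Sum>w\<in>tbasis d N m. F (x # w))"
proof -
  have "inj_on (\<lambda>(x, w). x # w) (vbasis d N \<times> tbasis d N m)" by (auto simp: inj_on_def)
  from sum.reindex[OF this, of F] show ?thesis
    by (simp add: tbasis_Suc sum.cartesian_product case_prod_beta o_def)
qed

lemma tbasis_Suc_cases:
  assumes "w \<in> tbasis d N (Suc m)"
  obtains x u where "w = x # u" "x \<in> vbasis d N" "u \<in> tbasis d N m"
  using assms by (auto simp: tbasis_Suc)

lemma op_tensor_carrier: "op_tensor d N m f g \<in> carrier (endo_alg (tbasis d N (Suc m)))"
  unfolding op_tensor_def using lin_ext_carrier by simp

lemma op_tensor_kdelta: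
  assumes "x \<in> vbasis d N" "w \<in> tbasis d N m" "x' \<in> vbasis d N" "w' \<in> tbasis d N m"
  shows "op_tensor d N m f g (kdelta (x # w)) (x' # w') = f (kdelta x) x' * g (kdelta w) w'"
  unfolding op_tensor_def using assms by (simp add: lin_ext_kdelta tbasis_Cons)

lemma op_tensor_matrix:
  assumes "v \<in> vspace (tbasis d N (Suc m))" "x \<in> vbasis d N" "w \<in> tbasis d N m"
  shows "op_tensor d N m f g v (x # w) =
    (\<Sum>x'\<in>vbasis d N. \<Sum>w'\<in>tbasis d N m. v (x' # w') * (f (kdelta x') x * g (kdelta w') w))"
  unfolding op_tensor_def using assms by (simp add: lin_ext_apply tbasis_Cons sum_tbasis_Suc)

lemma op_tensor_mult:
  assumes "f \<in> carrier (endo_alg (vbasis d N))" "f' \<in> carrier (endo_alg (vbasis d N))"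
    and "g \<in> carrier (endo_alg (tbasis d N m))" "g' \<in> carrier (endo_alg (tbasis d N m))"
  shows "op_tensor d N m (f \<otimes>\<^bsub>endo_alg (vbasis d N)\<^esub> f') (g \<otimes>\<^bsub>endo_alg (tbasis d N m)\<^esub> g') =
    op_tensor d N m f g \<otimes>\<^bsub>endo_alg (tbasis d N (Suc m))\<^esub> op_tensor d N m f' g'" (is "?l = ?r")
proof (rule endo_alg_kdelta_eqI[OF finite_tbasis])
  let ?T = "tbasis d N (Suc m)"
  show l: "?l \<in> carrier (endo_alg ?T)" and r: "?r \<in> carrier (endo_alg ?T)"
    by (intro endo_alg_closed op_tensor_carrier)+
  fix z y assume z: "z \<in> ?T"
  then obtain x w where zz: "z = x # w" and x: "x \<in> vbasis d N" and w: "w \<in> tbasis d N m"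
    by (rule tbasis_Suc_cases)
  have kz: "(kdelta z :: tvec) \<in> vspace ?T" using z by (rule vspace_closed)
  have u: "op_tensor d N m f' g' (kdelta z) \<in> vspace ?T" by (rule endo_algD(1)[OF op_tensor_carrier kz])
  have kx: "(kdelta x :: _ \<Rightarrow> Cq) \<in> vspace (vbasis d N)" and kw: "(kdelta w :: tvec) \<in> vspace (tbasis d N m)"
    using x w by (simp_all add: vspace_closed)
  show "?l (kdelta z) y = ?r (kdelta z) y"
  proof (cases "y \<in> ?T")
    case True
    then obtain x' w' where y: "y = x' # w'" and x': "x' \<in> vbasis d N" and w': "w' \<in> tbasis d N m"
      by (rule tbasis_Suc_cases)
    have "?r (kdelta z) y = op_tensor d N m f g (op_tensor d N m f' g' (kdelta z)) (x' # w')"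
      using kz by (simp add: endo_alg_simps y)
    also have "\<dots> = (\<Sum>a\<in>vbasis d N. \<Sum>b\<in>tbasis d N m.
        f' (kdelta x) a * g' (kdelta w) b * (f (kdelta a) x' * g (kdelta b) w'))"
      unfolding op_tensor_matrix[OF u x' w']
      by (intro sum.cong HOL.refl) (simp add: zz op_tensor_kdelta x w)
    also have "\<dots> = (\<Sum>a\<in>vbasis d N. f' (kdelta x) a * f (kdelta a) x') * (\<Sum>b\<in>tbasis d N m. g' (kdelta w) b * g (kdelta b) w')"
      unfolding sum_product by (intro sum.cong HOL.refl) (simp add: mult.assoc mult.left_commute)
    also have "\<dots> = f (f' (kdelta x)) x' * g (g' (kdelta w)) w'"
      using endo_alg_matrix[OF finite_vbasis assms(1) endo_algD(1)[OF assms(2) kx]]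
        endo_alg_matrix[OF finite_tbasis assms(3) endo_algD(1)[OF assms(4) kw]] by simp
    also have "\<dots> = ?l (kdelta z) y"
      unfolding zz y op_tensor_kdelta[OF x w x' w'] using kx kw by (simp add: endo_alg_simps)
    finally show ?thesis by simp
  next
    case False
    then show ?thesis
      using endo_algD(1)[OF l kz] endo_algD(1)[OF r kz] unfolding vspace_def by simp
  qed
qed

lemma op_tensor_one:
  "op_tensor d N m \<one>\<^bsub>endo_alg (vbasis d N)\<^esub> \<one>\<^bsub>endo_alg (tbasis d N m)\<^esub> = \<one>\<^bsub>endo_alg (tbasis d N (Suc m))\<^esub>"
proof (rule endo_alg_kdelta_eqI[OF finite_tbasis op_tensor_carrier endo_alg_one_zero(1)])
  let ?T = "tbasis d N (Suc m)"
  fix z y assume z: "z \<in> ?T"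
  then obtain x w where zz: "z = x # w" and x: "x \<in> vbasis d N" and w: "w \<in> tbasis d N m"
    by (rule tbasis_Suc_cases)
  show "op_tensor d N m \<one>\<^bsub>endo_alg (vbasis d N)\<^esub> \<one>\<^bsub>endo_alg (tbasis d N m)\<^esub> (kdelta z) y = \<one>\<^bsub>endo_alg ?T\<^esub> (kdelta z) y"
  proof (cases "y \<in> ?T")
    case True
    then obtain x' w' where y: "y = x' # w'" and x': "x' \<in> vbasis d N" and w': "w' \<in> tbasis d N m"
      by (rule tbasis_Suc_cases)
    show ?thesis
      unfolding zz y op_tensor_kdelta[OF x w x' w']
      using x w z unfolding zz by (simp add: endo_alg_simps vspace_closed) (simp add: kdelta_def)
  next
    case False
    then have "op_tensor d N m \<one>\<^bsub>endo_alg (vbasis d N)\<^esub> \<one>\<^bsub>endo_alg (tbasis d N m)\<^esub> (kdelta z) y = 0"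
      using endo_algD(1)[OF op_tensor_carrier vspace_closed(4)[OF z]] unfolding vspace_def by blast
    moreover have "y \<noteq> z" using False z by auto
    ultimately show ?thesis using z by (simp add: endo_alg_simps vspace_closed) (simp add: kdelta_def)
  qed
qed

text \<open>Evaluation by slices: \<open>g\<close> acts on the tail for each fixed first letter,
  then \<open>f\<close> acts in the first letter. This is the shape of the recursions defining
  \<open>Eop\<close> and \<open>Fop\<close>.\<close>

lemma op_tensor_apply:
  assumes f: "f \<in> carrier (endo_alg (vbasis d N))" and g: "g \<in> carrier (endo_alg (tbasis d N m))"
    and v: "v \<in> vspace (tbasis d N (Suc m))" and x: "x \<in> vbasis d N" and w: "w \<in> tbasis d N m"
  shows "op_tensor d N m f g v (x # w) = f (\<lambda>x'. g (\<lambda>u. v (x' # u)) w) x"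
    and "(\<lambda>u. v (y # u)) \<in> vspace (tbasis d N m)"
    and "(\<lambda>x'. g (\<lambda>u. v (x' # u)) w) \<in> vspace (vbasis d N)"
proof -
  show vs: "(\<lambda>u. v (y # u)) \<in> vspace (tbasis d N m)" for y
    using v by (auto simp: vspace_def tbasis_Cons)
  have "g (\<lambda>u. v (y # u)) w = 0" if "y \<notin> vbasis d N" for y
  proof -
    have "(\<lambda>u. v (y # u)) = (\<lambda>_. 0)" using v that by (auto simp: vspace_def tbasis_Cons)
    then show ?thesis using endo_alg_null[OF g] by simp
  qed
  then show vl: "(\<lambda>x'. g (\<lambda>u. v (x' # u)) w) \<in> vspace (vbasis d N)"
    by (simp add: vspace_def)
  have "f (\<lambda>x'. g (\<lambda>u. v (x' # u)) w) x = (\<Sum>x'\<in>vbasis d N. g (\<lambda>u. v (x' # u)) w * f (kdelta x') x)"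
    by (rule endo_alg_matrix[OF finite_vbasis f vl])
  also have "\<dots> = (\<Sum>x'\<in>vbasis d N. (\<Sum>w'\<in>tbasis d N m. v (x' # w') * g (kdelta w') w) * f (kdelta x') x)"
    by (rule sum.cong[OF HOL.refl]) (subst endo_alg_matrix[OF finite_tbasis g vs], rule HOL.refl)
  also have "\<dots> = op_tensor d N m f g v (x # w)"
    unfolding op_tensor_matrix[OF v x w] sum_distrib_right
    by (intro sum.cong HOL.refl) (simp add: mult.assoc mult.commute)
  finally show "op_tensor d N m f g v (x # w) = f (\<lambda>x'. g (\<lambda>u. v (x' # u)) w) x" by simp
qed

section \<open>Generators of the quantum group on tensor powers\<close>

definition kmu :: "'k::field \<Rightarrow> letter \<Rightarrow> letter \<Rightarrow> 'k" where
  "kmu q p x = (if x = p then q else 1)"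

text \<open>Explicit formulas for the generators on every tensor power at once, to be identified
  with the action obtained from the comultiplication. The free parameter \<open>q\<close> allows the
  same formulas to be read at q = 1.\<close>

fun Gop :: "'k::field \<Rightarrow> agen \<Rightarrow> (letter list \<Rightarrow> 'k) \<Rightarrow> letter list \<Rightarrow> 'k" where
  "Gop q (b, UE i) f = Eop q (b, i) (b, Suc i) f"
| "Gop q (b, UF i) f = Fop q (b, i) (b, Suc i) f"
| "Gop q (b, UK j) f = (\<lambda>w. wprod (kmu q (b, j)) w * f w)"
| "Gop q (b, UKinv j) f = (\<lambda>w. wprod (kmu (inverse q) (b, j)) w * f w)"

lemma a_gens_simps [simp]:
  "(b, UE i) \<in> a_gens d N \<longleftrightarrow> b \<in> {1..d} \<and> i \<in> {1..<N b}"
  "(b, UF i) \<in> a_gens d N \<longleftrightarrow> b \<in> {1..d} \<and> i \<in> {1..<N b}"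
  "(b, UK j) \<in> a_gens d N \<longleftrightarrow> b \<in> {1..d} \<and> j \<in> {1..N b}"
  "(b, UKinv j) \<in> a_gens d N \<longleftrightarrow> b \<in> {1..d} \<and> j \<in> {1..N b}"
  by (auto simp: a_gens_def uq_gens_def)

lemma Eop_vspace:
  assumes "f \<in> vspace (tbasis d N n)" "p \<in> vbasis d N" "p' \<in> vbasis d N"
  shows "Eop q p p' f \<in> vspace (tbasis d N n)"
proof -
  have "w \<notin> tbasis d N n \<Longrightarrow> Eop q p p' f w = 0" for w
    using assms(1)
  proof (induction w arbitrary: f n)
    case (Cons x w)
    show ?case
    proof (cases n)
      case 0
      \<comment> \<open>For tensor degree 0 only the empty word carries a value, so every slice by a
        first letter vanishes.\<close>
      have "f = (\<lambda>w. if w = [] then f [] else 0)"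
        using Cons.prems(2) 0 by (auto simp: vspace_def tbasis_def)
      then have "f (y # u) = 0" for y u by (metis list.distinct(1))
      then show ?thesis by simp
    next
      case (Suc m)
      have sl: "(\<lambda>u. f (y # u)) \<in> vspace (tbasis d N m)" for y
        using Cons.prems(2) by (auto simp: Suc vspace_def tbasis_Cons)
      have f0: "f u = 0" if "u \<notin> tbasis d N (Suc m)" for u
        using Cons.prems(2) that by (simp add: Suc vspace_def)
      show ?thesis
      proof (cases "x \<in> vbasis d N")
        case True
        then have "w \<notin> tbasis d N m" using Cons.prems(1) by (simp add: Suc tbasis_Cons)
        from Cons.IH[OF this sl] this show ?thesis by (simp add: f0 tbasis_Cons)
      next
        case False
        then have "(\<lambda>u. f (x # u)) = (\<lambda>u. 0)" by (auto simp: f0 tbasis_Cons)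
        then show ?thesis using False assms(2) by auto
      qed
    qed
  qed simp
  then show ?thesis by (simp add: vspace_def)
qed

lemma Fop_vspace:
  assumes "f \<in> vspace (tbasis d N n)" "p \<in> vbasis d N" "p' \<in> vbasis d N"
  shows "Fop q p p' f \<in> vspace (tbasis d N n)"
proof -
  have "w \<notin> tbasis d N n \<Longrightarrow> Fop q p p' f w = 0" for w
    using assms(1)
  proof (induction w arbitrary: f n)
    case (Cons x w)
    show ?case
    proof (cases n)
      case 0
      have "f = (\<lambda>w. if w = [] then f [] else 0)"
        using Cons.prems(2) 0 by (auto simp: vspace_def tbasis_def)
      then have "f (y # u) = 0" for y u by (metis list.distinct(1))
      then show ?thesis by simp
    next
      case (Suc m)
      have sl: "(\<lambda>u. f (y # u)) \<in> vspace (tbasis d N m)" for y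
        using Cons.prems(2) by (auto simp: Suc vspace_def tbasis_Cons)
      have f0: "f u = 0" if "u \<notin> tbasis d N (Suc m)" for u
        using Cons.prems(2) that by (simp add: Suc vspace_def)
      show ?thesis
      proof (cases "x \<in> vbasis d N")
        case True
        then have "w \<notin> tbasis d N m" using Cons.prems(1) by (simp add: Suc tbasis_Cons)
        from Cons.IH[OF this sl] this show ?thesis by (simp add: f0 tbasis_Cons)
      next
        case False
        then have "(\<lambda>u. f (x # u)) = (\<lambda>u. 0)" by (auto simp: f0 tbasis_Cons)
        then show ?thesis using False assms(3) by auto
      qed
    qed
  qed simp
  then show ?thesis by (simp add: vspace_def)
qed

lemma Gop_vspace:
  assumes "f \<in> vspace (tbasis d N n)" "a \<in> a_gens d N"
  shows "Gop q a f \<in> vspace (tbasis d N n)"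
proof -
  obtain b g where a: "a = (b, g)" by (cases a)
  show ?thesis
  proof (cases g)
    case (UE i)
    then show ?thesis using assms by (auto simp: a vbasis_def intro!: Eop_vspace)
  next
    case (UF i)
    then show ?thesis using assms by (auto simp: a vbasis_def intro!: Fop_vspace)
  qed (use assms in \<open>simp_all add: a vspace_def\<close>)
qed

lemma v_gen_apply:
  assumes "v \<in> vspace (vbasis d N)"
  shows "v_gen d N (b, UE i) v x = (if x = (b, i) then v (b, Suc i) else 0)"
    "v_gen d N (b, UF i) v x = (if x = (b, Suc i) then v (b, i) else 0)"
    "v_gen d N (b, UK j) v x = kmu qq (b, j) x * v x"
    "v_gen d N (b, UKinv j) v x = kmu (inverse qq) (b, j) x * v x"
  using assms by (auto simp: v_gen_def kmu_def split: prod.split)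

lemma v_gen_carrier:
  assumes "a \<in> a_gens d N"
  shows "v_gen d N a \<in> carrier (endo_alg (vbasis d N))"
proof -
  obtain b g where a: "a = (b, g)" by (cases a)
  note ap = v_gen_apply[where d = d and N = N and b = b]
  show ?thesis
  proof (rule endo_algI)
    fix v :: "nat \<times> nat \<Rightarrow> Cq" assume v: "v \<in> vspace (vbasis d N)"
    then show "v_gen d N a v \<in> vspace (vbasis d N)"
      using assms unfolding a vspace_def[of "vbasis d N"] mem_Collect_eq
      by (cases g) (auto simp: v_gen_apply vspace_def vbasis_def)
    fix c
    show "v_gen d N a (\<lambda>x. c * v x) = (\<lambda>x. c * v_gen d N a v x)"
      unfolding a by (rule ext, cases g) (simp_all add: ap v vspace_closed)
  next
    fix v w :: "nat \<times> nat \<Rightarrow> Cq" assume v: "v \<in> vspace (vbasis d N)" "w \<in> vspace (vbasis d N)"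
    show "v_gen d N a (\<lambda>x. v x + w x) = (\<lambda>x. v_gen d N a v x + v_gen d N a w x)"
      unfolding a by (rule ext, cases g) (simp_all add: ap v vspace_closed distrib_left)
  qed (simp add: v_gen_def a)
qed

lemma a_free_kalgebra: "kalgebra (a_free d N)"
  unfolding a_free_def free_algebra_def by (rule monoid_algebra_kalgebra[OF free_monoid_monoid])

lemma a_free_kdelta: "u \<in> lists (a_gens d N) \<Longrightarrow> kdelta u \<in> carrier (a_free d N)"
  unfolding a_free_def free_algebra_def by (rule kdelta_carrier) simp

lemma a_free_kdelta_mult: "kdelta u \<otimes>\<^bsub>a_free d N\<^esub> kdelta v = kdelta (u @ v)"
  unfolding a_free_def free_algebra_def by (simp add: kdelta_mult)

lemma a_free_one: "\<one>\<^bsub>a_free d N\<^esub> = kdelta []"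
  unfolding a_free_def free_algebra_def by (simp add: monoid_algebra_simps)

lemma a_free2_monoid: "Group.monoid (free_monoid (a_gens d N) \<times>\<times> free_monoid (a_gens d N))"
  by (intro DirProd_monoid free_monoid_monoid)

lemma a_free2_kalgebra: "kalgebra (a_free2 d N)"
  unfolding a_free2_def by (rule monoid_algebra_kalgebra[OF a_free2_monoid])

lemma a_free2_kdelta:
  "u \<in> lists (a_gens d N) \<Longrightarrow> v \<in> lists (a_gens d N) \<Longrightarrow> kdelta (u, v) \<in> carrier (a_free2 d N)"
  unfolding a_free2_def by (rule kdelta_carrier) simp

lemma comult_gen_carrier:
  assumes "a \<in> a_gens d N"
  shows "comult_gen d N a \<in> carrier (a_free2 d N)"
proof -
  interpret A2: kalgebra "a_free2 d N" by (rule a_free2_kalgebra)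
  obtain b g where a: "a = (b, g)" by (cases a)
  show ?thesis
    using assms unfolding a by (cases g) (auto intro!: A2.a_closed a_free2_kdelta)
qed

lemma comult_alg_hom: "comult d N \<in> alg_hom (a_free d N) (a_free2 d N)"
  and comult_kdelta: "a \<in> a_gens d N \<Longrightarrow> comult d N (kdelta [a]) = comult_gen d N a"
  unfolding comult_def a_free_def
  using free_lift_alg_hom[OF a_free2_kalgebra, of "a_gens d N" "comult_gen d N" d N] comult_gen_carrier by blast+

lemma v_act_alg_hom: "v_act d N \<in> alg_hom (a_free d N) (endo_alg (vbasis d N))"
  and v_act_kdelta: "a \<in> a_gens d N \<Longrightarrow> v_act d N (kdelta [a]) = v_gen d N a"
  unfolding v_act_def a_free_def
  using free_lift_alg_hom[OF endo_alg_kalgebra, of "a_gens d N" "v_gen d N" "vbasis d N"] v_gen_carrier by blast+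

lemma wprod_mult: "wprod \<mu> w * (wprod \<nu> w * e) = wprod (\<lambda>x. \<mu> x * \<nu> x) w * e"
  by (induction w arbitrary: e) (simp_all add: mult_ac)

text \<open>In degree m + 1 the action is \<open>comult\<close> followed by the linear extension of
  an operator-valued map on pairs of words. That map is multiplicative because tensor products of
  operators multiply factorwise, so the homomorphism property follows from
  \<open>mlift_alg_hom\<close>. On generators the comultiplication is expanded and compared with the
  first-letter recursion of \<open>Gop\<close>.\<close>

lemma t_act_step:
  assumes hom: "t_act d N m \<in> alg_hom (a_free d N) (endo_alg (tbasis d N m))"
    and gen: "\<And>a v. a \<in> a_gens d N \<Longrightarrow> v \<in> vspace (tbasis d N m) \<Longrightarrow> t_act d N m (kdelta [a]) v = Gop qq a v"
  shows "t_act d N (Suc m) \<in> alg_hom (a_free d N) (endo_alg (tbasis d N (Suc m)))"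
    and "a \<in> a_gens d N \<Longrightarrow> v \<in> vspace (tbasis d N (Suc m)) \<Longrightarrow> t_act d N (Suc m) (kdelta [a]) v = Gop qq a v"
proof -
  let ?M = "free_monoid (a_gens d N) \<times>\<times> free_monoid (a_gens d N)"
  let ?L = "endo_alg (vbasis d N) :: (Cq, _) module" and ?T = "endo_alg (tbasis d N m) :: (Cq, _) module"
    and ?E = "endo_alg (tbasis d N (Suc m)) :: (Cq, _) module"
  define \<phi> where "\<phi> = (\<lambda>p. op_tensor d N m (v_act d N (kdelta (fst p))) (t_act d N m (kdelta (snd p))))"
  interpret E: kalgebra ?E by (rule endo_alg_kalgebra)
  have eq: "t_act d N (Suc m) = (\<lambda>a. mlift ?E \<phi> (comult d N a))"
    by (simp add: mlift_def \<phi>_def)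
  have \<phi>: "\<phi> \<in> carrier ?M \<rightarrow> carrier ?E"
    by (simp add: \<phi>_def op_tensor_carrier)
  have vc: "v_act d N (kdelta u) \<in> carrier ?L" and tc: "t_act d N m (kdelta u) \<in> carrier ?T"
    if "u \<in> lists (a_gens d N)" for u
    using that alg_homD(1)[OF v_act_alg_hom] alg_homD(1)[OF hom] a_free_kdelta by blast+
  have vm: "v_act d N (kdelta (u @ u')) = v_act d N (kdelta u) \<otimes>\<^bsub>?L\<^esub> v_act d N (kdelta u')"
    and tm: "t_act d N m (kdelta (u @ u')) = t_act d N m (kdelta u) \<otimes>\<^bsub>?T\<^esub> t_act d N m (kdelta u')"
    if "u \<in> lists (a_gens d N)" "u' \<in> lists (a_gens d N)" for u u'
    using alg_homD(2)[OF v_act_alg_hom a_free_kdelta[OF that(1)] a_free_kdelta[OF that(2)]]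
      alg_homD(2)[OF hom a_free_kdelta[OF that(1)] a_free_kdelta[OF that(2)]]
    by (simp_all add: a_free_kdelta_mult)
  have v1: "v_act d N (kdelta []) = \<one>\<^bsub>?L\<^esub>" and t1: "t_act d N m (kdelta []) = \<one>\<^bsub>?T\<^esub>"
    using alg_homD(4)[OF v_act_alg_hom] alg_homD(4)[OF hom] by (simp_all add: a_free_one)
  have "mlift ?E \<phi> \<in> alg_hom (a_free2 d N) ?E"
    unfolding a_free2_def
  proof (rule mlift_alg_hom[OF a_free2_monoid E.kalgebra_axioms \<phi>])
    fix p p' assume "p \<in> carrier ?M" "p' \<in> carrier ?M"
    then have u: "fst p \<in> lists (a_gens d N)" "snd p \<in> lists (a_gens d N)"
      "fst p' \<in> lists (a_gens d N)" "snd p' \<in> lists (a_gens d N)" by (auto simp: DirProd_def)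
    have "p \<otimes>\<^bsub>?M\<^esub> p' = (fst p @ fst p', snd p @ snd p')" by (simp add: DirProd_def split: prod.split)
    then show "\<phi> (p \<otimes>\<^bsub>?M\<^esub> p') = \<phi> p \<otimes>\<^bsub>?E\<^esub> \<phi> p'"
      unfolding \<phi>_def by (simp only: fst_conv snd_conv vm[OF u(1,3)] tm[OF u(2,4)])
        (rule op_tensor_mult[OF vc[OF u(1)] vc[OF u(3)] tc[OF u(2)] tc[OF u(4)]])
  next
    show "\<phi> \<one>\<^bsub>?M\<^esub> = \<one>\<^bsub>?E\<^esub>"
      by (simp add: \<phi>_def DirProd_def v1 t1 op_tensor_one)
  qed
  note mh = this
  show "t_act d N (Suc m) \<in> alg_hom (a_free d N) ?E"
    unfolding eq by (rule alg_hom_comp[OF comult_alg_hom mh])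
  assume a: "a \<in> a_gens d N" and v: "v \<in> vspace (tbasis d N (Suc m))"
  have md: "mlift ?E \<phi> (kdelta (u, u')) = \<phi> (u, u')" if "u \<in> lists (a_gens d N)" "u' \<in> lists (a_gens d N)" for u u'
    using that by (intro mlift_kdelta[OF E.kalgebra_axioms \<phi>]) (simp add: DirProd_def)
  have ap: "\<phi> (u, u') v (x # w) = v_act d N (kdelta u) (\<lambda>x'. t_act d N m (kdelta u') (\<lambda>s. v (x' # s)) w) x"
    and vs: "(\<lambda>s. v (y # s)) \<in> vspace (tbasis d N m)"
    and vl: "(\<lambda>x'. t_act d N m (kdelta u') (\<lambda>s. v (x' # s)) w) \<in> vspace (vbasis d N)"
    if "u \<in> lists (a_gens d N)" "u' \<in> lists (a_gens d N)" "x \<in> vbasis d N" "w \<in> tbasis d N m" for u u' x w y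
    unfolding \<phi>_def fst_conv snd_conv
    by (rule op_tensor_apply[OF vc[OF that(1)] tc[OF that(2)] v that(3,4)])+
  have slice: "(\<lambda>s. v (y # s)) \<in> vspace (tbasis d N m)" for y
    using v by (auto simp: vspace_def tbasis_Cons)
  have two: "t_act d N m (kdelta [a, a']) u = Gop qq a (Gop qq a' u)"
    if "a \<in> a_gens d N" "a' \<in> a_gens d N" "u \<in> vspace (tbasis d N m)" for a a' u
    using tm[of "[a]" "[a']"] that by (simp add: endo_alg_simps gen Gop_vspace)
  have vtwo: "v_act d N (kdelta [a, a']) u = v_gen d N a (v_gen d N a' u)"
    if "a \<in> a_gens d N" "a' \<in> a_gens d N" "u \<in> vspace (vbasis d N)" for a a' u
    using vm[of "[a]" "[a']"] that by (simp add: endo_alg_simps v_act_kdelta)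
  obtain b g where ab: "a = (b, g)" by (cases a)
  have base: "t_act d N (Suc m) (kdelta [a]) = mlift ?E \<phi> (comult_gen d N a)"
    unfolding eq comult_kdelta[OF a] ..
  have "t_act d N (Suc m) (kdelta [a]) v z = Gop qq a v z" for z
  proof (cases "z \<in> tbasis d N (Suc m)")
    case False
    have "t_act d N (Suc m) (kdelta [a]) \<in> carrier ?E"
      unfolding eq using a by (intro alg_homD(1)[OF alg_hom_comp[OF comult_alg_hom mh]] a_free_kdelta) simp
    from endo_algD(1)[OF this v] Gop_vspace[OF v a, of qq] False show ?thesis
      unfolding vspace_def by simp
  next
    case True
    then obtain x w where z: "z = x # w" and x: "x \<in> vbasis d N" and w: "w \<in> tbasis d N m"
      by (rule tbasis_Suc_cases)
    show ?thesis
    proof (cases g)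
      case (UE i)
      then have i: "(b, UE i) \<in> a_gens d N" "(b, UK i) \<in> a_gens d N" "(b, UKinv (Suc i)) \<in> a_gens d N"
        using a by (auto simp: ab)
      have k: "wprod (\<lambda>x. kmu qq (b, i) x * kmu (inverse qq) (b, Suc i) x) w = wprod (kap qq (b, i) (b, Suc i)) w"
        by (rule arg_cong[where f = "\<lambda>\<mu>. wprod \<mu> w"]) (auto simp: kmu_def kap_def)
      have "t_act d N (Suc m) (kdelta [a]) v z =
          \<phi> ([(b, UE i)], [(b, UK i), (b, UKinv (Suc i))]) v z + \<phi> ([], [(b, UE i)]) v z"
        unfolding base unfolding ab UE comult_gen.simps
        using i v by (subst alg_homD(3)[OF mh]) (simp_all add: a_free2_kdelta md endo_alg_simps)
      also have "\<dots> = Gop qq a v z"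
        unfolding z using i x w vl[of "[]" "[(b, UK i), (b, UKinv (Suc i))]" x w] vl[of "[]" "[(b, UE i)]" x w]
        by (simp add: ap v1 v_act_kdelta v_gen_apply two gen slice endo_alg_simps wprod_mult k ab UE)
      finally show ?thesis .
    next
      case (UF i)
      then have i: "(b, UF i) \<in> a_gens d N" "(b, UKinv i) \<in> a_gens d N" "(b, UK (Suc i)) \<in> a_gens d N"
        using a by (auto simp: ab)
      have k: "kmu (inverse qq) (b, i) x * (kmu qq (b, Suc i) x * e) = inverse (kap qq (b, i) (b, Suc i) x) * e" for e
        by (auto simp: kmu_def kap_def)
      have k2: "(\<lambda>x. kmu qq (b, Suc i) x * F x) \<in> vspace (vbasis d N)" if "F \<in> vspace (vbasis d N)" for F
        using that by (simp add: vspace_def)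
      have vg: "v_gen d N (b, UK (Suc i)) F = (\<lambda>x. kmu qq (b, Suc i) x * F x)" if "F \<in> vspace (vbasis d N)" for F
        using that by (simp add: fun_eq_iff v_gen_apply)
      have "t_act d N (Suc m) (kdelta [a]) v z =
          \<phi> ([(b, UF i)], []) v z + \<phi> ([(b, UKinv i), (b, UK (Suc i))], [(b, UF i)]) v z"
        unfolding base unfolding ab UF comult_gen.simps
        using i v by (subst alg_homD(3)[OF mh]) (simp_all add: a_free2_kdelta md endo_alg_simps)
      also have "\<dots> = Gop qq a v z"
        unfolding z using i x w vl[of "[]" "[]" x w] vl[of "[]" "[(b, UF i)]" x w]
        by (simp add: ap t1 v_act_kdelta vtwo vg k2 k v_gen_apply gen slice endo_alg_simps ab UF)
      finally show ?thesis .
    next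
      case (UK j)
      then have i: "(b, UK j) \<in> a_gens d N" using a by (auto simp: ab)
      have "t_act d N (Suc m) (kdelta [a]) v z = \<phi> ([(b, UK j)], [(b, UK j)]) v z"
        unfolding base unfolding ab UK comult_gen.simps using i by (simp add: md)
      also have "\<dots> = Gop qq a v z"
        unfolding z using i x w vl[of "[]" "[(b, UK j)]" x w]
        by (simp add: ap v_act_kdelta v_gen_apply gen slice ab UK mult.assoc)
      finally show ?thesis .
    next
      case (UKinv j)
      then have i: "(b, UKinv j) \<in> a_gens d N" using a by (auto simp: ab)
      have "t_act d N (Suc m) (kdelta [a]) v z = \<phi> ([(b, UKinv j)], [(b, UKinv j)]) v z"
        unfolding base unfolding ab UKinv comult_gen.simps using i by (simp add: md)
      also have "\<dots> = Gop qq a v z"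
        unfolding z using i x w vl[of "[]" "[(b, UKinv j)]" x w]
        by (simp add: ap v_act_kdelta v_gen_apply gen slice ab UKinv mult.assoc)
      finally show ?thesis .
    qed
  qed
  then show "t_act d N (Suc m) (kdelta [a]) v = Gop qq a v" by (rule ext)
qed

lemma t_act_zero:
  shows "t_act d N 0 \<in> alg_hom (a_free d N) (endo_alg (tbasis d N 0))"
    and "a \<in> a_gens d N \<Longrightarrow> v \<in> vspace (tbasis d N 0) \<Longrightarrow> t_act d N 0 (kdelta [a]) v = Gop qq a v"
proof -
  let ?E = "endo_alg (tbasis d N 0) :: (Cq, _) module"
  let ?\<rho> = "\<lambda>(b :: nat, g). counit_gen g \<odot>\<^bsub>?E\<^esub> \<one>\<^bsub>?E\<^esub>"
  interpret E: kalgebra ?E by (rule endo_alg_kalgebra)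
  have \<rho>: "?\<rho> a \<in> carrier ?E" for a by (simp split: prod.split)
  note fl = free_lift_alg_hom[OF E.kalgebra_axioms, of "a_gens d N" ?\<rho>, OF \<rho>]
  show "t_act d N 0 \<in> alg_hom (a_free d N) ?E"
    using fl(1) by (simp add: a_free_def)
  assume a: "a \<in> a_gens d N" and v: "v \<in> vspace (tbasis d N 0)"
  obtain b g where ab: "a = (b, g)" by (cases a)
  have "t_act d N 0 (kdelta [a]) = ?\<rho> a"
    unfolding t_act.simps by (rule fl(2)[OF a])
  then have "t_act d N 0 (kdelta [a]) v = (\<lambda>w. counit_gen g * v w)"
    using v by (simp add: ab endo_alg_simps)
  also have "\<dots> = Gop qq a v"
  proof
    fix w
    show "counit_gen g * v w = Gop qq a v w"
    proof (cases "w = []")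
      case True
      then show ?thesis by (cases g) (simp_all add: ab)
    next
      case False
      then have "w \<notin> tbasis d N 0" by (simp add: tbasis_def)
      then show ?thesis using v Gop_vspace[OF v a, of qq] by (simp add: vspace_def)
    qed
  qed
  finally show "t_act d N 0 (kdelta [a]) v = Gop qq a v" .
qed

lemma t_act_alg_hom: "t_act d N m \<in> alg_hom (a_free d N) (endo_alg (tbasis d N m))"
  and t_act_gen: "a \<in> a_gens d N \<Longrightarrow> v \<in> vspace (tbasis d N m) \<Longrightarrow> t_act d N m (kdelta [a]) v = Gop qq a v"
proof -
  have "t_act d N m \<in> alg_hom (a_free d N) (endo_alg (tbasis d N m)) \<and>
    (\<forall>a\<in>a_gens d N. \<forall>v\<in>vspace (tbasis d N m). t_act d N m (kdelta [a]) v = Gop qq a v)"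
  proof (induction m)
    case 0
    then show ?case using t_act_zero by blast
  next
    case (Suc m)
    then show ?case using t_act_step[of d N m] by blast
  qed
  then show "t_act d N m \<in> alg_hom (a_free d N) (endo_alg (tbasis d N m))"
    and "a \<in> a_gens d N \<Longrightarrow> v \<in> vspace (tbasis d N m) \<Longrightarrow> t_act d N m (kdelta [a]) v = Gop qq a v"
    by blast+
qed

lemma qq_square: "qq * qq \<noteq> 1"
proof
  assume "qq * qq = 1"
  then have "Fract ([:0, 1:] * [:0, 1:]) 1 = Fract (1 :: complex poly) 1"
    by (simp add: qq_def One_fract_def)
  then have "[:0, 1:] * [:0, 1:] = (1 :: complex poly)"
    by (simp add: eq_fract)
  then show False by (simp add: one_pCons)
qed

lemma qq_minus_inverse: "qq - inverse qq \<noteq> 0"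
  using qq_square qq_nonzero by (simp add: field_simps)

lemma endo_alg_minus:
  assumes "f \<in> carrier (endo_alg B)" "g \<in> carrier (endo_alg B)" "v \<in> vspace B"
  shows "(f \<ominus>\<^bsub>endo_alg B\<^esub> g) v = (\<lambda>x. f v x - g v x)"
proof -
  interpret E: kalgebra "endo_alg B" by (rule endo_alg_kalgebra)
  show ?thesis
    using assms by (simp add: a_minus_def E.smult_minus_one[symmetric] endo_alg_simps)
qed

lemma wprod_nonzero: "(\<And>x. \<mu> x \<noteq> 0) \<Longrightarrow> wprod \<mu> w \<noteq> 0"
  by (induction w) simp_all

lemma wprod_kmu_inverse: "wprod (kmu (inverse q) p) w = inverse (wprod (kmu q p) w)"
proof -
  have "kmu (inverse q) p = (\<lambda>x. inverse (kmu q p x))" by (auto simp: kmu_def)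
  then show ?thesis by (simp add: wprod_inverse)
qed

lemma kmu_nonzero [simp]: "q \<noteq> 0 \<Longrightarrow> kmu q p x \<noteq> 0"
  by (simp add: kmu_def)

lemma wprod_kap:
  assumes "p \<noteq> p'" "q \<noteq> 0"
  shows "wprod (kmu q p) w * (inverse (wprod (kmu q p') w) * e) = wprod (kap q p p') w * e"
    and "inverse (wprod (kmu q p) w) * (wprod (kmu q p') w * e) = inverse (wprod (kap q p p') w) * e"
proof -
  have "wprod (kmu q p) w * (wprod (kmu (inverse q) p') w * 1) = wprod (kap q p p') w * 1"
    unfolding wprod_mult
    by (rule arg_cong[where f = "\<lambda>\<mu>. wprod \<mu> w * 1"]) (use assms in \<open>auto simp: kmu_def kap_def\<close>)
  then have eq: "wprod (kap q p p') w = wprod (kmu q p) w * inverse (wprod (kmu q p') w)"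
    by (simp add: wprod_kmu_inverse)
  show "wprod (kmu q p) w * (inverse (wprod (kmu q p') w) * e) = wprod (kap q p p') w * e"
    by (simp add: eq)
  show "inverse (wprod (kmu q p) w) * (wprod (kmu q p') w * e) = inverse (wprod (kap q p p') w) * e"
    by (simp add: eq)
qed

lemma Gop_commute:
  assumes "q \<noteq> 0" "b \<noteq> c"
  shows "Gop q (b, g) (Gop q (c, h) f) w = Gop q (c, h) (Gop q (b, g) f) w"
proof -
  have k: "kmu s (b, j) (c, i) = 1" "kmu s (c, j) (b, i) = 1" for s :: 'a and i j
    using assms(2) by (auto simp: kmu_def)
  note wp = Eop_wprod'[of "kmu _ _"] Fop_wprod'[of "kmu _ _"]
  show ?thesis
    using assms
    by (cases g; cases h)
      (simp_all add: wp k Eop_Fop_commute mult.left_commute, auto intro!: Eop_Eop_commute Fop_Fop_commute)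
qed

text \<open>Each defining relation becomes one of the identities for word operators. Membership in
  the free algebra is proved along the way, since it needs the same case distinction.\<close>

lemma a_rels_t_act:
  assumes "(x, y) \<in> a_rels d N"
  shows "x \<in> carrier (a_free d N) \<and> y \<in> carrier (a_free d N) \<and> t_act d N n x = t_act d N n y"
proof -
  let ?A = "a_free d N" and ?V = "vspace (tbasis d N n) :: tvec set" and ?h = "t_act d N n"
  let ?E = "endo_alg (tbasis d N n) :: (Cq, _) module"
  interpret A: kalgebra ?A by (rule a_free_kalgebra)
  note hom = alg_homD[OF t_act_alg_hom[of d N n]]
  note hm = alg_hom_more(2)[OF A.kalgebra_axioms endo_alg_kalgebra t_act_alg_hom[of d N n]]
  have kc: "a \<in> a_gens d N \<Longrightarrow> kdelta [a] \<in> carrier ?A" for a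
    by (rule a_free_kdelta) simp
  have ev: "?h (x \<otimes>\<^bsub>?A\<^esub> y) v = ?h x (?h y v)" "?h (x \<oplus>\<^bsub>?A\<^esub> y) v = (\<lambda>w. ?h x v w + ?h y v w)"
    "?h (x \<ominus>\<^bsub>?A\<^esub> y) v = (\<lambda>w. ?h x v w - ?h y v w)"
    if "x \<in> carrier ?A" "y \<in> carrier ?A" "v \<in> ?V" for x y v
    using that by (simp_all add: hom hm endo_alg_simps endo_alg_minus)
  have ev': "?h (c \<odot>\<^bsub>?A\<^esub> x) v = (\<lambda>w. c * ?h x v w)" if "x \<in> carrier ?A" "v \<in> ?V" for x v c
    using that by (simp add: hom endo_alg_simps)
  have ev'': "?h \<one>\<^bsub>?A\<^esub> v = v" if "v \<in> ?V" for v
    unfolding hom(4) by (rule endo_alg_simps(4)[OF that])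
  have eqI: "?h x = ?h y"
    if "x \<in> carrier ?A" "y \<in> carrier ?A" "\<And>v w. v \<in> ?V \<Longrightarrow> ?h x v w = ?h y v w" for x y
    by (rule endo_alg_ext[OF hom(1)[OF that(1)] hom(1)[OF that(2)]]) (rule ext, rule that(3))
  note simps = kc ev ev' ev'' t_act_gen Gop_vspace
  note qn = qq_nonzero
  show ?thesis
    using assms unfolding a_rels_def
  proof (elim UnE UN_E CollectE exE conjE)
    fix b assume b: "b \<in> {1..d}" and R: "(x, y) \<in> uq_rels ?A (\<lambda>g. kdelta [(b, g)]) (N b)"
    have g: "i \<in> {1..<N b} \<Longrightarrow> (b, UE i) \<in> a_gens d N" "i \<in> {1..<N b} \<Longrightarrow> (b, UF i) \<in> a_gens d N"
      "j \<in> {1..N b} \<Longrightarrow> (b, UK j) \<in> a_gens d N" "j \<in> {1..N b} \<Longrightarrow> (b, UKinv j) \<in> a_gens d N"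
      "i \<in> {1..<N b} \<Longrightarrow> (b, UK i) \<in> a_gens d N" "i \<in> {1..<N b} \<Longrightarrow> (b, UKinv i) \<in> a_gens d N"
      "i \<in> {1..<N b} \<Longrightarrow> (b, UK (Suc i)) \<in> a_gens d N" "i \<in> {1..<N b} \<Longrightarrow> (b, UKinv (Suc i)) \<in> a_gens d N" for i j
      using b by auto
    have nz: "wprod (kmu qq p) w \<noteq> 0" for p w
      by (rule wprod_nonzero) (simp add: qn)
    show ?thesis
      using R
    proof cases
      case (K_Kinv j)
      note g = g(3,4)[OF K_Kinv(3)]
      show ?thesis
        unfolding K_Kinv(1,2)
        by (intro conjI eqI; simp add: simps g del: a_gens_simps Gop.simps; simp add: wprod_kmu_inverse nz)
    next
      case (Kinv_K j)
      note g = g(3,4)[OF Kinv_K(3)]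
      show ?thesis
        unfolding Kinv_K(1,2)
        by (intro conjI eqI; simp add: simps g del: a_gens_simps Gop.simps; simp add: wprod_kmu_inverse nz)
    next
      case (K_K i j)
      note g = g(3)[OF K_K(3)] g(3)[OF K_K(4)]
      show ?thesis
        unfolding K_K(1,2)
        by (intro conjI eqI; simp add: simps g del: a_gens_simps Gop.simps; simp add: mult.left_commute)
    next
      case (K_E j i)
      note g = g(3,4)[OF K_E(3)] g(1)[OF K_E(4)]
      have "kmu (inverse qq) (b, j) (b, Suc i) * inverse (kmu (inverse qq) (b, j) (b, i)) = qq powi wt j i"
        by (auto simp: kmu_def wt_def qn power_int_minus)
      then have * : "wprod (kmu qq (b, j)) w * Eop qq (b, i) (b, Suc i) (\<lambda>u. wprod (kmu (inverse qq) (b, j)) u * v u) w =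
          qq powi wt j i * Eop qq (b, i) (b, Suc i) v w" for v w
        by (subst Eop_wprod') (simp_all add: qn nz wprod_kmu_inverse)
      show ?thesis
        unfolding K_E(1,2)
        by (intro conjI eqI; simp add: simps g del: a_gens_simps Gop.simps; simp add: *)
    next
      case (K_F j i)
      note g = g(3,4)[OF K_F(3)] g(2)[OF K_F(4)]
      have "kmu (inverse qq) (b, j) (b, i) * inverse (kmu (inverse qq) (b, j) (b, Suc i)) = qq powi (- wt j i)"
        by (auto simp: kmu_def wt_def qn power_int_minus)
      then have * : "wprod (kmu qq (b, j)) w * Fop qq (b, i) (b, Suc i) (\<lambda>u. wprod (kmu (inverse qq) (b, j)) u * v u) w =
          qq powi (- wt j i) * Fop qq (b, i) (b, Suc i) v w" for v w
        by (subst Fop_wprod') (simp_all add: qn nz wprod_kmu_inverse)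
      show ?thesis
        unfolding K_F(1,2)
        by (intro conjI eqI; simp add: simps g del: a_gens_simps Gop.simps; simp add: *)
    next
      case (E_F_same i)
      note g = g(1,2,5-8)[OF E_F_same(3)]
      have * : "Eop qq (b, i) (b, Suc i) (Fop qq (b, i) (b, Suc i) v) w - Fop qq (b, i) (b, Suc i) (Eop qq (b, i) (b, Suc i) v) w =
          1 / (qq - inverse qq) * (wprod (kap qq (b, i) (b, Suc i)) w * v w - inverse (wprod (kap qq (b, i) (b, Suc i)) w) * v w)"
          (is "?X = 1 / ?q * ?Y") for v w
      proof -
        have "?q * ?X = ?Y"
          unfolding left_diff_distrib[symmetric] by (rule Eop_Fop_same) (simp_all add: qn)
        then show ?thesis using qq_minus_inverse by (simp add: nonzero_eq_divide_eq mult.commute)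
      qed
      show ?thesis
        unfolding E_F_same(1,2)
        by (intro conjI eqI; simp add: simps g del: a_gens_simps Gop.simps; simp add: wprod_kmu_inverse wprod_kap qn *)
    next
      case (E_F_diff i j)
      note g = g(1)[OF E_F_diff(3)] g(2)[OF E_F_diff(4)]
      show ?thesis
        unfolding E_F_diff(1,2)
        by (intro conjI eqI; simp add: simps g del: a_gens_simps Gop.simps; use E_F_diff(5) in \<open>auto simp: qn intro!: Eop_Fop_commute\<close>)
    next
      case (E_far i j)
      note g = g(1)[OF E_far(3)] g(1)[OF E_far(4)]
      show ?thesis
        unfolding E_far(1,2)
        by (intro conjI eqI; simp add: simps g del: a_gens_simps Gop.simps; use E_far(5) in \<open>auto simp: qn intro!: Eop_Eop_commute\<close>)
    next
      case (F_far i j)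
      note g = g(2)[OF F_far(3)] g(2)[OF F_far(4)]
      show ?thesis
        unfolding F_far(1,2)
        by (intro conjI eqI; simp add: simps g del: a_gens_simps Gop.simps; use F_far(5) in \<open>auto simp: qn intro!: Fop_Fop_commute\<close>)
    next
      case (E_Serre i j)
      note g = g(1)[OF E_Serre(3)] g(1)[OF E_Serre(4)]
      \<comment> \<open>The word identity is directed along a chain \<open>p\<close>,
        \<open>p'\<close>, \<open>p''\<close>, so the neighbour above and the neighbour below use
        different halves of it.\<close>
      consider "j = Suc i" | "i = Suc j" using E_Serre(5) by linarith
      then have * : "Eop qq (b, i) (b, Suc i) (Eop qq (b, i) (b, Suc i) (Eop qq (b, j) (b, Suc j) v)) w +
          Eop qq (b, j) (b, Suc j) (Eop qq (b, i) (b, Suc i) (Eop qq (b, i) (b, Suc i) v)) w =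
          (qq + inverse qq) * Eop qq (b, i) (b, Suc i) (Eop qq (b, j) (b, Suc j) (Eop qq (b, i) (b, Suc i) v)) w" for v w
      proof cases
        case 1
        show ?thesis unfolding 1 by (rule Eop_Serre(1)) (simp_all add: qn)
      next
        case 2
        show ?thesis unfolding 2 by (rule Eop_Serre(2)) (simp_all add: qn)
      qed
      show ?thesis
        unfolding E_Serre(1,2)
        by (intro conjI eqI; simp add: simps g del: a_gens_simps Gop.simps; simp add: *)
    next
      case (F_Serre i j)
      note g = g(2)[OF F_Serre(3)] g(2)[OF F_Serre(4)]
      consider "j = Suc i" | "i = Suc j" using F_Serre(5) by linarith
      then have * : "Fop qq (b, i) (b, Suc i) (Fop qq (b, i) (b, Suc i) (Fop qq (b, j) (b, Suc j) v)) w +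
          Fop qq (b, j) (b, Suc j) (Fop qq (b, i) (b, Suc i) (Fop qq (b, i) (b, Suc i) v)) w =
          (qq + inverse qq) * Fop qq (b, i) (b, Suc i) (Fop qq (b, j) (b, Suc j) (Fop qq (b, i) (b, Suc i) v)) w" for v w
      proof cases
        case 1
        show ?thesis unfolding 1 by (rule Fop_Serre(1)) (simp_all add: qn)
      next
        case 2
        show ?thesis unfolding 2 by (rule Fop_Serre(2)) (simp_all add: qn)
      qed
      show ?thesis
        unfolding F_Serre(1,2)
        by (intro conjI eqI; simp add: simps g del: a_gens_simps Gop.simps; simp add: *)
    qed
  next
    fix b c g h
    assume *: "(x, y) = (kdelta [(b, g)] \<otimes>\<^bsub>?A\<^esub> kdelta [(c, h)], kdelta [(c, h)] \<otimes>\<^bsub>?A\<^esub> kdelta [(b, g)])"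
      "b \<noteq> c" "(b, g) \<in> a_gens d N" "(c, h) \<in> a_gens d N"
    then have xy: "x = kdelta [(b, g)] \<otimes>\<^bsub>?A\<^esub> kdelta [(c, h)]" "y = kdelta [(c, h)] \<otimes>\<^bsub>?A\<^esub> kdelta [(b, g)]"
      by simp_all
    show ?thesis
      unfolding xy
      by (intro conjI eqI; simp add: simps * del: a_gens_simps Gop.simps; rule Gop_commute[OF qn *(2)])
  qed
qed

lemma a_rels_carrier: "a_rels d N \<subseteq> carrier (a_free d N) \<times> carrier (a_free d N)"
proof (rule subrelI)
  fix x y assume "(x, y) \<in> a_rels d N"
  from a_rels_t_act[OF this, of 0] show "(x, y) \<in> carrier (a_free d N) \<times> carrier (a_free d N)" by simp
qed

lemma Uq_act_coset:
  assumes "a \<in> carrier (a_free d N)"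
  shows "Uq_act d N n (rel_ideal (a_free d N) (a_rels d N) +>\<^bsub>a_free d N\<^esub> a) = t_act d N n a"
proof -
  interpret A: kalgebra "a_free d N" by (rule a_free_kalgebra)
  have "\<forall>(x, y)\<in>a_rels d N. t_act d N n x = t_act d N n y"
    by clarify (rule a_rels_t_act[THEN conjunct2, THEN conjunct2])
  then show ?thesis
    unfolding Uq_act_def by (intro A.rel_coset_image[OF endo_alg_kalgebra t_act_alg_hom _ _ assms] a_rels_carrier)
qed

lemma Uq_carrier:
  "carrier (Uq d N) = (\<lambda>a. rel_ideal (a_free d N) (a_rels d N) +>\<^bsub>a_free d N\<^esub> a) ` carrier (a_free d N)"
proof -
  interpret A: kalgebra "a_free d N" by (rule a_free_kalgebra)
  note R = a_rels_carrier[of d N]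
  show ?thesis
    unfolding Uq_def alg_mod_rels_def by (rule A.quot_alg_proj(2)[OF A.rel_ideal_ideal[OF R]])
qed

text \<open>Cosets are replaced by free representatives, these by words, and words by generators,
  using that the action is a homomorphism. From here on the quantum group enters only through the
  operators \<open>Gop\<close>.\<close>

theorem End_Uq_iff:
  "f \<in> carrier (End_Uq d N n) \<longleftrightarrow> f \<in> carrier (endo_alg (tbasis d N n)) \<and>
    (\<forall>a\<in>a_gens d N. \<forall>v\<in>vspace (tbasis d N n). f (Gop qq a v) = Gop qq a (f v))"
proof -
  let ?A = "a_free d N" and ?V = "vspace (tbasis d N n) :: tvec set" and ?h = "t_act d N n"
  let ?E = "endo_alg (tbasis d N n) :: (Cq, _) module" and ?M = "free_monoid (a_gens d N)"
  interpret A: kalgebra ?A by (rule a_free_kalgebra)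
  note hom = alg_homD[OF t_act_alg_hom[of d N n]]
  have "f \<in> carrier (End_Uq d N n) \<longleftrightarrow> f \<in> carrier ?E \<and> (\<forall>a\<in>carrier ?A. \<forall>v\<in>?V. f (?h a v) = ?h a (f v))"
    unfolding End_Uq_def Uq_carrier by (auto simp: Uq_act_coset)
  also have "\<dots> \<longleftrightarrow> f \<in> carrier ?E \<and> (\<forall>a\<in>a_gens d N. \<forall>v\<in>?V. f (Gop qq a v) = Gop qq a (f v))"
  proof (intro conj_cong HOL.refl iffI ballI)
    fix a v assume f: "f \<in> carrier ?E" and all: "\<forall>a\<in>carrier ?A. \<forall>v\<in>?V. f (?h a v) = ?h a (f v)"
      and a: "a \<in> a_gens d N" and v: "v \<in> ?V"
    have "f (?h (kdelta [a]) v) = ?h (kdelta [a]) (f v)"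
      using all v a_free_kdelta[of "[a]"] a by simp
    then show "f (Gop qq a v) = Gop qq a (f v)"
      using a v endo_algD(1)[OF f v] by (simp add: t_act_gen)
  next
    fix a v assume f: "f \<in> carrier ?E"
      and all: "\<forall>a\<in>a_gens d N. \<forall>v\<in>?V. f (Gop qq a v) = Gop qq a (f v)" and a: "a \<in> carrier ?A" and v: "v \<in> ?V"
    have words: "u \<in> lists (a_gens d N) \<Longrightarrow> f (?h (kdelta u) v) = ?h (kdelta u) (f v)" for u
    proof (induction u)
      case Nil
      show ?case
        unfolding a_free_one[of d N, symmetric] hom(4) using v endo_algD(1)[OF f v] by (simp add: endo_alg_simps)
    next
      case (Cons g u)
      then have gu: "g \<in> a_gens d N" "u \<in> lists (a_gens d N)" by auto
      have hg: "?h (kdelta [g]) \<in> carrier ?E" and hu: "?h (kdelta u) \<in> carrier ?E"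
        using gu by (auto intro!: hom(1) a_free_kdelta)
      have m: "?h (kdelta (g # u)) = ?h (kdelta [g]) \<otimes>\<^bsub>?E\<^esub> ?h (kdelta u)"
        using hom(2)[of "kdelta [g]" "kdelta u"] gu by (simp add: a_free_kdelta a_free_kdelta_mult)
      have hv: "?h (kdelta u) v \<in> ?V" and hfv: "?h (kdelta u) (f v) \<in> ?V"
        using endo_algD(1)[OF hu] v endo_algD(1)[OF f v] by blast+
      have "f (?h (kdelta (g # u)) v) = f (Gop qq g (?h (kdelta u) v))"
        unfolding m using v hv gu by (simp add: endo_alg_simps t_act_gen)
      also have "\<dots> = Gop qq g (f (?h (kdelta u) v))" using all gu hv by blast
      also have "f (?h (kdelta u) v) = ?h (kdelta u) (f v)" by (rule Cons.IH[OF gu(2)])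
      also have "Gop qq g (?h (kdelta u) (f v)) = ?h (kdelta (g # u)) (f v)"
        unfolding m using endo_algD(1)[OF f v] hfv gu by (simp add: endo_alg_simps t_act_gen)
      finally show ?case .
    qed
    have "a \<in> carrier (monoid_algebra ?M)" using a by (simp add: a_free_def free_algebra_def)
    then show "f (?h a v) = ?h a (f v)"
    proof (induction rule: monoid_algebra_induct)
      case zero
      have "?h (\<lambda>_. 0) = \<zero>\<^bsub>?E\<^esub>"
        using alg_hom_more(1)[OF A.kalgebra_axioms endo_alg_kalgebra t_act_alg_hom[of d N n]]
        by (simp add: a_free_def free_algebra_def monoid_algebra_simps)
      then show ?case using v endo_algD(1)[OF f v] endo_alg_null[OF f] by (simp add: endo_alg_simps)
    next
      case (step c u a)
      have u: "u \<in> lists (a_gens d N)" and a: "a \<in> carrier ?A"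
        using step by (simp_all add: a_free_def free_algebra_def)
      have ku: "kdelta u \<in> carrier ?A" by (rule a_free_kdelta[OF u])
      have eq: "?h (\<lambda>y. c * kdelta u y + a y) = c \<odot>\<^bsub>?E\<^esub> ?h (kdelta u) \<oplus>\<^bsub>?E\<^esub> ?h a"
        using hom(3)[OF A.smult_closed[OF ku, of c] a] hom(5)[OF ku, of c]
        by (simp add: a_free_def free_algebra_def monoid_algebra_simps)
      have vs: "?h (kdelta u) v \<in> ?V" "?h a v \<in> ?V"
        using endo_algD(1)[OF hom(1)[OF ku] v] endo_algD(1)[OF hom(1)[OF a] v] by blast+
      have "f (?h (\<lambda>y. c * kdelta u y + a y) v) = f (\<lambda>w. c * ?h (kdelta u) v w + ?h a v w)"
        unfolding eq using v by (simp add: endo_alg_simps)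
      also have "\<dots> = (\<lambda>w. c * f (?h (kdelta u) v) w + f (?h a v) w)"
        using endo_algD(3)[OF f vspace_closed(2)[OF vs(1)] vs(2), of c] endo_algD(4)[OF f vs(1), of c] by simp
      also have "\<dots> = ?h (\<lambda>y. c * kdelta u y + a y) (f v)"
        unfolding eq words[OF u] step.IH using endo_algD(1)[OF f v] by (simp add: endo_alg_simps)
      finally show ?case .
    qed
  qed
  finally show ?thesis .
qed

section \<open>Specialization at q = 1\<close>

text \<open>The value at q = 1 as a relation, since an element with a pole there has none. Fractions
  need not be reduced: some representation with denominator nonzero at 1 is enough.\<close>

definition spec :: "Cq \<Rightarrow> complex \<Rightarrow> bool" where
  "spec x c \<longleftrightarrow> (\<exists>p r. x = Fract p r \<and> poly r 1 \<noteq> 0 \<and> c = poly p 1 / poly r 1)"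

lemma specI: "poly r 1 \<noteq> 0 \<Longrightarrow> c = poly p 1 / poly r 1 \<Longrightarrow> spec (Fract p r) c"
  by (auto simp: spec_def)

lemma spec_unique:
  assumes "spec x c" "spec x e"
  shows "c = e"
proof -
  obtain p r where 1: "x = Fract p r" "poly r 1 \<noteq> 0" "c = poly p 1 / poly r 1"
    using assms(1) by (auto simp: spec_def)
  obtain p' r' where 2: "x = Fract p' r'" "poly r' 1 \<noteq> 0" "e = poly p' 1 / poly r' 1"
    using assms(2) by (auto simp: spec_def)
  have "r \<noteq> 0" "r' \<noteq> 0" using 1 2 by auto
  then have "p * r' = p' * r" using 1(1) 2(1) by (simp add: eq_fract)
  then have "poly p 1 * poly r' 1 = poly p' 1 * poly r 1" by (metis poly_mult)
  then show ?thesis using 1 2 by (simp add: frac_eq_eq)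
qed

lemma spec_add: "spec x c \<Longrightarrow> spec y e \<Longrightarrow> spec (x + y) (c + e)"
proof -
  assume "spec x c" "spec y e"
  then obtain p r p' r' where 1: "x = Fract p r" "poly r 1 \<noteq> 0" "c = poly p 1 / poly r 1"
    and 2: "y = Fract p' r'" "poly r' 1 \<noteq> 0" "e = poly p' 1 / poly r' 1"
    by (auto simp: spec_def)
  have "r \<noteq> 0" "r' \<noteq> 0" using 1 2 by auto
  then have "x + y = Fract (p * r' + p' * r) (r * r')" using 1 2 by simp
  then show ?thesis
    unfolding 1(3) 2(3) by (auto intro!: specI simp: 1(2) 2(2) add_frac_eq)
qed

lemma spec_mult: "spec x c \<Longrightarrow> spec y e \<Longrightarrow> spec (x * y) (c * e)"
  unfolding spec_def by (elim exE conjE, rule exI, rule exI) auto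

lemma spec_inverse: "spec x c \<Longrightarrow> c \<noteq> 0 \<Longrightarrow> spec (inverse x) (inverse c)"
  unfolding spec_def
proof (elim exE conjE)
  fix p r assume *: "x = Fract p r" "poly r 1 \<noteq> 0" "c = poly p 1 / poly r 1" "c \<noteq> 0"
  show "\<exists>p r. inverse x = Fract p r \<and> poly r 1 \<noteq> 0 \<and> inverse c = poly p 1 / poly r 1"
    using * by (intro exI[of _ r] exI[of _ p]) auto
qed

definition cconst :: "complex \<Rightarrow> Cq" where
  "cconst c = Fract [:c:] 1"

lemma spec_cconst: "spec (cconst c) c"
  unfolding cconst_def by (rule specI) simp_all

lemma spec_0: "spec 0 0" and spec_1: "spec 1 1"
proof -
  show "spec 0 0" unfolding Zero_fract_def by (rule specI) simp_all
  show "spec 1 1" unfolding One_fract_def by (rule specI) simp_all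
qed

lemma spec_qq: "spec qq 1"
  unfolding qq_def by (rule specI) simp_all

lemma spec_sum: "(\<And>i. i \<in> S \<Longrightarrow> spec (f i) (g i)) \<Longrightarrow> spec (sum f S) (sum g S)"
  by (induction S rule: infinite_finite_induct) (auto intro: spec_0 spec_add)

text \<open>The local ring at q = 1 is a discrete valuation ring with uniformizer q - 1. After
  clearing denominators, the family is divided by the largest common power of q - 1, so that some
  member survives the specialization.\<close>

lemma spec_primitive:
  assumes "finite P" "p0 \<in> P" "h p0 \<noteq> 0"
  obtains l c where "l \<noteq> 0" "\<forall>p\<in>P. spec (l * h p) (c p)" "\<exists>p\<in>P. c p \<noteq> 0"
proof -
  have "\<exists>a b. h p = Fract a b \<and> b \<noteq> 0" for p by (cases "h p") auto
  then obtain a b where ab: "\<And>p. h p = Fract (a p) (b p)" "\<And>p. b p \<noteq> 0" by metis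
  define D where "D = (\<Prod>p\<in>P. b p)"
  define A where "A p = a p * (\<Prod>p'\<in>P - {p}. b p')" for p
  let ?X = "[:- 1, 1:] :: complex poly"
  have D: "D \<noteq> 0" using ab(2) assms(1) by (simp add: D_def)
  have A: "Fract D 1 * h p = Fract (A p) 1" if "p \<in> P" for p
    using that assms(1) ab(2)[of p] by (simp add: ab(1)[of p] eq_fract A_def D_def prod.remove)
  have "A p0 \<noteq> 0"
  proof
    assume "A p0 = 0"
    then have "Fract D 1 * h p0 = 0" using A[OF assms(2)] by (simp flip: Zero_fract_def)
    moreover have "Fract D 1 \<noteq> 0" using D by (simp add: Zero_fract_def eq_fract)
    ultimately show False using assms(3) by simp
  qed
  define S where "S = {p \<in> P. A p \<noteq> 0}"
  have S: "finite S" "p0 \<in> S" using assms \<open>A p0 \<noteq> 0\<close> by (auto simp: S_def)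
  \<comment> \<open>The least order of vanishing at 1 among the nonzero numerators; a member
    attaining it becomes a unit at 1 after division.\<close>
  define k where "k = Min (Polynomial.order 1 ` A ` S)"
  have "k \<in> Polynomial.order 1 ` A ` S" unfolding k_def using S by (intro Min_in) auto
  then obtain p1 where p1: "p1 \<in> S" "Polynomial.order 1 (A p1) = k" by auto
  have dv: "?X ^ k dvd A p" if "p \<in> P" for p
  proof (cases "A p = 0")
    case False
    then have "k \<le> Polynomial.order 1 (A p)" unfolding k_def using S that by (intro Min_le) (auto simp: S_def)
    then show ?thesis by (meson Polynomial.order_1 dvd_trans le_imp_power_dvd)
  qed simp
  define B where "B p = A p div ?X ^ k" for p
  have B: "A p = ?X ^ k * B p" if "p \<in> P" for p
    unfolding B_def by (rule dvd_mult_div_cancel[OF dv[OF that], symmetric])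
  have Xk: "?X ^ k \<noteq> 0" by simp
  have pB: "poly (B p1) 1 \<noteq> 0"
  proof
    assume "poly (B p1) 1 = 0"
    then have "?X dvd B p1" by (simp add: poly_eq_0_iff_dvd)
    then have "?X ^ k * ?X dvd ?X ^ k * B p1" by (rule mult_dvd_mono[OF dvd_refl])
    then have "?X ^ Suc k dvd A p1" using p1 unfolding S_def by (simp only: power_Suc2 B mem_Collect_eq)
    then show False using Polynomial.order_2[where p = "A p1" and a = 1] p1 unfolding S_def by blast
  qed
  show ?thesis
  proof (rule that[of "Fract D (?X ^ k)" "\<lambda>p. poly (B p) 1"])
    show "Fract D (?X ^ k) \<noteq> 0" using D Xk by (simp add: Zero_fract_def eq_fract)
    show "\<forall>p\<in>P. spec (Fract D (?X ^ k) * h p) (poly (B p) 1)"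
    proof
      fix p assume that: "p \<in> P"
      have "Fract D (?X ^ k) * h p = Fract 1 (?X ^ k) * (Fract D 1 * h p)"
        using ab(2)[of p] Xk by (simp add: ab(1)[of p] eq_fract)
      also have "\<dots> = Fract (B p) 1"
        unfolding A[OF that] using Xk by (simp add: eq_fract B[OF that])
      finally show "spec (Fract D (?X ^ k) * h p) (poly (B p) 1)" by (auto intro: specI)
    qed
    show "\<exists>p\<in>P. poly (B p) 1 \<noteq> 0" using pB p1 by (auto simp: S_def)
  qed
qed

section \<open>Linear systems and independence under specialization\<close>

lemma homogeneous_system:
  fixes M :: "'j \<Rightarrow> 'i \<Rightarrow> 'k::field"
  assumes "finite I" "finite J" "card I < card J"
  shows "\<exists>c. (\<exists>j\<in>J. c j \<noteq> 0) \<and> (\<forall>i\<in>I. (\<Sum>j\<in>J. c j * M j i) = 0)"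
  using assms
proof (induction I arbitrary: J M rule: finite_induct)
  case empty
  then have "J \<noteq> {}" by auto
  then show ?case by (intro exI[of _ "\<lambda>_. 1"]) auto
next
  case (insert i I)
  show ?case
  proof (cases "\<forall>j\<in>J. M j i = 0")
    case True
    from insert.IH[of J M] insert.prems insert.hyps obtain c
      where "\<exists>j\<in>J. c j \<noteq> 0" "\<forall>i\<in>I. (\<Sum>j\<in>J. c j * M j i) = 0" by auto
    then show ?thesis using True by (intro exI[of _ c]) simp
  next
    case False
    then obtain j0 where j0: "j0 \<in> J" "M j0 i \<noteq> 0" by auto
    define J' where "J' = J - {j0}"
    have J: "J = insert j0 J'" "j0 \<notin> J'" "finite J'" using j0 insert.prems by (auto simp: J'_def)
    have "card I < card J'" using insert.prems insert.hyps J by simp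
    \<comment> \<open>Gaussian elimination with pivot \<open>M j0 i\<close>: equation
      \<open>i\<close> removes the unknown \<open>j0\<close> from the others, leaving one equation
      and one unknown fewer.\<close>
    from insert.IH[OF J(3) this, of "\<lambda>j k. M j k - M j i / M j0 i * M j0 k"] obtain c
      where c: "\<exists>j\<in>J'. c j \<noteq> 0" "\<forall>k\<in>I. (\<Sum>j\<in>J'. c j * (M j k - M j i / M j0 i * M j0 k)) = 0"
      by blast
    \<comment> \<open>Back substitution gives the pivot unknown the value that solves equation
      \<open>i\<close>.\<close>
    define e where "e = (\<lambda>j. if j = j0 then - (\<Sum>j\<in>J'. c j * M j i) / M j0 i else c j)"
    have sum: "(\<Sum>j\<in>J. e j * M j k) = - (\<Sum>j\<in>J'. c j * M j i) / M j0 i * M j0 k + (\<Sum>j\<in>J'. c j * M j k)" for k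
    proof -
      have "(\<Sum>j\<in>J'. e j * M j k) = (\<Sum>j\<in>J'. c j * M j k)"
        using J(2) by (intro sum.cong) (auto simp: e_def)
      then show ?thesis using J by (simp add: e_def)
    qed
    have "(\<Sum>j\<in>J. e j * M j k) = 0" if "k \<in> I" for k
    proof -
      have "(\<Sum>j\<in>J'. c j * (M j k - M j i / M j0 i * M j0 k)) =
          (\<Sum>j\<in>J'. c j * M j k) - (\<Sum>j\<in>J'. c j * M j i) / M j0 i * M j0 k"
        by (simp add: right_diff_distrib sum_subtractf sum_distrib_right sum_divide_distrib mult.assoc)
      then show ?thesis using c(2) that unfolding sum by simp
    qed
    moreover have "(\<Sum>j\<in>J. e j * M j i) = 0" unfolding sum using j0 by simp
    moreover have "\<exists>j\<in>J. e j \<noteq> 0" using c(1) J by (auto simp: e_def)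
    ultimately show ?thesis by (intro exI[of _ e]) simp
  qed
qed

text \<open>Vectors are functions on \<open>P\<close>, in the application matrices with
  \<open>P\<close> the set of positions. Independence is that of the indexed family, so two indices
  with the same vector count as dependent.\<close>

definition indep_on :: "'p set \<Rightarrow> 'j set \<Rightarrow> ('j \<Rightarrow> 'p \<Rightarrow> 'k::field) \<Rightarrow> bool" where
  "indep_on P J g \<longleftrightarrow> (\<forall>\<alpha>. (\<forall>p\<in>P. (\<Sum>j\<in>J. \<alpha> j * g j p) = 0) \<longrightarrow> (\<forall>j\<in>J. \<alpha> j = 0))"

lemma indep_onD:
  assumes "indep_on P J g" "\<forall>p\<in>P. (\<Sum>j\<in>J. \<alpha> j * g j p) = 0" "j \<in> J"
  shows "\<alpha> j = 0"
  using assms unfolding indep_on_def by blast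

text \<open>A nontrivial relation over C(q) can be scaled so that its coefficients are regular at 1
  and not all zero there; its value at 1 would be a nontrivial relation among the specialized
  vectors.\<close>

lemma indep_on_deform:
  assumes "finite J" and spec: "\<And>j p. j \<in> J \<Longrightarrow> p \<in> P \<Longrightarrow> spec (gq j p) (g1 j p)"
    and ind: "indep_on P J g1"
  shows "indep_on P J gq"
  unfolding indep_on_def
proof (intro allI impI)
  fix \<alpha> assume \<alpha>: "\<forall>p\<in>P. (\<Sum>j\<in>J. \<alpha> j * gq j p) = 0"
  show "\<forall>j\<in>J. \<alpha> j = 0"
  proof (rule ccontr)
    assume "\<not> (\<forall>j\<in>J. \<alpha> j = 0)"
    then obtain j0 where "j0 \<in> J" "\<alpha> j0 \<noteq> 0" by auto
    then obtain l c where l: "l \<noteq> 0"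
      and c': "\<forall>j\<in>J. spec (l * \<alpha> j) (c j)" and c0: "\<exists>j\<in>J. c j \<noteq> 0"
      by (rule spec_primitive[where h = \<alpha>, OF assms(1)])
    have c: "spec (l * \<alpha> j) (c j)" if "j \<in> J" for j using c' that by blast
    have "(\<Sum>j\<in>J. c j * g1 j p) = 0" if "p \<in> P" for p
    proof (rule spec_unique[OF _ spec_0])
      have "spec (\<Sum>j\<in>J. l * \<alpha> j * gq j p) (\<Sum>j\<in>J. c j * g1 j p)"
        by (intro spec_sum spec_mult c spec that)
      also have "(\<Sum>j\<in>J. l * \<alpha> j * gq j p) = l * (\<Sum>j\<in>J. \<alpha> j * gq j p)"
        by (simp add: sum_distrib_left mult.assoc)
      also have "\<dots> = 0" using \<alpha> that by simp
      finally show "spec 0 (\<Sum>j\<in>J. c j * g1 j p)" .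
    qed
    then show False using ind c0 unfolding indep_on_def by blast
  qed
qed

text \<open>An inclusion-maximal independent subset of indices spans, because adjoining one more
  index creates a relation in which the new coefficient cannot vanish.\<close>

lemma maximal_indep:
  fixes g :: "'j \<Rightarrow> 'p \<Rightarrow> 'k::field"
  assumes "finite S"
  obtains J where "J \<subseteq> S" "indep_on P J g"
    "\<forall>i\<in>S. \<exists>\<beta>. \<forall>p\<in>P. g i p = (\<Sum>j\<in>J. \<beta> j * g j p)"
proof -
  let ?X = "{J. J \<subseteq> S \<and> indep_on P J g}"
  have "finite ?X" using assms by simp
  moreover have "{} \<in> ?X" by (simp add: indep_on_def)
  ultimately obtain J where J: "J \<in> ?X" "\<And>J'. J' \<in> ?X \<Longrightarrow> J \<subseteq> J' \<Longrightarrow> J' = J"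
    using finite_has_maximal2[of ?X "{}"] by metis
  have "finite J" using J(1) assms finite_subset by auto
  have "\<exists>\<beta>. \<forall>p\<in>P. g i p = (\<Sum>j\<in>J. \<beta> j * g j p)" if i: "i \<in> S" for i
  proof (cases "i \<in> J")
    case True
    have "(\<Sum>j\<in>J. (if j = i then 1 else 0) * g j p) = g i p" for p
      using True \<open>finite J\<close> by (simp add: if_distrib[where f = "\<lambda>x. x * _"] cong: if_cong)
    then show ?thesis by (intro exI[of _ "\<lambda>j. if j = i then 1 else 0"]) simp
  next
    case False
    then have "insert i J \<notin> ?X" using J(2)[of "insert i J"] by auto
    then obtain \<alpha> where \<alpha>: "\<forall>p\<in>P. (\<Sum>j\<in>insert i J. \<alpha> j * g j p) = 0" "\<exists>j\<in>insert i J. \<alpha> j \<noteq> 0"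
      using i J(1) by (auto simp: indep_on_def)
    have s: "(\<Sum>j\<in>insert i J. \<alpha> j * g j p) = \<alpha> i * g i p + (\<Sum>j\<in>J. \<alpha> j * g j p)" for p
      using False \<open>finite J\<close> by simp
    have ai: "\<alpha> i \<noteq> 0"
    proof
      assume "\<alpha> i = 0"
      then have "\<forall>p\<in>P. (\<Sum>j\<in>J. \<alpha> j * g j p) = 0" using \<alpha>(1) s by simp
      then have "\<forall>j\<in>J. \<alpha> j = 0" using J(1) by (auto simp: indep_on_def)
      with \<open>\<alpha> i = 0\<close> \<alpha>(2) show False by auto
    qed
    have "g i p = (\<Sum>j\<in>J. (- \<alpha> j / \<alpha> i) * g j p)" if "p \<in> P" for p
    proof -
      have "\<alpha> i * g i p = - (\<Sum>j\<in>J. \<alpha> j * g j p)" using \<alpha>(1) that s by (simp add: eq_neg_iff_add_eq_0)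
      then have "g i p = - (\<Sum>j\<in>J. \<alpha> j * g j p) / \<alpha> i" using ai by (simp add: field_simps)
      also have "\<dots> = (\<Sum>j\<in>J. (- \<alpha> j / \<alpha> i) * g j p)"
        by (simp add: sum_negf sum_divide_distrib)
      finally show ?thesis .
    qed
    then show ?thesis by (intro exI[of _ "\<lambda>j. - \<alpha> j / \<alpha> i"]) blast
  qed
  then show ?thesis using J(1) by (intro that[of J]) auto
qed

text \<open>
  The dimension over \<open>\<complex>(q)\<close> of a solution space of linear equations is at most the dimension of
  the space of solutions of the specialized equations, while the rank of a family of vectors can
  only drop under specialization. So if the specialized family spans the specialized solutions,
  the family spans the solutions.
\<close>

lemma deformation:
  fixes gq :: "'j \<Rightarrow> 'p \<Rightarrow> Cq" and g1 :: "'j \<Rightarrow> 'p \<Rightarrow> complex"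
  assumes fin: "finite P" "finite S"
    and spec: "\<And>j p. j \<in> S \<Longrightarrow> p \<in> P \<Longrightarrow> spec (gq j p) (g1 j p)"
    and Z: "(\<lambda>_. 0) \<in> Z" "\<And>c x y. x \<in> Z \<Longrightarrow> y \<in> Z \<Longrightarrow> (\<lambda>p. c * x p + y p) \<in> Z" "\<And>j. j \<in> S \<Longrightarrow> gq j \<in> Z"
    and nondeg: "\<And>H H1. H \<in> Z \<Longrightarrow> (\<And>p. p \<in> P \<Longrightarrow> spec (H p) (H1 p)) \<Longrightarrow>
      (\<And>j. j \<in> S \<Longrightarrow> (\<Sum>p\<in>P. g1 j p * H1 p) = 0) \<Longrightarrow> (\<And>p. p \<in> P \<Longrightarrow> H1 p = 0)"
  obtains J where "J \<subseteq> S" "indep_on P J g1"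
    "\<forall>H\<in>Z. \<exists>\<alpha>. \<forall>p\<in>P. H p = (\<Sum>j\<in>J. \<alpha> j * gq j p)"
proof -
  obtain J where J: "J \<subseteq> S" "indep_on P J g1"
    and span: "\<forall>i\<in>S. \<exists>\<beta>. \<forall>p\<in>P. g1 i p = (\<Sum>j\<in>J. \<beta> j * g1 j p)"
    by (rule maximal_indep[OF fin(2), of P g1])
  have finJ: "finite J" using J(1) fin(2) finite_subset by blast
  have indq: "indep_on P J gq"
    using J(1) by (intro indep_on_deform[OF finJ _ J(2)] spec) auto
  have "\<exists>\<alpha>. \<forall>p\<in>P. H p = (\<Sum>j\<in>J. \<alpha> j * gq j p)" if H: "H \<in> Z" for H
  proof -
    \<comment> \<open>The solution \<open>H\<close> joins the family under the index
      \<open>None\<close>. There is now one unknown more than there are orthogonality conditions,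
      which yields a nonzero coefficient family \<open>c\<close>.\<close>
    define g' where "g' = case_option H gq"
    define J' where "J' = insert None (Some ` J)"
    have "card J < card J'" "finite J'" using finJ by (simp_all add: J'_def card_image)
    from homogeneous_system[OF finJ this(2,1), of "\<lambda>j i. \<Sum>p\<in>P. cconst (g1 i p) * g' j p"]
    obtain c where c0: "\<exists>j\<in>J'. c j \<noteq> 0"
      and c: "\<And>i. i \<in> J \<Longrightarrow> (\<Sum>j\<in>J'. c j * (\<Sum>p\<in>P. cconst (g1 i p) * g' j p)) = 0" by blast
    define h where "h p = (\<Sum>j\<in>J'. c j * g' j p)" for p
    have h_eq: "h p = c None * H p + (\<Sum>j\<in>J. c (Some j) * gq j p)" for p
      using finJ by (simp add: h_def J'_def sum.reindex g'_def)
    have sumZ: "(\<lambda>p. \<Sum>j\<in>K. c (Some j) * gq j p) \<in> Z" if "K \<subseteq> J" for K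
      using finite_subset[OF that finJ] that
    proof (induction K)
      case (insert j K)
      then have "gq j \<in> Z" using J(1) Z(3) by auto
      from Z(2)[OF this, of "\<lambda>p. \<Sum>j\<in>K. c (Some j) * gq j p" "c (Some j)"] insert show ?case by simp
    qed (simp add: Z(1))
    have hZ: "h \<in> Z"
      using Z(2)[OF H sumZ[OF subset_refl], of "c None"] by (simp add: h_eq[abs_def])
    \<comment> \<open>The conditions imposed on \<open>c\<close>, rewritten as orthogonality of the
      combination \<open>h\<close> to the constant lifts of the \<open>g1 i\<close>.\<close>
    have orth: "(\<Sum>p\<in>P. cconst (g1 i p) * h p) = 0" if "i \<in> J" for i
    proof -
      have "(\<Sum>p\<in>P. cconst (g1 i p) * h p) = (\<Sum>p\<in>P. \<Sum>j\<in>J'. c j * (cconst (g1 i p) * g' j p))"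
        unfolding h_def sum_distrib_left by (intro sum.cong HOL.refl) (simp add: mult.left_commute)
      also have "\<dots> = (\<Sum>j\<in>J'. c j * (\<Sum>p\<in>P. cconst (g1 i p) * g' j p))"
        unfolding sum_distrib_left by (rule sum.swap)
      finally show ?thesis using c[OF that] by simp
    qed
    \<comment> \<open>A nonzero value would allow \<open>h\<close> to be scaled to a primitive
      family. Its limit is a nonzero specialized solution orthogonal to \<open>J\<close>, hence to
      all of \<open>S\<close>, contrary to \<open>nondeg\<close>.\<close>
    have h0: "h p = 0" if pP: "p \<in> P" for p
    proof (rule ccontr)
      assume "h p \<noteq> 0"
      then obtain l e where l: "l \<noteq> 0"
        and e': "\<forall>p\<in>P. spec (l * h p) (e p)" and e0: "\<exists>p\<in>P. e p \<noteq> 0"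
        by (rule spec_primitive[where h = h, OF fin(1) pP])
      have e: "spec (l * h p) (e p)" if "p \<in> P" for p using e' that by blast
      have lh: "(\<lambda>p. l * h p) \<in> Z" using Z(2)[OF hZ Z(1), of l] by simp
      have orthJ: "(\<Sum>p\<in>P. g1 i p * e p) = 0" if "i \<in> J" for i
      proof (rule spec_unique[OF _ spec_0])
        have "spec (\<Sum>p\<in>P. cconst (g1 i p) * (l * h p)) (\<Sum>p\<in>P. g1 i p * e p)"
          by (intro spec_sum spec_mult spec_cconst e)
        also have "(\<Sum>p\<in>P. cconst (g1 i p) * (l * h p)) = l * (\<Sum>p\<in>P. cconst (g1 i p) * h p)"
          by (simp add: sum_distrib_left mult.left_commute)
        finally show "spec 0 (\<Sum>p\<in>P. g1 i p * e p)" using orth[OF that] by simp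
      qed
      have orthS: "(\<Sum>p\<in>P. g1 i p * e p) = 0" if iS: "i \<in> S" for i
      proof -
        obtain \<beta> where \<beta>: "\<forall>p\<in>P. g1 i p = (\<Sum>j\<in>J. \<beta> j * g1 j p)" using span iS by blast
        have "(\<Sum>p\<in>P. g1 i p * e p) = (\<Sum>p\<in>P. \<Sum>j\<in>J. \<beta> j * (g1 j p * e p))"
          using \<beta> by (intro sum.cong HOL.refl) (simp add: sum_distrib_right mult.assoc)
        also have "\<dots> = (\<Sum>j\<in>J. \<beta> j * (\<Sum>p\<in>P. g1 j p * e p))"
          unfolding sum_distrib_left by (rule sum.swap)
        finally show ?thesis using orthJ by simp
      qed
      from nondeg[OF lh e orthS] e0 show False by blast
    qed
    \<comment> \<open>Otherwise \<open>h = 0\<close> would be a nontrivial relation among the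
      \<open>gq j\<close> alone, which are independent over C(q). With this coefficient nonzero, the
      relation can be solved for \<open>H\<close>.\<close>
    have cN: "c None \<noteq> 0"
    proof
      assume N: "c None = 0"
      then have "\<forall>p\<in>P. (\<Sum>j\<in>J. c (Some j) * gq j p) = 0" using h0 h_eq by simp
      then have "\<forall>j\<in>J. c (Some j) = 0" using indep_onD[OF indq, of "\<lambda>j. c (Some j)"] by blast
      with N c0 show False by (auto simp: J'_def)
    qed
    have "H p = (\<Sum>j\<in>J. (- c (Some j) / c None) * gq j p)" if "p \<in> P" for p
    proof -
      have "c None * H p = - (\<Sum>j\<in>J. c (Some j) * gq j p)"
        using h0[OF that] h_eq by (simp add: eq_neg_iff_add_eq_0)
      then have "H p = - (\<Sum>j\<in>J. c (Some j) * gq j p) / c None" using cN by (simp add: field_simps)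
      also have "\<dots> = (\<Sum>j\<in>J. (- c (Some j) / c None) * gq j p)"
        by (simp add: sum_negf sum_divide_distrib)
      finally show ?thesis .
    qed
    then show ?thesis by (intro exI[of _ "\<lambda>j. - c (Some j) / c None"]) blast
  qed
  then have "\<forall>H\<in>Z. \<exists>\<alpha>. \<forall>p\<in>P. H p = (\<Sum>j\<in>J. \<alpha> j * gq j p)" by (rule ballI)
  with J show ?thesis by (rule that)
qed

section \<open>Word operators at q = 1\<close>

lemma spec_wprod: "(\<And>x. spec (\<mu> x) 1) \<Longrightarrow> spec (wprod \<mu> w) 1"
proof (induction w)
  case Nil
  then show ?case by (simp add: spec_1)
next
  case (Cons x w)
  then show ?case using spec_mult[of "\<mu> x" 1 "wprod \<mu> w" 1] by simp
qed

lemma spec_kap: "spec (kap qq p p' x) 1"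
  using spec_qq spec_1 spec_inverse[OF spec_qq] by (simp add: kap_def)

lemma wprod_kap_1 [simp]: "wprod (kap 1 p p') w = 1"
  by (induction w) (simp_all add: kap_def)

lemma spec_Eop: "(\<And>w. spec (f w) (g w)) \<Longrightarrow> spec (Eop qq p p' f w) (Eop 1 p p' g w)"
proof (induction w arbitrary: f g)
  case (Cons x w)
  have "spec (wprod (kap qq p p') w * f (p' # w)) (1 * g (p' # w))"
    by (intro spec_mult spec_wprod spec_kap Cons.prems)
  moreover have "spec (Eop qq p p' (\<lambda>u. f (x # u)) w) (Eop 1 p p' (\<lambda>u. g (x # u)) w)"
    by (intro Cons.IH Cons.prems)
  ultimately show ?case
    using spec_add by (auto intro: spec_add[OF spec_0, simplified])
qed (simp add: spec_0)

lemma spec_Fop: "(\<And>w. spec (f w) (g w)) \<Longrightarrow> spec (Fop qq p p' f w) (Fop 1 p p' g w)"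
proof (induction w arbitrary: f g)
  case (Cons x w)
  have "spec (inverse (kap qq p p' x) * Fop qq p p' (\<lambda>u. f (x # u)) w) (inverse 1 * Fop 1 p p' (\<lambda>u. g (x # u)) w)"
    by (intro spec_mult spec_inverse spec_kap Cons.IH Cons.prems) simp
  then have *: "spec (inverse (kap qq p p' x) * Fop qq p p' (\<lambda>u. f (x # u)) w) (Fop 1 p p' (\<lambda>u. g (x # u)) w)"
    by simp
  have k: "inverse (kap 1 p p' x) = (1 :: complex)" by (simp add: kap_def)
  show ?case
    unfolding Fop.simps k mult_1 by (intro spec_add *) (simp add: Cons.prems spec_0)
qed (simp add: spec_0)

text \<open>The term with \<open>qq - inverse qq\<close> dies and only the exchange of letters
  remains. For equal letters the exchange does nothing, in agreement with \<open>qq\<close> tending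
  to 1.\<close>

lemma spec_Sop:
  assumes "\<And>w. spec (f w) (g w)"
  shows "spec (Sop qq r f w) (g (swp r w))"
proof (cases "w ! r = w ! Suc r")
  case True
  have "swp r w = w[r := w ! r, Suc r := w ! Suc r]" by (simp only: swp_def True)
  also have "\<dots> = w" by (simp only: list_update_id)
  finally have "swp r w = w" .
  then show ?thesis using spec_mult[OF spec_qq assms[of w]] True by (simp add: Sop_def)
next
  case False
  have "spec (qq + cconst (- 1) * inverse qq) (1 + (- 1) * inverse 1)"
    by (intro spec_add spec_mult spec_cconst spec_inverse spec_qq) simp
  moreover have "cconst (- 1) = - 1" by (simp add: cconst_def One_fract_def one_pCons)
  ultimately have "spec (qq - inverse qq) 0" by simp
  from spec_mult[OF this assms[of w]] have "spec ((qq - inverse qq) * f w) 0" by simp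
  then have "spec (if lgt (w ! r) (w ! Suc r) then (qq - inverse qq) * f w else 0) 0"
    using spec_0 by simp
  from spec_add[OF assms[of "swp r w"] this] False show ?thesis
    by (simp add: Sop_def)
qed

section \<open>The commutant of the Levi subalgebra on classical tensor space\<close>

text \<open>With all twists equal to 1 the comultiplication is that of a Lie algebra, so a matrix
  unit acts as a sum over positions. The letters \<open>x\<close> and \<open>y\<close> are arbitrary
  here and need not be neighbours.\<close>

lemma Eop_1_nth:
  "Eop 1 x y f w = (\<Sum>m<length w. if w ! m = x then f (w[m := y]) else 0)"
proof (induction w arbitrary: f)
  case (Cons z w)
  have "(\<Sum>m<length (z # w). if (z # w) ! m = x then f ((z # w)[m := y]) else 0) =
      (if z = x then f (y # w) else 0) + (\<Sum>m<length w. if w ! m = x then f (z # w[m := y]) else 0)"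
    by (simp add: sum.lessThan_Suc_shift del: sum.lessThan_Suc cong: if_cong)
  then show ?case using Cons.IH[of "\<lambda>u. f (z # u)"] by simp
qed simp

lemma Fop_1: "Fop 1 x y f w = Eop 1 y x f w"
  by (induction w arbitrary: f) (simp_all add: kap_def)

text \<open>The bracket of the matrix units (x, y) and (y, z) is the unit (x, z), minus a diagonal
  unit that occurs only if \<open>x = z\<close>.\<close>

lemma Eop_1_commutator:
  assumes "x \<noteq> z"
  shows "Eop 1 x y (Eop 1 y z f) w = Eop 1 y z (Eop 1 x y f) w + Eop 1 x z f w"
proof (induction w arbitrary: f)
  case (Cons a w)
  note IH = Cons.IH[of "\<lambda>u. f (a # u)"]
  show ?case
    using assms IH by (cases "a = x"; cases "a = y") simp_all
qed simp

abbreviation (input) pinv :: "('a \<Rightarrow> 'b) \<Rightarrow> 'b \<Rightarrow> 'a" where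
  "pinv \<equiv> inv_into UNIV"

lemma sum_permutes_compose_left:
  assumes t: "t permutes S"
  shows "(\<Sum>\<tau> | \<tau> permutes S. f (t \<circ> \<tau>)) = (\<Sum>\<tau> | \<tau> permutes S. f \<tau>)"
  by (rule sum.reindex_bij_witness[where i = "\<lambda>\<tau>. pinv t \<circ> \<tau>" and j = "\<lambda>\<tau>. t \<circ> \<tau>"])
    (auto simp: o_assoc permutes_inv_o[OF t] intro: permutes_compose[OF _ t] permutes_compose[OF _ permutes_inv[OF t]])

section \<open>Operators commuting with a fixed endomorphism\<close>

context
  fixes d :: nat and N :: "nat \<Rightarrow> nat" and n :: nat and h :: "(letter list \<Rightarrow> complex) \<Rightarrow> letter list \<Rightarrow> complex"
  assumes h: "h \<in> carrier (endo_alg (tbasis d N n))"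
begin

text \<open>Operators such as \<open>Eop\<close> act on all functions of words, not only on the
  tensor space. They are therefore tested on the subspace alone, and stability of the subspace is
  part of the condition.\<close>

definition comm :: "((letter list \<Rightarrow> complex) \<Rightarrow> letter list \<Rightarrow> complex) \<Rightarrow> bool" where
  "comm A \<longleftrightarrow> (\<forall>v\<in>vspace (tbasis d N n). A v \<in> vspace (tbasis d N n) \<and> h (A v) = A (h v))"

lemma comm_linear:
  assumes "comm A" "comm A'"
  shows "comm (\<lambda>v w. c * A v w + A' v w)"
  unfolding comm_def
proof
  fix v :: "letter list \<Rightarrow> complex" assume v: "v \<in> vspace (tbasis d N n)"
  then have o: "A v \<in> vspace (tbasis d N n)" "h (A v) = A (h v)" "A' v \<in> vspace (tbasis d N n)" "h (A' v) = A' (h v)"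
    using assms by (simp_all add: comm_def)
  have "h (\<lambda>w. c * A v w + A' v w) = (\<lambda>w. h (\<lambda>w. c * A v w) w + h (A' v) w)"
    by (rule endo_algD(3)[OF h vspace_closed(2)[OF o(1)] o(3)])
  also have "h (\<lambda>w. c * A v w) = (\<lambda>w. c * h (A v) w)" by (rule endo_algD(4)[OF h o(1)])
  finally show "(\<lambda>w. c * A v w + A' v w) \<in> vspace (tbasis d N n) \<and>
      h (\<lambda>w. c * A v w + A' v w) = (\<lambda>w. c * A (h v) w + A' (h v) w)"
    using vspace_closed(1)[OF vspace_closed(2)[OF o(1)] o(3)] by (simp add: o)
qed

lemma comm_zero: "comm (\<lambda>v w. 0)"
  using endo_alg_null[OF h] by (simp add: comm_def vspace_closed)

lemma comm_sum:
  assumes "finite S" "\<And>i. i \<in> S \<Longrightarrow> comm (A i)"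
  shows "comm (\<lambda>v w. \<Sum>i\<in>S. A i v w)"
  using assms
proof (induction S)
  case (insert i S)
  then have "comm (\<lambda>v w. 1 * A i v w + (\<Sum>i\<in>S. A i v w))"
    by (intro comm_linear) auto
  then show ?case using insert by simp
qed (simp add: comm_zero)

lemma comm_comp:
  assumes "comm A" "comm A'"
  shows "comm (\<lambda>v. A (A' v))"
  using assms endo_algD(1)[OF h] by (simp add: comm_def)

lemma comm_cong:
  assumes "comm A" "\<And>v w. v \<in> vspace (tbasis d N n) \<Longrightarrow> A' v w = A v w"
  shows "comm A'"
proof -
  have "A' v = A v" if "v \<in> vspace (tbasis d N n)" for v using assms(2)[OF that] by (rule ext)
  then show ?thesis using assms(1) endo_algD(1)[OF h] by (simp add: comm_def)
qed

text \<open>The symmetrization of a product of matrix units: every slot \<open>k\<close> in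
  \<open>K\<close> carries the unit from \<open>b k\<close> to \<open>a k\<close>, the other slots
  carry the identity, and a permutation \<open>\<tau>\<close> assigns a slot to each position.
  Summing over all permutations, and not over distinct placements, makes the slots interchangeable
  and gives n! times the identity for empty \<open>K\<close>.\<close>

definition pattern_op :: "nat set \<Rightarrow> (nat \<Rightarrow> letter) \<Rightarrow> (nat \<Rightarrow> letter) \<Rightarrow>
    (letter list \<Rightarrow> complex) \<Rightarrow> letter list \<Rightarrow> complex" where
  "pattern_op K a b f w = (if length w = n then \<Sum>\<tau> | \<tau> permutes {..<n}.
    if \<forall>m<n. \<tau> m \<in> K \<longrightarrow> w ! m = a (\<tau> m) then f (map (\<lambda>m. if \<tau> m \<in> K then b (\<tau> m) else w ! m) [0..<n]) else 0 else 0)"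

lemma pattern_op_empty: "v \<in> vspace (tbasis d N n) \<Longrightarrow> pattern_op {} a b v w = of_nat (fact n) * v w"
proof (cases "length w = n")
  case True
  then have "map ((!) w) [0..<n] = w" by (metis map_nth)
  then show ?thesis using True by (simp add: pattern_op_def card_permutations)
next
  case False
  assume "v \<in> vspace (tbasis d N n)"
  then show ?thesis using False by (simp add: pattern_op_def vspace_def tbasis_def)
qed

lemma pattern_op_shift:
  assumes "j < n" "j0 < n" "j \<notin> K" "j0 \<notin> K"
  shows "pattern_op (insert j K) (a(j := x)) (b(j := y)) f w = pattern_op (insert j0 K) (a(j0 := x)) (b(j0 := y)) f w"
proof (cases "length w = n")
  case True
  let ?t = "Transposition.transpose j j0"
  let ?F = "\<lambda>j \<tau>. if \<forall>m<n. \<tau> m \<in> insert j K \<longrightarrow> w ! m = (a(j := x)) (\<tau> m)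
    then f (map (\<lambda>m. if \<tau> m \<in> insert j K then (b(j := y)) (\<tau> m) else w ! m) [0..<n]) else 0"
  have t: "?t permutes {..<n}" using assms by (intro permutes_swap_id) auto
  have mem: "?t k \<in> insert j0 K \<longleftrightarrow> k \<in> insert j K" for k
    using assms(3,4) by (auto simp: Transposition.transpose_def)
  have val: "(c(j0 := z)) (?t k) = (c(j := z)) k" if "k \<in> insert j K" for k c and z :: letter
    using assms(3,4) that by (auto simp: Transposition.transpose_def)
  have "?F j0 (?t \<circ> \<tau>) = ?F j \<tau>" for \<tau>
  proof -
    have 1: "(\<forall>m<n. (?t \<circ> \<tau>) m \<in> insert j0 K \<longrightarrow> w ! m = (a(j0 := x)) ((?t \<circ> \<tau>) m)) \<longleftrightarrow>
        (\<forall>m<n. \<tau> m \<in> insert j K \<longrightarrow> w ! m = (a(j := x)) (\<tau> m))"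
      unfolding o_def mem using val[of _ a x] by metis
    have 2: "(\<lambda>m. if (?t \<circ> \<tau>) m \<in> insert j0 K then (b(j0 := y)) ((?t \<circ> \<tau>) m) else w ! m) =
        (\<lambda>m. if \<tau> m \<in> insert j K then (b(j := y)) (\<tau> m) else w ! m)"
    proof
      fix m
      show "(if (?t \<circ> \<tau>) m \<in> insert j0 K then (b(j0 := y)) ((?t \<circ> \<tau>) m) else w ! m) =
        (if \<tau> m \<in> insert j K then (b(j := y)) (\<tau> m) else w ! m)"
        unfolding o_def mem using val[of "\<tau> m" b y] by (cases "\<tau> m \<in> insert j K") (simp_all only: if_True if_False)
    qed
    show ?thesis unfolding 1 2 ..
  qed
  then have "(\<Sum>\<tau> | \<tau> permutes {..<n}. ?F j \<tau>) = (\<Sum>\<tau> | \<tau> permutes {..<n}. ?F j0 (?t \<circ> \<tau>))"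
    by (simp only:)
  also have "\<dots> = (\<Sum>\<tau> | \<tau> permutes {..<n}. ?F j0 \<tau>)"
    by (rule sum_permutes_compose_left[OF t])
  finally show ?thesis using True by (simp only: pattern_op_def if_True)
qed (simp add: pattern_op_def)

lemma pattern_op_step:
  assumes K: "K \<subseteq> {..<n}"
  shows "Eop 1 x y (pattern_op K a b f) w = (if length w = n then
    (\<Sum>i\<in>K. if a i = y then pattern_op K (a(i := x)) b f w else 0) +
    (\<Sum>j\<in>{..<n} - K. pattern_op (insert j K) (a(j := x)) (b(j := y)) f w) else 0)"
proof (cases "length w = n")
  case False
  then show ?thesis by (simp add: Eop_1_nth pattern_op_def cong: if_cong)
next
  case True
  let ?P = "{\<tau>. \<tau> permutes {..<n}}"
  define C where "C w K a \<tau> \<longleftrightarrow> (\<forall>m<n. \<tau> m \<in> K \<longrightarrow> w ! m = a (\<tau> m))" for w :: "letter list" and K :: "nat set" and a \<tau>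
  define V where "V w K b \<tau> = map (\<lambda>m. if \<tau> m \<in> K then b (\<tau> m) else w ! m) [0..<n]" for w :: "letter list" and K :: "nat set" and b \<tau>
  have po: "pattern_op K a b f w = (\<Sum>\<tau>\<in>?P. if C w K a \<tau> then f (V w K b \<tau>) else 0)" if "length w = n" for K a b w
    using that by (simp add: pattern_op_def C_def V_def cong: if_cong)
  define G1 where "G1 \<tau> i = (if a i = y then if C w K (a(i := x)) \<tau> then f (V w K b \<tau>) else 0 else 0)" for \<tau> i
  define G2 where "G2 \<tau> j = (if C w (insert j K) (a(j := x)) \<tau> then f (V w (insert j K) (b(j := y)) \<tau>) else 0)" for \<tau> j
  have main: "(\<Sum>m<n. if w ! m = x then if C (w[m := y]) K a \<tau> then f (V (w[m := y]) K b \<tau>) else 0 else 0) =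
      (\<Sum>i\<in>K. G1 \<tau> i) + (\<Sum>j\<in>{..<n} - K. G2 \<tau> j)" if \<tau>: "\<tau> permutes {..<n}" for \<tau>
  proof -
    have inj: "\<tau> m = \<tau> m' \<longleftrightarrow> m = m'" for m m' using permutes_inj[OF \<tau>] by (simp add: inj_eq)
    have eq: "(if w ! m = x then if C (w[m := y]) K a \<tau> then f (V (w[m := y]) K b \<tau>) else 0 else 0) =
      (if \<tau> m \<in> K then G1 \<tau> (\<tau> m) else G2 \<tau> (\<tau> m))" if m: "m < n" for m
    proof (cases "\<tau> m \<in> K")
      case True
      have v: "V (w[m := y]) K b \<tau> = V w K b \<tau>"
        unfolding V_def using True m \<open>length w = n\<close> by (intro map_cong HOL.refl) (auto simp: nth_list_update)
      have c: "w ! m = x \<and> C (w[m := y]) K a \<tau> \<longleftrightarrow> a (\<tau> m) = y \<and> C w K (a(\<tau> m := x)) \<tau>"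
        unfolding C_def using True m \<open>length w = n\<close> by (auto simp: nth_list_update inj)
      show ?thesis using True c by (auto simp: G1_def v)
    next
      case False
      have v: "V (w[m := y]) K b \<tau> = V w (insert (\<tau> m) K) (b(\<tau> m := y)) \<tau>"
        unfolding V_def using False m \<open>length w = n\<close> by (intro map_cong HOL.refl) (auto simp: nth_list_update inj)
      have c: "w ! m = x \<and> C (w[m := y]) K a \<tau> \<longleftrightarrow> C w (insert (\<tau> m) K) (a(\<tau> m := x)) \<tau>"
        unfolding C_def using False m \<open>length w = n\<close> by (auto simp: nth_list_update inj)
      show ?thesis using False c by (auto simp: G2_def v)
    qed
    have "(\<Sum>m<n. if w ! m = x then if C (w[m := y]) K a \<tau> then f (V (w[m := y]) K b \<tau>) else 0 else 0) =
        (\<Sum>m<n. if \<tau> m \<in> K then G1 \<tau> (\<tau> m) else G2 \<tau> (\<tau> m))"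
      by (intro sum.cong HOL.refl eq) simp
    \<comment> \<open>The sum over positions becomes a sum over slots, through the bijection
      \<open>\<tau>\<close>.\<close>
    also have "\<dots> = (\<Sum>i<n. if i \<in> K then G1 \<tau> i else G2 \<tau> i)"
      using sum.permute[OF \<tau>, of "\<lambda>i. if i \<in> K then G1 \<tau> i else G2 \<tau> i"] by (simp add: o_def)
    also have "\<dots> = (\<Sum>i\<in>K. G1 \<tau> i) + (\<Sum>j\<in>{..<n} - K. G2 \<tau> j)"
      using K by (simp add: sum.If_cases Int_absorb1 Diff_eq)
    finally show ?thesis .
  qed
  have "Eop 1 x y (pattern_op K a b f) w =
      (\<Sum>m<n. \<Sum>\<tau>\<in>?P. if w ! m = x then if C (w[m := y]) K a \<tau> then f (V (w[m := y]) K b \<tau>) else 0 else 0)"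
    unfolding Eop_1_nth True by (intro sum.cong HOL.refl) (simp add: po True)
  also have "\<dots> = (\<Sum>\<tau>\<in>?P. (\<Sum>i\<in>K. G1 \<tau> i) + (\<Sum>j\<in>{..<n} - K. G2 \<tau> j))"
    by (subst sum.swap) (intro sum.cong HOL.refl, simp add: main)
  also have "\<dots> = (\<Sum>i\<in>K. \<Sum>\<tau>\<in>?P. G1 \<tau> i) + (\<Sum>j\<in>{..<n} - K. \<Sum>\<tau>\<in>?P. G2 \<tau> j)"
    unfolding sum.distrib by (intro arg_cong2[where f = "(+)"] sum.swap)
  also have "(\<Sum>i\<in>K. \<Sum>\<tau>\<in>?P. G1 \<tau> i) = (\<Sum>i\<in>K. if a i = y then pattern_op K (a(i := x)) b f w else 0)"
    by (intro sum.cong HOL.refl) (simp add: po[OF True] G1_def)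
  also have "(\<Sum>j\<in>{..<n} - K. \<Sum>\<tau>\<in>?P. G2 \<tau> j) = (\<Sum>j\<in>{..<n} - K. pattern_op (insert j K) (a(j := x)) (b(j := y)) f w)"
    by (intro sum.cong HOL.refl) (simp add: po[OF True] G2_def)
  finally show ?thesis using True by simp
qed

context
  assumes E: "\<And>b i. b \<in> {1..d} \<Longrightarrow> i \<in> {1..<N b} \<Longrightarrow> comm (Eop 1 (b, i) (b, Suc i))"
    and F: "\<And>b i. b \<in> {1..d} \<Longrightarrow> i \<in> {1..<N b} \<Longrightarrow> comm (Eop 1 (b, Suc i) (b, i))"
    and weight: "\<And>w w'. w \<in> tbasis d N n \<Longrightarrow> h (kdelta w) w' \<noteq> 0 \<Longrightarrow> mset w' = mset w"
begin

text \<open>The diagonal unit multiplies a word by the multiplicity of \<open>x\<close>, so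
  preservation of the letter content suffices. This replaces the Cartan generators, whose
  specialization at q = 1 is trivial.\<close>

lemma comm_Eop_diag:
  assumes "x \<in> vbasis d N"
  shows "comm (Eop 1 x x)"
proof -
  have D: "Eop 1 x x v w = of_nat (count (mset w) x) * v w" for v :: "letter list \<Rightarrow> complex" and w
    by (induction w arbitrary: v) (simp_all add: algebra_simps)
  show ?thesis
    unfolding comm_def
  proof (intro ballI conjI)
    fix v :: "letter list \<Rightarrow> complex" assume v: "v \<in> vspace (tbasis d N n)"
    show ov: "Eop 1 x x v \<in> vspace (tbasis d N n)" by (rule Eop_vspace[OF v assms assms])
    show "h (Eop 1 x x v) = Eop 1 x x (h v)"
    proof
      fix w'
      have "h (Eop 1 x x v) w' = (\<Sum>w\<in>tbasis d N n. of_nat (count (mset w) x) * (v w * h (kdelta w) w'))"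
        unfolding endo_alg_matrix[OF finite_tbasis h ov] D by (simp add: mult.assoc)
      also have "\<dots> = (\<Sum>w\<in>tbasis d N n. of_nat (count (mset w') x) * (v w * h (kdelta w) w'))"
      proof (intro sum.cong HOL.refl)
        fix w assume "w \<in> tbasis d N n"
        then show "of_nat (count (mset w) x) * (v w * h (kdelta w) w') = of_nat (count (mset w') x) * (v w * h (kdelta w) w')"
          using weight[of w w'] by (cases "h (kdelta w) w' = 0") auto
      qed
      also have "\<dots> = Eop 1 x x (h v) w'"
        unfolding endo_alg_matrix[OF finite_tbasis h v] D by (simp add: sum_distrib_left)
      finally show "h (Eop 1 x x v) w' = Eop 1 x x (h v) w'" .
    qed
  qed
qed

text \<open>Iterated commutators of the simple root operators give all off-diagonal matrix units of
  one colour.\<close>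

lemma comm_Eop_chain:
  assumes "b \<in> {1..d}" "1 \<le> i" "i < j" "j \<le> N b"
  shows "comm (Eop 1 (b, i) (b, j)) \<and> comm (Eop 1 (b, j) (b, i))"
  using assms(3,4)
proof (induction j)
  case (Suc j)
  show ?case
  proof (cases "i = j")
    case True
    then show ?thesis using E F assms(1,2) Suc.prems by auto
  next
    case False
    then have IH: "comm (Eop 1 (b, i) (b, j))" "comm (Eop 1 (b, j) (b, i))"
      using Suc by auto
    have s: "comm (Eop 1 (b, j) (b, Suc j))" "comm (Eop 1 (b, Suc j) (b, j))"
      using E F assms(1,2) Suc.prems by auto
    have "comm (\<lambda>v w. (- 1) * Eop 1 (b, j) (b, Suc j) (Eop 1 (b, i) (b, j) v) w + Eop 1 (b, i) (b, j) (Eop 1 (b, j) (b, Suc j) v) w)"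
      by (rule comm_linear[OF comm_comp[OF s(1) IH(1)] comm_comp[OF IH(1) s(1)]])
    then have "comm (Eop 1 (b, i) (b, Suc j))"
      by (rule comm_cong) (use Suc.prems in \<open>simp add: Eop_1_commutator[of "(b, i)" "(b, Suc j)"]\<close>)
    moreover have "comm (\<lambda>v w. (- 1) * Eop 1 (b, j) (b, i) (Eop 1 (b, Suc j) (b, j) v) w + Eop 1 (b, Suc j) (b, j) (Eop 1 (b, j) (b, i) v) w)"
      by (rule comm_linear[OF comm_comp[OF IH(2) s(2)] comm_comp[OF s(2) IH(2)]])
    then have "comm (Eop 1 (b, Suc j) (b, i))"
      by (rule comm_cong) (use Suc.prems in \<open>simp add: Eop_1_commutator[of "(b, Suc j)" "(b, i)"]\<close>)
    ultimately show ?thesis ..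
  qed
qed simp

lemma comm_Eop:
  assumes "x \<in> vbasis d N" "y \<in> vbasis d N" "fst x = fst y"
  shows "comm (Eop 1 x y)"
proof -
  obtain b i j where xy: "x = (b, i)" "y = (b, j)" using assms(3) by (cases x; cases y) auto
  consider "i = j" | "i < j" | "j < i" by linarith
  then show ?thesis
  proof cases
    case 1
    then show ?thesis using comm_Eop_diag[OF assms(1)] xy by simp
  next
    case 2
    then show ?thesis using comm_Eop_chain[of b i j] assms xy by (auto simp: vbasis_def)
  next
    case 3
    then show ?thesis using comm_Eop_chain[of b j i] assms xy by (auto simp: vbasis_def)
  qed
qed

lemma comm_pattern_op:
  assumes "K \<subseteq> {..<n}"
    and "\<And>i. i \<in> K \<Longrightarrow> a i \<in> vbasis d N \<and> b i \<in> vbasis d N \<and> fst (a i) = fst (b i)"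
  shows "comm (pattern_op K a b)"
proof -
  have "finite K" using assms(1) finite_subset by blast
  then show ?thesis
    using assms
  proof (induction K arbitrary: a b rule: finite_induct)
    case empty
    have "comm (\<lambda>v. v)" using endo_algD(1)[OF h] by (simp add: comm_def)
    from comm_linear[OF this comm_zero, of "of_nat (fact n)"] show ?case
      by (rule comm_cong) (simp add: pattern_op_empty)
  next
    case (insert k K)
    let ?x = "a k" and ?y = "b k"
    let ?c = "of_nat (card ({..<n} - K)) :: complex"
    have k: "k < n" "K \<subseteq> {..<n}" using insert.prems(1) by auto
    have cD: "?c \<noteq> 0" using k insert.hyps by (auto simp: card_eq_0_iff)
    have xy: "?x \<in> vbasis d N" "?y \<in> vbasis d N" "fst ?x = fst ?y" using insert.prems(2) by auto
    have IH: "comm (pattern_op K a' b)"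
      if "\<And>i. i \<in> K \<Longrightarrow> a' i \<in> vbasis d N \<and> fst (a' i) = fst (b i)" for a'
      using insert.IH[OF k(2), of a' b] that insert.prems(2) by auto
    have c1: "comm (\<lambda>v. Eop 1 ?x ?y (pattern_op K a b v))"
      by (rule comm_comp[OF comm_Eop[OF xy] IH]) (use insert.prems(2) in auto)
    have c2: "comm (\<lambda>v w. \<Sum>i\<in>K. if a i = ?y then pattern_op K (a(i := ?x)) b v w else 0)"
    proof (rule comm_sum[OF insert.hyps(1)])
      fix i assume i: "i \<in> K"
      show "comm (\<lambda>v w. if a i = ?y then pattern_op K (a(i := ?x)) b v w else 0)"
      proof (cases "a i = ?y")
        case True
        have "fst ?x = fst (b i)" using xy(3) True insert.prems(2)[of i] i by auto
        then have "comm (pattern_op K (a(i := ?x)) b)"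
          using insert.prems(2) xy(1) by (intro IH) auto
        then show ?thesis using True by simp
      qed (simp add: comm_zero)
    qed
    have "comm (\<lambda>v w. (- 1 / ?c) * (\<Sum>i\<in>K. if a i = ?y then pattern_op K (a(i := ?x)) b v w else 0) +
        ((1 / ?c) * Eop 1 ?x ?y (pattern_op K a b v) w + 0))"
      by (rule comm_linear[OF c2 comm_linear[OF c1 comm_zero]])
    then show ?case
    proof (rule comm_cong)
      fix v :: "letter list \<Rightarrow> complex" and w
      have "(\<Sum>j\<in>{..<n} - K. pattern_op (insert j K) (a(j := ?x)) (b(j := ?y)) v w) =
          (\<Sum>j\<in>{..<n} - K. pattern_op (insert k K) (a(k := ?x)) (b(k := ?y)) v w)"
        using k insert.hyps by (intro sum.cong HOL.refl pattern_op_shift) auto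
      also have "\<dots> = ?c * pattern_op (insert k K) a b v w" by simp
      finally have eq: "(\<Sum>j\<in>{..<n} - K. pattern_op (insert j K) (a(j := ?x)) (b(j := ?y)) v w) =
          ?c * pattern_op (insert k K) a b v w" .
      show "pattern_op (insert k K) a b v w = (- 1 / ?c) * (\<Sum>i\<in>K. if a i = ?y then pattern_op K (a(i := ?x)) b v w else 0) +
          ((1 / ?c) * Eop 1 ?x ?y (pattern_op K a b v) w + 0)"
      proof (cases "length w = n")
        case True
        let ?S = "\<Sum>i\<in>K. if a i = ?y then pattern_op K (a(i := ?x)) b v w else 0"
        have st: "Eop 1 ?x ?y (pattern_op K a b v) w = ?S + ?c * pattern_op (insert k K) a b v w"
          unfolding pattern_op_step[OF k(2)] eq using True by simp
        show ?thesis unfolding st using cD by (simp add: field_simps)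
      next
        case False
        then show ?thesis unfolding pattern_op_step[OF k(2)] by (simp add: pattern_op_def cong: if_cong)
      qed
    qed
  qed
qed

lemma pattern_op_full:
  assumes "length x = n" "length y = n" "length w = n"
  shows "pattern_op {..<n} (nth x) (nth y) f w =
    (\<Sum>\<tau> | \<tau> permutes {..<n}. if w = permute_list \<tau> x then f (permute_list \<tau> y) else 0)"
proof -
  have 1: "(\<forall>m<n. \<tau> m \<in> {..<n} \<longrightarrow> w ! m = x ! \<tau> m) \<longleftrightarrow> w = permute_list \<tau> x"
    and 2: "map (\<lambda>m. if \<tau> m \<in> {..<n} then y ! \<tau> m else w ! m) [0..<n] = permute_list \<tau> y"
    if "\<tau> permutes {..<n}" for \<tau>
  proof -
    have m: "m < n \<Longrightarrow> \<tau> m < n" for m using permutes_in_image[OF that, of m] by simp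
    show "(\<forall>m<n. \<tau> m \<in> {..<n} \<longrightarrow> w ! m = x ! \<tau> m) \<longleftrightarrow> w = permute_list \<tau> x"
      using assms that m by (auto simp: list_eq_iff_nth_eq permute_list_nth)
    show "map (\<lambda>m. if \<tau> m \<in> {..<n} then y ! \<tau> m else w ! m) [0..<n] = permute_list \<tau> y"
      unfolding permute_list_def assms(2) by (intro map_cong HOL.refl) (simp add: m)
  qed
  show ?thesis
    unfolding pattern_op_def if_P[OF assms(3)]
  proof (rule sum.cong[OF HOL.refl], drule CollectD)
    fix \<tau> assume \<tau>: "\<tau> permutes {..<n}"
    show "(if \<forall>m<n. \<tau> m \<in> {..<n} \<longrightarrow> w ! m = x ! \<tau> m
        then f (map (\<lambda>m. if \<tau> m \<in> {..<n} then y ! \<tau> m else w ! m) [0..<n]) else 0) =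
      (if w = permute_list \<tau> x then f (permute_list \<tau> y) else 0)"
      unfolding 1[OF \<tau>] 2[OF \<tau>] ..
  qed
qed

lemma tbasis_permute: "\<tau> permutes {..<n} \<Longrightarrow> w \<in> tbasis d N n \<Longrightarrow> permute_list \<tau> w \<in> tbasis d N n"
  by (auto simp: tbasis_def set_permute_list)

text \<open>The coefficient at \<open>u\<close> of \<open>h S = S h\<close> applied to the basis
  vector \<open>w\<close>, where \<open>S\<close> is the full symmetrized product taking the letters
  of \<open>y\<close> to those of \<open>x\<close>. Equality of the colour sequences keeps every
  matrix unit inside one colour.\<close>

lemma schur_weyl_identity:
  assumes x: "x \<in> tbasis d N n" and y: "y \<in> tbasis d N n" and u: "u \<in> tbasis d N n" and w: "w \<in> tbasis d N n"
    and col: "map fst x = map fst y"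
  shows "(\<Sum>\<tau> | \<tau> permutes {..<n}. if w = permute_list \<tau> y then h (kdelta (permute_list \<tau> x)) u else 0) =
    (\<Sum>\<tau> | \<tau> permutes {..<n}. if u = permute_list \<tau> x then h (kdelta w) (permute_list \<tau> y) else 0)"
proof -
  let ?S = "pattern_op {..<n} (nth x) (nth y)"
  have len: "length x = n" "length y = n" "length u = n" "length w = n"
    using x y u w by (auto simp: tbasis_def)
  have "fst (x ! i) = fst (y ! i)" if "i < n" for i
    using arg_cong[OF col, of "\<lambda>l. l ! i"] that len by simp
  then have c: "comm ?S"
    using x y len by (intro comm_pattern_op) (auto simp: tbasis_def)
  have kw: "(kdelta w :: _ \<Rightarrow> complex) \<in> vspace (tbasis d N n)" using w by (rule vspace_closed)
  have hS: "h (?S (kdelta w)) = ?S (h (kdelta w))" and Sv: "?S (kdelta w) \<in> vspace (tbasis d N n)"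
    using c kw by (auto simp: comm_def)
  have "?S (h (kdelta w)) u = (\<Sum>\<tau> | \<tau> permutes {..<n}. if u = permute_list \<tau> x then h (kdelta w) (permute_list \<tau> y) else 0)"
    by (rule pattern_op_full[OF len(1-3)])
  moreover have "h (?S (kdelta w)) u = (\<Sum>\<tau> | \<tau> permutes {..<n}. if w = permute_list \<tau> y then h (kdelta (permute_list \<tau> x)) u else 0)"
  proof -
    have "h (?S (kdelta w)) u = (\<Sum>z\<in>tbasis d N n. ?S (kdelta w) z * h (kdelta z) u)"
      by (rule endo_alg_matrix[OF finite_tbasis h Sv])
    also have "\<dots> = (\<Sum>z\<in>tbasis d N n. \<Sum>\<tau> | \<tau> permutes {..<n}.
        if z = permute_list \<tau> x then if w = permute_list \<tau> y then h (kdelta z) u else 0 else 0)"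
    proof (intro sum.cong HOL.refl)
      fix z assume "z \<in> tbasis d N n"
      then have "length z = n" by (simp add: tbasis_def)
      show "?S (kdelta w) z * h (kdelta z) u = (\<Sum>\<tau> | \<tau> permutes {..<n}.
        if z = permute_list \<tau> x then if w = permute_list \<tau> y then h (kdelta z) u else 0 else 0)"
        unfolding pattern_op_full[OF len(1,2) \<open>length z = n\<close>] sum_distrib_right
        by (intro sum.cong HOL.refl) (auto simp: kdelta_def)
    qed
    also have "\<dots> = (\<Sum>\<tau> | \<tau> permutes {..<n}. \<Sum>z\<in>tbasis d N n.
        if z = permute_list \<tau> x then if w = permute_list \<tau> y then h (kdelta z) u else 0 else 0)"
      by (rule sum.swap)
    also have "\<dots> = (\<Sum>\<tau> | \<tau> permutes {..<n}. if w = permute_list \<tau> y then h (kdelta (permute_list \<tau> x)) u else 0)"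
      using x by (intro sum.cong HOL.refl) (simp add: sum.delta tbasis_permute)
    finally show ?thesis .
  qed
  ultimately show ?thesis using hS by simp
qed

text \<open>
  By the previous identity, \<open>h\<close> times the positive definite operator with matrix
  \<open>#{(\<tau>, y). x \<tau> = w, y \<tau> = y}\<close> is the combination of the coloured permutations whose coefficients
  are the traces that vanish by assumption.
\<close>

lemma classical_commutant_null:
  assumes orth: "\<And>c \<tau>. \<tau> permutes {..<n} \<Longrightarrow>
      (\<Sum>w\<in>{w\<in>tbasis d N n. map fst w = c}. h (kdelta (permute_list \<tau> w)) w) = 0"
    and u: "u \<in> tbasis d N n" and z: "z \<in> tbasis d N n"
  shows "h (kdelta z) u = 0"
proof -
  let ?T = "tbasis d N n" and ?P = "{\<tau>. \<tau> permutes {..<n}}"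
  define v where "v x = h (kdelta x) u" for x
  define Cl where "Cl y = {x\<in>?T. map fst x = map fst y}" for y :: "letter list"
  define H where "H y = {\<tau>\<in>?P. permute_list \<tau> y = y}" for y :: "letter list"
  have finP: "finite ?P" by (rule finite_permutations) simp
  have finH: "finite (H y)" for y using finP by (simp add: H_def)
  have finC: "finite (Cl y)" for y by (simp add: Cl_def)
  have len: "length x = n" if "x \<in> ?T" for x using that by (simp add: tbasis_def)
  have col: "map fst (permute_list \<tau> x) = permute_list \<tau> (map fst x)" if "\<tau> permutes {..<n}" "x \<in> ?T" for \<tau> and x
    using that len[OF that(2)] by (simp add: permute_list_map)
  \<comment> \<open>The identity is taken at \<open>w = y\<close> and summed over the colour class.
    On the right each \<open>\<tau>\<close> contributes a trace of \<open>h\<close> against a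
    coloured permutation, zero by assumption; on the left exactly the permutations stabilizing
    \<open>y\<close> survive.\<close>
  have zero: "(\<Sum>y\<in>Cl x. \<Sum>\<tau>\<in>H y. v (permute_list \<tau> x)) = 0" if x: "x \<in> ?T" for x
  proof -
    have "(\<Sum>y\<in>Cl x. \<Sum>\<tau>\<in>H y. v (permute_list \<tau> x)) =
        (\<Sum>y\<in>Cl x. \<Sum>\<tau>\<in>?P. if y = permute_list \<tau> y then h (kdelta (permute_list \<tau> x)) u else 0)"
      unfolding H_def v_def sum.inter_filter[OF finP] by (simp only: eq_commute)
    also have "\<dots> = (\<Sum>y\<in>Cl x. \<Sum>\<tau>\<in>?P. if u = permute_list \<tau> x then h (kdelta y) (permute_list \<tau> y) else 0)"
      using x u by (intro sum.cong HOL.refl schur_weyl_identity) (auto simp: Cl_def)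
    also have "\<dots> = (\<Sum>\<tau>\<in>?P. \<Sum>y\<in>Cl x. if u = permute_list \<tau> x then h (kdelta y) (permute_list \<tau> y) else 0)"
      by (rule sum.swap)
    also have "\<dots> = (\<Sum>\<tau>\<in>?P. 0)"
    proof (rule sum.cong[OF HOL.refl])
      fix \<tau> assume "\<tau> \<in> ?P"
      then have \<tau>: "\<tau> permutes {..<n}" by simp
      then have i\<tau>: "pinv \<tau> permutes {..<n}" by (rule permutes_inv)
      have pp: "permute_list (pinv \<tau>) (permute_list \<tau> y) = y" "permute_list \<tau> (permute_list (pinv \<tau>) y) = y"
        if "length y = n" for y :: "letter list"
      proof -
        have "permute_list (\<tau> \<circ> pinv \<tau>) y = permute_list (pinv \<tau>) (permute_list \<tau> y)"
          using i\<tau> that by (intro permute_list_compose) simp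
        then show "permute_list (pinv \<tau>) (permute_list \<tau> y) = y" by (simp add: permutes_inv_o[OF \<tau>])
        have "permute_list (pinv \<tau> \<circ> \<tau>) y = permute_list \<tau> (permute_list (pinv \<tau>) y)"
          using \<tau> that by (intro permute_list_compose) simp
        then show "permute_list \<tau> (permute_list (pinv \<tau>) y) = y" by (simp add: permutes_inv_o[OF \<tau>])
      qed
      let ?c = "permute_list \<tau> (map fst x)"
      have "(\<Sum>y\<in>Cl x. h (kdelta y) (permute_list \<tau> y)) =
          (\<Sum>w\<in>{w\<in>?T. map fst w = ?c}. h (kdelta (permute_list (pinv \<tau>) w)) w)"
      proof (rule sum.reindex_bij_witness[where i = "permute_list (pinv \<tau>)" and j = "permute_list \<tau>"])
        fix y assume "y \<in> Cl x"
        then have y: "y \<in> ?T" "map fst y = map fst x" by (auto simp: Cl_def)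
        show "permute_list (pinv \<tau>) (permute_list \<tau> y) = y" by (rule pp(1)[OF len[OF y(1)]])
        show "permute_list \<tau> y \<in> {w\<in>?T. map fst w = ?c}"
          using y \<tau> by (simp add: tbasis_permute col)
        show "h (kdelta (permute_list (pinv \<tau>) (permute_list \<tau> y))) (permute_list \<tau> y) = h (kdelta y) (permute_list \<tau> y)"
          by (simp only: pp(1)[OF len[OF y(1)]])
      next
        fix w assume "w \<in> {w\<in>?T. map fst w = ?c}"
        then have w: "w \<in> ?T" "map fst w = ?c" by auto
        show "permute_list \<tau> (permute_list (pinv \<tau>) w) = w" by (rule pp(2)[OF len[OF w(1)]])
        have "permute_list (pinv \<tau>) (permute_list \<tau> (map fst x)) = map fst x"
        proof -
          have "permute_list (\<tau> \<circ> pinv \<tau>) (map fst x) = permute_list (pinv \<tau>) (permute_list \<tau> (map fst x))"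
            using i\<tau> len[OF \<open>x \<in> ?T\<close>] by (intro permute_list_compose) simp
          then show ?thesis by (simp add: permutes_inv_o[OF \<tau>])
        qed
        then show "permute_list (pinv \<tau>) w \<in> Cl x"
          using w i\<tau> by (simp add: Cl_def tbasis_permute col)
      qed
      also have "\<dots> = 0" by (rule orth[OF i\<tau>])
      finally show "(\<Sum>y\<in>Cl x. if u = permute_list \<tau> x then h (kdelta y) (permute_list \<tau> y) else 0) = 0" by (cases "u = permute_list \<tau> x") simp_all
    qed
    finally show ?thesis by simp
  qed
  \<comment> \<open>\<open>v\<close> is a fixed row of \<open>h\<close>. \<open>S y\<close> is the
    sum over the stabilizer of \<open>y\<close> applied to \<open>v\<close>, and \<open>Q y\<close>
    is its Hermitian pairing with \<open>v\<close>.\<close>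
  define Q where "Q y = (\<Sum>x\<in>Cl y. \<Sum>\<tau>\<in>H y. v (permute_list \<tau> x) * cnj (v x))" for y
  define S where "S y x = (\<Sum>\<tau>\<in>H y. v (permute_list \<tau> x))" for y x
  have Hgrp: "\<tau> permutes {..<n}" "pinv \<tau> \<in> H y" "\<rho> \<in> H y \<Longrightarrow> \<rho> \<circ> \<tau> \<in> H y" if "\<tau> \<in> H y" "y \<in> ?T" for \<tau> \<rho> y
  proof -
    show \<tau>: "\<tau> permutes {..<n}" using that by (simp add: H_def)
    have i\<tau>: "pinv \<tau> permutes {..<n}" by (rule permutes_inv[OF \<tau>])
    have "permute_list (\<tau> \<circ> pinv \<tau>) y = permute_list (pinv \<tau>) (permute_list \<tau> y)"
      using i\<tau> len[OF that(2)] by (intro permute_list_compose) simp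
    then have "permute_list (pinv \<tau>) y = y" using that by (simp add: H_def permutes_inv_o[OF \<tau>])
    then show "pinv \<tau> \<in> H y" using i\<tau> by (simp add: H_def)
    assume \<rho>: "\<rho> \<in> H y"
    have "permute_list (\<rho> \<circ> \<tau>) y = permute_list \<tau> (permute_list \<rho> y)"
      using \<tau> len[OF that(2)] by (intro permute_list_compose) simp
    then show "\<rho> \<circ> \<tau> \<in> H y" using \<rho> that \<tau> by (simp add: H_def permutes_compose)
  qed
  \<comment> \<open>The sum over a finite group of permutations is self-adjoint, and its square is
    the group order times itself. Elements of the stabilizer fix the colours of \<open>y\<close>, so
    they permute the colour class.\<close>
  have quad: "(\<Sum>x\<in>Cl y. S y x * cnj (S y x)) = of_nat (card (H y)) * Q y" if y: "y \<in> ?T" for y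
  proof -
    have "(\<Sum>x\<in>Cl y. S y x * cnj (S y x)) =
        (\<Sum>x\<in>Cl y. \<Sum>\<tau>\<in>H y. \<Sum>\<rho>\<in>H y. v (permute_list \<tau> x) * cnj (v (permute_list \<rho> x)))"
      by (simp add: S_def sum_product)
    also have "\<dots> = (\<Sum>x\<in>Cl y. \<Sum>\<rho>\<in>H y. \<Sum>\<tau>\<in>H y. v (permute_list \<tau> x) * cnj (v (permute_list \<rho> x)))"
      by (intro sum.cong HOL.refl sum.swap)
    also have "\<dots> = (\<Sum>\<rho>\<in>H y. \<Sum>x\<in>Cl y. \<Sum>\<tau>\<in>H y. v (permute_list \<tau> x) * cnj (v (permute_list \<rho> x)))"
      by (rule sum.swap)
    also have "\<dots> = (\<Sum>\<rho>\<in>H y. Q y)"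
    proof (rule sum.cong[OF HOL.refl])
      fix \<rho> assume \<rho>: "\<rho> \<in> H y"
      note R = Hgrp[OF \<rho> y]
      have bij\<rho>: "\<rho> \<circ> pinv \<rho> = id" "pinv \<rho> \<circ> \<rho> = id" using permutes_inv_o[OF R(1)] by auto
      have yc: "permute_list \<rho> (map fst y) = map fst y" "permute_list (pinv \<rho>) (map fst y) = map fst y"
        using \<rho> R(2) y col[OF R(1) y] col[OF permutes_inv[OF R(1)] y] by (auto simp: H_def)
      have pl: "permute_list \<sigma> (permute_list \<tau> x) = permute_list (\<tau> \<circ> \<sigma>) x" if "\<sigma> permutes {..<n}" "x \<in> ?T" for \<sigma> \<tau> x
        using that len[OF that(2)] by (intro permute_list_compose[symmetric]) simp
      have "(\<Sum>x\<in>Cl y. \<Sum>\<tau>\<in>H y. v (permute_list \<tau> x) * cnj (v (permute_list \<rho> x))) =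
          (\<Sum>x\<in>Cl y. \<Sum>\<tau>\<in>H y. v (permute_list \<tau> (permute_list (pinv \<rho>) x)) * cnj (v x))"
      proof (rule sum.reindex_bij_witness[where i = "permute_list (pinv \<rho>)" and j = "permute_list \<rho>"])
        fix x assume "x \<in> Cl y"
        then have x: "x \<in> ?T" "map fst x = map fst y" by (auto simp: Cl_def)
        note i\<rho> = permutes_inv[OF R(1)]
        show 1: "permute_list (pinv \<rho>) (permute_list \<rho> x) = x" using x i\<rho> by (simp add: pl bij\<rho>)
        show "permute_list \<rho> (permute_list (pinv \<rho>) x) = x" using x R(1) by (simp add: pl bij\<rho>)
        show "permute_list \<rho> x \<in> Cl y" "permute_list (pinv \<rho>) x \<in> Cl y"
          using x R(1) i\<rho> yc by (simp_all add: Cl_def tbasis_permute col)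
        show "(\<Sum>\<tau>\<in>H y. v (permute_list \<tau> (permute_list (pinv \<rho>) (permute_list \<rho> x))) * cnj (v (permute_list \<rho> x))) =
            (\<Sum>\<tau>\<in>H y. v (permute_list \<tau> x) * cnj (v (permute_list \<rho> x)))" unfolding 1 ..
      qed
      also have "\<dots> = Q y"
        unfolding Q_def
      proof (rule sum.cong[OF HOL.refl])
        fix x assume "x \<in> Cl y"
        then have x: "x \<in> ?T" by (simp add: Cl_def)
        show "(\<Sum>\<tau>\<in>H y. v (permute_list \<tau> (permute_list (pinv \<rho>) x)) * cnj (v x)) =
            (\<Sum>\<tau>\<in>H y. v (permute_list \<tau> x) * cnj (v x))"
        proof (rule sum.reindex_bij_witness[where i = "\<lambda>\<tau>. \<rho> \<circ> \<tau>" and j = "\<lambda>\<tau>. pinv \<rho> \<circ> \<tau>"])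
          fix \<tau> assume \<tau>: "\<tau> \<in> H y"
          show "\<rho> \<circ> (pinv \<rho> \<circ> \<tau>) = \<tau>" "pinv \<rho> \<circ> (\<rho> \<circ> \<tau>) = \<tau>" by (simp_all add: o_assoc bij\<rho>)
          show "pinv \<rho> \<circ> \<tau> \<in> H y" "\<rho> \<circ> \<tau> \<in> H y" using Hgrp(3)[OF \<tau> y] R(2) \<rho> by blast+
          show "v (permute_list (pinv \<rho> \<circ> \<tau>) x) * cnj (v x) = v (permute_list \<tau> (permute_list (pinv \<rho>) x)) * cnj (v x)"
            using pl[OF Hgrp(1)[OF \<tau> y] x] by simp
        qed
      qed
      finally show "(\<Sum>x\<in>Cl y. \<Sum>\<tau>\<in>H y. v (permute_list \<tau> x) * cnj (v (permute_list \<rho> x))) = Q y" .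
    qed
    finally show ?thesis by simp
  qed
  have idH: "id \<in> H y" for y by (simp add: H_def permutes_id)
  have cardH: "card (H y) > 0" for y using idH finH by (auto simp: card_gt_0_iff)
  define B where "B y = (\<Sum>x\<in>Cl y. (cmod (S y x))\<^sup>2) / card (H y)" for y
  have QB: "Q y = of_real (B y)" if "y \<in> ?T" for y
  proof -
    have "of_nat (card (H y)) * Q y = of_real (\<Sum>x\<in>Cl y. (cmod (S y x))\<^sup>2)"
      unfolding quad[OF that, symmetric] by (simp add: complex_norm_square del: of_real_power)
    then show ?thesis using cardH[of y] by (simp add: B_def field_simps)
  qed
  \<comment> \<open>Exchanging the two sums turns the total of the \<open>Q y\<close> into the
    vanishing sums \<open>zero\<close>, each paired with a value of \<open>v\<close>. Since every
    \<open>Q y\<close> is a nonnegative real, all of them vanish.\<close>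
  have "(\<Sum>y\<in>?T. Q y) = (\<Sum>y\<in>?T. \<Sum>x\<in>?T. if map fst x = map fst y then S y x * cnj (v x) else 0)"
  proof (intro sum.cong HOL.refl)
    fix y
    have "Q y = (\<Sum>x\<in>Cl y. S y x * cnj (v x))" by (simp add: Q_def S_def sum_distrib_right)
    then show "Q y = (\<Sum>x\<in>?T. if map fst x = map fst y then S y x * cnj (v x) else 0)"
      by (simp add: Cl_def sum.inter_filter)
  qed
  also have "\<dots> = (\<Sum>x\<in>?T. \<Sum>y\<in>?T. if map fst x = map fst y then S y x * cnj (v x) else 0)"
    by (rule sum.swap)
  also have "\<dots> = (\<Sum>x\<in>?T. 0)"
  proof (rule sum.cong[OF HOL.refl])
    fix x assume x: "x \<in> ?T"
    have "(\<Sum>y\<in>?T. if map fst x = map fst y then S y x * cnj (v x) else 0) = (\<Sum>y\<in>Cl x. S y x) * cnj (v x)"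
      unfolding sum_distrib_right Cl_def sum.inter_filter[OF finite_tbasis] by (intro sum.cong HOL.refl) auto
    also have "\<dots> = 0" using zero[OF x] by (simp add: S_def)
    finally show "(\<Sum>y\<in>?T. if map fst x = map fst y then S y x * cnj (v x) else 0) = 0" .
  qed
  finally have "(\<Sum>y\<in>?T. Q y) = 0" by simp
  then have "of_real (\<Sum>y\<in>?T. B y) = (0 :: complex)" using QB by simp
  then have "(\<Sum>y\<in>?T. B y) = 0" by (simp only: of_real_eq_0_iff)
  moreover have B0: "B y \<ge> 0" for y by (simp add: B_def sum_nonneg)
  ultimately have "B z = 0" using sum_nonneg_eq_0_iff[of ?T B] z by auto
  then have "(\<Sum>x\<in>Cl z. (cmod (S z x))\<^sup>2) = 0" using cardH[of z] by (simp add: B_def)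
  moreover have "z \<in> Cl z" using z by (simp add: Cl_def)
  ultimately have "(cmod (S z z))\<^sup>2 = 0" using sum_nonneg_eq_0_iff[OF finC, of z "\<lambda>x. (cmod (S z x))\<^sup>2"] by auto
  \<comment> \<open>At the word \<open>z\<close> itself all elements of the stabilizer act
    trivially, so the stabilizer sum returns \<open>v z\<close> up to a nonzero integer.\<close>
  moreover have "S z z = of_nat (card (H z)) * v z"
  proof -
    have "S z z = (\<Sum>\<tau>\<in>H z. v z)" unfolding S_def by (intro sum.cong HOL.refl) (simp add: H_def)
    then show ?thesis by simp
  qed
  ultimately show ?thesis using cardH[of z] by (simp add: v_def)
qed

end

end

section \<open>Reduced words in normal form\<close>

text \<open>Normal forms for the symmetric group on k + 1 letters: a normal form for the first k
  letters followed by a coset representative, the descending run from k to j. The value j = k + 1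
  gives the empty run.\<close>

fun cws :: "nat \<Rightarrow> nat list set" where
  "cws 0 = {[]}"
| "cws (Suc k) = (\<Union>u\<in>cws k. \<Union>j\<in>{1..Suc (Suc k)}. {u @ rev [j..<Suc (Suc k)]})"

lemma cws_SucI: "u \<in> cws k \<Longrightarrow> 1 \<le> j \<Longrightarrow> j \<le> Suc (Suc k) \<Longrightarrow> u @ rev [j..<Suc (Suc k)] \<in> cws (Suc k)"
  by (simp del: upt_Suc) (rule bexI[of _ u], rule bexI[of _ j], auto)

lemma cws_SucE:
  assumes "u \<in> cws (Suc k)"
  obtains u0 j where "u0 \<in> cws k" "1 \<le> j" "j \<le> Suc (Suc k)" "u = u0 @ rev [j..<Suc (Suc k)]"
  using assms by (auto simp del: upt_Suc)

lemma cws_set: "u \<in> cws k \<Longrightarrow> set u \<subseteq> {1..k}"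
proof (induction k arbitrary: u)
  case (Suc k)
  from Suc.prems obtain u0 j where u: "u0 \<in> cws k" "1 \<le> j" "u = u0 @ rev [j..<Suc (Suc k)]"
    by (rule cws_SucE)
  have "set u = set u0 \<union> {j..<Suc (Suc k)}" using u by (simp del: upt_Suc)
  moreover have "set u0 \<subseteq> {1..k}" by (rule Suc.IH[OF u(1)])
  ultimately show ?case using u(2) by auto
qed simp

lemma cws_finite: "finite (cws k)"
  by (induction k) (auto simp del: upt_Suc)

lemma cws_Nil: "[] \<in> cws k"
proof (induction k)
  case (Suc k)
  from cws_SucI[OF this, of "Suc (Suc k)"] show ?case by simp
qed simp

text \<open>Generators are numbered from 1 and positions from 0, hence the shift. The first
  generator of the word acts first, which is the order in which \<open>Sop\<close> operators
  rearrange the argument of a coordinate function.\<close>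

fun act :: "nat list \<Rightarrow> 'a list \<Rightarrow> 'a list" where
  "act [] w = w"
| "act (i # u) w = act u (swp (i - 1) w)"

lemma act_append: "act (u @ v) w = act v (act u w)"
  by (induction u arbitrary: w) auto

lemma length_act [simp]: "length (act u w) = length w"
  by (induction u arbitrary: w) auto

lemma act_map: "set u \<subseteq> {1..<length w} \<Longrightarrow> act u (map f w) = map f (act u w)"
proof (induction u arbitrary: w)
  case (Cons i u)
  then have "Suc (i - 1) < length w" "set u \<subseteq> {1..<length (swp (i - 1) w)}" by auto
  then show ?case using Cons.IH[of "swp (i - 1) w"] by (simp add: map_swp)
qed simp

lemma mset_act: "set u \<subseteq> {1..<length w} \<Longrightarrow> mset (act u w) = mset w"
proof (induction u arbitrary: w)
  case (Cons i u)
  then have "Suc (i - 1) < length w" "set u \<subseteq> {1..<length (swp (i - 1) w)}" by auto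
  then show ?case using Cons.IH[of "swp (i - 1) w"] by simp
qed simp

lemma swp_append: "length a = r \<Longrightarrow> swp r (a @ y # z # v) = a @ z # y # v"
  by (simp add: swp_def nth_append list_update_append)

text \<open>A descending run carries a single letter leftwards past a block and leaves the order of
  the block unchanged.\<close>

lemma act_desc:
  assumes "length a = j - 1" "1 \<le> j"
  shows "act (rev [j..<j + length b]) (a @ b @ z # v) = a @ z # b @ v"
proof (induction b arbitrary: v rule: rev_induct)
  case (snoc y b)
  have "rev [j..<j + length (b @ [y])] = (j + length b) # rev [j..<j + length b]" by simp
  moreover have "swp (j + length b - 1) ((a @ b) @ y # z # v) = (a @ b) @ z # y # v"
    using assms by (intro swp_append) simp
  ultimately show ?case using snoc.IH[of "y # v"] by simp
qed simp

text \<open>Insertion sort: the first letters are arranged by a shorter normal form, then the last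
  letter is carried to its place by the final run. The tail \<open>v\<close> is the untouched rest
  that the recursion requires.\<close>

lemma cws_act_exists:
  assumes "length w = Suc k" "mset p = mset w"
  shows "\<exists>u\<in>cws k. act u (w @ v) = p @ v"
  using assms
proof (induction k arbitrary: w p v)
  case 0
  then obtain x where "w = [x]" by (cases w) auto
  with 0 have "p = w" by simp
  then show ?case by simp
next
  case (Suc k)
  then have "w \<noteq> []" by auto
  then obtain x z where w: "w = x @ [z]" by (metis rev_exhaust)
  have "z \<in> set p" using Suc.prems w by (metis in_set_conv_decomp set_mset_mset)
  then obtain a b where p: "p = a @ z # b" by (meson split_list)
  have x: "length x = Suc k" "mset (a @ b) = mset x" using Suc.prems by (auto simp: w p)
  from Suc.IH[OF this, of "[z] @ v"] obtain u where u: "u \<in> cws k" "act u (x @ [z] @ v) = (a @ b) @ [z] @ v" by blast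
  have "length a + length b = Suc k" using x mset_eq_length[OF x(2)] by simp
  then have j: "Suc (length a) + length b = Suc (Suc k)" by simp
  have "act (u @ rev [Suc (length a)..<Suc (Suc k)]) (w @ v) = act (rev [Suc (length a)..<Suc (length a) + length b]) (a @ b @ z # v)"
    unfolding act_append j using u(2) by (simp add: w del: upt_Suc)
  also have "\<dots> = a @ z # b @ v" by (rule act_desc) simp_all
  finally have "act (u @ rev [Suc (length a)..<Suc (Suc k)]) (w @ v) = p @ v" by (simp add: p)
  moreover have "u @ rev [Suc (length a)..<Suc (Suc k)] \<in> cws (Suc k)"
    using u(1) j by (intro cws_SucI) simp_all
  ultimately show ?case by blast
qed

lemma cws_act_shape:
  assumes "u \<in> cws k" "length w = Suc k"
  shows "\<exists>p. mset p = mset w \<and> act u (w @ v) = p @ v"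
  using assms
proof (induction k arbitrary: u w v)
  case (Suc k)
  obtain u0 j where u: "u0 \<in> cws k" "1 \<le> j" "j \<le> Suc (Suc k)" "u = u0 @ rev [j..<Suc (Suc k)]"
    using Suc.prems(1) by (rule cws_SucE)
  have "w \<noteq> []" using Suc.prems by auto
  then obtain x z where w: "w = x @ [z]" by (metis rev_exhaust)
  have lx: "length x = Suc k" using Suc.prems w by simp
  from Suc.IH[OF u(1) this, of "[z] @ v"] obtain p where p: "mset p = mset x" "act u0 (x @ [z] @ v) = p @ [z] @ v" by blast
  define a b where "a = take (j - 1) p" and "b = drop (j - 1) p"
  have lp: "length p = Suc k" using p(1) lx mset_eq_length by metis
  then have ab: "p = a @ b" "length a = j - 1" "j + length b = Suc (Suc k)" using u(2,3) by (auto simp: a_def b_def)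
  have "act u (w @ v) = act (rev [j..<j + length b]) (a @ b @ z # v)"
    unfolding u(4) act_append ab(3) using p(2) by (simp add: w ab(1) del: upt_Suc)
  also have "\<dots> = a @ z # b @ v" by (rule act_desc[OF ab(2) u(2)])
  finally show ?case using p(1) by (intro exI[of _ "a @ z # b"]) (simp add: w ab(1))
qed auto

text \<open>For distinct letters the final place of the last letter determines the run, and deleting
  that letter leaves the result of the shorter word.\<close>

lemma cws_act_inj:
  assumes "u \<in> cws k" "u' \<in> cws k" "length w = Suc k" "distinct w" "act u (w @ v) = act u' (w @ v)"
  shows "u = u'"
  using assms
proof (induction k arbitrary: u u' w v)
  case (Suc k)
  have "w \<noteq> []" using Suc.prems by auto
  then obtain x z where w: "w = x @ [z]" by (metis rev_exhaust)
  have lx: "length x = Suc k" "distinct x" "z \<notin> set x" using Suc.prems w by simp_all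
  have nf: "\<exists>u0 a b. u0 \<in> cws k \<and> u = u0 @ rev [Suc (length a)..<Suc (Suc k)] \<and> act u0 (x @ z # v) = a @ b @ z # v \<and>
      z \<notin> set a \<and> z \<notin> set b \<and> act u (w @ v) = a @ z # b @ v \<and> length a + length b = Suc k"
    if u: "u \<in> cws (Suc k)" for u
  proof -
    obtain u0 j where u: "u0 \<in> cws k" "1 \<le> j" "j \<le> Suc (Suc k)" "u = u0 @ rev [j..<Suc (Suc k)]"
      using u by (rule cws_SucE)
    from cws_act_shape[OF u(1) lx(1), of "z # v"] obtain p where p: "mset p = mset x" "act u0 (x @ z # v) = p @ z # v" by blast
    define a b where "a = take (j - 1) p" and "b = drop (j - 1) p"
    have lp: "length p = Suc k" using p(1) lx mset_eq_length by metis
    then have ab: "p = a @ b" "length a = j - 1" "j + length b = Suc (Suc k)" using u(2,3) by (auto simp: a_def b_def)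
    have "act u (w @ v) = act (rev [j..<j + length b]) (a @ b @ z # v)"
      unfolding u(4) act_append ab(3) using p(2) by (simp add: w ab(1) del: upt_Suc)
    also have "\<dots> = a @ z # b @ v" by (rule act_desc[OF ab(2) u(2)])
    finally have 1: "act u (w @ v) = a @ z # b @ v" .
    have "z \<notin> set p" using p(1) lx(3) by (metis set_mset_mset)
    then have 2: "z \<notin> set a" "z \<notin> set b" using ab(1) by auto
    have 3: "Suc (length a) = j" using ab(2) u(2) by simp
    show ?thesis
      by (rule exI[of _ u0], rule exI[of _ a], rule exI[of _ b])
        (use u(1,4) p(2) ab(1) 1 2 3 lp in \<open>simp del: upt_Suc\<close>)
  qed
  obtain u0 a b where u0: "u0 \<in> cws k" "u = u0 @ rev [Suc (length a)..<Suc (Suc k)]" "act u0 (x @ z # v) = a @ b @ z # v"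
    "z \<notin> set a" "z \<notin> set b" "act u (w @ v) = a @ z # b @ v" "length a + length b = Suc k"
    using nf[OF Suc.prems(1)] by (elim exE conjE)
  obtain u0' a' b' where u0': "u0' \<in> cws k" "u' = u0' @ rev [Suc (length a')..<Suc (Suc k)]" "act u0' (x @ z # v) = a' @ b' @ z # v"
    "z \<notin> set a'" "z \<notin> set b'" "act u' (w @ v) = a' @ z # b' @ v" "length a' + length b' = Suc k"
    using nf[OF Suc.prems(2)] by (elim exE conjE)
  have "(a @ z # b) @ v = (a' @ z # b') @ v" using Suc.prems(5) u0(6) u0'(6) by simp
  then have "a @ z # b = a' @ z # b'" by (simp only: append_same_eq)
  then have ab: "a = a'" "b = b'"
    using append_Cons_eq_iff[of z a b a' b'] u0(4,5) u0'(4,5) by auto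
  have "act u0 (x @ z # v) = act u0' (x @ z # v)" using u0(3) u0'(3) ab by simp
  from Suc.IH[OF u0(1) u0'(1) lx(1,2) this] show ?case using u0(2) u0'(2) ab by simp
qed simp

text \<open>The action on \<open>[0..<n]\<close> determines the action on every word of length n,
  because exchanging positions commutes with renaming letters.\<close>

lemma cws_permutation:
  assumes \<pi>: "\<pi> permutes {..<n}" and n: "n \<ge> 1"
  shows "\<exists>u\<in>cws (n - 1). \<forall>w. length w = n \<longrightarrow> act u w = permute_list \<pi> w"
proof -
  have l: "length [0..<n] = Suc (n - 1)" using n by simp
  have "mset (permute_list \<pi> [0..<n]) = mset [0..<n]" using \<pi> by (intro mset_permute_list) simp
  from cws_act_exists[OF l this, of "[]"] obtain u where u: "u \<in> cws (n - 1)" "act u [0..<n] = permute_list \<pi> [0..<n]" by auto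
  have "act u w = permute_list \<pi> w" if w: "length w = n" for w :: "'b list"
  proof -
    have s: "set u \<subseteq> {1..<length [0..<n]}" by (rule order_trans[OF cws_set[OF u(1)]]) (use n in auto)
    have "act u w = act u (map (nth w) [0..<n])" using w by (metis map_nth)
    also have "\<dots> = map (nth w) (permute_list \<pi> [0..<n])" by (simp only: act_map[OF s] u(2))
    also have "\<dots> = permute_list \<pi> (map (nth w) [0..<n])" using \<pi> by (intro permute_list_map[symmetric]) simp
    finally show ?thesis using w by (metis map_nth)
  qed
  then show ?thesis using u(1) by (intro bexI[of _ u]) auto
qed

section \<open>A spanning set of the Yokonuma--Hecke algebra\<close>

text \<open>The relations in the form used for straightening. The element E_i appears only through
  its membership in the span of words in the t's, and the power relation bounds the
  exponents.\<close>

locale yh_presentation = kalgebra Y for Y :: "('k::field, 'a) module" (structure) +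
  fixes d n :: nat and s t :: "nat \<Rightarrow> 'a"
  assumes d: "d \<ge> 1" and n: "n \<ge> 1"
    and s_closed: "i \<in> {1..<n} \<Longrightarrow> s i \<in> carrier Y"
    and t_closed: "i \<in> {1..n} \<Longrightarrow> t i \<in> carrier Y"
    and s_far: "i \<in> {1..<n} \<Longrightarrow> j \<in> {1..<n} \<Longrightarrow> Suc i < j \<Longrightarrow> s i \<otimes> s j = s j \<otimes> s i"
    and s_braid: "1 \<le> i \<Longrightarrow> Suc i < n \<Longrightarrow> s i \<otimes> (s (Suc i) \<otimes> s i) = s (Suc i) \<otimes> (s i \<otimes> s (Suc i))"
    and t_comm: "i \<in> {1..n} \<Longrightarrow> j \<in> {1..n} \<Longrightarrow> t i \<otimes> t j = t j \<otimes> t i"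
    and t_pow: "i \<in> {1..n} \<Longrightarrow> t i [^] d = \<one>"
    and s_t: "i \<in> {1..<n} \<Longrightarrow> j \<in> {1..n} \<Longrightarrow> s i \<otimes> t j = t (Transposition.transpose i (Suc i) j) \<otimes> s i"
    and quad: "i \<in> {1..<n} \<Longrightarrow> \<exists>e\<in>lspan Y (word_eval t ` lists {1..n}). s i \<otimes> s i = e \<otimes> s i \<oplus> \<one>"
begin

abbreviation tw :: "nat list \<Rightarrow> 'a" where "tw \<equiv> word_eval t"
abbreviation sw :: "nat list \<Rightarrow> 'a" where "sw \<equiv> word_eval s"

lemma tw_closed: "v \<in> lists {1..n} \<Longrightarrow> tw v \<in> carrier Y"
  by (rule word_eval_closed[of "{1..n}"]) (auto simp: t_closed)

lemma sw_closed: "u \<in> lists {1..<n} \<Longrightarrow> sw u \<in> carrier Y"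
  by (rule word_eval_closed[of "{1..<n}"]) (auto simp: s_closed)

lemma tw_append: "v \<in> lists {1..n} \<Longrightarrow> v' \<in> lists {1..n} \<Longrightarrow> tw (v @ v') = tw v \<otimes> tw v'"
  by (rule word_eval_append[of "{1..n}"]) (auto simp: t_closed)

lemma sw_append: "u \<in> lists {1..<n} \<Longrightarrow> u' \<in> lists {1..<n} \<Longrightarrow> sw (u @ u') = sw u \<otimes> sw u'"
  by (rule word_eval_append[of "{1..<n}"]) (auto simp: s_closed)

definition TS :: "'a set" where "TS = lspan Y (tw ` lists {1..n})"

lemma tw_image: "tw ` lists {1..n} \<subseteq> carrier Y"
  using tw_closed by auto

lemma TS_closed: "x \<in> TS \<Longrightarrow> x \<in> carrier Y"
  unfolding TS_def by (rule lspan_carrier[OF tw_image])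

lemma TS_mult:
  assumes "x \<in> TS" "y \<in> TS"
  shows "x \<otimes> y \<in> TS"
  unfolding TS_def
proof (rule lspan_mult_right[OF tw_image tw_image TS_closed[OF assms(2)] _ assms(1)[unfolded TS_def]])
  fix x assume "x \<in> tw ` lists {1..n}"
  then obtain v where v: "v \<in> lists {1..n}" "x = tw v" by auto
  show "x \<otimes> y \<in> lspan Y (tw ` lists {1..n})"
  proof (rule lspan_mult_left[OF tw_image tw_image _ _ assms(2)[unfolded TS_def]])
    show "x \<in> carrier Y" using v tw_closed by simp
    fix z assume "z \<in> tw ` lists {1..n}"
    then obtain v' where v': "v' \<in> lists {1..n}" "z = tw v'" by auto
    have "x \<otimes> z = tw (v @ v')" using v v' by (simp add: tw_append)
    then show "x \<otimes> z \<in> lspan Y (tw ` lists {1..n})"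
      using v v' by (intro lspan_incl[OF tw_image]) auto
  qed
qed

lemma TS_one: "\<one> \<in> TS"
  unfolding TS_def by (rule lspan_incl[OF tw_image]) (auto intro: image_eqI[of _ _ "[]"])

lemma TS_t: "i \<in> {1..n} \<Longrightarrow> t i \<in> TS"
  unfolding TS_def using t_closed by (intro lspan_incl[OF tw_image]) (auto intro!: image_eqI[of _ _ "[i]"])

text \<open>Conjugation by s_i permutes the t's, so s_i can be moved to the right of any element of
  the torus algebra at the cost of changing that element.\<close>

lemma s_TS:
  assumes "i \<in> {1..<n}" "x \<in> TS"
  shows "\<exists>x'\<in>TS. s i \<otimes> x = x' \<otimes> s i"
proof -
  have w: "\<exists>x'\<in>TS. s i \<otimes> tw v = x' \<otimes> s i" if "v \<in> lists {1..n}" for v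
    using that
  proof (induction v)
    case Nil
    then show ?case using TS_one s_closed[OF assms(1)] by (intro bexI[of _ "\<one>"]) auto
  next
    case (Cons j v)
    then obtain x' where x': "x' \<in> TS" "s i \<otimes> tw v = x' \<otimes> s i" by auto
    have j: "j \<in> {1..n}" using Cons by auto
    let ?j = "Transposition.transpose i (Suc i) j"
    have j': "?j \<in> {1..n}" using j assms(1) by (auto simp: Transposition.transpose_def)
    note c = s_closed[OF assms(1)] t_closed[OF j] t_closed[OF j'] tw_closed[of v] TS_closed[OF x'(1)]
    have "s i \<otimes> tw (j # v) = (s i \<otimes> t j) \<otimes> tw v" using c Cons by (simp add: m_assoc)
    also have "\<dots> = t ?j \<otimes> (s i \<otimes> tw v)" using c Cons by (simp add: s_t[OF assms(1) j] m_assoc)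
    also have "\<dots> = (t ?j \<otimes> x') \<otimes> s i" using c by (simp add: x'(2) m_assoc)
    finally show ?case using TS_mult[OF TS_t[OF j'] x'(1)] by blast
  qed
  show ?thesis
    using assms(2) unfolding TS_def
  proof induction
    case zero
    then show ?case using lspan.zero[of Y] s_closed[OF assms(1)] by (intro bexI[of _ "\<zero>"]) auto
  next
    case (step x v c)
    then obtain v' where v': "v' \<in> TS" "s i \<otimes> v = v' \<otimes> s i" unfolding TS_def by blast
    from step obtain x' where x': "x' \<in> TS" "s i \<otimes> x = x' \<otimes> s i" using w by blast
    have cl: "x \<in> carrier Y" "v \<in> carrier Y" "x' \<in> carrier Y" "v' \<in> carrier Y" "s i \<in> carrier Y"
      using step tw_image TS_closed[OF x'(1)] TS_closed[OF v'(1)] lspan_carrier[OF tw_image] s_closed[OF assms(1)] by auto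
    have "s i \<otimes> (c \<odot> x \<oplus> v) = (c \<odot> x' \<oplus> v') \<otimes> s i"
      using cl by (simp add: r_distr l_distr smult_mult_l smult_mult_r x' v')
    moreover have "c \<odot> x' \<oplus> v' \<in> TS"
      using x'(1) v'(1) unfolding TS_def by (intro lspan_add lspan_smult tw_image)
    ultimately show ?case unfolding TS_def by blast
  qed
qed

lemma sw_TS:
  assumes "u \<in> lists {1..<n}" "x \<in> TS"
  shows "\<exists>x'\<in>TS. sw u \<otimes> x = x' \<otimes> sw u"
  using assms
proof (induction u arbitrary: x rule: list.induct)
  case Nil
  then show ?case using TS_closed by (intro bexI[of _ x]) auto
next
  case (Cons i u)
  then obtain x' where x': "x' \<in> TS" "sw u \<otimes> x = x' \<otimes> sw u" by auto
  have i: "i \<in> {1..<n}" and u: "u \<in> lists {1..<n}" using Cons by auto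
  obtain x'' where x'': "x'' \<in> TS" "s i \<otimes> x' = x'' \<otimes> s i" using s_TS[OF i x'(1)] by blast
  note c = s_closed[OF i] sw_closed[OF u] TS_closed[OF Cons.prems(2)] TS_closed[OF x'(1)] TS_closed[OF x''(1)]
  have "sw (i # u) \<otimes> x = s i \<otimes> (x' \<otimes> sw u)" using c by (simp add: m_assoc x'(2))
  also have "\<dots> = (s i \<otimes> x') \<otimes> sw u" using c by (simp add: m_assoc)
  also have "\<dots> = x'' \<otimes> sw (i # u)" using c by (simp add: x''(2) m_assoc)
  finally show ?case using x''(1) by blast
qed

lemma s_far': "i \<in> {1..<n} \<Longrightarrow> j \<in> {1..<n} \<Longrightarrow> Suc i < j \<or> Suc j < i \<Longrightarrow> s i \<otimes> s j = s j \<otimes> s i"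
  using s_far[of i j] s_far[of j i] by auto

lemma sw_far:
  assumes "u \<in> lists {1..<n}" "i \<in> {1..<n}" "\<And>j. j \<in> set u \<Longrightarrow> Suc i < j \<or> Suc j < i"
  shows "sw u \<otimes> s i = s i \<otimes> sw u"
  using assms(1,3)
proof (induction u rule: list.induct)
  case (Cons j u)
  have j: "j \<in> {1..<n}" and u: "u \<in> lists {1..<n}" using Cons by auto
  note c = s_closed[OF assms(2)] s_closed[OF j] sw_closed[OF u]
  have "sw (j # u) \<otimes> s i = s j \<otimes> (sw u \<otimes> s i)" using c by (simp add: m_assoc)
  also have "\<dots> = (s j \<otimes> s i) \<otimes> sw u" using c Cons by (simp add: m_assoc)
  also have "s j \<otimes> s i = s i \<otimes> s j" using Cons.prems(2)[of j] j assms(2) by (intro s_far') auto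
  finally show ?case using c by (simp add: m_assoc)
qed (simp add: s_closed[OF assms(2)])

text \<open>On its way left through the run, \<open>s i\<close> commutes with everything up to its
  two neighbours. One braid relation turns it into \<open>s (i - 1)\<close>, which commutes with the
  rest.\<close>

lemma sw_desc_braid:
  assumes "1 \<le> j" "j < i" "i \<le> m" "m < n"
  shows "sw (rev [j..<Suc m]) \<otimes> s i = s (i - 1) \<otimes> sw (rev [j..<Suc m])"
  using assms(3,4)
proof (induction m)
  case 0
  then show ?case using assms by simp
next
  case (Suc m)
  have ul: "rev [j..<k] \<in> lists {1..<n}" if "k \<le> n" for k using assms(1) that by auto
  have e: "rev [j..<Suc (Suc m)] = Suc m # rev [j..<Suc m]" using assms(1,2) Suc.prems by simp
  have im: "i - 1 \<in> {1..<n}" "i \<in> {1..<n}" "Suc m \<in> {1..<n}" using assms Suc.prems by auto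
  note c = s_closed[OF im(1)] s_closed[OF im(2)] s_closed[OF im(3)] sw_closed[OF ul[of "Suc m"]]
  show ?case
  proof (cases "i = Suc m")
    case True
    then obtain k where k: "m = Suc k" "i = Suc (Suc k)" using assms(1,2) by (cases m) auto
    have e': "rev [j..<Suc m] = m # rev [j..<m]" using assms(1,2) True by simp
    have m: "m \<in> {1..<n}" using k Suc.prems by auto
    note c' = s_closed[OF m] sw_closed[OF ul[of m]]
    have "sw (rev [j..<m]) \<otimes> s i = s i \<otimes> sw (rev [j..<m])"
      using k ul[of m] im(2) Suc.prems by (intro sw_far) auto
    then have "sw (rev [j..<Suc (Suc m)]) \<otimes> s i = (s i \<otimes> (s m \<otimes> s i)) \<otimes> sw (rev [j..<m])"
      unfolding e e' using c c' Suc.prems True by (simp add: m_assoc del: upt_Suc)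
    also have "s i \<otimes> (s m \<otimes> s i) = s m \<otimes> (s i \<otimes> s m)"
      using s_braid[of m] k Suc.prems m by simp
    also have "\<dots> \<otimes> sw (rev [j..<m]) = s (i - 1) \<otimes> sw (rev [j..<Suc (Suc m)])"
      unfolding e e' using c c' Suc.prems True by (simp add: m_assoc del: upt_Suc)
    finally show ?thesis .
  next
    case False
    then have i: "i \<le> m" using Suc.prems by simp
    have "sw (rev [j..<Suc (Suc m)]) \<otimes> s i = s (Suc m) \<otimes> (sw (rev [j..<Suc m]) \<otimes> s i)"
      unfolding e using c Suc.prems by (simp add: m_assoc del: upt_Suc)
    also have "\<dots> = (s (Suc m) \<otimes> s (i - 1)) \<otimes> sw (rev [j..<Suc m])"
      using Suc.IH[OF i] c Suc.prems by (simp add: m_assoc del: upt_Suc)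
    also have "s (Suc m) \<otimes> s (i - 1) = s (i - 1) \<otimes> s (Suc m)"
      using im i assms(1,2) by (intro s_far') auto
    finally show ?thesis
      unfolding e using c Suc.prems by (simp add: m_assoc del: upt_Suc)
  qed
qed

section \<open>Straightening into normal form\<close>

definition nfs :: "nat \<Rightarrow> 'a set" where
  "nfs k = (\<lambda>(v, u). tw v \<otimes> sw u) ` (lists {1..n} \<times> cws k)"

lemma cws_lists: "u \<in> cws k \<Longrightarrow> k < n \<Longrightarrow> u \<in> lists {1..<n}"
  using cws_set[of u k] by auto

lemma nfs_closed: "k < n \<Longrightarrow> nfs k \<subseteq> carrier Y"
  by (auto simp: nfs_def simp del: in_lists_conv_set intro!: m_closed tw_closed sw_closed[OF cws_lists])

lemma nfs_TS:
  assumes "k < n" "x \<in> TS" "u \<in> cws k"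
  shows "x \<otimes> sw u \<in> lspan Y (nfs k)"
proof (rule lspan_mult_right[OF tw_image nfs_closed[OF assms(1)] sw_closed[OF cws_lists[OF assms(3,1)]] _ assms(2)[unfolded TS_def]])
  fix x assume "x \<in> tw ` lists {1..n}"
  then have "x \<otimes> sw u \<in> nfs k" using assms(3) by (auto simp: nfs_def)
  then show "x \<otimes> sw u \<in> lspan Y (nfs k)" by (rule lspan_incl[OF nfs_closed[OF assms(1)]])
qed

text \<open>Four positions of \<open>i\<close> relative to the end \<open>j\<close> of the last run:
  \<open>j = i + 1\<close> lengthens the run, \<open>i = j\<close> calls for the quadratic relation,
  and otherwise \<open>s i\<close> passes the run, unchanged or lowered by one, into the shorter
  normal form, where the induction hypothesis absorbs it.\<close>

lemma nfs_step:
  assumes "k < n" "u \<in> cws k" "i \<in> {1..k}"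
  shows "sw u \<otimes> s i \<in> lspan Y (nfs k)"
  using assms
proof (induction k arbitrary: u i)
  case (Suc k)
  have kn: "k < n" using Suc.prems by simp
  note sp = lspan_add[OF nfs_closed[OF Suc.prems(1)]] and cl = nfs_closed[OF Suc.prems(1)] nfs_closed[OF kn]
  obtain u0 j where u: "u0 \<in> cws k" "1 \<le> j" "j \<le> Suc (Suc k)" "u = u0 @ rev [j..<Suc (Suc k)]"
    using Suc.prems(2) by (rule cws_SucE)
  have ul: "u0 \<in> lists {1..<n}" by (rule cws_lists[OF u(1) kn])
  have dl: "rev [l..<Suc (Suc k)] \<in> lists {1..<n}" if "1 \<le> l" for l using that Suc.prems(1) by auto
  have i: "i \<in> {1..<n}" using Suc.prems by auto
  let ?D = "\<lambda>l. sw (rev [l..<Suc (Suc k)])"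
  note c = sw_closed[OF ul] sw_closed[OF dl] s_closed[OF i]
  have uD: "sw (u0 @ rev [l..<Suc (Suc k)]) = sw u0 \<otimes> ?D l" if "1 \<le> l" for l
    by (rule sw_append[OF ul dl[OF that]])
  have inn: "sw u0 \<otimes> ?D l \<in> lspan Y (nfs (Suc k))" if "1 \<le> l" "l \<le> Suc (Suc k)" for l
  proof -
    have "\<one> \<otimes> sw (u0 @ rev [l..<Suc (Suc k)]) \<in> lspan Y (nfs (Suc k))"
      by (rule nfs_TS[OF Suc.prems(1) TS_one cws_SucI[OF u(1) that]])
    then show ?thesis using uD[OF that(1)] c that by simp
  qed
  have Dsplit: "?D l = ?D (Suc l) \<otimes> s l" if "1 \<le> l" "l \<le> Suc k" for l
  proof -
    have "rev [l..<Suc (Suc k)] = rev [Suc l..<Suc (Suc k)] @ [l]"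
      using that by (simp add: upt_conv_Cons del: upt_Suc)
    moreover have "l \<in> {1..<n}" using that Suc.prems(1) by auto
    ultimately show ?thesis using sw_append[OF dl[of "Suc l"], of "[l]"] s_closed[of l] by simp
  qed
  \<comment> \<open>Once a generator has crossed the run it multiplies \<open>u0\<close> alone. The
    induction hypothesis straightens that product, and the run is then reattached to each resulting
    normal form.\<close>
  have absorb: "sw u0 \<otimes> (s i' \<otimes> ?D j) \<in> lspan Y (nfs (Suc k))" if i': "i' \<in> {1..k}" for i'
  proof -
    have i'n: "i' \<in> {1..<n}" using i' kn by auto
    have "(sw u0 \<otimes> s i') \<otimes> ?D j \<in> lspan Y (nfs (Suc k))"
    proof (rule lspan_mult_right[OF cl(2,1) sw_closed[OF dl[OF u(2)]] _ Suc.IH[OF kn u(1) i']])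
      fix x assume "x \<in> nfs k"
      then obtain v u' where x: "v \<in> lists {1..n}" "u' \<in> cws k" "x = tw v \<otimes> sw u'" by (auto simp: nfs_def)
      have u'l: "u' \<in> lists {1..<n}" by (rule cws_lists[OF x(2) kn])
      have "x \<otimes> ?D j = tw v \<otimes> sw (u' @ rev [j..<Suc (Suc k)])"
        using sw_append[OF u'l dl[OF u(2)]] tw_closed[OF x(1)] sw_closed[OF u'l] sw_closed[OF dl[OF u(2)]]
        by (simp add: x(3) m_assoc)
      also have "\<dots> \<in> nfs (Suc k)"
        unfolding nfs_def using x(1) cws_SucI[OF x(2) u(2,3)] by (intro image_eqI[of _ _ "(v, u' @ rev [j..<Suc (Suc k)])"]) (simp_all del: upt_Suc cws.simps)
      finally show "x \<otimes> ?D j \<in> lspan Y (nfs (Suc k))" by (rule lspan_incl[OF cl(1)])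
    qed
    then show ?thesis using c(1) sw_closed[OF dl[OF u(2)]] s_closed[OF i'n] by (simp add: m_assoc)
  qed
  have eq: "sw u \<otimes> s i = sw u0 \<otimes> (?D j \<otimes> s i)"
    unfolding u(4) uD[OF u(2)] using c u(2) by (simp add: m_assoc)
  consider "j = Suc i" | "i = j" | "Suc i < j" | "j < i" by linarith
  then show ?case
  proof cases
    case 1
    have "?D j \<otimes> s i = ?D i" using Dsplit[of i] Suc.prems(3) 1 by (simp del: upt_Suc)
    then show ?thesis unfolding eq using inn[of i] Suc.prems(3) by (simp del: upt_Suc)
  next
    case 2
    \<comment> \<open>The quadratic case: the torus element \<open>e\<close> is carried to the far
      left through the shortened run and through \<open>u0\<close>. What remains is a torus multiple
      of the original normal form plus the one with the shorter run.\<close>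
    obtain e where e: "e \<in> TS" "s i \<otimes> s i = e \<otimes> s i \<oplus> \<one>" using quad[OF i] unfolding TS_def by blast
    have jl: "1 \<le> Suc j" "Suc j \<le> Suc (Suc k)" using Suc.prems(3) 2 by auto
    obtain e' where e': "e' \<in> TS" "?D (Suc j) \<otimes> e = e' \<otimes> ?D (Suc j)" using sw_TS[OF dl[OF jl(1)] e(1)] by blast
    obtain e'' where e'': "e'' \<in> TS" "sw u0 \<otimes> e' = e'' \<otimes> sw u0" using sw_TS[OF ul e'(1)] by blast
    note cc = c(1) c(3) sw_closed[OF dl[OF jl(1)]] sw_closed[OF dl[OF u(2)]] TS_closed[OF e(1)] TS_closed[OF e'(1)] TS_closed[OF e''(1)]
    have Dj: "?D j = ?D (Suc j) \<otimes> s i" using Dsplit[of j] u(2) Suc.prems(3) 2 by (simp del: upt_Suc)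
    have "?D j \<otimes> s i = ?D (Suc j) \<otimes> (s i \<otimes> s i)" unfolding Dj using cc by (simp add: m_assoc)
    also have "\<dots> = (?D (Suc j) \<otimes> e) \<otimes> s i \<oplus> ?D (Suc j)" unfolding e(2) using cc by (simp add: r_distr m_assoc)
    also have "\<dots> = e' \<otimes> ?D j \<oplus> ?D (Suc j)" unfolding e'(2) Dj using cc by (simp add: m_assoc)
    finally have "sw u \<otimes> s i = (sw u0 \<otimes> e') \<otimes> ?D j \<oplus> sw u0 \<otimes> ?D (Suc j)"
      unfolding eq using cc by (simp add: r_distr m_assoc)
    also have "(sw u0 \<otimes> e') \<otimes> ?D j = e'' \<otimes> sw u"
      unfolding e''(2) u(4) uD[OF u(2)] using cc by (simp add: m_assoc)
    finally show ?thesis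
      using sp[OF nfs_TS[OF Suc.prems(1) e''(1) Suc.prems(2)] inn[OF jl]] by simp
  next
    case 3
    have "?D j \<otimes> s i = s i \<otimes> ?D j" using 3 by (intro sw_far[OF dl[OF u(2)] i]) (auto simp del: upt_Suc)
    then show ?thesis unfolding eq using absorb[of i] 3 u(3) Suc.prems(3) by (simp del: upt_Suc)
  next
    case 4
    have "?D j \<otimes> s i = s (i - 1) \<otimes> ?D j"
      using Suc.prems by (intro sw_desc_braid[OF u(2) 4]) auto
    moreover have "i - 1 \<in> {1..k}" using 4 u(2) Suc.prems(3) by auto
    ultimately show ?thesis unfolding eq using absorb[of "i - 1"] by (simp only:)
  qed
qed simp

lemma nf_mult_s:
  assumes "x \<in> lspan Y (nfs (n - 1))" "i \<in> {1..<n}"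
  shows "x \<otimes> s i \<in> lspan Y (nfs (n - 1))"
proof -
  have k: "n - 1 < n" using n by simp
  note cl = nfs_closed[OF k]
  show ?thesis
  proof (rule lspan_mult_right[OF cl cl s_closed[OF assms(2)] _ assms(1)])
    fix x assume "x \<in> nfs (n - 1)"
    then obtain v u where x: "v \<in> lists {1..n}" "u \<in> cws (n - 1)" "x = tw v \<otimes> sw u" by (auto simp: nfs_def)
    have "tw v \<otimes> (sw u \<otimes> s i) \<in> lspan Y (nfs (n - 1))"
    proof (rule lspan_mult_left[OF cl cl tw_closed[OF x(1)] _ nfs_step[OF k x(2)]])
      show "i \<in> {1..n - 1}" using assms(2) by auto
      fix y assume "y \<in> nfs (n - 1)"
      then obtain v' u' where y: "v' \<in> lists {1..n}" "u' \<in> cws (n - 1)" "y = tw v' \<otimes> sw u'" by (auto simp: nfs_def)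
      have "tw v \<otimes> y = tw (v @ v') \<otimes> sw u'"
        using tw_closed[OF x(1)] tw_closed[OF y(1)] sw_closed[OF cws_lists[OF y(2) k]]
        by (simp add: y(3) tw_append[OF x(1) y(1)] m_assoc)
      also have "\<dots> \<in> nfs (n - 1)"
        unfolding nfs_def using x(1) y(1,2) by (intro image_eqI[of _ _ "(v @ v', u')"]) auto
      finally show "tw v \<otimes> y \<in> lspan Y (nfs (n - 1))" by (rule lspan_incl[OF cl])
    qed
    then show "x \<otimes> s i \<in> lspan Y (nfs (n - 1))"
      using tw_closed[OF x(1)] sw_closed[OF cws_lists[OF x(2) k]] s_closed[OF assms(2)] by (simp add: x(3) m_assoc)
  qed
qed

lemma nf_mult_TS:
  assumes "x \<in> lspan Y (nfs (n - 1))" "y \<in> TS"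
  shows "x \<otimes> y \<in> lspan Y (nfs (n - 1))"
proof -
  have k: "n - 1 < n" using n by simp
  note cl = nfs_closed[OF k]
  show ?thesis
  proof (rule lspan_mult_right[OF cl cl TS_closed[OF assms(2)] _ assms(1)])
    fix x assume "x \<in> nfs (n - 1)"
    then obtain v u where x: "v \<in> lists {1..n}" "u \<in> cws (n - 1)" "x = tw v \<otimes> sw u" by (auto simp: nfs_def)
    note ul = cws_lists[OF x(2) k]
    obtain y' where y': "y' \<in> TS" "sw u \<otimes> y = y' \<otimes> sw u" using sw_TS[OF ul assms(2)] by blast
    have "tw v \<in> TS" unfolding TS_def using x(1) by (intro lspan_incl[OF tw_image]) auto
    then have "(tw v \<otimes> y') \<otimes> sw u \<in> lspan Y (nfs (n - 1))" by (intro nfs_TS[OF k _ x(2)] TS_mult y'(1))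
    then show "x \<otimes> y \<in> lspan Y (nfs (n - 1))"
      using tw_closed[OF x(1)] sw_closed[OF ul] TS_closed[OF y'(1)] TS_closed[OF assms(2)] by (simp add: x(3) m_assoc y'(2))
  qed
qed

section \<open>Monomials in the torus generators\<close>

fun tmon :: "nat \<Rightarrow> nat list \<Rightarrow> 'a" where
  "tmon k [] = \<one>"
| "tmon k (x # a) = t k [^] x \<otimes> tmon (Suc k) a"

lemma tmon_closed: "1 \<le> k \<Longrightarrow> k + length a \<le> Suc n \<Longrightarrow> tmon k a \<in> carrier Y"
  by (induction a arbitrary: k) (auto intro!: m_closed nat_pow_closed t_closed)

lemma t_tmon:
  assumes "1 \<le> k" "k + length a = Suc n" "i \<in> {k..n}"
  shows "t i \<otimes> tmon k a = tmon k (a[i - k := (a ! (i - k) + 1) mod d])"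
  using assms
proof (induction a arbitrary: k)
  case (Cons x a)
  have k: "k \<in> {1..n}" using Cons.prems by auto
  note c = t_closed[OF k] tmon_closed[of "Suc k" a]
  show ?case
  proof (cases "i = k")
    case True
    have "t k [^] (Suc x mod d) = t k [^] Suc x"
    proof -
      have "t k [^] Suc x = t k [^] (d * (Suc x div d) + Suc x mod d)" by simp
      also have "\<dots> = (t k [^] d) [^] (Suc x div d) \<otimes> t k [^] (Suc x mod d)"
        using c(1) by (simp only: nat_pow_mult[symmetric] nat_pow_pow)
      also have "\<dots> = t k [^] (Suc x mod d)" using t_pow[OF k] c(1) by simp
      finally show ?thesis by simp
    qed
    moreover have "t k [^] Suc x = t k \<otimes> t k [^] x" by (rule nat_pow_Suc2[OF c(1)])
    ultimately show ?thesis using True c Cons.prems by (simp add: m_assoc)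
  next
    case False
    then have i: "i \<in> {Suc k..n}" "i \<in> {1..n}" using Cons.prems by auto
    have e: "i - k = Suc (i - Suc k)" using i by auto
    have "t i \<otimes> t k [^] x = t k [^] x \<otimes> t i"
    proof (induction x)
      case (Suc x)
      then show ?case using c(1) t_closed[OF i(2)] t_comm[OF i(2) k] by (simp add: m_assoc m_assoc[symmetric, of "t i"])
    qed (simp add: t_closed[OF i(2)])
    then have "t i \<otimes> tmon k (x # a) = t k [^] x \<otimes> (t i \<otimes> tmon (Suc k) a)"
      using c t_closed[OF i(2)] Cons.prems by (simp add: m_assoc[symmetric])
    also have "t i \<otimes> tmon (Suc k) a = tmon (Suc k) (a[i - Suc k := (a ! (i - Suc k) + 1) mod d])"
      using Cons.IH[of "Suc k"] Cons.prems i by simp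
    finally show ?thesis by (simp add: e)
  qed
qed simp

definition exps :: "nat list set" where "exps = {a. length a = n \<and> set a \<subseteq> {..<d}}"

lemma tmon_zero: "1 \<le> k \<Longrightarrow> tmon k (replicate m 0) = \<one>"
  by (induction m arbitrary: k) auto

lemma tw_tmon: "v \<in> lists {1..n} \<Longrightarrow> \<exists>a\<in>exps. tw v = tmon 1 a"
proof (induction v)
  case Nil
  have "replicate n 0 \<in> exps" using d by (auto simp: exps_def)
  then show ?case using tmon_zero[of 1 n] by (intro bexI[of _ "replicate n 0"]) auto
next
  case (Cons i v)
  then obtain a where a: "a \<in> exps" "tw v = tmon 1 a" by auto
  have i: "i \<in> {1..n}" using Cons by auto
  let ?a = "a[i - 1 := (a ! (i - 1) + 1) mod d]"
  have "tw (i # v) = tmon 1 ?a" using a i t_tmon[of 1 a i] by (simp add: exps_def)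
  moreover have "?a \<in> exps" using a(1) d set_update_subset_insert[of a] by (fastforce simp: exps_def)
  ultimately show ?case by blast
qed

text \<open>The spanning set \<open>X\<close> stays abstract here; it will be the image of the
  group. The t-words in the normal forms are sorted into monomials with exponents below d, which
  makes the index set finite.\<close>

theorem span:
  assumes gen: "x \<in> lspan Y X" and X: "X \<subseteq> carrier Y"
    and words: "X \<subseteq> lspan Y (nfs (n - 1))"
  shows "\<exists>\<alpha>. x = (\<Oplus>j\<in>exps \<times> cws (n - 1). \<alpha> j \<odot> (tmon 1 (fst j) \<otimes> sw (snd j)))"
proof -
  have k: "n - 1 < n" using n by simp
  have fin: "finite (exps \<times> cws (n - 1))"
    using cws_finite finite_lists_length_eq[of "{..<d}" n] by (simp add: exps_def conj_commute)
  let ?g = "\<lambda>j. tmon 1 (fst j) \<otimes> sw (snd j)"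
  have g: "?g \<in> exps \<times> cws (n - 1) \<rightarrow> carrier Y"
    by (auto simp: exps_def simp del: in_lists_conv_set intro!: m_closed tmon_closed sw_closed[OF cws_lists[OF _ k]])
  have "nfs (n - 1) \<subseteq> ?g ` (exps \<times> cws (n - 1))"
  proof
    fix y assume "y \<in> nfs (n - 1)"
    then obtain v u where y: "v \<in> lists {1..n}" "u \<in> cws (n - 1)" "y = tw v \<otimes> sw u" by (auto simp: nfs_def)
    obtain a where "a \<in> exps" "tw v = tmon 1 a" using tw_tmon[OF y(1)] by blast
    then show "y \<in> ?g ` (exps \<times> cws (n - 1))" using y by (intro image_eqI[of _ _ "(a, u)"]) auto
  qed
  moreover have gc: "?g ` (exps \<times> cws (n - 1)) \<subseteq> carrier Y" using g by auto
  ultimately have "nfs (n - 1) \<subseteq> lspan Y (?g ` (exps \<times> cws (n - 1)))"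
    using lspan_incl[OF gc] by blast
  then have "x \<in> lspan Y (?g ` (exps \<times> cws (n - 1)))"
    using lspan_subset[OF X nfs_closed[OF k] words] lspan_subset[OF nfs_closed[OF k] gc] gen by blast
  then show ?thesis by (rule lspan_lincomb[OF kalgebra_axioms fin g])
qed

end

section \<open>The operators as endomorphisms\<close>

lemma Sop_alt: "Sop q r f w = sal q (w ! r) (w ! Suc r) * f w + sbe (w ! r) (w ! Suc r) * f (swp r w)"
  by (simp add: Sop_def sal_def sbe_def)

lemma swp_tbasis:
  assumes "Suc r < n"
  shows "swp r w \<in> tbasis d N n \<longleftrightarrow> w \<in> tbasis d N n"
  using assms by (auto simp: tbasis_def)

lemma Sop_vspace:
  assumes "Suc r < n" "v \<in> vspace (tbasis d N n)"
  shows "Sop q r v \<in> vspace (tbasis d N n)"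
  using assms by (simp add: vspace_def Sop_alt swp_tbasis)

text \<open>The left side is \<open>Rcheck_apply\<close> on a basis vector, written by output
  coordinates; the right side reads it as keeping or exchanging two letters of colour
  \<open>b\<close>.\<close>

lemma sal_sbe_kdelta:
  fixes q :: "'k::field" and b j k j' k' :: nat
  shows "(if j' = k' then q * kdelta (j, k) (j', j') else
      if j' < k' then kdelta (j, k) (k', j') else kdelta (j, k) (k', j') + (q - inverse q) * kdelta (j, k) (j', k')) =
    sal q (b, j') (b, k') * (if ((b, j), (b, k)) = ((b, j'), (b, k')) then 1 else 0) +
    sbe (b, j') (b, k') * (if ((b, j), (b, k)) = ((b, k'), (b, j')) then 1 else 0)"
  by (auto simp: sal_def sbe_def lgt_def kdelta_def)

lemma sigma2_same:
  assumes "(b, j) \<in> vbasis d N" "(b, k) \<in> vbasis d N"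
  shows "sigma2 N ((b, j), (b, k)) ((b', j'), (c', k')) =
    sal qq (b', j') (c', k') * (if ((b, j), (b, k)) = ((b', j'), (c', k')) then 1 else 0) +
    sbe (b', j') (c', k') * (if ((b, j), (b, k)) = ((c', k'), (b', j')) then 1 else 0)"
proof (cases "b' = b \<and> c' = b")
  case True
  then have bc: "b' = b" "c' = b" by simp_all
  have "j \<in> {1..N b}" "k \<in> {1..N b}" using assms by (auto simp: vbasis_def)
  then have kd: "kdelta (j, k) \<in> vspace ({1..N b} \<times> {1..N b})" by (intro vspace_closed) simp
  have "sigma2 N ((b, j), (b, k)) ((b', j'), (c', k')) = (if j' = k' then qq * kdelta (j, k) (j', j') else
      if j' < k' then kdelta (j, k) (k', j') else kdelta (j, k) (k', j') + (qq - inverse qq) * kdelta (j, k) (j', k'))"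
    unfolding sigma2_def bc prod.case Rcheck_apply[OF kd] by (simp only: HOL.refl if_True simp_thms)
  then show ?thesis unfolding bc sal_sbe_kdelta[of j' k' qq j k b] .
next
  case False
  have 1: "((b, j), (b, k)) \<noteq> ((b', j'), (c', k'))" "((b, j), (b, k)) \<noteq> ((c', k'), (b', j'))" using False by blast+
  have "sigma2 N ((b, j), (b, k)) ((b', j'), (c', k')) = 0"
    unfolding sigma2_def prod.case if_not_P[OF False] by (simp only: HOL.refl if_True)
  then show ?thesis unfolding if_not_P[OF 1(1)] if_not_P[OF 1(2)] by simp
qed

lemma sigma2_diff:
  assumes "b \<noteq> c"
  shows "sigma2 N ((b, j), (c, k)) ((b', j'), (c', k')) =
    sal qq (b', j') (c', k') * (if ((b, j), (c, k)) = ((b', j'), (c', k')) then 1 else 0) +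
    sbe (b', j') (c', k') * (if ((b, j), (c, k)) = ((c', k'), (b', j')) then 1 else 0)"
proof -
  have s2: "sigma2 N ((b, j), (c, k)) ((b', j'), (c', k')) = (if ((b', j'), (c', k')) = ((c, k), (b, j)) then 1 else 0)"
    unfolding sigma2_def prod.case if_not_P[OF assms] kdelta_def ..
  show ?thesis
  proof (cases "b' = c'")
    case True
    have "((b', j'), (c', k')) \<noteq> ((c, k), (b, j))" "((b, j), (c, k)) \<noteq> ((c', k'), (b', j'))" "((b, j), (c, k)) \<noteq> ((b', j'), (c', k'))"
      using assms True by blast+
    then show ?thesis unfolding s2 by (simp only: if_False mult_zero_right add_0_left)
  next
    case False
    then have "sal qq (b', j') (c', k') = 0" "sbe (b', j') (c', k') = (1::Cq)" by (simp_all add: sal_def sbe_def lgt_def)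
    moreover have "((b', j'), (c', k')) = ((c, k), (b, j)) \<longleftrightarrow> ((b, j), (c, k)) = ((c', k'), (b', j'))" by blast
    ultimately show ?thesis unfolding s2 by (simp only: mult_zero_left mult_1_left add_0_left)
  qed
qed

lemma sigma2_eq:
  assumes "x \<in> vbasis d N" "y \<in> vbasis d N"
  shows "sigma2 N (x, y) (x', y') =
    sal qq x' y' * (if (x, y) = (x', y') then 1 else 0) + sbe x' y' * (if (x, y) = (y', x') then 1 else 0)"
  using assms sigma2_same[of "fst x" "snd x" d N "snd y" "fst x'" "snd x'" "fst y'" "snd y'"]
    sigma2_diff[of "fst x" "fst y" N "snd x" "snd y" "fst x'" "snd x'" "fst y'" "snd y'"]
  unfolding prod.collapse by (cases "fst x = fst y") (metis prod.collapse)+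

lemma mult_if_add:
  "c * (a * (if A then 1 else 0) + b * (if B then 1 else 0)) = (if A then a * c else 0) + (if B then b * c else (0::'k::field))"
  by (simp add: algebra_simps)

text \<open>In the sum over input words only \<open>w'\<close> itself and its exchange contribute.
  If the two letters agree these words coincide, but then \<open>sbe\<close> is 0 and nothing is
  counted twice.\<close>

lemma sigma_apply:
  assumes i: "i \<in> {1..<n}" and v: "v \<in> vspace (tbasis d N n)"
  shows "sigma d N n i v = Sop qq (i - 1) v"
proof
  fix w'
  define r where "r = i - 1"
  have r: "i = Suc r" "Suc r < n" using i by (auto simp: r_def)
  let ?T = "tbasis d N n"
  show "sigma d N n i v w' = Sop qq (i - 1) v w'"
  proof (cases "w' \<in> ?T")
    case False
    then show ?thesis
      using v Sop_vspace[OF r(2) v, of qq] unfolding sigma_def lin_ext_apply[OF v] by (simp add: vspace_def r)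
  next
    case True
    then have lw': "length w' = n" by (simp add: tbasis_def)
    let ?x = "w' ! r" and ?y = "w' ! Suc r"
    have tm: "v w * (if \<forall>k<n. k \<noteq> i - 1 \<and> k \<noteq> i \<longrightarrow> w' ! k = w ! k
        then sigma2 N (w ! (i - 1), w ! i) (w' ! (i - 1), w' ! i) else 0) =
      (if w = w' then sal qq ?x ?y * v w else 0) + (if w = swp r w' then sbe ?x ?y * v w else 0)" (is "?l = ?r")
      if w: "w \<in> ?T" for w
    proof -
      have lw: "length w = n" using w by (simp add: tbasis_def)
      have sub: "set w \<subseteq> vbasis d N" using w by (simp add: tbasis_def)
      have vb: "w ! r \<in> vbasis d N" "w ! Suc r \<in> vbasis d N"
        using subsetD[OF sub nth_mem[of r w]] subsetD[OF sub nth_mem[of "Suc r" w]] lw r by simp_all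
      have 1: "w = w' \<longleftrightarrow> (\<forall>k<n. k \<noteq> r \<and> k \<noteq> Suc r \<longrightarrow> w' ! k = w ! k) \<and> (w ! r, w ! Suc r) = (?x, ?y)"
        unfolding list_eq_iff_nth_eq lw lw' using r(2) by auto
      have 2: "w = swp r w' \<longleftrightarrow> (\<forall>k<n. k \<noteq> r \<and> k \<noteq> Suc r \<longrightarrow> w' ! k = w ! k) \<and> (w ! r, w ! Suc r) = (?y, ?x)"
      proof
        assume "w = swp r w'"
        then show "(\<forall>k<n. k \<noteq> r \<and> k \<noteq> Suc r \<longrightarrow> w' ! k = w ! k) \<and> (w ! r, w ! Suc r) = (?y, ?x)"
          using r(2) lw' by (simp add: swp_nth)
      next
        assume *: "(\<forall>k<n. k \<noteq> r \<and> k \<noteq> Suc r \<longrightarrow> w' ! k = w ! k) \<and> (w ! r, w ! Suc r) = (?y, ?x)"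
        show "w = swp r w'"
          by (rule nth_equalityI) (use * r(2) lw lw' in \<open>auto simp: swp_nth\<close>)
      qed
      show ?thesis
      proof (cases "\<forall>k<n. k \<noteq> r \<and> k \<noteq> Suc r \<longrightarrow> w' ! k = w ! k")
        case True
        have "?l = v w * sigma2 N (w ! r, w ! Suc r) (?x, ?y)" unfolding r(1) diff_Suc_1 if_P[OF True] ..
        also have "\<dots> = ?r" unfolding 1 2 sigma2_eq[OF vb] mult_if_add eqTrueI[OF True] simp_thms ..
        finally show ?thesis .
      next
        case False
        then have "w \<noteq> w'" "w \<noteq> swp r w'" unfolding 1 2 by blast+
        then show ?thesis unfolding r(1) diff_Suc_1 if_not_P[OF False] by simp
      qed
    qed
    have "sigma d N n i v w' = (\<Sum>w\<in>?T. (if w = w' then sal qq ?x ?y * v w else 0) + (if w = swp r w' then sbe ?x ?y * v w else 0))"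
      unfolding sigma_def lin_ext_apply[OF v] using True by (simp only: if_True) (intro sum.cong HOL.refl tm)
    also have "\<dots> = sal qq ?x ?y * v w' + sbe ?x ?y * v (swp r w')"
      using True swp_tbasis[OF r(2), of w' d N] by (simp add: sum.distrib)
    finally show ?thesis by (simp add: Sop_alt r)
  qed
qed

text \<open>Diagonal operators that see only colours: the images of the torus algebra, in particular
  of the t's and of E_i.\<close>

definition dia :: "nat \<Rightarrow> (nat \<Rightarrow> nat) \<Rightarrow> nat \<Rightarrow> (nat list \<Rightarrow> Cq) \<Rightarrow> tvec \<Rightarrow> tvec" where
  "dia d N n M = lin_ext (tbasis d N n) (\<lambda>w w'. M (map fst w) * kdelta w w')"

lemma dia_apply:
  assumes v: "v \<in> vspace (tbasis d N n)"
  shows "dia d N n M v = (\<lambda>w. M (map fst w) * v w)"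
proof
  fix w'
  have "(\<Sum>w\<in>tbasis d N n. v w * (M (map fst w) * kdelta w w')) =
      (\<Sum>w\<in>tbasis d N n. if w = w' then M (map fst w) * v w else 0)"
    by (intro sum.cong HOL.refl) (auto simp: kdelta_def)
  then show "dia d N n M v w' = M (map fst w') * v w'"
    unfolding dia_def lin_ext_apply[OF v] using v by (simp add: vspace_def)
qed

lemma dia_carrier: "dia d N n M \<in> carrier (endo_alg (tbasis d N n))"
  unfolding dia_def by (rule lin_ext_carrier)

lemma dia_cong:
  assumes "\<And>w. w \<in> tbasis d N n \<Longrightarrow> M (map fst w) = M' (map fst w)"
  shows "dia d N n M = dia d N n M'"
proof (rule endo_alg_ext[OF dia_carrier dia_carrier])
  fix v :: tvec assume v: "v \<in> vspace (tbasis d N n)"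
  show "dia d N n M v = dia d N n M' v"
    unfolding dia_apply[OF v]
  proof
    fix w
    show "M (map fst w) * v w = M' (map fst w) * v w"
      by (cases "w \<in> tbasis d N n") (use assms v in \<open>simp_all add: vspace_def\<close>)
  qed
qed

lemma tau_dia:
  assumes "i \<in> {1..n}"
  shows "tau d N n z i = dia d N n (\<lambda>c. z ^ (c ! (i - 1) - 1))"
proof (rule endo_alg_ext)
  let ?T = "tbasis d N n"
  show "tau d N n z i \<in> carrier (endo_alg ?T)" unfolding tau_def by (rule lin_ext_carrier)
  show "dia d N n (\<lambda>c. z ^ (c ! (i - 1) - 1)) \<in> carrier (endo_alg ?T)" by (rule dia_carrier)
  fix v :: tvec assume v: "v \<in> vspace ?T"
  show "tau d N n z i v = dia d N n (\<lambda>c. z ^ (c ! (i - 1) - 1)) v"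
  proof
    fix w'
    have "(\<Sum>w\<in>?T. v w * (z ^ (fst (w ! (i - 1)) - 1) * kdelta w w')) = (\<Sum>w\<in>?T. v w * (z ^ (map fst w ! (i - 1) - 1) * kdelta w w'))"
      using assms by (intro sum.cong HOL.refl) (auto simp: tbasis_def)
    then show "tau d N n z i v w' = dia d N n (\<lambda>c. z ^ (c ! (i - 1) - 1)) v w'"
      unfolding tau_def dia_def lin_ext_apply[OF v] by simp
  qed
qed

lemma sigma_carrier: "sigma d N n i \<in> carrier (endo_alg (tbasis d N n))"
  unfolding sigma_def by (rule lin_ext_carrier)

lemma endo_alg_tbasis_eqI:
  fixes f g :: "tvec \<Rightarrow> tvec"
  assumes "f \<in> carrier (endo_alg (tbasis d N n))" "g \<in> carrier (endo_alg (tbasis d N n))"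
    and "\<And>v w. v \<in> vspace (tbasis d N n) \<Longrightarrow> w \<in> tbasis d N n \<Longrightarrow> f v w = g v w"
  shows "f = g"
proof (rule endo_alg_ext[OF assms(1,2)], rule ext)
  fix v :: tvec and w assume v: "v \<in> vspace (tbasis d N n)"
  show "f v w = g v w"
    using assms(3)[OF v] endo_algD(1)[OF assms(1) v] endo_algD(1)[OF assms(2) v]
    by (cases "w \<in> tbasis d N n") (simp_all add: vspace_def)
qed

definition same_col :: "nat \<Rightarrow> nat list \<Rightarrow> Cq" where
  "same_col i c = (if c ! (i - 1) = c ! i then 1 else 0)"

text \<open>Solves the quadratic relation for the inverse: sigma minus (q - q^(-1)) times the image
  of E_i.\<close>

definition sigma_inv :: "nat \<Rightarrow> (nat \<Rightarrow> nat) \<Rightarrow> nat \<Rightarrow> nat \<Rightarrow> tvec \<Rightarrow> tvec" where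
  "sigma_inv d N n i = ((inverse qq - qq) \<odot>\<^bsub>endo_alg (tbasis d N n)\<^esub> dia d N n (same_col i))
    \<oplus>\<^bsub>endo_alg (tbasis d N n)\<^esub> sigma d N n i"

lemma sigma_inv_carrier: "sigma_inv d N n i \<in> carrier (endo_alg (tbasis d N n))"
  unfolding sigma_inv_def by (intro endo_alg_closed dia_carrier sigma_carrier)

fun fb_op :: "nat \<Rightarrow> (nat \<Rightarrow> nat) \<Rightarrow> nat \<Rightarrow> Cq \<Rightarrow> fb_gen \<times> bool \<Rightarrow> tvec \<Rightarrow> tvec" where
  "fb_op d N n z (Sgen i, e) = (if e then sigma d N n i else sigma_inv d N n i)"
| "fb_op d N n z (Tgen i, e) = dia d N n (\<lambda>c. (if e then z else inverse z) ^ (c ! (i - 1) - 1))"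

lemma fb_op_carrier: "fb_op d N n z g \<in> carrier (endo_alg (tbasis d N n))"
  by (cases "(d, N, n, z, g)" rule: fb_op.cases) (simp_all add: sigma_carrier sigma_inv_carrier dia_carrier)

lemma sigma_inverse:
  assumes i: "i \<in> {1..<n}"
  shows "sigma d N n i \<otimes>\<^bsub>endo_alg (tbasis d N n)\<^esub> sigma_inv d N n i = \<one>\<^bsub>endo_alg (tbasis d N n)\<^esub>"
    and "sigma_inv d N n i \<otimes>\<^bsub>endo_alg (tbasis d N n)\<^esub> sigma d N n i = \<one>\<^bsub>endo_alg (tbasis d N n)\<^esub>"
proof -
  let ?T = "tbasis d N n" and ?E = "endo_alg (tbasis d N n) :: (Cq, _) module"
  define r where "r = i - 1"
  have r: "i = Suc r" "Suc r < n" using i by (auto simp: r_def)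
  have sv: "Sop qq r v \<in> vspace ?T" if "v \<in> vspace ?T" for v by (rule Sop_vspace[OF r(2) that])
  have s: "sigma d N n i v = Sop qq r v" if "v \<in> vspace ?T" for v
    using sigma_apply[OF i that] by (simp add: r)
  have iv: "sigma_inv d N n i v = (\<lambda>w. (inverse qq - qq) * (same_col i (map fst w) * v w) + Sop qq r v w)"
    if "v \<in> vspace ?T" for v
    unfolding sigma_inv_def using that by (simp add: endo_alg_simps dia_apply s)
  have sc: "same_col i (map fst w) = (if fst (w ! r) = fst (w ! Suc r) then 1 else 0)" if "length w = n" for w :: "letter list"
    using that r by (simp add: same_col_def)
  have lw: "Suc r < length w" "length w = n" if "w \<in> ?T" for w using that r by (auto simp: tbasis_def)
  show "sigma_inv d N n i \<otimes>\<^bsub>?E\<^esub> sigma d N n i = \<one>\<^bsub>?E\<^esub>"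
  proof (rule endo_alg_tbasis_eqI)
    fix v :: tvec and w assume v: "v \<in> vspace ?T" and w: "w \<in> ?T"
    show "(sigma_inv d N n i \<otimes>\<^bsub>?E\<^esub> sigma d N n i) v w = \<one>\<^bsub>?E\<^esub> v w"
      using v lw[OF w] by (simp add: endo_alg_simps s iv sv sc Sop_quadratic[OF _ qq_nonzero] algebra_simps)
  qed (intro endo_alg_closed sigma_inv_carrier sigma_carrier endo_alg_one_zero)+
  show "sigma d N n i \<otimes>\<^bsub>?E\<^esub> sigma_inv d N n i = \<one>\<^bsub>?E\<^esub>"
  proof (rule endo_alg_tbasis_eqI)
    fix v :: tvec and w assume v: "v \<in> vspace ?T" and w: "w \<in> ?T"
    have ivv: "sigma_inv d N n i v \<in> vspace ?T" by (rule endo_algD(1)[OF sigma_inv_carrier v])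
    have scs: "Sop qq r (\<lambda>u. same_col i (map fst u) * v u) w = same_col i (map fst w) * Sop qq r v w"
    proof -
      have "same_col i (map fst (swp r w)) = same_col i (map fst w)"
        using lw[OF w] r by (auto simp: same_col_def swp_nth)
      then show ?thesis using Sop_diag[of r w "\<lambda>u. same_col i (map fst u)" qq v] lw[OF w] by simp
    qed
    have "(sigma d N n i \<otimes>\<^bsub>?E\<^esub> sigma_inv d N n i) v w = Sop qq r (sigma_inv d N n i v) w"
      using v ivv by (simp add: endo_alg_simps s)
    also have "\<dots> = (inverse qq - qq) * (same_col i (map fst w) * Sop qq r v w) + Sop qq r (Sop qq r v) w"
      unfolding iv[OF v] by (simp only: Sop_linear scs)
    also have "\<dots> = v w"
      using lw[OF w] by (simp add: sc Sop_quadratic[OF _ qq_nonzero] algebra_simps)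
    finally show "(sigma d N n i \<otimes>\<^bsub>?E\<^esub> sigma_inv d N n i) v w = \<one>\<^bsub>?E\<^esub> v w"
      using v by (simp add: endo_alg_simps)
  qed (intro endo_alg_closed sigma_inv_carrier sigma_carrier endo_alg_one_zero)+
qed

lemma dia_mult:
  "dia d N n M \<otimes>\<^bsub>endo_alg (tbasis d N n)\<^esub> dia d N n M' = dia d N n (\<lambda>c. M c * M' c)"
proof (rule endo_alg_ext[OF endo_alg_closed(1)[OF dia_carrier dia_carrier] dia_carrier])
  fix v :: tvec assume v: "v \<in> vspace (tbasis d N n)"
  then have "(\<lambda>w. M' (map fst w) * v w) \<in> vspace (tbasis d N n)" by (simp add: vspace_def)
  then show "(dia d N n M \<otimes>\<^bsub>endo_alg (tbasis d N n)\<^esub> dia d N n M') v = dia d N n (\<lambda>c. M c * M' c) v"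
    using v by (simp add: endo_alg_simps dia_apply mult.assoc)
qed

lemma dia_one: "dia d N n (\<lambda>c. 1) = \<one>\<^bsub>endo_alg (tbasis d N n)\<^esub>"
  by (rule endo_alg_ext[OF dia_carrier endo_alg_one_zero(1)]) (simp add: endo_alg_simps dia_apply)

lemma dia_pow: "dia d N n M [^]\<^bsub>endo_alg (tbasis d N n)\<^esub> (k::nat) = dia d N n (\<lambda>c. M c ^ k)"
proof (induction k)
  case 0
  then show ?case by (simp add: nat_pow_def dia_one)
next
  case (Suc k)
  interpret E: kalgebra "endo_alg (tbasis d N n) :: (Cq, _) module" by (rule endo_alg_kalgebra)
  show ?case by (simp add: Suc dia_mult mult.commute)
qed

lemma fb_op_rels:
  assumes z: "z ^ d = 1" "z \<noteq> 0" and rel: "(u, v) \<in> fb_rels d n"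
  shows "monoid.word_eval (endo_alg (tbasis d N n)) (fb_op d N n z) u =
    monoid.word_eval (endo_alg (tbasis d N n)) (fb_op d N n z) v"
proof -
  let ?T = "tbasis d N n" and ?E = "endo_alg (tbasis d N n) :: (Cq, _) module"
  interpret E: kalgebra ?E by (rule endo_alg_kalgebra)
  note cl = sigma_carrier[of d N n] dia_carrier[of d N n]
  have s: "sigma d N n i v = Sop qq (i - 1) v" "Sop qq (i - 1) v \<in> vspace ?T" if "i \<in> {1..<n}" "v \<in> vspace ?T" for i v
    using sigma_apply[OF that] Sop_vspace[OF _ that(2), of "i - 1"] that(1) by auto
  show ?thesis
    using rel
  proof cases
    case (s_far i j)
    have "sigma d N n i \<otimes>\<^bsub>?E\<^esub> sigma d N n j = sigma d N n j \<otimes>\<^bsub>?E\<^esub> sigma d N n i"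
    proof (rule endo_alg_tbasis_eqI)
      fix v :: tvec and w assume v: "v \<in> vspace ?T" and w: "w \<in> ?T"
      have "Sop qq (i - 1) (Sop qq (j - 1) v) w = Sop qq (j - 1) (Sop qq (i - 1) v) w"
      proof (cases "i < j")
        case True
        then show ?thesis using s_far w by (intro Sop_far) (auto simp: tbasis_def)
      next
        case False
        then show ?thesis using s_far w by (intro Sop_far[symmetric]) (auto simp: tbasis_def)
      qed
      then show "(sigma d N n i \<otimes>\<^bsub>?E\<^esub> sigma d N n j) v w = (sigma d N n j \<otimes>\<^bsub>?E\<^esub> sigma d N n i) v w"
        using s_far(3,4) v by (simp add: endo_alg_simps s[simplified])
    qed (intro endo_alg_closed sigma_carrier)+
    then show ?thesis using cl by (simp add: s_far(1,2))
  next
    case (s_braid i j)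
    have br: "sigma d N n i \<otimes>\<^bsub>?E\<^esub> (sigma d N n (Suc i) \<otimes>\<^bsub>?E\<^esub> sigma d N n i) =
        sigma d N n (Suc i) \<otimes>\<^bsub>?E\<^esub> (sigma d N n i \<otimes>\<^bsub>?E\<^esub> sigma d N n (Suc i))" if i: "i \<in> {1..<n}" "Suc i \<in> {1..<n}" for i
    proof (rule endo_alg_tbasis_eqI)
      fix v :: tvec and w assume v: "v \<in> vspace ?T" and w: "w \<in> ?T"
      have "Sop qq (i - 1) (Sop qq (Suc (i - 1)) (Sop qq (i - 1) v)) w = Sop qq (Suc (i - 1)) (Sop qq (i - 1) (Sop qq (Suc (i - 1)) v)) w"
        using i w by (intro Sop_braid qq_nonzero) (auto simp: tbasis_def)
      moreover have "Suc (i - 1) = i" using i by simp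
      ultimately have e: "Sop qq (i - 1) (Sop qq i (Sop qq (i - 1) v)) w = Sop qq i (Sop qq (i - 1) (Sop qq i v)) w" by simp
      note s' = s[OF i(1), simplified] s[OF i(2), simplified]
      show "(sigma d N n i \<otimes>\<^bsub>?E\<^esub> (sigma d N n (Suc i) \<otimes>\<^bsub>?E\<^esub> sigma d N n i)) v w =
        (sigma d N n (Suc i) \<otimes>\<^bsub>?E\<^esub> (sigma d N n i \<otimes>\<^bsub>?E\<^esub> sigma d N n (Suc i))) v w"
        using v e by (simp add: endo_alg_simps s')
    qed (intro endo_alg_closed sigma_carrier)+
    consider "j = Suc i" | "i = Suc j" using s_braid(5) by linarith
    then show ?thesis
    proof cases
      case 1
      then show ?thesis using br[of i] s_braid(3,4) cl by (simp add: s_braid(1,2))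
    next
      case 2
      then show ?thesis using br[of j] s_braid(3,4) cl by (simp add: s_braid(1,2))
    qed
  next
    case (t_power i)
    have "E.word_eval (fb_op d N n z) (concat (replicate k (tw i))) = dia d N n (\<lambda>c. (z ^ (c ! (i - 1) - 1)) ^ k)" for k
      by (induction k) (simp_all add: dia_one dia_mult)
    moreover have "(z ^ m) ^ d = 1" for m using z(1) by (metis power_mult mult.commute power_one)
    ultimately show ?thesis by (simp add: t_power dia_one)
  next
    case (t_comm i j)
    then show ?thesis using cl by (simp add: dia_mult mult.commute)
  next
    case (s_t i j)
    let ?j = "Transposition.transpose i (i + 1) j"
    have "sigma d N n i \<otimes>\<^bsub>?E\<^esub> dia d N n (\<lambda>c. z ^ (c ! (j - 1) - 1)) =
        dia d N n (\<lambda>c. z ^ (c ! (?j - 1) - 1)) \<otimes>\<^bsub>?E\<^esub> sigma d N n i"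
    proof (rule endo_alg_tbasis_eqI)
      fix v :: tvec and w assume v: "v \<in> vspace ?T" and w: "w \<in> ?T"
      have lw: "length w = n" "Suc (i - 1) < n" using w s_t by (auto simp: tbasis_def)
      define m where "m w = z ^ (map fst w ! (j - 1) - 1)" for w :: "letter list"
      have msw: "m (swp (i - 1) w) = z ^ (map fst w ! (?j - 1) - 1)"
        using lw s_t(3,4) unfolding m_def by (auto simp: swp_nth Transposition.transpose_def)
      have dv: "dia d N n (\<lambda>c. z ^ (c ! (j - 1) - 1)) v = (\<lambda>w. m w * v w)"
        unfolding dia_apply[OF v] m_def ..
      have mv: "(\<lambda>w. m w * v w) \<in> vspace ?T" using v by (simp add: vspace_def)
      have "m (swp (i - 1) w) = m w" if "fst (w ! (i - 1)) = fst (w ! Suc (i - 1))"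
        using that lw s_t(3,4) unfolding m_def by (auto simp: swp_nth)
      then have sop: "Sop qq (i - 1) (\<lambda>w. m w * v w) w = m (swp (i - 1) w) * Sop qq (i - 1) v w"
        using lw by (intro Sop_diag) simp_all
      have 1: "(sigma d N n i \<otimes>\<^bsub>?E\<^esub> D) v = sigma d N n i (D v)" "(D \<otimes>\<^bsub>?E\<^esub> sigma d N n i) v = D (sigma d N n i v)" for D
        using v by (simp_all add: endo_alg_simps)
      show "(sigma d N n i \<otimes>\<^bsub>?E\<^esub> dia d N n (\<lambda>c. z ^ (c ! (j - 1) - 1))) v w =
          (dia d N n (\<lambda>c. z ^ (c ! (?j - 1) - 1)) \<otimes>\<^bsub>?E\<^esub> sigma d N n i) v w"
        unfolding 1 dv s(1)[OF s_t(3) mv] s(1)[OF s_t(3) v] dia_apply[OF s(2)[OF s_t(3) v]] msw[symmetric] by (rule sop)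
    qed (intro endo_alg_closed sigma_carrier dia_carrier)+
    then show ?thesis using cl by (simp add: s_t(1,2))
  qed
qed

lemma fb_op_inverse:
  assumes z: "z \<noteq> 0" and g: "g \<in> fb_gens n"
  shows "fb_op d N n z (g, e) \<otimes>\<^bsub>endo_alg (tbasis d N n)\<^esub> fb_op d N n z (g, \<not> e) = \<one>\<^bsub>endo_alg (tbasis d N n)\<^esub>"
proof (cases g)
  case (Sgen i)
  then have "i \<in> {1..<n}" using g by (auto simp: fb_gens_def)
  then show ?thesis using sigma_inverse[of i n d N] by (simp add: Sgen)
next
  case (Tgen i)
  have "x ^ k * inverse x ^ k = (1::Cq)" "inverse x ^ k * x ^ k = (1::Cq)" if "x \<noteq> 0" for x k
    using that by (simp_all add: power_mult_distrib[symmetric])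
  then show ?thesis using z by (simp add: Tgen dia_mult dia_one)
qed

lemma FB_lift:
  assumes z: "z ^ d = 1" "z \<noteq> 0"
  obtains \<phi> where "\<phi> \<in> hom (FB d n) (endo_alg (tbasis d N n))" "\<phi> \<one>\<^bsub>FB d n\<^esub> = \<one>\<^bsub>endo_alg (tbasis d N n)\<^esub>"
    "\<forall>u\<in>lists (fb_gens n \<times> UNIV). \<phi> (group_cong (fb_gens n) (fb_rels d n) `` {u}) =
      monoid.word_eval (endo_alg (tbasis d N n)) (fb_op d N n z) u"
proof -
  interpret E: kalgebra "endo_alg (tbasis d N n) :: (Cq, _) module" by (rule endo_alg_kalgebra)
  have "\<exists>\<phi>\<in>hom (presented_group (fb_gens n) (fb_rels d n)) (endo_alg (tbasis d N n)).
    (\<forall>u\<in>lists (fb_gens n \<times> UNIV). \<phi> (group_cong (fb_gens n) (fb_rels d n) `` {u}) = E.word_eval (fb_op d N n z) u) \<and>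
    \<phi> \<one>\<^bsub>presented_group (fb_gens n) (fb_rels d n)\<^esub> = \<one>\<^bsub>endo_alg (tbasis d N n)\<^esub>"
    by (rule E.presented_group_lift) (simp_all add: fb_op_carrier fb_op_inverse[OF z(2)] fb_op_rels[OF z] del: fb_op.simps)
  then show ?thesis using that unfolding FB_def by blast
qed

section \<open>The relations in the Yokonuma--Hecke algebra\<close>

lemma FB_group: "group (FB d n)"
  unfolding FB_def by (rule presented_group_group)

lemma kFB_kalgebra: "kalgebra (kFB d n)"
  unfolding kFB_def using FB_group by (intro monoid_algebra_kalgebra) (simp add: group_def)

lemma fb_gen_mem:
  "i \<in> {1..<n} \<Longrightarrow> (Sgen i, e) \<in> fb_gens n \<times> UNIV" "i \<in> {1..n} \<Longrightarrow> (Tgen i, e) \<in> fb_gens n \<times> UNIV"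
  by (auto simp: fb_gens_def)

lemma fb_class:
  "u \<in> lists (fb_gens n \<times> UNIV) \<Longrightarrow> group_cong (fb_gens n) (fb_rels d n) `` {u} \<in> carrier (FB d n)"
  unfolding FB_def by (rule presented_group_class)

lemma fb_class_mult:
  "u \<in> lists (fb_gens n \<times> UNIV) \<Longrightarrow> v \<in> lists (fb_gens n \<times> UNIV) \<Longrightarrow>
    group_cong (fb_gens n) (fb_rels d n) `` {u} \<otimes>\<^bsub>FB d n\<^esub> group_cong (fb_gens n) (fb_rels d n) `` {v} =
    group_cong (fb_gens n) (fb_rels d n) `` {u @ v}"
  unfolding FB_def by (rule presented_group_mult)

lemma fb_class_rel:
  assumes "(u, v) \<in> fb_rels d n" "u \<in> lists (fb_gens n \<times> UNIV)" "v \<in> lists (fb_gens n \<times> UNIV)"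
  shows "group_cong (fb_gens n) (fb_rels d n) `` {u} = group_cong (fb_gens n) (fb_rels d n) `` {v}"
  by (rule equiv_class_eq[OF group_cong_equiv group_cong.rel[OF assms]])

lemma fb_s_closed: "i \<in> {1..<n} \<Longrightarrow> fb_s d n i \<in> carrier (FB d n)"
  unfolding fb_s_def using fb_gen_mem(1)[of i n True] by (intro fb_class) simp

lemma fb_t_closed: "i \<in> {1..n} \<Longrightarrow> fb_t d n i \<in> carrier (FB d n)"
  unfolding fb_t_def using fb_gen_mem(2)[of i n True] by (intro fb_class) simp

lemma fb_relations:
  assumes "d \<ge> 1"
  shows "i \<in> {1..<n} \<Longrightarrow> j \<in> {1..<n} \<Longrightarrow> \<bar>int i - int j\<bar> > 1 \<Longrightarrow>
      fb_s d n i \<otimes>\<^bsub>FB d n\<^esub> fb_s d n j = fb_s d n j \<otimes>\<^bsub>FB d n\<^esub> fb_s d n i"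
    and "i \<in> {1..<n} \<Longrightarrow> j \<in> {1..<n} \<Longrightarrow> \<bar>int i - int j\<bar> = 1 \<Longrightarrow>
      fb_s d n i \<otimes>\<^bsub>FB d n\<^esub> (fb_s d n j \<otimes>\<^bsub>FB d n\<^esub> fb_s d n i) = fb_s d n j \<otimes>\<^bsub>FB d n\<^esub> (fb_s d n i \<otimes>\<^bsub>FB d n\<^esub> fb_s d n j)"
    and "i \<in> {1..n} \<Longrightarrow> fb_t d n i [^]\<^bsub>FB d n\<^esub> d = \<one>\<^bsub>FB d n\<^esub>"
    and "i \<in> {1..n} \<Longrightarrow> j \<in> {1..n} \<Longrightarrow> fb_t d n i \<otimes>\<^bsub>FB d n\<^esub> fb_t d n j = fb_t d n j \<otimes>\<^bsub>FB d n\<^esub> fb_t d n i"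
    and "i \<in> {1..<n} \<Longrightarrow> j \<in> {1..n} \<Longrightarrow> fb_s d n i \<otimes>\<^bsub>FB d n\<^esub> fb_t d n j =
      fb_t d n (Transposition.transpose i (Suc i) j) \<otimes>\<^bsub>FB d n\<^esub> fb_s d n i"
proof -
  interpret G: group "FB d n" by (rule FB_group)
  note m = fb_gen_mem[of _ n True]
  show "fb_s d n i \<otimes>\<^bsub>FB d n\<^esub> fb_s d n j = fb_s d n j \<otimes>\<^bsub>FB d n\<^esub> fb_s d n i"
    if ij: "i \<in> {1..<n}" "j \<in> {1..<n}" "\<bar>int i - int j\<bar> > 1"
  proof -
    have l: "sw i \<in> lists (fb_gens n \<times> UNIV)" "sw j \<in> lists (fb_gens n \<times> UNIV)" using m ij by auto
    then have l2: "sw i @ sw j \<in> lists (fb_gens n \<times> UNIV)" "sw j @ sw i \<in> lists (fb_gens n \<times> UNIV)" by auto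
    show ?thesis
      unfolding fb_s_def fb_class_mult[OF l(1) l(2)] fb_class_mult[OF l(2) l(1)]
      by (rule fb_class_rel[OF fb_rels.s_far[OF ij] l2])
  qed
  show "fb_s d n i \<otimes>\<^bsub>FB d n\<^esub> (fb_s d n j \<otimes>\<^bsub>FB d n\<^esub> fb_s d n i) = fb_s d n j \<otimes>\<^bsub>FB d n\<^esub> (fb_s d n i \<otimes>\<^bsub>FB d n\<^esub> fb_s d n j)"
    if ij: "i \<in> {1..<n}" "j \<in> {1..<n}" "\<bar>int i - int j\<bar> = 1"
  proof -
    have l: "sw i \<in> lists (fb_gens n \<times> UNIV)" "sw j \<in> lists (fb_gens n \<times> UNIV)" using m ij by auto
    then have l2: "sw i @ sw j \<in> lists (fb_gens n \<times> UNIV)" "sw j @ sw i \<in> lists (fb_gens n \<times> UNIV)" by auto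
    have l3: "sw i @ sw j @ sw i \<in> lists (fb_gens n \<times> UNIV)" "sw j @ sw i @ sw j \<in> lists (fb_gens n \<times> UNIV)" using l by auto
    show ?thesis
      unfolding fb_s_def fb_class_mult[OF l(1) l(2)] fb_class_mult[OF l(2) l(1)]
        fb_class_mult[OF l(1) l2(2)] fb_class_mult[OF l(2) l2(1)]
      by (rule fb_class_rel[OF fb_rels.s_braid[OF ij] l3])
  qed
  show "fb_t d n i [^]\<^bsub>FB d n\<^esub> d = \<one>\<^bsub>FB d n\<^esub>" if i: "i \<in> {1..n}"
  proof -
    have l: "concat (replicate k (tw i)) \<in> lists (fb_gens n \<times> UNIV)" for k
      using m(2)[OF i] by (induction k) auto
    have li: "tw i \<in> lists (fb_gens n \<times> UNIV)" using m(2)[OF i] by auto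
    have "fb_t d n i [^]\<^bsub>FB d n\<^esub> k = group_cong (fb_gens n) (fb_rels d n) `` {concat (replicate k (tw i))}" for k :: nat
    proof (induction k)
      case 0
      then show ?case by (simp add: FB_def presented_group_one)
    next
      case (Suc k)
      have e: "concat (replicate (Suc k) (tw i)) = concat (replicate k (tw i)) @ tw i"
        by (induction k) auto
      show ?case
        unfolding G.nat_pow_Suc Suc e by (subst fb_t_def) (rule fb_class_mult[OF l li])
    qed
    then show ?thesis
      using fb_class_rel[OF fb_rels.t_power[OF i] l] by (simp add: FB_def presented_group_one)
  qed
  show "fb_t d n i \<otimes>\<^bsub>FB d n\<^esub> fb_t d n j = fb_t d n j \<otimes>\<^bsub>FB d n\<^esub> fb_t d n i"
    if ij: "i \<in> {1..n}" "j \<in> {1..n}"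
  proof -
    have l: "tw i \<in> lists (fb_gens n \<times> UNIV)" "tw j \<in> lists (fb_gens n \<times> UNIV)" using m ij by auto
    then have l2: "tw i @ tw j \<in> lists (fb_gens n \<times> UNIV)" "tw j @ tw i \<in> lists (fb_gens n \<times> UNIV)" by auto
    show ?thesis
      unfolding fb_t_def fb_class_mult[OF l(1) l(2)] fb_class_mult[OF l(2) l(1)]
      by (rule fb_class_rel[OF fb_rels.t_comm[OF ij] l2])
  qed
  show "fb_s d n i \<otimes>\<^bsub>FB d n\<^esub> fb_t d n j = fb_t d n (Transposition.transpose i (Suc i) j) \<otimes>\<^bsub>FB d n\<^esub> fb_s d n i"
    if ij: "i \<in> {1..<n}" "j \<in> {1..n}"
  proof -
    have "Transposition.transpose i (Suc i) j \<in> {1..n}" using ij by (auto simp: Transposition.transpose_def)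
    then have l: "sw i \<in> lists (fb_gens n \<times> UNIV)" "tw j \<in> lists (fb_gens n \<times> UNIV)"
      "tw (Transposition.transpose i (Suc i) j) \<in> lists (fb_gens n \<times> UNIV)" using m ij by auto
    then have l2: "sw i @ tw j \<in> lists (fb_gens n \<times> UNIV)"
      "tw (Transposition.transpose i (Suc i) j) @ sw i \<in> lists (fb_gens n \<times> UNIV)" by auto
    show ?thesis
      unfolding fb_t_def fb_s_def fb_class_mult[OF l(1) l(2)] fb_class_mult[OF l(3) l(1)]
      by (rule fb_class_rel[OF fb_rels.s_t[OF ij, unfolded Suc_eq_plus1[symmetric]] l2])
  qed
qed

lemma yh_E_carrier:
  assumes i: "i \<in> {1..<n}"
  shows "yh_E d n i \<in> carrier (kFB d n)"
proof -
  interpret A: kalgebra "kFB d n" by (rule kFB_kalgebra)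
  interpret G: group "FB d n" by (rule FB_group)
  have "fb_t d n i \<in> carrier (FB d n)" "fb_t d n (i + 1) \<in> carrier (FB d n)"
    using i by (auto intro!: fb_t_closed)
  then show ?thesis
    unfolding yh_E_def by (intro A.smult_closed A.finsum_closed) (auto simp: kFB_def intro!: kdelta_carrier)
qed

lemma yh_rels_carrier: "yh_rels d n \<subseteq> carrier (kFB d n) \<times> carrier (kFB d n)"
proof -
  interpret A: kalgebra "kFB d n" by (rule kFB_kalgebra)
  have "kdelta (fb_s d n i) \<in> carrier (kFB d n)" if "i \<in> {1..<n}" for i
    using fb_s_closed[OF that] by (simp add: kFB_def)
  then show ?thesis unfolding yh_rels_def using yh_E_carrier by auto
qed

definition yh_proj :: "nat \<Rightarrow> nat \<Rightarrow> (fb_gen gword set \<Rightarrow> Cq) \<Rightarrow> (fb_gen gword set \<Rightarrow> Cq) set" where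
  "yh_proj d n a = rel_ideal (kFB d n) (yh_rels d n) +>\<^bsub>kFB d n\<^esub> a"

lemma yh_proj_hom: "yh_proj d n \<in> alg_hom (kFB d n) (YH d n)"
  and YH_carrier: "carrier (YH d n) = yh_proj d n ` carrier (kFB d n)"
  and YH_kalgebra: "kalgebra (YH d n)"
proof -
  interpret A: kalgebra "kFB d n" by (rule kFB_kalgebra)
  note I = A.rel_ideal_ideal[OF yh_rels_carrier]
  show "yh_proj d n \<in> alg_hom (kFB d n) (YH d n)"
    unfolding yh_proj_def[abs_def] YH_def alg_mod_rels_def by (rule A.quot_alg_proj(1)[OF I])
  show "carrier (YH d n) = yh_proj d n ` carrier (kFB d n)"
    unfolding yh_proj_def[abs_def] YH_def alg_mod_rels_def by (rule A.quot_alg_proj(2)[OF I])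
  show "kalgebra (YH d n)"
    unfolding YH_def alg_mod_rels_def by (rule A.quot_alg_kalgebra[OF I])
qed

lemma yh_s_proj: "yh_s d n i = yh_proj d n (kdelta (fb_s d n i))"
  and yh_t_proj: "yh_t d n i = yh_proj d n (kdelta (fb_t d n i))"
  by (simp_all add: yh_s_def yh_t_def yh_proj_def)

abbreviation yh_grp :: "nat \<Rightarrow> nat \<Rightarrow> fb_gen gword set \<Rightarrow> (fb_gen gword set \<Rightarrow> Cq) set" where
  "yh_grp d n g \<equiv> yh_proj d n (kdelta g)"

lemma yh_grp_closed: "g \<in> carrier (FB d n) \<Longrightarrow> yh_grp d n g \<in> carrier (YH d n)"
  by (rule alg_homD(1)[OF yh_proj_hom]) (simp add: kFB_def)

lemma yh_grp_mult:
  assumes "g \<in> carrier (FB d n)" "g' \<in> carrier (FB d n)"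
  shows "yh_grp d n g \<otimes>\<^bsub>YH d n\<^esub> yh_grp d n g' = yh_grp d n (g \<otimes>\<^bsub>FB d n\<^esub> g')"
  using alg_homD(2)[OF yh_proj_hom, of "kdelta g" d n "kdelta g'"] assms
  by (simp add: kFB_def kdelta_mult)

lemma yh_grp_one: "yh_grp d n \<one>\<^bsub>FB d n\<^esub> = \<one>\<^bsub>YH d n\<^esub>"
  using alg_homD(4)[OF yh_proj_hom, of d n] by (simp add: kFB_def monoid_algebra_simps)

lemma yh_grp_pow:
  assumes "g \<in> carrier (FB d n)"
  shows "yh_grp d n (g [^]\<^bsub>FB d n\<^esub> (k::nat)) = yh_grp d n g [^]\<^bsub>YH d n\<^esub> k"
proof -
  interpret G: group "FB d n" by (rule FB_group)
  interpret Y: kalgebra "YH d n" by (rule YH_kalgebra)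
  show ?thesis
    by (induction k) (simp_all add: yh_grp_one yh_grp_mult[symmetric] assms)
qed

text \<open>Since t_i has order dividing d, its inverse is a positive power. This places E_i, which
  is defined with inverses, in the span of positive words in the t's.\<close>

lemma fb_t_inv:
  assumes "d \<ge> 1" "i \<in> {1..n}"
  shows "inv\<^bsub>FB d n\<^esub> (fb_t d n i [^]\<^bsub>FB d n\<^esub> (a::nat)) = fb_t d n i [^]\<^bsub>FB d n\<^esub> (a * (d - 1))"
proof -
  interpret G: group "FB d n" by (rule FB_group)
  note c = fb_t_closed[OF assms(2), of d]
  have "fb_t d n i [^]\<^bsub>FB d n\<^esub> (a * (d - 1)) \<otimes>\<^bsub>FB d n\<^esub> fb_t d n i [^]\<^bsub>FB d n\<^esub> a = fb_t d n i [^]\<^bsub>FB d n\<^esub> (d * a)"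
  proof -
    have "a * (d - 1) + a = d * a" using assms(1) by (cases d) auto
    then show ?thesis using G.nat_pow_mult[OF c, of "a * (d - 1)" a] by simp
  qed
  also have "\<dots> = \<one>\<^bsub>FB d n\<^esub>"
    using G.nat_pow_pow[OF c, of d a] fb_relations(3)[OF assms] by simp
  finally show ?thesis
    using c by (intro G.inv_equality) auto
qed

lemma yh_pres:
  assumes d: "d \<ge> 1" and n: "n \<ge> 1"
  shows "yh_presentation (YH d n) d n (yh_s d n) (yh_t d n)"
proof -
  interpret Y: kalgebra "YH d n" by (rule YH_kalgebra)
  interpret A: kalgebra "kFB d n" by (rule kFB_kalgebra)
  interpret G: group "FB d n" by (rule FB_group)
  note sc = fb_s_closed[of _ n d] and tc = fb_t_closed[of _ n d] and rels = fb_relations[OF d, of _ n]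
  note m = yh_s_proj yh_t_proj yh_grp_mult
  show ?thesis
  proof (intro yh_presentation.intro yh_presentation_axioms.intro)
    show "kalgebra (YH d n)" by (rule YH_kalgebra)
    show "1 \<le> d" "1 \<le> n" by fact+
    show "yh_s d n i \<in> carrier (YH d n)" if "i \<in> {1..<n}" for i
      unfolding yh_s_proj by (rule yh_grp_closed[OF sc[OF that]])
    show "yh_t d n i \<in> carrier (YH d n)" if "i \<in> {1..n}" for i
      unfolding yh_t_proj by (rule yh_grp_closed[OF tc[OF that]])
    show "yh_s d n i \<otimes>\<^bsub>YH d n\<^esub> yh_s d n j = yh_s d n j \<otimes>\<^bsub>YH d n\<^esub> yh_s d n i"
      if "i \<in> {1..<n}" "j \<in> {1..<n}" "Suc i < j" for i j
      unfolding m(1) m(3)[OF sc[OF that(1)] sc[OF that(2)]] m(3)[OF sc[OF that(2)] sc[OF that(1)]]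
      using that rels(1)[of i j] by simp
    show "yh_s d n i \<otimes>\<^bsub>YH d n\<^esub> (yh_s d n (Suc i) \<otimes>\<^bsub>YH d n\<^esub> yh_s d n i) =
        yh_s d n (Suc i) \<otimes>\<^bsub>YH d n\<^esub> (yh_s d n i \<otimes>\<^bsub>YH d n\<^esub> yh_s d n (Suc i))" if "1 \<le> i" "Suc i < n" for i
    proof -
      have i: "i \<in> {1..<n}" "Suc i \<in> {1..<n}" using that by auto
      then show ?thesis using rels(2)[of i "Suc i"] by (simp add: m sc)
    qed
    show "yh_t d n i \<otimes>\<^bsub>YH d n\<^esub> yh_t d n j = yh_t d n j \<otimes>\<^bsub>YH d n\<^esub> yh_t d n i"
      if "i \<in> {1..n}" "j \<in> {1..n}" for i j
      using that rels(4)[of i j] by (simp add: m tc)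
    show "yh_t d n i [^]\<^bsub>YH d n\<^esub> d = \<one>\<^bsub>YH d n\<^esub>" if "i \<in> {1..n}" for i
      unfolding yh_t_proj yh_grp_pow[OF tc[OF that], symmetric] rels(3)[OF that] by (rule yh_grp_one)
    show "yh_s d n i \<otimes>\<^bsub>YH d n\<^esub> yh_t d n j = yh_t d n (Transposition.transpose i (Suc i) j) \<otimes>\<^bsub>YH d n\<^esub> yh_s d n i"
      if ij: "i \<in> {1..<n}" "j \<in> {1..n}" for i j
    proof -
      have "Transposition.transpose i (Suc i) j \<in> {1..n}" using ij by (auto simp: Transposition.transpose_def)
      then show ?thesis using ij rels(5)[OF ij] by (simp add: m sc tc)
    qed
    show "\<exists>e\<in>lspan (YH d n) (Y.word_eval (yh_t d n) ` lists {1..n}).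
        yh_s d n i \<otimes>\<^bsub>YH d n\<^esub> yh_s d n i = e \<otimes>\<^bsub>YH d n\<^esub> yh_s d n i \<oplus>\<^bsub>YH d n\<^esub> \<one>\<^bsub>YH d n\<^esub>" if i: "i \<in> {1..<n}" for i
    proof -
      let ?X = "Y.word_eval (yh_t d n) ` lists {1..n}"
      have X: "?X \<subseteq> carrier (YH d n)"
        by (auto simp del: in_lists_conv_set intro!: Y.word_eval_closed[of "{1..n}"]) (simp add: yh_t_proj yh_grp_closed tc)
      have ti: "i \<in> {1..n}" "i + 1 \<in> {1..n}" using i by auto
      have EC: "yh_E d n i \<in> carrier (kFB d n)" by (rule yh_E_carrier[OF i])
      have sC: "kdelta (fb_s d n i) \<in> carrier (kFB d n)" using sc[OF i] by (simp add: kFB_def)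
      have pw: "yh_grp d n (fb_t d n j [^]\<^bsub>FB d n\<^esub> (k::nat)) = Y.word_eval (yh_t d n) (replicate k j)" if "j \<in> {1..n}" for j k
      proof (induction k)
        case 0
        then show ?case by (simp add: yh_grp_one)
      next
        case (Suc k)
        have "fb_t d n j [^]\<^bsub>FB d n\<^esub> Suc k = fb_t d n j \<otimes>\<^bsub>FB d n\<^esub> fb_t d n j [^]\<^bsub>FB d n\<^esub> k"
          by (rule G.nat_pow_Suc2[OF tc[OF that]])
        then show ?case using Suc tc[OF that] by (simp add: yh_grp_mult[symmetric] yh_t_proj)
      qed
      \<comment> \<open>Each summand of E_i is the image of a positive t-word, so the average lies
        in their span.\<close>
      have "yh_proj d n (yh_E d n i) \<in> lspan (YH d n) ?X"
      proof -
        have tcl: "fb_t d n i \<in> carrier (FB d n)" "fb_t d n (i + 1) \<in> carrier (FB d n)" using ti tc by auto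
        let ?g = "\<lambda>a. fb_t d n i [^]\<^bsub>FB d n\<^esub> (a::nat) \<otimes>\<^bsub>FB d n\<^esub> inv\<^bsub>FB d n\<^esub> (fb_t d n (i + 1) [^]\<^bsub>FB d n\<^esub> a)"
        have gc: "?g a \<in> carrier (FB d n)" for a using tcl by simp
        have kc: "(\<lambda>a. kdelta (?g a)) \<in> {1..d} \<rightarrow> carrier (kFB d n)" using gc by (simp add: kFB_def)
        have 1: "yh_proj d n (yh_E d n i) = (1 / of_nat d) \<odot>\<^bsub>YH d n\<^esub> (\<Oplus>\<^bsub>YH d n\<^esub>a\<in>{1..d}. yh_grp d n (?g a))"
          unfolding yh_E_def alg_homD(5)[OF yh_proj_hom A.finsum_closed[OF kc]]
            alg_hom_more(3)[OF A.kalgebra_axioms Y.kalgebra_axioms yh_proj_hom finite_atLeastAtMost kc] ..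
        have 2: "yh_grp d n (?g a) \<in> ?X" for a
        proof -
          have "yh_grp d n (?g a) = Y.word_eval (yh_t d n) (replicate a i) \<otimes>\<^bsub>YH d n\<^esub> Y.word_eval (yh_t d n) (replicate (a * (d - 1)) (i + 1))"
            unfolding fb_t_inv[OF d ti(2)] using tcl pw[OF ti(1), of a] pw[OF ti(2), of "a * (d - 1)"] by (simp add: yh_grp_mult[symmetric])
          also have "\<dots> = Y.word_eval (yh_t d n) (replicate a i @ replicate (a * (d - 1)) (i + 1))"
            using ti by (intro Y.word_eval_append[of "{1..n}", symmetric]) (auto simp: yh_t_proj yh_grp_closed tc)
          finally show ?thesis using ti by (intro image_eqI) auto
        qed
        show ?thesis
          unfolding 1 by (intro Y.lspan_smult[OF X] Y.lspan_finsum[OF X] finite_atLeastAtMost Y.lspan_incl[OF X] 2)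
      qed
      then have "(qq - inverse qq) \<odot>\<^bsub>YH d n\<^esub> yh_proj d n (yh_E d n i) \<in> lspan (YH d n) ?X"
        by (rule Y.lspan_smult[OF X])
      moreover have "yh_s d n i \<otimes>\<^bsub>YH d n\<^esub> yh_s d n i =
          ((qq - inverse qq) \<odot>\<^bsub>YH d n\<^esub> yh_proj d n (yh_E d n i)) \<otimes>\<^bsub>YH d n\<^esub> yh_s d n i \<oplus>\<^bsub>YH d n\<^esub> \<one>\<^bsub>YH d n\<^esub>"
      proof -
        let ?s = "kdelta (fb_s d n i) :: fb_gen gword set \<Rightarrow> Cq"
        have "(?s \<otimes>\<^bsub>kFB d n\<^esub> ?s, (qq - inverse qq) \<odot>\<^bsub>kFB d n\<^esub> (yh_E d n i \<otimes>\<^bsub>kFB d n\<^esub> ?s) \<oplus>\<^bsub>kFB d n\<^esub> \<one>\<^bsub>kFB d n\<^esub>) \<in> yh_rels d n"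
          unfolding yh_rels_def using i by blast
        from A.rel_coset_eq[OF yh_rels_carrier this]
        have "yh_proj d n (?s \<otimes>\<^bsub>kFB d n\<^esub> ?s) =
            yh_proj d n ((qq - inverse qq) \<odot>\<^bsub>kFB d n\<^esub> (yh_E d n i \<otimes>\<^bsub>kFB d n\<^esub> ?s) \<oplus>\<^bsub>kFB d n\<^esub> \<one>\<^bsub>kFB d n\<^esub>)"
          by (simp add: yh_proj_def)
        then show ?thesis
          using EC sC alg_homD(1)[OF yh_proj_hom EC]  alg_homD(1)[OF yh_proj_hom sC]
          by (simp add: alg_homD(2-5)[OF yh_proj_hom] yh_s_proj Y.smult_mult_l)
      qed
      ultimately show ?thesis by blast
    qed
  qed
qed

text \<open>Images of group elements span the quotient, and signed words are straightened letter by
  letter. Inverse letters need separate treatment: an inverse t is a positive power, an inverse s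
  comes from the quadratic relation.\<close>

lemma yh_span:
  assumes d: "d \<ge> 1" and n: "n \<ge> 1" and x: "x \<in> carrier (YH d n)"
  shows "\<exists>\<alpha>. x = (\<Oplus>\<^bsub>YH d n\<^esub>j\<in>yh_presentation.exps d n \<times> cws (n - 1).
    \<alpha> j \<odot>\<^bsub>YH d n\<^esub> (yh_presentation.tmon (YH d n) (yh_t d n) 1 (fst j) \<otimes>\<^bsub>YH d n\<^esub>
      monoid.word_eval (YH d n) (yh_s d n) (snd j)))"
proof -
  interpret P: yh_presentation "YH d n" d n "yh_s d n" "yh_t d n" by (rule yh_pres[OF d n])
  interpret G: group "FB d n" by (rule FB_group)
  let ?Y = "YH d n" and ?X = "yh_grp d n ` carrier (FB d n)" and ?L = "lspan (YH d n) (P.nfs (n - 1))"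
  let ?cl = "\<lambda>u. group_cong (fb_gens n) (fb_rels d n) `` {u}"
  have X: "?X \<subseteq> carrier ?Y" using yh_grp_closed by auto
  have k: "n - 1 < n" using n by simp
  note nfc = P.nfs_closed[OF k]
  have gen: "x \<in> lspan ?Y ?X"
  proof -
    obtain a where a: "a \<in> carrier (monoid_algebra (FB d n))" "x = yh_proj d n a"
      using x unfolding YH_carrier kFB_def by auto
    have "yh_proj d n a \<in> lspan ?Y ?X"
      using a(1)
    proof (induction rule: monoid_algebra_induct)
      case zero
      have "yh_proj d n (\<lambda>_. 0) = \<zero>\<^bsub>?Y\<^esub>"
        using alg_hom_more(1)[OF kFB_kalgebra YH_kalgebra yh_proj_hom[of d n]] by (simp add: kFB_def monoid_algebra_simps)
      then show ?case using lspan.zero by simp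
    next
      case (step c g f)
      have kg: "kdelta g \<in> carrier (kFB d n)" and f: "f \<in> carrier (kFB d n)" using step by (simp_all add: kFB_def)
      have "yh_proj d n (\<lambda>y. c * kdelta g y + f y) = c \<odot>\<^bsub>?Y\<^esub> yh_grp d n g \<oplus>\<^bsub>?Y\<^esub> yh_proj d n f"
        using alg_homD(3)[OF yh_proj_hom kalgebra.smult_closed[OF kFB_kalgebra kg, of c] f] alg_homD(5)[OF yh_proj_hom kg, of c]
        by (simp add: kFB_def monoid_algebra_simps)
      then show ?case using step by (auto intro: lspan.step)
    qed
    then show ?thesis using a by simp
  qed
  have tinv: "?cl [(Tgen i, False)] = fb_t d n i [^]\<^bsub>FB d n\<^esub> (d - 1)" if i: "i \<in> {1..n}" for i
  proof -
    have m: "[(Tgen i, e)] \<in> lists (fb_gens n \<times> UNIV)" for e using fb_gen_mem(2)[OF i, of e] by simp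
    have "([(Tgen i, False), (Tgen i, \<not> False)], []) \<in> group_cong (fb_gens n) (fb_rels d n)"
      using m[of True] by (intro group_cong.cancel) simp
    then have "?cl [(Tgen i, False), (Tgen i, True)] = ?cl []"
      by (intro equiv_class_eq[OF group_cong_equiv]) simp
    then have "?cl [(Tgen i, False)] \<otimes>\<^bsub>FB d n\<^esub> fb_t d n i = \<one>\<^bsub>FB d n\<^esub>"
      unfolding fb_t_def using fb_class_mult[OF m[of False] m[of True], of d] by (simp add: FB_def presented_group_one)
    then have "inv\<^bsub>FB d n\<^esub> (fb_t d n i) = ?cl [(Tgen i, False)]"
      using fb_t_closed[OF i] fb_class[OF m] by (intro G.inv_equality) auto
    then show ?thesis using fb_t_inv[OF d i, of 1] fb_t_closed[OF i, of d] by simp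
  qed
  have word: "yh_grp d n (?cl u) \<in> ?L" if "u \<in> lists (fb_gens n \<times> UNIV)" for u
    using that
  \<comment> \<open>Letters are appended at the end, because the span of the normal forms has been
    shown stable under multiplication from the right.\<close>
  proof (induction u rule: rev_induct)
    case Nil
    have "\<one>\<^bsub>?Y\<^esub> \<otimes>\<^bsub>?Y\<^esub> P.sw [] \<in> ?L" by (rule P.nfs_TS[OF k P.TS_one cws_Nil])
    moreover have "?cl [] = \<one>\<^bsub>FB d n\<^esub>" by (simp add: FB_def presented_group_one)
    ultimately show ?case by (simp add: yh_grp_one)
  next
    case (snoc g u)
    then have u: "u \<in> lists (fb_gens n \<times> UNIV)" and g: "[g] \<in> lists (fb_gens n \<times> UNIV)" by auto
    have IH: "yh_grp d n (?cl u) \<in> ?L" by (rule snoc.IH[OF u])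
    have eq: "yh_grp d n (?cl (u @ [g])) = yh_grp d n (?cl u) \<otimes>\<^bsub>?Y\<^esub> yh_grp d n (?cl [g])"
      unfolding yh_grp_mult[OF fb_class[OF u] fb_class[OF g]] fb_class_mult[OF u g] ..
    obtain h e where ge: "g = (h, e)" by (cases g)
    show ?case
    proof (cases h)
      case (Sgen i)
      then have i: "i \<in> {1..<n}" using g by (auto simp: ge fb_gens_def)
      show ?thesis
      proof (cases e)
        case True
        then have "yh_grp d n (?cl [g]) = yh_s d n i" by (simp add: ge Sgen yh_s_proj fb_s_def)
        then show ?thesis unfolding eq using P.nf_mult_s[OF IH i] by simp
      next
        case False
        let ?s = "yh_s d n i" and ?s' = "yh_grp d n (?cl [g])"
        have m: "[(Sgen i, e)] \<in> lists (fb_gens n \<times> UNIV)" for e using fb_gen_mem(1)[OF i, of e] by simp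
        have "([(Sgen i, True), (Sgen i, \<not> True)], []) \<in> group_cong (fb_gens n) (fb_rels d n)"
          using m[of True] by (intro group_cong.cancel) simp
        then have "?cl [(Sgen i, True), (Sgen i, False)] = ?cl []"
          by (intro equiv_class_eq[OF group_cong_equiv]) simp
        then have "fb_s d n i \<otimes>\<^bsub>FB d n\<^esub> ?cl [g] = \<one>\<^bsub>FB d n\<^esub>"
          unfolding fb_s_def ge Sgen using fb_class_mult[OF m[of True] m[of False], of d] False by (simp add: FB_def presented_group_one)
        then have ss': "?s \<otimes>\<^bsub>?Y\<^esub> ?s' = \<one>\<^bsub>?Y\<^esub>"
          unfolding yh_s_proj yh_grp_mult[OF fb_s_closed[OF i] fb_class[OF g]] by (simp add: yh_grp_one)
        obtain c where c: "c \<in> P.TS" "?s \<otimes>\<^bsub>?Y\<^esub> ?s = c \<otimes>\<^bsub>?Y\<^esub> ?s \<oplus>\<^bsub>?Y\<^esub> \<one>\<^bsub>?Y\<^esub>"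
          using P.quad[OF i] unfolding P.TS_def by blast
        note cl = P.s_closed[OF i] yh_grp_closed[OF fb_class[OF g]] P.TS_closed[OF c(1)]
        \<comment> \<open>Multiplying s_i s_i = c s_i + 1 by the inverse on the right expresses the
          inverse as s_i - c, with c in the torus algebra.\<close>
        have "?s = (?s \<otimes>\<^bsub>?Y\<^esub> ?s) \<otimes>\<^bsub>?Y\<^esub> ?s'" using cl ss' by (simp add: P.m_assoc)
        also have "\<dots> = c \<oplus>\<^bsub>?Y\<^esub> ?s'" unfolding c(2) using cl ss' by (simp add: P.l_distr P.m_assoc)
        finally have "?s' = ?s \<ominus>\<^bsub>?Y\<^esub> c"
          using cl by (simp add: a_minus_def P.a_ac P.r_neg2)
        then have "yh_grp d n (?cl u) \<otimes>\<^bsub>?Y\<^esub> ?s' = yh_grp d n (?cl u) \<otimes>\<^bsub>?Y\<^esub> ?s \<ominus>\<^bsub>?Y\<^esub> yh_grp d n (?cl u) \<otimes>\<^bsub>?Y\<^esub> c"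
          using cl yh_grp_closed[OF fb_class[OF u]] by (simp add: a_minus_def P.r_distr P.r_minus)
        then show ?thesis
          unfolding eq using P.lspan_minus[OF nfc P.nf_mult_s[OF IH i] P.nf_mult_TS[OF IH c(1)]] by simp
      qed
    next
      case (Tgen i)
      then have i: "i \<in> {1..n}" using g by (auto simp: ge fb_gens_def)
      have "yh_grp d n (?cl [g]) \<in> P.TS"
      proof (cases e)
        case True
        then have "yh_grp d n (?cl [g]) = yh_t d n i" by (simp add: ge Tgen yh_t_proj fb_t_def)
        then show ?thesis using P.TS_t[OF i] by simp
      next
        case False
        have "yh_t d n i [^]\<^bsub>?Y\<^esub> m \<in> P.TS" for m :: nat
          by (induction m) (auto intro: P.TS_one P.TS_mult P.TS_t[OF i])
        then show ?thesis
          using False tinv[OF i] yh_grp_pow[OF fb_t_closed[OF i], of d "d - 1"] by (simp add: ge Tgen yh_t_proj)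
      qed
      then show ?thesis unfolding eq by (rule P.nf_mult_TS[OF IH])
    qed
  qed
  have "?X \<subseteq> ?L"
  proof clarify
    fix g assume "g \<in> carrier (FB d n)"
    then obtain u where "u \<in> lists (fb_gens n \<times> UNIV)" "g = ?cl u"
      unfolding FB_def by (rule presented_group_cases)
    then show "yh_grp d n g \<in> ?L" using word by simp
  qed
  from P.span[OF gen X this] show ?thesis .
qed

section \<open>Characters of the torus\<close>

lemma sum_lists_Suc:
  assumes "finite D"
  shows "(\<Sum>a\<in>{a. length a = Suc m \<and> set a \<subseteq> D}. f a) =
    (\<Sum>x\<in>D. \<Sum>a\<in>{a. length a = m \<and> set a \<subseteq> D}. f (x # a))"
proof -
  have "{a. length a = Suc m \<and> set a \<subseteq> D} = (\<lambda>(x, a). x # a) ` (D \<times> {a. length a = m \<and> set a \<subseteq> D})"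
    by (auto simp: length_Suc_conv image_iff)
  moreover have "inj_on (\<lambda>(x, a). x # a) (D \<times> {a. length a = m \<and> set a \<subseteq> D})"
    by (auto simp: inj_on_def)
  ultimately show ?thesis
    by (simp add: sum.reindex sum.cartesian_product split_def)
qed

lemma power_ratio: "(x::'k::field) ^ a * inverse (y ^ a) = (x * inverse y) ^ a"
  by (simp add: power_mult_distrib power_inverse)

lemma power_ratio_mult:
  "(x::'k::field) ^ (k * p) * A * (inverse x ^ (k * r) * B) = (x ^ p * inverse (x ^ r)) ^ k * (A * B)"
proof -
  have "x ^ (k * p) = (x ^ p) ^ k" "inverse x ^ (k * r) = inverse ((x ^ r) ^ k)"
    by (simp_all add: power_inverse mult.commute flip: power_mult)
  then show ?thesis by (simp only: power_ratio[symmetric] mult_ac)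
qed

text \<open>The value at q = 1 of a natural number is that number in the complex field, where it is
  nonzero.\<close>

lemma of_nat_Cq_nonzero:
  assumes "m \<ge> 1"
  shows "(of_nat m :: Cq) \<noteq> 0"
proof
  assume "(of_nat m :: Cq) = 0"
  moreover have "spec (of_nat m) (of_nat m)"
    by (induction m) (simp_all add: spec_add spec_0 spec_1)
  ultimately have "spec 0 (of_nat m)" by (rule subst)
  then have "(of_nat m :: complex) = 0" by (rule spec_unique[OF _ spec_0])
  then show False using assms by simp
qed

text \<open>The eigenvalue of the t-monomial with exponents \<open>a\<close> on words of colours
  \<open>c\<close>. Colours start at 1 and act by \<open>z ^ (b - 1)\<close>, hence the
  shift.\<close>

primrec chi :: "'k::field \<Rightarrow> nat list \<Rightarrow> nat list \<Rightarrow> 'k" where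
  "chi z [] c = 1"
| "chi z (x # a) c = z ^ (x * (hd c - 1)) * chi z a (tl c)"

locale prim_root =
  fixes d :: nat and z :: Cq
  assumes d: "d \<ge> 1" and z_pow: "z ^ d = 1" and prim: "0 < m \<Longrightarrow> m < d \<Longrightarrow> z ^ m \<noteq> 1"
begin

lemma z_nonzero: "z \<noteq> 0"
  using d z_pow by (auto simp: power_0_left)

lemma root_inj:
  assumes "k < d" "k' < d" "z ^ k = z ^ k'"
  shows "k = k'"
proof -
  have *: "i = j" if ij: "i \<le> j" "j < d" "z ^ i = z ^ j" for i j
  proof (rule ccontr)
    assume "i \<noteq> j"
    have "z ^ i * z ^ (j - i) = z ^ j" using ij(1) by (simp flip: power_add)
    also have "\<dots> = z ^ i * 1" using ij(3) by simp
    finally have "z ^ (j - i) = 1" using z_nonzero by simp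
    then show False using prim[of "j - i"] ij \<open>i \<noteq> j\<close> by simp
  qed
  show ?thesis using *[of k k'] *[of k' k] assms by (cases "k \<le> k'") auto
qed

text \<open>The ratio is a d-th root of unity, equal to 1 only for equal exponents because
  \<open>z\<close> is primitive. The range from 0 serves the Fourier transform, the range from 1 the
  average that defines E_i.\<close>

lemma ratio_sum:
  assumes "p < d" "r < d"
  shows "(\<Sum>k<d. (z ^ p * inverse (z ^ r)) ^ k) = (if p = r then of_nat d else 0)"
    and "(\<Sum>k\<in>{1..d}. (z ^ p * inverse (z ^ r)) ^ k) = (if p = r then of_nat d else 0)"
proof -
  define x where "x = z ^ p * inverse (z ^ r)"
  have "(z ^ m) ^ d = 1" for m using z_pow by (metis power_mult mult.commute power_one)
  then have xd: "x ^ d = 1" unfolding x_def power_ratio[symmetric] by simp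
  have x1: "x = 1 \<longleftrightarrow> p = r"
  proof
    assume "x = 1"
    then have "z ^ p * inverse (z ^ r) * z ^ r = z ^ r" unfolding x_def by simp
    then have "z ^ p = z ^ r" using z_nonzero by (simp add: mult.assoc)
    then show "p = r" using root_inj assms by blast
  next
    assume "p = r"
    then show "x = 1" unfolding x_def using z_nonzero by simp
  qed
  have s: "(\<Sum>k<d. x ^ k) = (if x = 1 then of_nat d else 0)"
    using xd by (cases "x = 1") (simp_all add: geometric_sum)
  show "(\<Sum>k<d. (z ^ p * inverse (z ^ r)) ^ k) = (if p = r then of_nat d else 0)"
    using s unfolding x1 unfolding x_def .
  have "(\<Sum>k\<in>{1..d}. x ^ k) = x * (\<Sum>k<d. x ^ k)"
    by (simp add: sum.atLeast1_atMost_eq sum_distrib_left)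
  also have "\<dots> = (if x = 1 then of_nat d else 0)" unfolding s by simp
  finally show "(\<Sum>k\<in>{1..d}. (z ^ p * inverse (z ^ r)) ^ k) = (if p = r then of_nat d else 0)"
    unfolding x1 unfolding x_def .
qed

text \<open>The sum over tuples factors into one geometric sum for each position. Summing over
  exponents isolates a colour sequence, as is needed for the idempotents e_c.\<close>

lemma chi_orth:
  assumes "length c = length c'" "set c \<subseteq> {1..d}" "set c' \<subseteq> {1..d}"
  shows "(\<Sum>a\<in>{a. length a = length c \<and> set a \<subseteq> {..<d}}. chi z a c * chi (inverse z) a c') =
    (if c = c' then of_nat d ^ length c else 0)"
  using assms
proof (induction c c' rule: list_induct2)
  case Nil
  have "{a. length a = length [] \<and> set a \<subseteq> {..<d}} = {[]}" by auto
  then show ?case by simp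
next
  case (Cons x c y c')
  let ?L = "{a. length a = length c \<and> set a \<subseteq> {..<d}}"
  let ?r = "z ^ (x - 1) * inverse (z ^ (y - 1))"
  have xy: "x - 1 < d" "y - 1 < d" "x - 1 = y - 1 \<longleftrightarrow> x = y" using Cons.prems d by auto
  have "(\<Sum>a\<in>{a. length a = length (x # c) \<and> set a \<subseteq> {..<d}}. chi z a (x # c) * chi (inverse z) a (y # c')) =
      (\<Sum>k<d. \<Sum>a\<in>?L. z ^ (k * (x - 1)) * chi z a c * (inverse z ^ (k * (y - 1)) * chi (inverse z) a c'))"
    unfolding list.size(4) add_Suc_right add_0_right sum_lists_Suc[OF finite_lessThan] chi.simps list.sel ..
  also have "\<dots> = (\<Sum>k<d. ?r ^ k) * (\<Sum>a\<in>?L. chi z a c * chi (inverse z) a c')"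
    unfolding power_ratio_mult sum_product ..
  also have "\<dots> = (if x # c = y # c' then of_nat d ^ length (x # c) else 0)"
    using Cons unfolding ratio_sum(1)[OF xy(1,2)] xy(3) by simp
  finally show ?case .
qed

text \<open>The inverse transform: summing over colours isolates an exponent, which recovers the
  coefficients of t-monomials from their values on colour sequences.\<close>

lemma chi_orth_dual:
  assumes "length a = length a'" "set a \<subseteq> {..<d}" "set a' \<subseteq> {..<d}"
  shows "(\<Sum>c\<in>{c. length c = length a \<and> set c \<subseteq> {1..d}}. chi z a c * chi (inverse z) a' c) =
    (if a = a' then of_nat d ^ length a else 0)"
  using assms
proof (induction a a' rule: list_induct2)
  case Nil
  have "{c. length c = length [] \<and> set c \<subseteq> {1..d}} = {[]}" by auto
  then show ?case by simp
next
  case (Cons x a y a')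
  let ?L = "{c. length c = length a \<and> set c \<subseteq> {1..d}}"
  let ?r = "z ^ x * inverse (z ^ y)"
  have xy: "x < d" "y < d" using Cons.prems by auto
  have "(\<Sum>c\<in>{c. length c = length (x # a) \<and> set c \<subseteq> {1..d}}. chi z (x # a) c * chi (inverse z) (y # a') c) =
      (\<Sum>k\<in>{1..d}. \<Sum>c\<in>?L. z ^ ((k - 1) * x) * chi z a c * (inverse z ^ ((k - 1) * y) * chi (inverse z) a' c))"
    unfolding list.size(4) add_Suc_right add_0_right sum_lists_Suc[OF finite_atLeastAtMost] chi.simps list.sel
      mult.commute[of x] mult.commute[of y] ..
  also have "\<dots> = (\<Sum>k\<in>{1..d}. ?r ^ (k - 1)) * (\<Sum>c\<in>?L. chi z a c * chi (inverse z) a' c)"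
    unfolding power_ratio_mult sum_product ..
  also have "(\<Sum>k\<in>{1..d}. ?r ^ (k - 1)) = (\<Sum>k<d. ?r ^ k)"
    by (simp add: sum.atLeast1_atMost_eq)
  also have "\<dots> * (\<Sum>c\<in>?L. chi z a c * chi (inverse z) a' c) = (if x # a = y # a' then of_nat d ^ length (x # a) else 0)"
    using Cons unfolding ratio_sum(1)[OF xy] by simp
  finally show ?case .
qed

end

section \<open>The homomorphism\<close>

text \<open>The operators define a homomorphism of the framed braid group, extended linearly and
  then factored through the quadratic relations. \<open>N\<close> is arbitrary, so one
  Yokonuma-Hecke algebra acts on tensor spaces of different sizes; the converse direction of the
  isomorphism criterion relies on this.\<close>

lemma (in prim_root) YH_rep_exists:
  "\<exists>\<Psi>\<in>alg_hom (YH d n) (endo_alg (tbasis d N n)).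
    (\<forall>i\<in>{1..<n}. \<Psi> (yh_s d n i) = sigma d N n i) \<and> (\<forall>i\<in>{1..n}. \<Psi> (yh_t d n i) = tau d N n z i)"
proof -
  let ?T = "tbasis d N n" and ?E = "endo_alg (tbasis d N n) :: (Cq, _) module"
  interpret E: kalgebra ?E by (rule endo_alg_kalgebra)
  interpret A: kalgebra "kFB d n" by (rule kFB_kalgebra)
  interpret G: group "FB d n" by (rule FB_group)
  obtain \<phi> where \<phi>: "\<phi> \<in> hom (FB d n) ?E" "\<phi> \<one>\<^bsub>FB d n\<^esub> = \<one>\<^bsub>?E\<^esub>"
    "\<forall>u\<in>lists (fb_gens n \<times> UNIV). \<phi> (group_cong (fb_gens n) (fb_rels d n) `` {u}) = E.word_eval (fb_op d N n z) u"
    by (rule FB_lift[OF z_pow z_nonzero])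
  have \<phi>c: "\<phi> \<in> carrier (FB d n) \<rightarrow> carrier ?E" using \<phi>(1) by (simp add: hom_def)
  have \<phi>m: "\<phi> (x \<otimes>\<^bsub>FB d n\<^esub> y) = \<phi> x \<otimes>\<^bsub>?E\<^esub> \<phi> y" if "x \<in> carrier (FB d n)" "y \<in> carrier (FB d n)" for x y
    using \<phi>(1) that by (simp add: hom_def)
  have \<phi>cl: "\<phi> g \<in> carrier ?E" if "g \<in> carrier (FB d n)" for g using \<phi>c that by blast
  have \<phi>s: "\<phi> (fb_s d n i) = sigma d N n i" if i: "i \<in> {1..<n}" for i
  proof -
    have "sw i \<in> lists (fb_gens n \<times> UNIV)" using fb_gen_mem(1)[OF i, of True] by simp
    then have "\<phi> (fb_s d n i) = E.word_eval (fb_op d N n z) (sw i)" unfolding fb_s_def by (rule bspec[OF \<phi>(3)])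
    then show ?thesis by (simp add: sigma_carrier)
  qed
  have \<phi>t: "\<phi> (fb_t d n i) = tau d N n z i" if i: "i \<in> {1..n}" for i
  proof -
    have "tw i \<in> lists (fb_gens n \<times> UNIV)" using fb_gen_mem(2)[OF i, of True] by simp
    then have "\<phi> (fb_t d n i) = E.word_eval (fb_op d N n z) (tw i)" unfolding fb_t_def by (rule bspec[OF \<phi>(3)])
    then show ?thesis unfolding tau_dia[OF i] by (simp add: dia_carrier)
  qed
  define h where "h = mlift ?E \<phi>"
  have h: "h \<in> alg_hom (kFB d n) ?E"
    unfolding h_def kFB_def by (rule mlift_alg_hom[OF G.monoid_axioms E.kalgebra_axioms \<phi>c \<phi>m \<phi>(2)])
  have hk: "h (kdelta g) = \<phi> g" if "g \<in> carrier (FB d n)" for g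
    unfolding h_def by (rule mlift_kdelta[OF E.kalgebra_axioms \<phi>c that])
  have tpow: "\<phi> (fb_t d n i [^]\<^bsub>FB d n\<^esub> a) = dia d N n (\<lambda>c. (z ^ (c ! (i - 1) - 1)) ^ a)" if i: "i \<in> {1..n}" for i and a :: nat
  proof -
    have "\<phi> (fb_t d n i [^]\<^bsub>FB d n\<^esub> a) = \<phi> (fb_t d n i) [^]\<^bsub>?E\<^esub> a"
      using fb_t_closed[OF i, of d] by (induction a) (simp_all add: \<phi>(2) \<phi>m)
    then show ?thesis unfolding \<phi>t[OF i] tau_dia[OF i] dia_pow .
  qed
  have tinv: "\<phi> (inv\<^bsub>FB d n\<^esub> (fb_t d n i [^]\<^bsub>FB d n\<^esub> a)) = dia d N n (\<lambda>c. inverse ((z ^ (c ! (i - 1) - 1)) ^ a))"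
    if i: "i \<in> {1..n}" for i and a :: nat
  proof -
    let ?g = "fb_t d n i [^]\<^bsub>FB d n\<^esub> a"
    have g: "?g \<in> carrier (FB d n)" using fb_t_closed[OF i, of d] by simp
    have e: "(\<lambda>c. (z ^ (c ! (i - 1) - 1)) ^ a * inverse ((z ^ (c ! (i - 1) - 1)) ^ a)) = (\<lambda>c. 1)"
      using z_nonzero by (intro ext right_inverse) simp
    show ?thesis
    \<comment> \<open>The group inverse is identified with the reciprocal diagonal operator through
      uniqueness of inverses in the endomorphism algebra.\<close>
    proof (rule E.inv_unique[of _ "\<phi> ?g"])
      show "\<phi> (inv\<^bsub>FB d n\<^esub> ?g) \<otimes>\<^bsub>?E\<^esub> \<phi> ?g = \<one>\<^bsub>?E\<^esub>"
        unfolding \<phi>m[OF G.inv_closed[OF g] g, symmetric] G.l_inv[OF g] by (rule \<phi>(2))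
      show "\<phi> ?g \<otimes>\<^bsub>?E\<^esub> dia d N n (\<lambda>c. inverse ((z ^ (c ! (i - 1) - 1)) ^ a)) = \<one>\<^bsub>?E\<^esub>"
        unfolding tpow[OF i] dia_mult e by (rule dia_one)
    qed (use g in \<open>auto intro: \<phi>cl dia_carrier\<close>)
  qed
  \<comment> \<open>On given colours the average over a runs through powers of a root of unity that
    is 1 exactly when the two colours agree, so E_i becomes the indicator of equal colours.\<close>
  have hE: "h (yh_E d n i) = dia d N n (same_col i)" if i: "i \<in> {1..<n}" for i
  proof -
    have ti: "i \<in> {1..n}" "i + 1 \<in> {1..n}" using i by auto
    note tc = fb_t_closed[OF ti(1), of d] fb_t_closed[OF ti(2), of d]
    let ?g = "\<lambda>a. fb_t d n i [^]\<^bsub>FB d n\<^esub> (a::nat) \<otimes>\<^bsub>FB d n\<^esub> inv\<^bsub>FB d n\<^esub> (fb_t d n (i + 1) [^]\<^bsub>FB d n\<^esub> a)"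
    let ?x = "\<lambda>c::nat list. z ^ (c ! (i - 1) - 1)" and ?y = "\<lambda>c::nat list. z ^ (c ! (i + 1 - 1) - 1)"
    have gc: "?g a \<in> carrier (FB d n)" for a using tc by simp
    have kc: "(\<lambda>a. kdelta (?g a)) \<in> {1..d} \<rightarrow> carrier (kFB d n)" using gc by (simp add: kFB_def)
    have hg: "h (kdelta (?g a)) = dia d N n (\<lambda>c. ?x c ^ a * inverse (?y c ^ a))" for a
      unfolding hk[OF gc] \<phi>m[OF G.nat_pow_closed[OF tc(1)] G.inv_closed[OF G.nat_pow_closed[OF tc(2)]]]
        tpow[OF ti(1)] tinv[OF ti(2)] dia_mult ..
    have "h (yh_E d n i) = (1 / of_nat d) \<odot>\<^bsub>?E\<^esub> (\<Oplus>\<^bsub>?E\<^esub>a\<in>{1..d}. dia d N n (\<lambda>c. ?x c ^ a * inverse (?y c ^ a)))"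
      unfolding yh_E_def alg_homD(5)[OF h A.finsum_closed[OF kc]]
        alg_hom_more(3)[OF A.kalgebra_axioms E.kalgebra_axioms h finite_atLeastAtMost kc] hg ..
    also have "\<dots> = dia d N n (same_col i)"
    proof (rule endo_alg_tbasis_eqI)
      fix v :: tvec and w assume v: "v \<in> vspace ?T" and w: "w \<in> ?T"
      let ?c = "map fst w"
      have lw: "length w = n" "set w \<subseteq> vbasis d N" using w by (simp_all add: tbasis_def)
      have cc: "?c ! m \<in> {1..d}" if "m < n" for m
      proof -
        have "w ! m \<in> vbasis d N" using subsetD[OF lw(2) nth_mem[of m w]] that lw(1) by simp
        then show ?thesis using lw(1) that by (auto simp: vbasis_def)
      qed
      have "((1 / of_nat d) \<odot>\<^bsub>?E\<^esub> (\<Oplus>\<^bsub>?E\<^esub>a\<in>{1..d}. dia d N n (\<lambda>c. ?x c ^ a * inverse (?y c ^ a)))) v w =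
          (1 / of_nat d) * (\<Sum>a\<in>{1..d}. dia d N n (\<lambda>c. ?x c ^ a * inverse (?y c ^ a)) v w)"
        unfolding endo_alg_simps(3)[OF v] endo_alg_finsum[OF finite_atLeastAtMost dia_carrier v] ..
      also have "\<dots> = (1 / of_nat d) * (\<Sum>a\<in>{1..d}. (?x ?c * inverse (?y ?c)) ^ a) * v w"
        unfolding dia_apply[OF v] power_ratio sum_distrib_right[symmetric] mult.assoc ..
      also have "(\<Sum>a\<in>{1..d}. (?x ?c * inverse (?y ?c)) ^ a) = of_nat d * same_col i ?c"
      proof -
        have 1: "?c ! (i - 1) \<in> {1..d}" "?c ! (i + 1 - 1) \<in> {1..d}" using cc i by auto
        then have "?c ! (i - 1) - 1 < d" "?c ! (i + 1 - 1) - 1 < d"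
          "?c ! (i - 1) - 1 = ?c ! (i + 1 - 1) - 1 \<longleftrightarrow> ?c ! (i - 1) = ?c ! i" by auto
        then show ?thesis using ratio_sum(2) unfolding same_col_def by simp
      qed
      also have "(1 / of_nat d) * (of_nat d * same_col i ?c) * v w = same_col i ?c * v w"
        using of_nat_Cq_nonzero[OF d] by simp
      finally show "((1 / of_nat d) \<odot>\<^bsub>?E\<^esub> (\<Oplus>\<^bsub>?E\<^esub>a\<in>{1..d}. dia d N n (\<lambda>c. ?x c ^ a * inverse (?y c ^ a)))) v w =
          dia d N n (same_col i) v w"
        unfolding dia_apply[OF v] .
    qed (auto intro!: E.smult_closed E.finsum_closed dia_carrier)
    finally show ?thesis .
  qed
  have rels: "\<forall>(x, y)\<in>yh_rels d n. h x = h y"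
  proof (clarify)
    fix x y assume "(x, y) \<in> yh_rels d n"
    then obtain i where i: "i \<in> {1..<n}" and xy: "x = kdelta (fb_s d n i) \<otimes>\<^bsub>kFB d n\<^esub> kdelta (fb_s d n i)"
      "y = (qq - inverse qq) \<odot>\<^bsub>kFB d n\<^esub> (yh_E d n i \<otimes>\<^bsub>kFB d n\<^esub> kdelta (fb_s d n i)) \<oplus>\<^bsub>kFB d n\<^esub> \<one>\<^bsub>kFB d n\<^esub>"
      unfolding yh_rels_def by blast
    have sc: "kdelta (fb_s d n i) \<in> carrier (kFB d n)" using fb_s_closed[OF i] by (simp add: kFB_def)
    note EC = yh_E_carrier[OF i, of d]
    have hs: "h (kdelta (fb_s d n i)) = sigma d N n i" unfolding hk[OF fb_s_closed[OF i]] by (rule \<phi>s[OF i])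
    have hx: "h x = sigma d N n i \<otimes>\<^bsub>?E\<^esub> sigma d N n i"
      unfolding xy alg_homD(2)[OF h sc sc] hs ..
    have hy: "h y = (qq - inverse qq) \<odot>\<^bsub>?E\<^esub> (dia d N n (same_col i) \<otimes>\<^bsub>?E\<^esub> sigma d N n i) \<oplus>\<^bsub>?E\<^esub> \<one>\<^bsub>?E\<^esub>"
      unfolding xy alg_homD(3)[OF h A.smult_closed[OF A.m_closed[OF EC sc]] A.one_closed]
        alg_homD(5)[OF h A.m_closed[OF EC sc]] alg_homD(2)[OF h EC sc] alg_homD(4)[OF h] hE[OF i] hs ..
    show "h x = h y"
      unfolding hx hy
    proof (rule endo_alg_tbasis_eqI)
      fix v :: tvec and w assume v: "v \<in> vspace ?T" and w: "w \<in> ?T"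
      have lw: "length w = n" "Suc (i - 1) < n" "Suc (i - 1) < length w" "Suc (i - 1) = i" using w i by (auto simp: tbasis_def)
      have sv: "Sop qq (i - 1) v \<in> vspace ?T" by (rule Sop_vspace[OF lw(2) v])
      have l: "(sigma d N n i \<otimes>\<^bsub>?E\<^esub> sigma d N n i) v w = Sop qq (i - 1) (Sop qq (i - 1) v) w"
        unfolding endo_alg_simps(1)[OF v] sigma_apply[OF i v] sigma_apply[OF i sv] ..
      have r: "((qq - inverse qq) \<odot>\<^bsub>?E\<^esub> (dia d N n (same_col i) \<otimes>\<^bsub>?E\<^esub> sigma d N n i) \<oplus>\<^bsub>?E\<^esub> \<one>\<^bsub>?E\<^esub>) v w =
          (qq - inverse qq) * (same_col i (map fst w) * Sop qq (i - 1) v w) + v w"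
        unfolding endo_alg_simps(2)[OF v] endo_alg_simps(3)[OF v] endo_alg_simps(1)[OF v] endo_alg_simps(4)[OF v]
          sigma_apply[OF i v] dia_apply[OF sv] ..
      have sc: "same_col i (map fst w) * e = (if fst (w ! (i - 1)) = fst (w ! Suc (i - 1)) then e else 0)" for e
      proof -
        have il: "i - 1 < length w" "i < length w" using lw(1,2) i by auto
        show ?thesis unfolding same_col_def lw(4) nth_map[OF il(1)] nth_map[OF il(2)] by simp
      qed
      show "(sigma d N n i \<otimes>\<^bsub>?E\<^esub> sigma d N n i) v w =
          ((qq - inverse qq) \<odot>\<^bsub>?E\<^esub> (dia d N n (same_col i) \<otimes>\<^bsub>?E\<^esub> sigma d N n i) \<oplus>\<^bsub>?E\<^esub> \<one>\<^bsub>?E\<^esub>) v w"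
        unfolding l r sc by (rule Sop_quadratic[OF lw(3) qq_nonzero])
    qed (intro endo_alg_closed sigma_carrier dia_carrier endo_alg_one_zero)+
  qed
  let ?P = "\<lambda>X. the_elem (h ` X)"
  have hom: "?P \<in> alg_hom (YH d n) ?E"
    unfolding YH_def by (rule A.alg_mod_rels_lift[OF E.kalgebra_axioms h yh_rels_carrier rels])
  have P: "?P (yh_proj d n a) = h a" if "a \<in> carrier (kFB d n)" for a
    unfolding yh_proj_def by (rule A.rel_coset_image[OF E.kalgebra_axioms h yh_rels_carrier rels that])
  have kc: "kdelta g \<in> carrier (kFB d n)" if "g \<in> carrier (FB d n)" for g using that by (simp add: kFB_def)
  have 1: "?P (yh_s d n i) = sigma d N n i" if i: "i \<in> {1..<n}" for i
    unfolding yh_s_proj P[OF kc[OF fb_s_closed[OF i]]] hk[OF fb_s_closed[OF i]] by (rule \<phi>s[OF i])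
  have 2: "?P (yh_t d n i) = tau d N n z i" if i: "i \<in> {1..n}" for i
    unfolding yh_t_proj P[OF kc[OF fb_t_closed[OF i]]] hk[OF fb_t_closed[OF i]] by (rule \<phi>t[OF i])
  show ?thesis
  proof (rule bexI[OF _ hom], rule conjI)
    show "\<forall>i\<in>{1..<n}. ?P (yh_s d n i) = sigma d N n i" by (rule ballI) (rule 1)
    show "\<forall>i\<in>{1..n}. ?P (yh_t d n i) = tau d N n z i" by (rule ballI) (rule 2)
  qed
qed

section \<open>The image commutes with the quantum group\<close>

text \<open>The operator changes the index of a letter and never its colour, so a factor depending
  on colours alone passes through.\<close>

lemma Eop_diag: "Eop q (b, i) (b, j) (\<lambda>u. M (map fst u) * f u) w = M (map fst w) * Eop q (b, i) (b, j) f w"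
proof (induction w arbitrary: M f)
  case (Cons x w)
  show ?case using Cons[of "\<lambda>c. M (fst x # c)" "\<lambda>u. f (x # u)"] by (auto simp: algebra_simps)
qed simp

lemma Fop_diag: "Fop q (b, i) (b, j) (\<lambda>u. M (map fst u) * f u) w = M (map fst w) * Fop q (b, i) (b, j) f w"
proof (induction w arbitrary: M f)
  case (Cons x w)
  show ?case using Cons[of "\<lambda>c. M (fst x # c)" "\<lambda>u. f (x # u)"] by (auto simp: algebra_simps)
qed simp

lemma Gop_diag: "Gop q a (\<lambda>u. M (map fst u) * f u) w = M (map fst w) * Gop q a f w"
  by (cases "(q, a, f)" rule: Gop.cases) (simp_all add: Eop_diag Fop_diag)

lemma Gop_linear:
  "Gop q a (\<lambda>u. f u + g u) w = Gop q a f w + Gop q a g w"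
  "Gop q a (\<lambda>u. c * f u) w = c * Gop q a f w"
  "Gop q a (\<lambda>u. 0) w = 0"
  by (cases "(q, a, f)" rule: Gop.cases; simp add: distrib_left)+

lemma Gop_sum: "Gop q a (\<lambda>u. \<Sum>j\<in>J. f j u) w = (\<Sum>j\<in>J. Gop q a (f j) w)"
  by (induction J rule: infinite_finite_induct) (simp_all add: Gop_linear)

lemma Gop_Sop:
  assumes "Suc r < length w" "q \<noteq> 0"
  shows "Gop q a (Sop q r f) w = Sop q r (Gop q a f) w"
  by (cases "(q, a, f)" rule: Gop.cases) (simp_all add: Eop_Sop_commute Fop_Sop_commute Sop_wprod assms)

definition sopw :: "nat list \<Rightarrow> tvec \<Rightarrow> tvec" where
  "sopw u f = foldr (\<lambda>i. Sop qq (i - 1)) u f"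

lemma sopw_simps [simp]: "sopw [] f = f" "sopw (i # u) f = Sop qq (i - 1) (sopw u f)"
  by (simp_all add: sopw_def)

text \<open>Commutation holds pointwise, on words long enough for all exchanges in \<open>u\<close>.
  \<open>Sop\<close> at \<open>w\<close> looks at \<open>w\<close> and at the exchanged word, so the
  induction hypothesis is used at both.\<close>

lemma Gop_sopw:
  assumes "set u \<subseteq> {1..<length w}"
  shows "Gop qq a (sopw u f) w = sopw u (Gop qq a f) w"
  using assms
proof (induction u arbitrary: w)
  case (Cons i u)
  have r: "Suc (i - 1) < length w" using Cons.prems by auto
  have "Gop qq a (sopw (i # u) f) w = Sop qq (i - 1) (Gop qq a (sopw u f)) w"
    unfolding sopw_simps by (rule Gop_Sop[OF r qq_nonzero])
  also have "\<dots> = sopw (i # u) (Gop qq a f) w"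
    unfolding sopw_simps Sop_alt using Cons.IH[of w] Cons.IH[of "swp (i - 1) w"] Cons.prems by simp
  finally show ?case .
qed simp

lemma sopw_vspace:
  assumes "set u \<subseteq> {1..<n}" "v \<in> vspace (tbasis d N n)"
  shows "sopw u v \<in> vspace (tbasis d N n)"
  using assms(1)
proof (induction u)
  case (Cons i u)
  then show ?case using Sop_vspace[of "i - 1" n "sopw u v" d N qq] by auto
qed (simp add: assms(2))

lemma spec_sopw:
  assumes "\<And>w. spec (f w) (g w)"
  shows "spec (sopw u f w) (g (act u w))"
proof (induction u arbitrary: w)
  case (Cons i u)
  show ?case unfolding sopw_simps act.simps by (rule spec_Sop[OF Cons.IH])
qed (simp add: assms)

lemma End_Uq_ops:
  "(\<otimes>\<^bsub>End_Uq d N n\<^esub>) = (\<otimes>\<^bsub>endo_alg (tbasis d N n)\<^esub>)"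
  "(\<oplus>\<^bsub>End_Uq d N n\<^esub>) = (\<oplus>\<^bsub>endo_alg (tbasis d N n)\<^esub>)"
  "(\<odot>\<^bsub>End_Uq d N n\<^esub>) = (\<odot>\<^bsub>endo_alg (tbasis d N n)\<^esub>)"
  "\<one>\<^bsub>End_Uq d N n\<^esub> = \<one>\<^bsub>endo_alg (tbasis d N n)\<^esub>"
  by (simp_all add: End_Uq_def)

lemma End_Uq_linear:
  "\<zero>\<^bsub>endo_alg (tbasis d N n)\<^esub> \<in> carrier (End_Uq d N n)"
  "f \<in> carrier (End_Uq d N n) \<Longrightarrow> g \<in> carrier (End_Uq d N n) \<Longrightarrow>
    c \<odot>\<^bsub>endo_alg (tbasis d N n)\<^esub> f \<oplus>\<^bsub>endo_alg (tbasis d N n)\<^esub> g \<in> carrier (End_Uq d N n)"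
proof -
  show "\<zero>\<^bsub>endo_alg (tbasis d N n)\<^esub> \<in> carrier (End_Uq d N n)"
    unfolding End_Uq_iff by (auto simp: endo_alg_one_zero endo_alg_simps Gop_vspace Gop_linear)
  assume "f \<in> carrier (End_Uq d N n)" and "g \<in> carrier (End_Uq d N n)"
  then show "c \<odot>\<^bsub>endo_alg (tbasis d N n)\<^esub> f \<oplus>\<^bsub>endo_alg (tbasis d N n)\<^esub> g \<in> carrier (End_Uq d N n)"
    unfolding End_Uq_iff by (auto simp: endo_alg_closed endo_alg_simps Gop_vspace Gop_linear)
qed

text \<open>The element e_c s_u: the first factor is the inverse Fourier transform of the indicator
  of the colour sequence c, written in t-monomials.\<close>

definition yel :: "nat \<Rightarrow> nat \<Rightarrow> Cq \<Rightarrow> nat list \<times> nat list \<Rightarrow> (fb_gen gword set \<Rightarrow> Cq) set" where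
  "yel d n z j =
    (\<Oplus>\<^bsub>YH d n\<^esub>a\<in>yh_presentation.exps d n.
      (chi (inverse z) a (fst j) / of_nat d ^ n) \<odot>\<^bsub>YH d n\<^esub> yh_presentation.tmon (YH d n) (yh_t d n) 1 a)
    \<otimes>\<^bsub>YH d n\<^esub> monoid.word_eval (YH d n) (yh_s d n) (snd j)"

definition cidx :: "nat \<Rightarrow> nat \<Rightarrow> (nat list \<times> nat list) set" where
  "cidx d n = {c. length c = n \<and> set c \<subseteq> {1..d}} \<times> cws (n - 1)"

text \<open>The matrix entry of e_c s_u at the pair (output word, input word). The idempotent tests
  the colours of the output.\<close>

definition gq :: "nat list \<times> nat list \<Rightarrow> letter list \<times> letter list \<Rightarrow> Cq" where
  "gq j p = (if map fst (fst p) = fst j then sopw (snd j) (kdelta (snd p)) (fst p) else 0)"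

definition g1 :: "nat list \<times> nat list \<Rightarrow> letter list \<times> letter list \<Rightarrow> complex" where
  "g1 j p = (if map fst (fst p) = fst j \<and> act (snd j) (fst p) = snd p then 1 else 0)"

lemma finite_cidx: "finite (cidx d n)"
  unfolding cidx_def using finite_lists_length_eq[of "{1..d}" n] cws_finite by (simp add: conj_commute)

lemma spec_gq: "spec (gq j p) (g1 j p)"
proof -
  have "spec (sopw (snd j) (kdelta (snd p)) (fst p)) (kdelta (snd p) (act (snd j) (fst p)))"
    by (rule spec_sopw) (simp add: kdelta_def spec_0 spec_1)
  then show ?thesis unfolding gq_def g1_def by (auto simp: kdelta_def spec_0)
qed

locale yh_rep = prim_root +
  fixes N :: "nat \<Rightarrow> nat" and n :: nat and \<Psi> :: "(fb_gen gword set \<Rightarrow> Cq) set \<Rightarrow> tvec \<Rightarrow> tvec"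
  assumes n: "n \<ge> 1" and hom: "\<Psi> \<in> alg_hom (YH d n) (endo_alg (tbasis d N n))"
    and \<Psi>_s: "i \<in> {1..<n} \<Longrightarrow> \<Psi> (yh_s d n i) = sigma d N n i"
    and \<Psi>_t: "i \<in> {1..n} \<Longrightarrow> \<Psi> (yh_t d n i) = tau d N n z i"
begin

sublocale P: yh_presentation "YH d n" d n "yh_s d n" "yh_t d n"
  by (rule yh_pres[OF d n])

sublocale E: kalgebra "endo_alg (tbasis d N n) :: (Cq, tvec \<Rightarrow> tvec) module"
  by (rule endo_alg_kalgebra)

abbreviation "T \<equiv> tbasis d N n"
abbreviation "E \<equiv> endo_alg T :: (Cq, tvec \<Rightarrow> tvec) module"
abbreviation "Y \<equiv> YH d n"

lemma n1: "n - 1 < n"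
  using n by simp

lemma \<Psi>_closed: "x \<in> carrier Y \<Longrightarrow> \<Psi> x \<in> carrier E"
  by (rule alg_homD(1)[OF hom])

lemma \<Psi>_lincomb:
  assumes J: "finite J" and X: "\<And>j. j \<in> J \<Longrightarrow> X j \<in> carrier Y" and v: "v \<in> vspace T"
  shows "\<Psi> (\<Oplus>\<^bsub>Y\<^esub>j\<in>J. \<alpha> j \<odot>\<^bsub>Y\<^esub> X j) v w = (\<Sum>j\<in>J. \<alpha> j * \<Psi> (X j) v w)"
proof -
  have c: "(\<lambda>j. \<alpha> j \<odot>\<^bsub>Y\<^esub> X j) \<in> J \<rightarrow> carrier Y" using X by auto
  have "\<Psi> (\<Oplus>\<^bsub>Y\<^esub>j\<in>J. \<alpha> j \<odot>\<^bsub>Y\<^esub> X j) v w = (\<Oplus>\<^bsub>E\<^esub>j\<in>J. \<Psi> (\<alpha> j \<odot>\<^bsub>Y\<^esub> X j)) v w"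
    unfolding alg_hom_more(3)[OF P.kalgebra_axioms E.kalgebra_axioms hom J c] ..
  also have "\<dots> = (\<Sum>j\<in>J. \<Psi> (\<alpha> j \<odot>\<^bsub>Y\<^esub> X j) v w)"
    by (rule endo_alg_finsum[OF J _ v]) (rule \<Psi>_closed[OF P.smult_closed[OF X]])
  also have "\<dots> = (\<Sum>j\<in>J. \<alpha> j * \<Psi> (X j) v w)"
    by (intro sum.cong HOL.refl) (simp only: alg_homD(5)[OF hom X] endo_alg_simps(3)[OF v])
  finally show ?thesis .
qed

lemma \<Psi>_sw:
  assumes "set u \<subseteq> {1..<n}" "v \<in> vspace T"
  shows "\<Psi> (P.sw u) v = sopw u v"
  using assms(1)
proof (induction u)
  case Nil
  show ?case unfolding P.word_eval_simps alg_homD(4)[OF hom] endo_alg_simps(4)[OF assms(2)] by simp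
next
  case (Cons i u)
  then have i: "i \<in> {1..<n}" and u: "u \<in> lists {1..<n}" "set u \<subseteq> {1..<n}" by auto
  have sv: "sopw u v \<in> vspace T" by (rule sopw_vspace[OF u(2) assms(2)])
  show ?case
    unfolding P.word_eval_simps alg_homD(2)[OF hom P.s_closed[OF i] P.sw_closed[OF u(1)]] \<Psi>_s[OF i]
      endo_alg_simps(1)[OF assms(2)] Cons.IH[OF u(2)] sigma_apply[OF i sv] sopw_simps ..
qed

lemma \<Psi>_tmon:
  assumes "1 \<le> k" "k + length a \<le> Suc n"
  shows "\<Psi> (P.tmon k a) = dia d N n (\<lambda>c. chi z a (drop (k - 1) c))"
  using assms
proof (induction a arbitrary: k)
  case Nil
  show ?case unfolding P.tmon.simps chi.simps alg_homD(4)[OF hom] dia_one ..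
next
  case (Cons x a)
  have k: "k \<in> {1..n}" "1 \<le> Suc k" "Suc k + length a \<le> Suc n" using Cons.prems by auto
  have pow: "\<Psi> (yh_t d n k [^]\<^bsub>Y\<^esub> m) = \<Psi> (yh_t d n k) [^]\<^bsub>E\<^esub> m" for m :: nat
    using P.t_closed[OF k(1)] by (induction m) (simp_all add: alg_homD(2,4)[OF hom])
  have "\<Psi> (P.tmon k (x # a)) = dia d N n (\<lambda>c. (z ^ (c ! (k - 1) - 1)) ^ x * chi z a (drop k c))"
    unfolding P.tmon.simps alg_homD(2)[OF hom P.nat_pow_closed[OF P.t_closed[OF k(1)]] P.tmon_closed[OF k(2,3)]]
      pow \<Psi>_t[OF k(1)] tau_dia[OF k(1)] dia_pow Cons.IH[OF k(2,3)] dia_mult diff_Suc_1 ..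
  also have "\<dots> = dia d N n (\<lambda>c. chi z (x # a) (drop (k - 1) c))"
  proof (rule dia_cong)
    fix w assume "w \<in> T"
    then have l: "k - 1 < length (map fst w)" using k(1) by (auto simp: tbasis_def)
    have "drop k (map fst w) = tl (drop (k - 1) (map fst w))" using k(1) by (cases k) (simp_all add: drop_Suc tl_drop)
    then show "(z ^ (map fst w ! (k - 1) - 1)) ^ x * chi z a (drop k (map fst w)) = chi z (x # a) (drop (k - 1) (map fst w))"
      unfolding chi.simps hd_drop_conv_nth[OF l] by (simp add: mult.commute flip: power_mult)
  qed
  finally show ?case .
qed

lemma exps_D: "a \<in> P.exps \<Longrightarrow> P.tmon 1 a \<in> carrier Y" "a \<in> P.exps \<Longrightarrow> \<Psi> (P.tmon 1 a) = dia d N n (chi z a)"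
  using P.tmon_closed[of 1 a] \<Psi>_tmon[of 1 a] by (auto simp: P.exps_def)

lemma finite_exps: "finite P.exps"
  unfolding P.exps_def using finite_lists_length_eq[of "{..<d}" n] by (simp add: conj_commute)

lemma cws_D:
  assumes "u \<in> cws (n - 1)"
  shows "set u \<subseteq> {1..<n}" "P.sw u \<in> carrier Y"
  using P.cws_lists[OF assms n1] P.sw_closed[of u] by (auto simp: lists_eq_set)

text \<open>The same coefficients describe \<open>x\<close> and all its matrix entries, so that
  vanishing of the entries can be turned into vanishing of \<open>x\<close>.\<close>

lemma \<Psi>_span:
  assumes "x \<in> carrier Y"
  obtains \<alpha> where "x = (\<Oplus>\<^bsub>Y\<^esub>j\<in>P.exps \<times> cws (n - 1). \<alpha> j \<odot>\<^bsub>Y\<^esub> (P.tmon 1 (fst j) \<otimes>\<^bsub>Y\<^esub> P.sw (snd j)))"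
    "\<forall>v\<in>vspace T. \<forall>w. \<Psi> x v w = (\<Sum>j\<in>P.exps \<times> cws (n - 1). \<alpha> j * (chi z (fst j) (map fst w) * sopw (snd j) v w))"
proof -
  obtain \<alpha> where x: "x = (\<Oplus>\<^bsub>Y\<^esub>j\<in>P.exps \<times> cws (n - 1). \<alpha> j \<odot>\<^bsub>Y\<^esub> (P.tmon 1 (fst j) \<otimes>\<^bsub>Y\<^esub> P.sw (snd j)))"
    using yh_span[OF d n assms] by blast
  have fin: "finite (P.exps \<times> cws (n - 1))" by (intro finite_cartesian_product finite_exps cws_finite)
  have m: "fst j \<in> P.exps" "snd j \<in> cws (n - 1)" if "j \<in> P.exps \<times> cws (n - 1)" for j using that by auto
  have c: "P.tmon 1 (fst j) \<otimes>\<^bsub>Y\<^esub> P.sw (snd j) \<in> carrier Y" if "j \<in> P.exps \<times> cws (n - 1)" for j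
    by (rule P.m_closed[OF exps_D(1)[OF m(1)[OF that]] cws_D(2)[OF m(2)[OF that]]])
  have "\<Psi> x v w = (\<Sum>j\<in>P.exps \<times> cws (n - 1). \<alpha> j * (chi z (fst j) (map fst w) * sopw (snd j) v w))"
    if v: "v \<in> vspace T" for v w
  proof -
    have "\<Psi> x v w = (\<Sum>j\<in>P.exps \<times> cws (n - 1). \<alpha> j * \<Psi> (P.tmon 1 (fst j) \<otimes>\<^bsub>Y\<^esub> P.sw (snd j)) v w)"
      unfolding x by (rule \<Psi>_lincomb[OF fin c v])
    also have "\<dots> = (\<Sum>j\<in>P.exps \<times> cws (n - 1). \<alpha> j * (chi z (fst j) (map fst w) * sopw (snd j) v w))"
    proof (intro sum.cong HOL.refl)
      fix j assume "j \<in> P.exps \<times> cws (n - 1)"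
      note m = m[OF this]
      show "\<alpha> j * \<Psi> (P.tmon 1 (fst j) \<otimes>\<^bsub>Y\<^esub> P.sw (snd j)) v w = \<alpha> j * (chi z (fst j) (map fst w) * sopw (snd j) v w)"
        unfolding alg_homD(2)[OF hom exps_D(1)[OF m(1)] cws_D(2)[OF m(2)]] exps_D(2)[OF m(1)] endo_alg_simps(1)[OF v]
          \<Psi>_sw[OF cws_D(1)[OF m(2)] v] dia_apply[OF sopw_vspace[OF cws_D(1)[OF m(2)] v]] ..
    qed
    finally show ?thesis .
  qed
  then show ?thesis by (intro that[OF x] ballI allI)
qed

text \<open>Checked on the spanning set: colour-diagonal operators and products of
  \<open>Sop\<close> both commute with \<open>Gop\<close>.\<close>

lemma \<Psi>_End_Uq:
  assumes x: "x \<in> carrier Y"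
  shows "\<Psi> x \<in> carrier (End_Uq d N n)"
proof -
  obtain \<alpha> where \<alpha>: "\<forall>v\<in>vspace T. \<forall>w. \<Psi> x v w =
      (\<Sum>j\<in>P.exps \<times> cws (n - 1). \<alpha> j * (chi z (fst j) (map fst w) * sopw (snd j) v w))"
    by (rule \<Psi>_span[OF x])
  have "\<Psi> x (Gop qq a v) = Gop qq a (\<Psi> x v)" if a: "a \<in> a_gens d N" and v: "v \<in> vspace T" for a v
  proof
    fix w
    have Gv: "Gop qq a v \<in> vspace T" by (rule Gop_vspace[OF v a])
    have \<Psi>v: "\<Psi> x v \<in> vspace T" by (rule endo_algD(1)[OF \<Psi>_closed[OF x] v])
    show "\<Psi> x (Gop qq a v) w = Gop qq a (\<Psi> x v) w"
    proof (cases "w \<in> T")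
      case False
      then show ?thesis
        using endo_algD(1)[OF \<Psi>_closed[OF x] Gv] Gop_vspace[OF \<Psi>v a, of qq] unfolding vspace_def by simp
    next
      case True
      then have lw: "length w = n" by (simp add: tbasis_def)
      have e: "\<Psi> x v = (\<lambda>w. \<Sum>j\<in>P.exps \<times> cws (n - 1). \<alpha> j * (chi z (fst j) (map fst w) * sopw (snd j) v w))"
        by (rule ext) (rule \<alpha>[THEN bspec, OF v, THEN spec])
      have "Gop qq a (\<Psi> x v) w = (\<Sum>j\<in>P.exps \<times> cws (n - 1). \<alpha> j * (chi z (fst j) (map fst w) * Gop qq a (sopw (snd j) v) w))"
        unfolding e Gop_sum Gop_linear(2) Gop_diag ..
      also have "\<dots> = (\<Sum>j\<in>P.exps \<times> cws (n - 1). \<alpha> j * (chi z (fst j) (map fst w) * sopw (snd j) (Gop qq a v) w))"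
      proof (intro sum.cong HOL.refl)
        fix j assume "j \<in> P.exps \<times> cws (n - 1)"
        then have "snd j \<in> cws (n - 1)" by auto
        then have "set (snd j) \<subseteq> {1..<length w}" unfolding lw by (rule cws_D(1))
        from Gop_sopw[OF this, of a v]
        show "\<alpha> j * (chi z (fst j) (map fst w) * Gop qq a (sopw (snd j) v) w) =
          \<alpha> j * (chi z (fst j) (map fst w) * sopw (snd j) (Gop qq a v) w)" by (rule arg_cong)
      qed
      also have "\<dots> = \<Psi> x (Gop qq a v) w"
        by (rule \<alpha>[THEN bspec, OF Gv, THEN spec, symmetric])
      finally show ?thesis by (rule HOL.sym)
    qed
  qed
  then show ?thesis unfolding End_Uq_iff using \<Psi>_closed[OF x] by blast
qed

lemma hom_End_Uq: "\<Psi> \<in> alg_hom Y (End_Uq d N n)"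
proof -
  have "\<Psi> \<in> ring_hom Y (End_Uq d N n)"
    by (rule ring_hom_memI)
      (simp_all only: \<Psi>_End_Uq End_Uq_ops alg_homD(2)[OF hom] alg_homD(3)[OF hom] alg_homD(4)[OF hom])
  then show ?thesis unfolding alg_hom_def using alg_homD(5)[OF hom] by (simp add: End_Uq_ops)
qed

lemma yel_closed: "j \<in> cidx d n \<Longrightarrow> yel d n z j \<in> carrier Y"
  unfolding yel_def cidx_def by (intro P.m_closed P.finsum_closed Pi_I P.smult_closed exps_D(1) cws_D(2)) auto

text \<open>Orthogonality of characters turns the combination of diagonal operators into the
  projection onto one colour sequence, which leaves the entry of the product of \<open>Sop\<close>
  operators.\<close>

lemma \<Psi>_yel:
  assumes j: "j \<in> cidx d n" and w: "w \<in> T" "w' \<in> T"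
  shows "\<Psi> (yel d n z j) (kdelta w) w' = gq j (w', w)"
proof -
  obtain c u where ju: "j = (c, u)" "length c = n" "set c \<subseteq> {1..d}" "u \<in> cws (n - 1)"
    using j by (auto simp: cidx_def)
  let ?e = "\<Oplus>\<^bsub>Y\<^esub>a\<in>P.exps. (chi (inverse z) a c / of_nat d ^ n) \<odot>\<^bsub>Y\<^esub> P.tmon 1 a"
  have kv: "kdelta w \<in> vspace T" by (rule vspace_closed(4)[OF w(1)])
  have sv: "sopw u (kdelta w) \<in> vspace T" by (rule sopw_vspace[OF cws_D(1)[OF ju(4)] kv])
  have ec: "?e \<in> carrier Y" by (intro P.finsum_closed Pi_I P.smult_closed exps_D(1))
  let ?c = "map fst w'"
  have cw: "length ?c = length c" "set ?c \<subseteq> {1..d}" using w(2) ju(2) by (auto simp: tbasis_def vbasis_def)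
  have "\<Psi> (yel d n z j) (kdelta w) w' = \<Psi> ?e (sopw u (kdelta w)) w'"
    unfolding yel_def ju(1) fst_conv snd_conv alg_homD(2)[OF hom ec cws_D(2)[OF ju(4)]] endo_alg_simps(1)[OF kv]
      \<Psi>_sw[OF cws_D(1)[OF ju(4)] kv] ..
  also have "\<dots> = (\<Sum>a\<in>P.exps. chi (inverse z) a c / of_nat d ^ n * \<Psi> (P.tmon 1 a) (sopw u (kdelta w)) w')"
    by (rule \<Psi>_lincomb[OF finite_exps exps_D(1) sv])
  also have "\<dots> = (\<Sum>a\<in>P.exps. chi z a ?c * chi (inverse z) a c) * (sopw u (kdelta w) w' / of_nat d ^ n)"
    unfolding sum_distrib_right
    by (intro sum.cong HOL.refl) (simp only: exps_D(2) dia_apply[OF sv], simp only: divide_inverse mult_ac)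
  also have "(\<Sum>a\<in>P.exps. chi z a ?c * chi (inverse z) a c) = (if ?c = c then of_nat d ^ n else 0)"
    using chi_orth[OF cw ju(3)] unfolding P.exps_def cw(1) ju(2) .
  finally show ?thesis
    unfolding gq_def ju(1) fst_conv snd_conv using of_nat_Cq_nonzero[OF d] by (cases "?c = c") simp_all
qed

end

section \<open>Specialization of commuting operators\<close>

text \<open>Powers of an indeterminate have different degrees. This is what separates weights before
  q is set to 1.\<close>

lemma qq_power_inj:
  assumes "qq ^ a = qq ^ b"
  shows "a = b"
proof -
  have "qq ^ k = Fract ([:0, 1:] ^ k) 1" for k
  proof (induction k)
    case (Suc k)
    show ?case unfolding power_Suc Suc unfolding qq_def mult_fract by (simp only: mult_1_left)
  qed (simp add: One_fract_def)
  then have "Fract ([:0, 1:] ^ a) 1 = (Fract ([:0, 1:] ^ b) 1 :: Cq)" using assms by simp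
  then have "[:0, 1:] ^ a = ([:0, 1:] ^ b :: complex poly)" by (simp add: eq_fract)
  then have "degree ([:0, 1:] ^ a :: complex poly) = degree ([:0, 1:] ^ b :: complex poly)" by (rule arg_cong)
  then show ?thesis by (simp add: degree_power_eq)
qed

lemma wprod_kmu_count: "wprod (kmu q p) w = q ^ count (mset w) p"
  by (induction w) (auto simp: wprod_def kmu_def)

lemma act_tbasis:
  assumes "set u \<subseteq> {1..<n}" "w \<in> tbasis d N n"
  shows "act u w \<in> tbasis d N n"
proof -
  have "mset (act u w) = mset w" using assms by (intro mset_act) (simp add: tbasis_def)
  then have "length (act u w) = length w" "set (act u w) = set w" by (rule mset_eq_length, rule mset_eq_setD)
  then show ?thesis using assms(2) by (simp add: tbasis_def)
qed

lemma spec_Gop: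
  assumes a: "a = (b, UE i) \<or> a = (b, UF i)" and "\<And>w. spec (f w) (g w)"
  shows "spec (Gop qq a f w) (Gop 1 a g w)"
  using a by (elim disjE) (simp_all only: Gop.simps spec_Eop[OF assms(2)] spec_Fop[OF assms(2)])

text \<open>Both composites at q = 1 are matrices whose entries are the values of the corresponding
  entries over C(q), where the composites agree; a value at 1 is unique. Only E and F occur, as K is
  handled through weights.\<close>

lemma comm_specialize:
  fixes f :: "tvec \<Rightarrow> tvec" and h :: "(letter list \<Rightarrow> complex) \<Rightarrow> letter list \<Rightarrow> complex"
  assumes f: "f \<in> carrier (endo_alg (tbasis d N n))" and h: "h \<in> carrier (endo_alg (tbasis d N n))"
    and fh: "\<And>x y. x \<in> tbasis d N n \<Longrightarrow> spec (f (kdelta x) y) (h (kdelta x) y)"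
    and a: "a \<in> a_gens d N" "a = (b, UE i) \<or> a = (b, UF i)"
    and com: "\<And>v. v \<in> vspace (tbasis d N n) \<Longrightarrow> f (Gop qq a v) = Gop qq a (f v)"
    and v: "v \<in> vspace (tbasis d N n)"
  shows "h (Gop 1 a v) = Gop 1 a (h v)"
proof -
  let ?T = "tbasis d N n"
  let ?L = "\<lambda>v\<in>vspace ?T. h (Gop 1 a v)" and ?R = "\<lambda>v\<in>vspace ?T. Gop 1 a (h v)"
  have G: "Gop 1 a v \<in> vspace ?T" if "v \<in> vspace ?T" for v :: "letter list \<Rightarrow> complex"
    by (rule Gop_vspace[OF that a(1)])
  have lin: "Gop 1 a (\<lambda>x. v x + w x) = (\<lambda>x. Gop 1 a v x + Gop 1 a w x)" "Gop 1 a (\<lambda>x. c * v x) = (\<lambda>x. c * Gop 1 a v x)"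
    for v w :: "letter list \<Rightarrow> complex" and c
    by (rule ext, rule Gop_linear)+
  have L: "?L \<in> carrier (endo_alg ?T)"
  proof (rule endo_algI)
    fix v w :: "letter list \<Rightarrow> complex" and c
    show "?L v \<in> vspace ?T" if "v \<in> vspace ?T"
      unfolding restrict_apply'[OF that] by (rule endo_algD(1)[OF h G[OF that]])
    show "?L v = undefined" if "v \<notin> vspace ?T" using that by (simp only: restrict_apply if_False)
    show "?L (\<lambda>x. v x + w x) = (\<lambda>x. ?L v x + ?L w x)" if "v \<in> vspace ?T" "w \<in> vspace ?T"
      unfolding restrict_apply'[OF that(1)] restrict_apply'[OF that(2)] restrict_apply'[OF vspace_closed(1)[OF that]]
        lin(1) endo_algD(3)[OF h G[OF that(1)] G[OF that(2)]] ..
    show "?L (\<lambda>x. c * v x) = (\<lambda>x. c * ?L v x)" if "v \<in> vspace ?T"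
      unfolding restrict_apply'[OF that] restrict_apply'[OF vspace_closed(2)[OF that]]
        lin(2) endo_algD(4)[OF h G[OF that]] ..
  qed
  have R: "?R \<in> carrier (endo_alg ?T)"
  proof (rule endo_algI)
    fix v w :: "letter list \<Rightarrow> complex" and c
    show "?R v \<in> vspace ?T" if "v \<in> vspace ?T"
      unfolding restrict_apply'[OF that] by (rule G[OF endo_algD(1)[OF h that]])
    show "?R v = undefined" if "v \<notin> vspace ?T" using that by (simp only: restrict_apply if_False)
    show "?R (\<lambda>x. v x + w x) = (\<lambda>x. ?R v x + ?R w x)" if "v \<in> vspace ?T" "w \<in> vspace ?T"
      unfolding restrict_apply'[OF that(1)] restrict_apply'[OF that(2)] restrict_apply'[OF vspace_closed(1)[OF that]]
        endo_algD(3)[OF h that] lin(1) ..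
    show "?R (\<lambda>x. c * v x) = (\<lambda>x. c * ?R v x)" if "v \<in> vspace ?T"
      unfolding restrict_apply'[OF that] restrict_apply'[OF vspace_closed(2)[OF that]]
        endo_algD(4)[OF h that] lin(2) ..
  qed
  have "?L = ?R"
  proof (rule endo_alg_kdelta_eqI[OF finite_tbasis L R])
    fix x y assume x: "x \<in> ?T"
    have k1: "(kdelta x :: _ \<Rightarrow> complex) \<in> vspace ?T" and kq: "(kdelta x :: tvec) \<in> vspace ?T"
      by (rule vspace_closed(4)[OF x])+
    have kd: "spec (kdelta x w) (kdelta x w)" for w by (simp add: kdelta_def spec_0 spec_1)
    have 1: "spec (f (Gop qq a (kdelta x)) y) (h (Gop 1 a (kdelta x)) y)"
      unfolding endo_alg_matrix[OF finite_tbasis f Gop_vspace[OF kq a(1)], of qq y] endo_alg_matrix[OF finite_tbasis h G[OF k1], of y]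
      by (intro spec_sum spec_mult spec_Gop[OF a(2) kd] fh)
    have 2: "spec (Gop qq a (f (kdelta x)) y) (Gop 1 a (h (kdelta x)) y)"
      by (rule spec_Gop[OF a(2) fh[OF x]])
    show "?L (kdelta x) y = ?R (kdelta x) y"
      unfolding restrict_apply'[OF k1] by (rule spec_unique[OF 1[unfolded com[OF kq]] 2])
  qed
  from fun_cong[OF this, of v] show ?thesis unfolding restrict_apply'[OF v] .
qed

text \<open>Nondegeneracy at q = 1: the limit of a commuting matrix satisfies the assumptions of the
  classical statement, and orthogonality to the specialized family is the vanishing of its traces
  against coloured permutations.\<close>

lemma End_Uq_specialization_null:
  assumes n: "n \<ge> 1" and f: "f \<in> carrier (End_Uq d N n)"
    and H: "\<And>w w'. w \<in> tbasis d N n \<Longrightarrow> w' \<in> tbasis d N n \<Longrightarrow> spec (f (kdelta w) w') (H1 (w', w))"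
    and orth: "\<And>j. j \<in> cidx d n \<Longrightarrow> (\<Sum>p\<in>tbasis d N n \<times> tbasis d N n. g1 j p * H1 p) = 0"
    and u: "u \<in> tbasis d N n" and t: "t \<in> tbasis d N n"
  shows "H1 (u, t) = 0"
proof -
  let ?T = "tbasis d N n"
  have fE: "f \<in> carrier (endo_alg ?T)" and fC: "\<And>a v. a \<in> a_gens d N \<Longrightarrow> v \<in> vspace ?T \<Longrightarrow> f (Gop qq a v) = Gop qq a (f v)"
    using f unfolding End_Uq_iff by blast+
  define h where "h = lin_ext ?T (\<lambda>w w'. H1 (w', w))"
  have h: "h \<in> carrier (endo_alg ?T)" unfolding h_def by (rule lin_ext_carrier)
  have hk: "h (kdelta w) w' = (if w' \<in> ?T then H1 (w', w) else 0)" if "w \<in> ?T" for w w'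
    unfolding h_def by (rule lin_ext_kdelta[OF finite_tbasis that])
  have fh: "spec (f (kdelta w) w') (h (kdelta w) w')" if w: "w \<in> ?T" for w w'
  proof (cases "w' \<in> ?T")
    case True
    then show ?thesis using H[OF w True] by (simp add: hk[OF w])
  next
    case False
    have "f (kdelta w) \<in> vspace ?T" by (rule endo_algD(1)[OF fE vspace_closed(4)[OF w]])
    then show ?thesis using False by (simp add: hk[OF w] vspace_def spec_0)
  qed
  have c: "comm d N n h (Gop 1 a)" if a: "a \<in> a_gens d N" "a = (b, UE i) \<or> a = (b, UF i)" for a b i
  proof -
    have "\<forall>v\<in>vspace ?T. Gop 1 a v \<in> vspace ?T \<and> h (Gop 1 a v) = Gop 1 a (h v)"
      by (intro ballI conjI Gop_vspace[OF _ a(1)] comm_specialize[OF fE h fh a fC[OF a(1)]])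
    then show ?thesis by (intro iffD2[OF comm_def]) (use h in blast)+
  qed
  have E: "comm d N n h (Eop 1 (b, i) (b, Suc i))" if "b \<in> {1..d}" "i \<in> {1..<N b}" for b i
  proof -
    have "Gop 1 (b, UE i) = (Eop 1 (b, i) (b, Suc i) :: (_ \<Rightarrow> complex) \<Rightarrow> _)" by (rule ext) simp
    then show ?thesis using c[of "(b, UE i)" b i] that by simp
  qed
  have F: "comm d N n h (Eop 1 (b, Suc i) (b, i))" if "b \<in> {1..d}" "i \<in> {1..<N b}" for b i
  proof -
    have "Gop 1 (b, UF i) = (Eop 1 (b, Suc i) (b, i) :: (_ \<Rightarrow> complex) \<Rightarrow> _)" by (intro ext) (simp add: Fop_1)
    then show ?thesis using c[of "(b, UF i)" b i] that by simp
  qed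
  \<comment> \<open>Here the K-generators are used over C(q). An entry nonzero at q = 1 is nonzero
    before specialization, so its row and column have the same eigenvalue \<open>qq ^ count\<close>
    for every K, and the exponents agree.\<close>
  have weight: "mset w' = mset w" if w: "w \<in> ?T" and nz: "h (kdelta w) w' \<noteq> 0" for w w'
  proof (rule multiset_eqI)
    fix p
    have w': "w' \<in> ?T" using nz by (auto simp: hk[OF w] split: if_splits)
    show "count (mset w') p = count (mset w) p"
    proof (cases "p \<in> vbasis d N")
      case False
      then have "p \<notin># mset w" "p \<notin># mset w'" using w w' by (auto simp: tbasis_def)
      then show ?thesis by (simp only: not_in_iff)
    next
      case True
      then obtain b j where p: "p = (b, j)" "b \<in> {1..d}" "j \<in> {1..N b}" by (auto simp: vbasis_def)
      let ?m = "wprod (kmu qq p)"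
      have kv: "(kdelta w :: tvec) \<in> vspace ?T" by (rule vspace_closed(4)[OF w])
      have "(b, UK j) \<in> a_gens d N" using p by simp
      from fC[OF this kv] have "f (\<lambda>u. ?m u * kdelta w u) = (\<lambda>u. ?m u * f (kdelta w) u)" unfolding Gop.simps p .
      moreover have "(\<lambda>u. ?m u * kdelta w u) = (\<lambda>u. ?m w * kdelta w u)" by (auto simp: kdelta_def fun_eq_iff)
      ultimately have "f (\<lambda>u. ?m w * kdelta w u) = (\<lambda>u. ?m u * f (kdelta w) u)" by (simp only:)
      then have "(\<lambda>u. ?m w * f (kdelta w) u) = (\<lambda>u. ?m u * f (kdelta w) u)" unfolding endo_algD(4)[OF fE kv] .
      from fun_cong[OF this, of w'] have eq: "?m w * f (kdelta w) w' = ?m w' * f (kdelta w) w'" .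
      have "f (kdelta w) w' \<noteq> 0"
      proof
        assume "f (kdelta w) w' = 0"
        then have "spec 0 (h (kdelta w) w')" using fh[OF w, of w'] by (simp only:)
        then show False using spec_unique[OF _ spec_0] nz by blast
      qed
      then have "?m w' = ?m w" using eq by simp
      then show ?thesis unfolding wprod_kmu_count by (rule qq_power_inj)
    qed
  qed
  have orth': "(\<Sum>w\<in>{w\<in>?T. map fst w = c}. h (kdelta (permute_list \<tau> w)) w) = 0" if \<tau>: "\<tau> permutes {..<n}" for c \<tau>
  proof (cases "length c = n \<and> set c \<subseteq> {1..d}")
    case False
    have "w \<notin> ?T" if "map fst w = c" for w
    proof
      assume "w \<in> ?T"
      then have "length (map fst w) = n" "set (map fst w) \<subseteq> {1..d}" by (auto simp: tbasis_def vbasis_def)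
      then show False using False that by simp
    qed
    then have "{w\<in>?T. map fst w = c} = {}" by blast
    then show ?thesis by (simp only: sum.empty)
  next
    case True
    \<comment> \<open>A normal form word realizes \<open>\<tau>\<close>, so the trace is one of the
      sums assumed to vanish. Inadmissible colour sequences were dismissed before, as no basis word
      has them.\<close>
    obtain x where x: "x \<in> cws (n - 1)" "\<forall>w::letter list. length w = n \<longrightarrow> act x w = permute_list \<tau> w"
      using cws_permutation[OF \<tau> n] by blast
    have j: "(c, x) \<in> cidx d n" using True x(1) by (simp add: cidx_def)
    have "{1..n - 1} \<subseteq> {1..<n}" using n by auto
    with cws_set[OF x(1)] have xs: "set x \<subseteq> {1..<n}" by (rule subset_trans)
    have "0 = (\<Sum>p\<in>?T \<times> ?T. g1 (c, x) p * H1 p)" using orth[OF j] by simp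
    also have "\<dots> = (\<Sum>w'\<in>?T. \<Sum>w\<in>?T. g1 (c, x) (w', w) * H1 (w', w))"
      by (simp add: sum.cartesian_product split_def)
    also have "\<dots> = (\<Sum>w'\<in>?T. if map fst w' = c then H1 (w', act x w') else 0)"
    proof (intro sum.cong HOL.refl)
      fix w' assume w': "w' \<in> ?T"
      have "(\<Sum>w\<in>?T. g1 (c, x) (w', w) * H1 (w', w)) =
          (\<Sum>w\<in>?T. if act x w' = w then (if map fst w' = c then H1 (w', w) else 0) else 0)"
        by (intro sum.cong HOL.refl) (simp add: g1_def)
      then show "(\<Sum>w\<in>?T. g1 (c, x) (w', w) * H1 (w', w)) = (if map fst w' = c then H1 (w', act x w') else 0)"
        using act_tbasis[OF xs w'] by simp
    qed
    also have "\<dots> = (\<Sum>w\<in>{w\<in>?T. map fst w = c}. H1 (w, act x w))"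
      by (rule sum.inter_filter[OF finite_tbasis, symmetric])
    also have "\<dots> = (\<Sum>w\<in>{w\<in>?T. map fst w = c}. h (kdelta (permute_list \<tau> w)) w)"
    proof (intro sum.cong HOL.refl)
      fix w assume "w \<in> {w\<in>?T. map fst w = c}"
      then have w: "w \<in> ?T" by simp
      then have "act x w = permute_list \<tau> w" using x(2) by (simp add: tbasis_def)
      then show "H1 (w, act x w) = h (kdelta (permute_list \<tau> w)) w"
        using hk[OF act_tbasis[OF xs w], of w] w by simp
    qed
    finally show ?thesis by (rule HOL.sym)
  qed
  have "h (kdelta t) u = 0" by (rule classical_commutant_null[OF h E F weight orth' u t])
  then show ?thesis using hk[OF t, of u] u by simp
qed

section \<open>Surjectivity and injectivity\<close>

context yh_rep
begin

text \<open>The index set \<open>J\<close> is exposed together with its independence at q = 1: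
  surjectivity needs the combinations, while failure of injectivity needs that \<open>J\<close> is a
  proper subset of all indices.\<close>

lemma deform:
  "\<exists>J\<subseteq>cidx d n. indep_on (T \<times> T) J g1 \<and>
    (\<forall>f\<in>carrier (End_Uq d N n). \<exists>\<alpha>. f = \<Psi> (\<Oplus>\<^bsub>Y\<^esub>j\<in>J. \<alpha> j \<odot>\<^bsub>Y\<^esub> yel d n z j))"
proof -
  \<comment> \<open>Matrices of commuting endomorphisms as functions of (output, input). Values off
    the basis pairs are left free, which does not matter as all conclusions are restricted to
    them.\<close>
  define Z where "Z = {H. \<exists>f\<in>carrier (End_Uq d N n). \<forall>w\<in>T. \<forall>w'\<in>T. H (w', w) = f (kdelta w) w'}"
  have kv: "(kdelta w :: tvec) \<in> vspace T" if "w \<in> T" for w by (rule vspace_closed(4)[OF that])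
  have ex: "\<exists>J. J \<subseteq> cidx d n \<and> indep_on (T \<times> T) J g1 \<and> (\<forall>H\<in>Z. \<exists>\<alpha>. \<forall>p\<in>T \<times> T. H p = (\<Sum>j\<in>J. \<alpha> j * gq j p))"
  proof (rule deformation[of "T \<times> T" "cidx d n" gq g1 Z])
    show "finite (T \<times> T)" by simp
    show "finite (cidx d n)" by (rule finite_cidx)
    show "spec (gq j p) (g1 j p)" for j p by (rule spec_gq)
    show "(\<lambda>_. 0) \<in> Z"
      unfolding Z_def by (intro CollectI bexI[OF _ End_Uq_linear(1)]) (simp add: endo_alg_simps(5)[OF kv])
    show "(\<lambda>p. c * x p + y p) \<in> Z" if xy: "x \<in> Z" "y \<in> Z" for c x y
    proof -
      obtain f where f: "f \<in> carrier (End_Uq d N n)" "\<forall>w\<in>T. \<forall>w'\<in>T. x (w', w) = f (kdelta w) w'" using xy(1) unfolding Z_def by blast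
      obtain g where g: "g \<in> carrier (End_Uq d N n)" "\<forall>w\<in>T. \<forall>w'\<in>T. y (w', w) = g (kdelta w) w'" using xy(2) unfolding Z_def by blast
      show ?thesis
        unfolding Z_def using f(2) g(2)
        by (intro CollectI bexI[OF _ End_Uq_linear(2)[OF f(1) g(1), of c]]) (simp add: endo_alg_simps(2,3)[OF kv])
    qed
    show "gq j \<in> Z" if j: "j \<in> cidx d n" for j
      unfolding Z_def using \<Psi>_yel[OF j]
      by (intro CollectI bexI[OF _ \<Psi>_End_Uq[OF yel_closed[OF j]]]) simp
    show "H1 p = 0" if H: "H \<in> Z" and sp: "\<And>p. p \<in> T \<times> T \<Longrightarrow> spec (H p) (H1 p)"
      and orth: "\<And>j. j \<in> cidx d n \<Longrightarrow> (\<Sum>p\<in>T \<times> T. g1 j p * H1 p) = 0" and p: "p \<in> T \<times> T" for H H1 p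
    proof -
      obtain f where f: "f \<in> carrier (End_Uq d N n)" "\<forall>w\<in>T. \<forall>w'\<in>T. H (w', w) = f (kdelta w) w'" using H unfolding Z_def by blast
      have fs: "spec (f (kdelta w) w') (H1 (w', w))" if "w \<in> T" "w' \<in> T" for w w'
        using sp[of "(w', w)"] f(2) that by simp
      obtain u t where ut: "p = (u, t)" "u \<in> T" "t \<in> T" using p by auto
      show ?thesis unfolding ut(1) by (rule End_Uq_specialization_null[OF n f(1) fs orth ut(2,3)])
    qed
    show "\<exists>J. J \<subseteq> cidx d n \<and> indep_on (T \<times> T) J g1 \<and> (\<forall>H\<in>Z. \<exists>\<alpha>. \<forall>p\<in>T \<times> T. H p = (\<Sum>j\<in>J. \<alpha> j * gq j p))"
      if "J \<subseteq> cidx d n" "indep_on (T \<times> T) J g1" "\<forall>H\<in>Z. \<exists>\<alpha>. \<forall>p\<in>T \<times> T. H p = (\<Sum>j\<in>J. \<alpha> j * gq j p)" for J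
      using that by blast
  qed
  obtain J where J: "J \<subseteq> cidx d n" "indep_on (T \<times> T) J g1" "\<forall>H\<in>Z. \<exists>\<alpha>. \<forall>p\<in>T \<times> T. H p = (\<Sum>j\<in>J. \<alpha> j * gq j p)"
    using ex by blast
  have finJ: "finite J" by (rule finite_subset[OF J(1) finite_cidx])
  have yc: "yel d n z j \<in> carrier Y" if "j \<in> J" for j using yel_closed J(1) that by blast
  have "\<exists>\<alpha>. f = \<Psi> (\<Oplus>\<^bsub>Y\<^esub>j\<in>J. \<alpha> j \<odot>\<^bsub>Y\<^esub> yel d n z j)" if f: "f \<in> carrier (End_Uq d N n)" for f
  proof -
    have fE: "f \<in> carrier E" using f unfolding End_Uq_iff by blast
    define H where "H p = f (kdelta (snd p)) (fst p)" for p
    have "H \<in> Z" unfolding Z_def H_def using f by auto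
    then obtain \<alpha> where \<alpha>: "\<forall>p\<in>T \<times> T. H p = (\<Sum>j\<in>J. \<alpha> j * gq j p)" using J(3) by blast
    let ?x = "\<Oplus>\<^bsub>Y\<^esub>j\<in>J. \<alpha> j \<odot>\<^bsub>Y\<^esub> yel d n z j"
    have x: "?x \<in> carrier Y" by (intro P.finsum_closed Pi_I P.smult_closed yc)
    have fx: "f = \<Psi> ?x"
    proof (rule endo_alg_kdelta_eqI[OF finite_tbasis fE \<Psi>_closed[OF x]])
      fix w w' assume w: "w \<in> T"
      show "f (kdelta w) w' = \<Psi> ?x (kdelta w) w'"
      proof (cases "w' \<in> T")
        case True
        have "\<Psi> ?x (kdelta w) w' = (\<Sum>j\<in>J. \<alpha> j * \<Psi> (yel d n z j) (kdelta w) w')"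
          by (rule \<Psi>_lincomb[OF finJ yc kv[OF w]])
        also have "\<dots> = (\<Sum>j\<in>J. \<alpha> j * gq j (w', w))"
        proof (intro sum.cong HOL.refl)
          fix j assume "j \<in> J"
          then have "j \<in> cidx d n" using J(1) by blast
          then show "\<alpha> j * \<Psi> (yel d n z j) (kdelta w) w' = \<alpha> j * gq j (w', w)" by (simp only: \<Psi>_yel[OF _ w True])
        qed
        also have "\<dots> = H (w', w)" by (rule \<alpha>[THEN bspec, symmetric]) (use w True in simp)
        finally show ?thesis unfolding H_def fst_conv snd_conv by (rule HOL.sym)
      next
        case False
        then show ?thesis
          using endo_algD(1)[OF fE kv[OF w]] endo_algD(1)[OF \<Psi>_closed[OF x] kv[OF w]] unfolding vspace_def by simp
      qed
    qed
    show ?thesis by (rule exI[of _ \<alpha>]) (rule fx)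
  qed
  then have "\<forall>f\<in>carrier (End_Uq d N n). \<exists>\<alpha>. f = \<Psi> (\<Oplus>\<^bsub>Y\<^esub>j\<in>J. \<alpha> j \<odot>\<^bsub>Y\<^esub> yel d n z j)" by (rule ballI)
  then show ?thesis by (intro exI[of _ J] conjI J(1,2))
qed

lemma surj: "\<Psi> ` carrier Y = carrier (End_Uq d N n)"
proof
  show "\<Psi> ` carrier Y \<subseteq> carrier (End_Uq d N n)" using \<Psi>_End_Uq by blast
  from deform obtain J where J': "J \<subseteq> cidx d n \<and> indep_on (T \<times> T) J g1 \<and>
      (\<forall>f\<in>carrier (End_Uq d N n). \<exists>\<alpha>. f = \<Psi> (\<Oplus>\<^bsub>Y\<^esub>j\<in>J. \<alpha> j \<odot>\<^bsub>Y\<^esub> yel d n z j))"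
    by (rule exE)
  note J = J'[THEN conjunct1] J'[THEN conjunct2, THEN conjunct1] J'[THEN conjunct2, THEN conjunct2]
  have "(\<Oplus>\<^bsub>Y\<^esub>j\<in>J. \<alpha> j \<odot>\<^bsub>Y\<^esub> yel d n z j) \<in> carrier Y" for \<alpha>
    by (intro P.finsum_closed Pi_I P.smult_closed yel_closed) (use J(1) in blast)
  note xc = this
  show "carrier (End_Uq d N n) \<subseteq> \<Psi> ` carrier Y"
  proof
    fix f assume "f \<in> carrier (End_Uq d N n)"
    from J(3)[THEN bspec, OF this] obtain \<alpha> where "f = \<Psi> (\<Oplus>\<^bsub>Y\<^esub>j\<in>J. \<alpha> j \<odot>\<^bsub>Y\<^esub> yel d n z j)" by (rule exE)
    then show "f \<in> \<Psi> ` carrier Y" by (rule image_eqI[OF _ xc])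
  qed
qed

text \<open>If every colour has at least n letters, any colour sequence is carried by a word of
  distinct letters. The entry that pairs this word with its rearrangement by \<open>u\<close> is
  nonzero for the single index \<open>(c, u)\<close>.\<close>

lemma indep_cidx:
  assumes N: "\<forall>b\<in>{1..d}. n \<le> N b"
  shows "indep_on (T \<times> T) (cidx d n) g1"
  unfolding indep_on_def
proof (intro allI impI ballI)
  fix \<alpha> :: "nat list \<times> nat list \<Rightarrow> complex" and j
  assume sum: "\<forall>p\<in>T \<times> T. (\<Sum>j\<in>cidx d n. \<alpha> j * g1 j p) = 0" and j: "j \<in> cidx d n"
  obtain c u where ju: "j = (c, u)" "length c = n" "set c \<subseteq> {1..d}" "u \<in> cws (n - 1)"
    using j by (auto simp: cidx_def)
  \<comment> \<open>The i-th letter gets index i, which makes all letters distinct whatever the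
    colours are.\<close>
  define w where "w = zip c [1..<Suc n]"
  have l: "length [1..<Suc n] = n" by simp
  have lw: "length w = n" unfolding w_def length_zip l ju(2) by simp
  have "x \<in> vbasis d N" if "x \<in> set w" for x
  proof -
    obtain b i where x: "x = (b, i)" by (cases x)
    have "b \<in> set c" "i \<in> set [1..<Suc n]" using that unfolding w_def x by (rule set_zip_leftD, rule set_zip_rightD)
    then have "b \<in> {1..d}" "1 \<le> i" "i \<le> n" using ju(3) by auto
    then show ?thesis using N by (force simp: x vbasis_def)
  qed
  then have wT: "w \<in> T" using lw by (auto simp: tbasis_def)
  have mf: "map fst w = c" unfolding w_def by (rule map_fst_zip) (simp only: l ju(2))
  have dw: "distinct w" unfolding w_def by (rule distinct_zipI2) (rule distinct_upt)
  have at: "act u w \<in> T" by (rule act_tbasis[OF cws_D(1)[OF ju(4)] wT])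
  have "0 = (\<Sum>j'\<in>cidx d n. \<alpha> j' * g1 j' (w, act u w))" using sum wT at by simp
  also have "\<dots> = (\<Sum>j'\<in>cidx d n. if j' = j then \<alpha> j' else 0)"
  proof (intro sum.cong HOL.refl)
    fix j' assume "j' \<in> cidx d n"
    then obtain c' u' where j': "j' = (c', u')" "u' \<in> cws (n - 1)" by (auto simp: cidx_def)
    have "length w = Suc (n - 1)" using lw n by simp
    then have "u' = u" if "act u' w = act u w"
      using cws_act_inj[OF j'(2) ju(4) _ dw, of "[]"] that by simp
    then have "g1 j' (w, act u w) = (if j' = j then 1 else 0)"
      unfolding g1_def ju(1) j'(1) fst_conv snd_conv mf by auto
    then show "\<alpha> j' * g1 j' (w, act u w) = (if j' = j then \<alpha> j' else 0)" by simp
  qed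
  also have "\<dots> = \<alpha> j" using j by (simp add: finite_cidx)
  finally show "\<alpha> j = 0" by (rule HOL.sym)
qed

text \<open>An element of the kernel is expanded in t-monomials times normal forms. Fourier
  transform of its coefficients gives a relation among the independent families \<open>gq\<close>,
  and the inverse transform shows that the coefficients vanish.\<close>

lemma inj:
  assumes N: "\<forall>b\<in>{1..d}. n \<le> N b"
  shows "inj_on \<Psi> (carrier Y)"
proof (rule inj_onI)
  let ?C = "{c. length c = n \<and> set c \<subseteq> {1..d}}" and ?W = "cws (n - 1)"
  have finC: "finite ?C" using finite_lists_length_eq[of "{1..d}" n] by (simp add: conj_commute)
  note ind = indep_on_deform[OF finite_cidx spec_gq indep_cidx[OF N]]
  have ker: "x = \<zero>\<^bsub>Y\<^esub>" if x: "x \<in> carrier Y" "\<Psi> x = \<zero>\<^bsub>E\<^esub>" for x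
  proof -
    obtain \<alpha> where x\<alpha>: "x = (\<Oplus>\<^bsub>Y\<^esub>j\<in>P.exps \<times> ?W. \<alpha> j \<odot>\<^bsub>Y\<^esub> (P.tmon 1 (fst j) \<otimes>\<^bsub>Y\<^esub> P.sw (snd j)))"
      and \<alpha>: "\<forall>v\<in>vspace T. \<forall>w. \<Psi> x v w = (\<Sum>j\<in>P.exps \<times> ?W. \<alpha> j * (chi z (fst j) (map fst w) * sopw (snd j) v w))"
      by (rule \<Psi>_span[OF x(1)])
    \<comment> \<open>The coefficient of \<open>x\<close> at e_c s_u, obtained by evaluating the
      t-monomials on the colours c.\<close>
    define \<beta> where "\<beta> j = (\<Sum>a\<in>P.exps. \<alpha> (a, snd j) * chi z a (fst j))" for j
    have "(\<Sum>j\<in>cidx d n. \<beta> j * gq j p) = 0" if p: "p \<in> T \<times> T" for p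
    proof -
      obtain w' w where pw: "p = (w', w)" "w' \<in> T" "w \<in> T" using p by auto
      have kv: "(kdelta w :: tvec) \<in> vspace T" by (rule vspace_closed(4)[OF pw(3)])
      let ?c = "map fst w'" and ?s = "\<lambda>u. sopw u (kdelta w) w'"
      have c: "?c \<in> ?C" using pw(2) by (auto simp: tbasis_def vbasis_def)
      have "(\<Sum>j\<in>cidx d n. \<beta> j * gq j p) = (\<Sum>c\<in>?C. \<Sum>u\<in>?W. \<beta> (c, u) * gq (c, u) p)"
        unfolding cidx_def by (simp add: sum.cartesian_product split_def)
      also have "\<dots> = (\<Sum>c\<in>?C. if c = ?c then \<Sum>u\<in>?W. \<beta> (c, u) * ?s u else 0)"
        by (intro sum.cong HOL.refl) (auto simp: gq_def pw(1) intro!: sum.neutral)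
      also have "\<dots> = (\<Sum>u\<in>?W. \<beta> (?c, u) * ?s u)"
        using c finC by (simp only: sum.delta if_True)
      also have "\<dots> = (\<Sum>u\<in>?W. \<Sum>a\<in>P.exps. \<alpha> (a, u) * (chi z a ?c * ?s u))"
        unfolding \<beta>_def fst_conv snd_conv sum_distrib_right mult.assoc ..
      also have "\<dots> = (\<Sum>a\<in>P.exps. \<Sum>u\<in>?W. \<alpha> (a, u) * (chi z a ?c * ?s u))"
        by (rule sum.swap)
      also have "\<dots> = (\<Sum>j\<in>P.exps \<times> ?W. \<alpha> j * (chi z (fst j) ?c * sopw (snd j) (kdelta w) w'))"
        by (simp add: sum.cartesian_product split_def)
      also have "\<dots> = \<Psi> x (kdelta w) w'" by (rule \<alpha>[THEN bspec, OF kv, THEN spec, symmetric])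
      also have "\<dots> = 0" unfolding x(2) endo_alg_simps(5)[OF kv] ..
      finally show ?thesis .
    qed
    then have \<beta>0: "\<beta> j = 0" if "j \<in> cidx d n" for j using indep_onD[OF ind _ that] by blast
    have \<alpha>0: "\<alpha> (a', u) = 0" if a': "a' \<in> P.exps" and u: "u \<in> ?W" for a' u
    proof -
      \<comment> \<open>Inverse transform: multiplying by the dual character at \<open>a'\<close>
        and summing over colours leaves \<open>\<alpha>\<close> at \<open>a'\<close> times
        d^n.\<close>
      have ao: "(\<Sum>c\<in>?C. chi z a c * chi (inverse z) a' c) = (if a = a' then of_nat d ^ n else 0)" if "a \<in> P.exps" for a
        using chi_orth_dual[of a a'] that a' by (simp add: P.exps_def)
      have "0 = (\<Sum>c\<in>?C. \<beta> (c, u) * chi (inverse z) a' c)"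
        using \<beta>0 u by (intro sum.neutral[symmetric]) (auto simp: cidx_def)
      also have "\<dots> = (\<Sum>c\<in>?C. \<Sum>a\<in>P.exps. \<alpha> (a, u) * (chi z a c * chi (inverse z) a' c))"
        unfolding \<beta>_def fst_conv snd_conv sum_distrib_right mult.assoc ..
      also have "\<dots> = (\<Sum>a\<in>P.exps. \<Sum>c\<in>?C. \<alpha> (a, u) * (chi z a c * chi (inverse z) a' c))"
        by (rule sum.swap)
      also have "\<dots> = (\<Sum>a\<in>P.exps. if a = a' then \<alpha> (a, u) * of_nat d ^ n else 0)"
      proof (intro sum.cong HOL.refl)
        fix a assume "a \<in> P.exps"
        from ao[OF this] show "(\<Sum>c\<in>?C. \<alpha> (a, u) * (chi z a c * chi (inverse z) a' c)) = (if a = a' then \<alpha> (a, u) * of_nat d ^ n else 0)"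
          unfolding sum_distrib_left[symmetric] by simp
      qed
      also have "\<dots> = \<alpha> (a', u) * of_nat d ^ n" using a' finite_exps by (simp only: sum.delta if_True)
      finally show ?thesis using of_nat_Cq_nonzero[OF d] by simp
    qed
    have "(\<Oplus>\<^bsub>Y\<^esub>j\<in>P.exps \<times> ?W. \<alpha> j \<odot>\<^bsub>Y\<^esub> (P.tmon 1 (fst j) \<otimes>\<^bsub>Y\<^esub> P.sw (snd j))) = (\<Oplus>\<^bsub>Y\<^esub>j\<in>P.exps \<times> ?W. \<zero>\<^bsub>Y\<^esub>)"
    proof (rule P.finsum_cong')
      fix j assume j: "j \<in> P.exps \<times> ?W"
      then have m: "P.tmon 1 (fst j) \<otimes>\<^bsub>Y\<^esub> P.sw (snd j) \<in> carrier Y" by (intro P.m_closed exps_D(1) cws_D(2)) auto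
      have "\<alpha> j = 0" using \<alpha>0 j by auto
      moreover have "0 \<odot>\<^bsub>Y\<^esub> (P.tmon 1 (fst j) \<otimes>\<^bsub>Y\<^esub> P.sw (snd j)) = \<zero>\<^bsub>Y\<^esub>"
        using P.smult_l_distr[OF m, of 0 0] P.add.l_cancel_one'[OF P.smult_closed[OF m] P.smult_closed[OF m]] by simp
      ultimately show "\<alpha> j \<odot>\<^bsub>Y\<^esub> (P.tmon 1 (fst j) \<otimes>\<^bsub>Y\<^esub> P.sw (snd j)) = \<zero>\<^bsub>Y\<^esub>" by (simp only:)
    qed auto
    then show ?thesis unfolding x\<alpha> by simp
  qed
  fix x y assume xy: "x \<in> carrier Y" "y \<in> carrier Y" "\<Psi> x = \<Psi> y"
  have "\<Psi> (x \<ominus>\<^bsub>Y\<^esub> y) = \<Psi> x \<ominus>\<^bsub>E\<^esub> \<Psi> y"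
    by (rule alg_hom_more(2)[OF P.kalgebra_axioms E.kalgebra_axioms hom xy(1,2)])
  also have "\<dots> = \<zero>\<^bsub>E\<^esub>" unfolding xy(3) a_minus_def E.r_neg[OF \<Psi>_closed[OF xy(2)]] ..
  finally have z0: "x \<ominus>\<^bsub>Y\<^esub> y = \<zero>\<^bsub>Y\<^esub>" by (rule ker[OF P.minus_closed[OF xy(1,2)]])
  have "x = (x \<ominus>\<^bsub>Y\<^esub> y) \<oplus>\<^bsub>Y\<^esub> y" using xy(1,2) by (simp add: a_minus_def P.a_assoc P.l_neg)
  also have "\<dots> = y" unfolding z0 using xy(2) by simp
  finally show "x = y" .
qed

text \<open>With fewer than n letters of colour b, every word of the constant colour sequence b
  repeats a letter, so the antisymmetrizer on n letters acts by zero. This is a nontrivial relation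
  among permutation operators.\<close>

lemma dep_cidx:
  assumes b: "b \<in> {1..d}" "N b < n"
  shows "\<not> indep_on (T \<times> T) (cidx d n) g1"
proof
  assume ind: "indep_on (T \<times> T) (cidx d n) g1"
  let ?\<Pi> = "{\<pi>. \<pi> permutes {..<n}}" and ?C = "{c. length c = n \<and> set c \<subseteq> {1..d}}" and ?W = "cws (n - 1)"
  have finC: "finite ?C" using finite_lists_length_eq[of "{1..d}" n] by (simp add: conj_commute)
  have fin\<Pi>: "finite ?\<Pi>" by (rule finite_permutations) simp
  have "\<forall>\<pi>\<in>?\<Pi>. \<exists>u. u \<in> ?W \<and> (\<forall>w::letter list. length w = n \<longrightarrow> act u w = permute_list \<pi> w)"
    using cws_permutation[OF _ n] by blast
  from bchoice[OF this] obtain U where U: "\<And>\<pi>. \<pi> permutes {..<n} \<Longrightarrow> U \<pi> \<in> ?W"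
    "\<And>\<pi> w. \<pi> permutes {..<n} \<Longrightarrow> length (w::letter list) = n \<Longrightarrow> act (U \<pi>) w = permute_list \<pi> w" by auto
  have Uinj: "\<pi> = \<rho>" if p: "\<pi> permutes {..<n}" "\<rho> permutes {..<n}" "U \<pi> = U \<rho>" for \<pi> \<rho>
  proof
    fix k
    \<comment> \<open>A word of distinct letters to tell permutations apart. It need not lie in the
      tensor space, since rearrangement is defined for all words.\<close>
    let ?w = "map (\<lambda>k. (b, k)) [0..<n]"
    have lw: "length ?w = n" by simp
    show "\<pi> k = \<rho> k"
    proof (cases "k < n")
      case True
      have "\<pi> k < n" "\<rho> k < n" using permutes_in_image[OF p(1), of k] permutes_in_image[OF p(2), of k] True by auto
      moreover have "permute_list \<pi> ?w ! k = permute_list \<rho> ?w ! k"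
        using U(2)[OF p(1) lw] U(2)[OF p(2) lw] p(3) by simp
      ultimately show ?thesis using p True by (simp add: permute_list_nth)
    next
      case False
      then show ?thesis using permutes_not_in[OF p(1), of k] permutes_not_in[OF p(2), of k] by simp
    qed
  qed
  let ?c0 = "replicate n b"
  have c0: "?c0 \<in> ?C" using b(1) by auto
  \<comment> \<open>The antisymmetrizer written on normal forms: \<open>U\<close> chooses a word for
    each permutation, and signs are summed over its fibres so that the sum over words regroups into
    one over permutations.\<close>
  define \<alpha> where "\<alpha> j = (if fst j = ?c0 then \<Sum>\<pi>\<in>{\<pi>. \<pi> \<in> ?\<Pi> \<and> U \<pi> = snd j}. (of_int (sign \<pi>) :: complex) else 0)" for j
  have "(\<Sum>j\<in>cidx d n. \<alpha> j * g1 j p) = 0" if p: "p \<in> T \<times> T" for p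
  proof -
    obtain w' w where pw: "p = (w', w)" "w' \<in> T" using p by auto
    have lw: "length w' = n" using pw(2) by (simp add: tbasis_def)
    define F where "F \<pi> = of_int (sign \<pi>) * g1 (?c0, U \<pi>) p" for \<pi>
    have "(\<Sum>j\<in>cidx d n. \<alpha> j * g1 j p) = (\<Sum>c\<in>?C. \<Sum>u\<in>?W. \<alpha> (c, u) * g1 (c, u) p)"
      unfolding cidx_def by (simp add: sum.cartesian_product split_def)
    also have "\<dots> = (\<Sum>c\<in>?C. if c = ?c0 then \<Sum>u\<in>?W. \<alpha> (?c0, u) * g1 (?c0, u) p else 0)"
      by (intro sum.cong HOL.refl) (auto simp: \<alpha>_def intro!: sum.neutral)
    also have "\<dots> = (\<Sum>u\<in>?W. \<alpha> (?c0, u) * g1 (?c0, u) p)"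
      using c0 finC by (simp only: sum.delta if_True)
    also have "\<dots> = (\<Sum>u\<in>?W. sum F {\<pi>. \<pi> \<in> ?\<Pi> \<and> U \<pi> = u})"
    proof (intro sum.cong HOL.refl)
      fix u
      show "\<alpha> (?c0, u) * g1 (?c0, u) p = sum F {\<pi>. \<pi> \<in> ?\<Pi> \<and> U \<pi> = u}"
        unfolding \<alpha>_def fst_conv snd_conv if_P[OF HOL.refl] sum_distrib_right F_def by (intro sum.cong HOL.refl) simp
    qed
    also have "\<dots> = sum F ?\<Pi>"
      by (rule sum.group[OF fin\<Pi> cws_finite]) (use U(1) in auto)
    also have "\<dots> = 0"
    proof (cases "map fst w' = ?c0")
      case False
      then show ?thesis by (intro sum.neutral) (simp add: F_def g1_def pw(1))
    next
      case True
      have "set w' \<subseteq> {b} \<times> {1..N b}"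
      proof
        fix x assume x: "x \<in> set w'"
        have "fst x \<in> set (map fst w')" using x by simp
        then have "fst x = b" unfolding True by simp
        moreover have "x \<in> vbasis d N" using pw(2) x by (auto simp: tbasis_def)
        ultimately show "x \<in> {b} \<times> {1..N b}" by (auto simp: vbasis_def)
      qed
      then have "card (set w') \<le> card ({b} \<times> {1..N b})" by (intro card_mono) auto
      then have "card (set w') < length w'" using b(2) lw by (simp add: card_cartesian_product)
      then have "\<not> distinct w'" using distinct_card[of w'] by auto
      then obtain i k where ik: "i < n" "k < n" "i \<noteq> k" "w' ! i = w' ! k" unfolding distinct_conv_nth lw by blast
      let ?t = "Transposition.transpose i k"
      have t: "?t permutes {..<n}" using ik by (intro permutes_swap_id) auto
      have wt: "w' ! ?t m = w' ! m" for m using ik(4) by (simp add: Transposition.transpose_def)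
      \<comment> \<open>Transposing the two positions with equal letters leaves the rearranged word
        unchanged and reverses the sign, so the signed sum equals its own negative.\<close>
      have "F (?t \<circ> \<pi>) = - F \<pi>" if \<pi>: "\<pi> permutes {..<n}" for \<pi>
      proof -
        have tp: "(?t \<circ> \<pi>) permutes {..<n}" by (rule permutes_compose[OF \<pi> t])
        have "sign (?t \<circ> \<pi>) = sign ?t * sign \<pi>"
          by (rule sign_compose) (use t \<pi> permutes_imp_permutation[of "{..<n}"] in auto)
        then have "sign (?t \<circ> \<pi>) = - sign \<pi>" using ik(3) by (simp add: sign_swap_id)
        moreover have "act (U (?t \<circ> \<pi>)) w' = act (U \<pi>) w'"
          unfolding U(2)[OF tp lw] U(2)[OF \<pi> lw] permute_list_def by (simp add: wt)
        ultimately show ?thesis by (simp add: F_def g1_def pw(1))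
      qed
      then have "(\<Sum>\<pi>\<in>?\<Pi>. F (?t \<circ> \<pi>)) = (\<Sum>\<pi>\<in>?\<Pi>. - F \<pi>)" by (intro sum.cong HOL.refl) simp
      then have "sum F ?\<Pi> = - sum F ?\<Pi>" unfolding sum_permutes_compose_left[OF t] sum_negf by simp
      then show ?thesis by simp
    qed
    finally show ?thesis .
  qed
  moreover have jd: "(?c0, U id) \<in> cidx d n" using c0 U(1)[OF permutes_id] by (simp add: cidx_def)
  ultimately have "\<alpha> (?c0, U id) = 0" using indep_onD[OF ind _ jd] by blast
  moreover have "{\<pi>. \<pi> \<in> ?\<Pi> \<and> U \<pi> = snd (?c0, U id)} = {id}" using Uinj[OF _ permutes_id] permutes_id by auto
  ultimately show False by (simp add: \<alpha>_def sign_id)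
qed

text \<open>For small \<open>N b\<close> the image of some e_c s_u is a combination of the images of
  the others. Injectivity lifts this to a relation inside the algebra, which then holds in every
  representation, in particular in one where these elements are independent.\<close>

lemma inj_imp_le:
  assumes inj: "inj_on \<Psi> (carrier Y)" and b: "b \<in> {1..d}"
  shows "n \<le> N b"
proof (rule ccontr)
  assume "\<not> n \<le> N b"
  then have Nb: "N b < n" by simp
  from deform obtain J where J': "J \<subseteq> cidx d n \<and> indep_on (T \<times> T) J g1 \<and>
      (\<forall>f\<in>carrier (End_Uq d N n). \<exists>\<alpha>. f = \<Psi> (\<Oplus>\<^bsub>Y\<^esub>j\<in>J. \<alpha> j \<odot>\<^bsub>Y\<^esub> yel d n z j))"
    by (rule exE)
  note J = J'[THEN conjunct1] J'[THEN conjunct2, THEN conjunct1] J'[THEN conjunct2, THEN conjunct2]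
  have "J \<noteq> cidx d n" using dep_cidx[OF b Nb] J(2) by blast
  then obtain i where i: "i \<in> cidx d n" "i \<notin> J" using J(1) by blast
  have finJ: "finite J" by (rule finite_subset[OF J(1) finite_cidx])
  have yc: "yel d n z j \<in> carrier Y" if "j \<in> J" for j using yel_closed J(1) that by blast
  from J(3)[THEN bspec, OF \<Psi>_End_Uq[OF yel_closed[OF i(1)]]]
  obtain \<alpha> where "\<Psi> (yel d n z i) = \<Psi> (\<Oplus>\<^bsub>Y\<^esub>j\<in>J. \<alpha> j \<odot>\<^bsub>Y\<^esub> yel d n z j)" by (rule exE)
  then have eq: "yel d n z i = (\<Oplus>\<^bsub>Y\<^esub>j\<in>J. \<alpha> j \<odot>\<^bsub>Y\<^esub> yel d n z j)"
    by (rule inj_onD[OF inj _ yel_closed[OF i(1)]]) (intro P.finsum_closed Pi_I P.smult_closed yc)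
  \<comment> \<open>Enlarging every colour to at least n letters gives a representation of the same
    algebra to which \<open>indep_cidx\<close> applies.\<close>
  define N' where "N' b = max (N b) n" for b
  let ?T' = "tbasis d N' n"
  obtain \<Psi>' where \<Psi>': "\<Psi>' \<in> alg_hom (YH d n) (endo_alg ?T')" "\<forall>i\<in>{1..<n}. \<Psi>' (yh_s d n i) = sigma d N' n i"
    "\<forall>i\<in>{1..n}. \<Psi>' (yh_t d n i) = tau d N' n z i"
  proof -
    from YH_rep_exists[of n N'] obtain \<Psi> where 1: "\<Psi> \<in> alg_hom (YH d n) (endo_alg ?T')"
      and 2: "(\<forall>i\<in>{1..<n}. \<Psi> (yh_s d n i) = sigma d N' n i) \<and> (\<forall>i\<in>{1..n}. \<Psi> (yh_t d n i) = tau d N' n z i)"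
      by (rule bexE)
    show ?thesis by (rule that[OF 1 conjunct1[OF 2] conjunct2[OF 2]])
  qed
  interpret R: yh_rep d z N' n \<Psi>'
    by unfold_locales (rule n \<Psi>'(1) \<Psi>'(2)[THEN bspec] \<Psi>'(3)[THEN bspec]; assumption?)+
  have "\<forall>b\<in>{1..d}. n \<le> N' b" by (simp add: N'_def)
  note ind = indep_on_deform[OF finite_cidx spec_gq R.indep_cidx[OF this]]
  \<comment> \<open>The lifted relation moved to one side; the coefficient -1 at \<open>i\<close>,
    which is not in \<open>J\<close>, contradicts independence.\<close>
  let ?\<beta> = "\<lambda>j. if j \<in> J then \<alpha> j else if j = i then - 1 else 0"
  have "\<forall>p\<in>?T' \<times> ?T'. (\<Sum>j\<in>cidx d n. ?\<beta> j * gq j p) = 0"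
  proof
    fix p assume "p \<in> ?T' \<times> ?T'"
    then obtain w' w where pw: "p = (w', w)" "w' \<in> ?T'" "w \<in> ?T'" by auto
    have "gq i p = \<Psi>' (yel d n z i) (kdelta w) w'" unfolding pw(1) by (rule R.\<Psi>_yel[OF i(1) pw(3,2), symmetric])
    also have "\<dots> = (\<Sum>j\<in>J. \<alpha> j * \<Psi>' (yel d n z j) (kdelta w) w')"
      unfolding eq by (rule R.\<Psi>_lincomb[OF finJ yc vspace_closed(4)[OF pw(3)]])
    also have "\<dots> = (\<Sum>j\<in>J. \<alpha> j * gq j p)"
    proof (intro sum.cong HOL.refl)
      fix j assume "j \<in> J"
      then have "j \<in> cidx d n" using J(1) by blast
      then show "\<alpha> j * \<Psi>' (yel d n z j) (kdelta w) w' = \<alpha> j * gq j p"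
        unfolding pw(1) by (simp only: R.\<Psi>_yel[OF _ pw(3,2)])
    qed
    finally have gi: "gq i p = (\<Sum>j\<in>J. \<alpha> j * gq j p)" .
    have "(\<Sum>j\<in>cidx d n. ?\<beta> j * gq j p) = (\<Sum>j\<in>insert i J. ?\<beta> j * gq j p)"
      by (rule sum.mono_neutral_right[OF finite_cidx]) (use i(1) J(1) in auto)
    also have "\<dots> = - gq i p + (\<Sum>j\<in>J. ?\<beta> j * gq j p)"
      using finJ i(2) by (simp add: sum.insert)
    also have "(\<Sum>j\<in>J. ?\<beta> j * gq j p) = (\<Sum>j\<in>J. \<alpha> j * gq j p)" by (intro sum.cong HOL.refl) simp
    finally show "(\<Sum>j\<in>cidx d n. ?\<beta> j * gq j p) = 0" unfolding gi by simp
  qed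
  from indep_onD[OF ind this i(1)] i(2) show False by simp
qed

end

theorem theorem5p2:
  fixes d n :: nat and N :: "nat \<Rightarrow> nat" and \<zeta> :: Cq
  assumes "d \<ge> 1" and "n \<ge> 1"
    and "\<forall>b\<in>{1..d}. N b > 1"
    and "\<zeta> ^ d = 1" and "\<forall>m. 0 < m \<and> m < d \<longrightarrow> \<zeta> ^ m \<noteq> 1"
  shows "\<exists>\<Phi> \<in> alg_hom (YH d n) (End_Uq d N n).
    (\<forall>i\<in>{1..n}. \<Phi> (yh_t d n i) = tau d N n \<zeta> i) \<and>
    (\<forall>i\<in>{1..<n}. \<Phi> (yh_s d n i) = sigma d N n i) \<and>
    \<Phi> ` carrier (YH d n) = carrier (End_Uq d N n) \<and>
    (\<Phi> \<in> alg_iso (YH d n) (End_Uq d N n) \<longleftrightarrow> (\<forall>b\<in>{1..d}. n \<le> N b))"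
proof -
  interpret Z: prim_root d \<zeta> by unfold_locales (use assms in auto)
  obtain \<Psi> where \<Psi>: "\<Psi> \<in> alg_hom (YH d n) (endo_alg (tbasis d N n))" "\<forall>i\<in>{1..<n}. \<Psi> (yh_s d n i) = sigma d N n i"
    "\<forall>i\<in>{1..n}. \<Psi> (yh_t d n i) = tau d N n \<zeta> i"
  proof -
    from Z.YH_rep_exists[of n N] obtain \<Psi> where 1: "\<Psi> \<in> alg_hom (YH d n) (endo_alg (tbasis d N n))"
      and 2: "(\<forall>i\<in>{1..<n}. \<Psi> (yh_s d n i) = sigma d N n i) \<and> (\<forall>i\<in>{1..n}. \<Psi> (yh_t d n i) = tau d N n \<zeta> i)"
      by (rule bexE)
    show ?thesis by (rule that[OF 1 conjunct1[OF 2] conjunct2[OF 2]])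
  qed
  interpret R: yh_rep d \<zeta> N n \<Psi>
    by unfold_locales (rule assms(2) \<Psi>(1) \<Psi>(2)[THEN bspec] \<Psi>(3)[THEN bspec]; assumption?)+
  have "\<Psi> \<in> alg_iso (YH d n) (End_Uq d N n) \<longleftrightarrow> inj_on \<Psi> (carrier (YH d n))"
    unfolding alg_iso_def bij_betw_def using R.hom_End_Uq R.surj by simp
  also have "\<dots> \<longleftrightarrow> (\<forall>b\<in>{1..d}. n \<le> N b)"
    using R.inj R.inj_imp_le by blast
  finally show ?thesis
    by (intro bexI[OF _ R.hom_End_Uq] conjI \<Psi>(2,3) R.surj)
qed

end
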